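(* Let $1<p<\infty$, $n\in\mathbb N$, and $T(a)+H(b)\in\mathcal F_{TH}^p(-2n,2n)$ with subordinated pair $(c,d)$. Let $d=\boldsymbol\sigma(d)d_+t^{-2n}\tilde d_+^{-1}$ be the Wiener–Hopf factorization of $d$ in $L^p$, and define for $k=0,\dots,n-1$ $$\omega_k^{a,b}:=T^{-1}(ct^{-2n})\,T(\tilde a^{-1}t^{-n})\big(d_+^{-1}(t^{n-k-1}+\boldsymbol\sigma(d)t^{n+k})\big)$$ (here $T(ct^{-2n})$ is invertible on $H^p$), and the $n\times n$ matrix $W_n(a,b)=(\omega_{jk}^{a,b})_{j,k=0}^{n-1}$, $\omega_{jk}^{a,b}=\frac1{2\pi}\int_0^{2\pi}\omega_k^{a,b}(e^{i\theta})e^{-ij\theta}\,d\theta$. Define $W_n(\bar a,\widetilde{\bar b})$ analogously for the matching pair $(\bar a,\widetilde{\bar b})$ (for which $T(\bar a)+H(\widetilde{\bar b})\in\mathcal F^q_{TH}(-2n,2n)$), with $p$ replaced by $q=p/(p-1)$. Then: (a) $T(a)+H(b)$ is left-invertible iff $W_n(a,b)$ is nondegenerate; (b) $T(a)+H(b)$ is right-invertible iff $W_n(\bar a,\widetilde{\bar b})$ is nondegenerate; (c) $T(a)+H(b)$ is invertible iff both $W_n(a,b)$ and $W_n(\bar a,\widetilde{\bar b})$ are nondegenerate; (d) if $W_n(a,b)$ and $W_n(a,-b)$ are nondegenerate, then $T(a)+H(b)$ and $T(a)-H(b)$ are both invertible.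
   Context: $\mathbb T$ is the unit circle, $1<p<\infty$, $1/p+1/q=1$; $H^p=\{f\in L^p(\mathbb T):\hat f_n=0\ \forall n<0\}$, $\overline{H^p}=\{f\in L^p:\hat f_n=0\ \forall n>0\}$; $P$ is the Riesz projection onto $H^p$, $Q=I-P$, $(Jf)(t)=t^{-1}f(t^{-1})$, $\tilde a(t)=a(1/t)$, $\bar a$ is the complex conjugate; $t$ denotes $t\mapsto t$. On $H^p$: $T(a)f=P(af)$, $H(a)f=P(aQJf)$. A pair $(a,b)$ with $a\in GL^\infty(\mathbb T)$ (invertible in $L^\infty$) and $b\in L^\infty(\mathbb T)$ is a matching pair if $a\tilde a=b\tilde b$; the subordinated pair is $(c,d)$, $c:=a/b$, $d:=a/\tilde b$, with $c\tilde c=d\tilde d=1$. We write $T(a)+H(b)\in\mathcal F_{TH}^p(\kappa_1,\kappa_2)$ if $(a,b)$ is a matching pair whose subordinated operators $T(c),T(d)$ are Fredholm on $H^p$ with $\operatorname{ind}T(c)=\kappa_1$, $\operatorname{ind}T(d)=\kappa_2$. A Wiener–Hopf factorization of $a\in L^\infty$ in $L^p$ is $a=a_-t^ma_+$ with $m\in\mathbb Z$, $a_+\in H^q$, $a_+^{-1}\in H^p$, $a_-\in\overline{H^p}$, $a_-^{-1}\in\overline{H^q}$, and $\|a_+^{-1}P(a_+\varphi)\|_p\le c_p\|\varphi\|_p$ for all trigonometric polynomials $\varphi$. If $g$ satisfies $g\tilde g=1$ and $T(g)$ is Fredholm on $H^p$ with index $n$, its Wiener–Hopf factorization normalized by $g_-(\infty)=1$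 has the form $g=\boldsymbol\sigma(g)g_+t^{-n}\tilde g_+^{-1}$ with $\boldsymbol\sigma(g)=g_+(0)\in\{-1,1\}$ (the factorization signature) and plus factor $g_+$. *)

theory Defs
  imports "HOL-Analysis.Analysis" "Jordan_Normal_Form.Determinant"
begin

text \<open>Functions on the unit circle are represented as functions complex => complex,
  of which only the values on the unit circle matter.  The circle is parametrised by
  theta in [0, 2 pi] via cis; all statements are modulo equality almost everywhere.\<close>

definition circ :: "(complex \<Rightarrow> complex) \<Rightarrow> real \<Rightarrow> complex" where
  "circ f \<theta> = f (cis \<theta>)"

abbreviation TM :: "real measure" where
  "TM \<equiv> lebesgue_on {0..2*pi}"

definition ae_eq :: "(complex \<Rightarrow> complex) \<Rightarrow> (complex \<Rightarrow> complex) \<Rightarrow> bool" where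
  "ae_eq f g \<longleftrightarrow> (AE \<theta> in TM. f (cis \<theta>) = g (cis \<theta>))"

definition Lp :: "real \<Rightarrow> (complex \<Rightarrow> complex) set" where
  "Lp p = {f. circ f \<in> borel_measurable TM \<and>
              integrable TM (\<lambda>\<theta>. norm (circ f \<theta>) powr p)}"

definition pnorm :: "real \<Rightarrow> (complex \<Rightarrow> complex) \<Rightarrow> real" where
  "pnorm p f = (LINT \<theta>|TM. norm (circ f \<theta>) powr p) powr (1 / p)"

definition Linf :: "(complex \<Rightarrow> complex) set" where
  "Linf = {f. circ f \<in> borel_measurable TM \<and> (\<exists>C. AE \<theta> in TM. norm (circ f \<theta>) \<le> C)}"

definition GLinf :: "(complex \<Rightarrow> complex) set" where
  "GLinf = {f. f \<in> Linf \<and> (\<exists>g\<in>Linf. ae_eq (\<lambda>z. f z * g z) (\<lambda>z. 1))}"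

definition fc :: "(complex \<Rightarrow> complex) \<Rightarrow> int \<Rightarrow> complex" where
  "fc f j = (1 / (2 * pi)) * (LINT \<theta>|TM. f (cis \<theta>) * cis (- (of_int j * \<theta>)))"

definition Hp :: "real \<Rightarrow> (complex \<Rightarrow> complex) set" where
  "Hp p = {f \<in> Lp p. \<forall>j<0. fc f j = 0}"

definition Hbar :: "real \<Rightarrow> (complex \<Rightarrow> complex) set" where
  "Hbar p = {f \<in> Lp p. \<forall>j>0. fc f j = 0}"

text \<open>Riesz projection (well defined up to a.e. equality; M. Riesz theorem).\<close>
definition Pr :: "(complex \<Rightarrow> complex) \<Rightarrow> (complex \<Rightarrow> complex)" where
  "Pr f = (SOME g. g \<in> Lp 1 \<and> (\<forall>j. fc g j = (if j \<ge> 0 then fc f j else 0)))"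

definition Qr :: "(complex \<Rightarrow> complex) \<Rightarrow> (complex \<Rightarrow> complex)" where
  "Qr f = (\<lambda>z. f z - Pr f z)"

definition Jflip :: "(complex \<Rightarrow> complex) \<Rightarrow> (complex \<Rightarrow> complex)" where
  "Jflip f = (\<lambda>t. inverse t * f (inverse t))"

definition tld :: "(complex \<Rightarrow> complex) \<Rightarrow> (complex \<Rightarrow> complex)" where
  "tld a = (\<lambda>t. a (inverse t))"

definition Toep :: "(complex \<Rightarrow> complex) \<Rightarrow> (complex \<Rightarrow> complex) \<Rightarrow> (complex \<Rightarrow> complex)" where
  "Toep a f = Pr (\<lambda>z. a z * f z)"

definition Hank :: "(complex \<Rightarrow> complex) \<Rightarrow> (complex \<Rightarrow> complex) \<Rightarrow> (complex \<Rightarrow> complex)" where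
  "Hank b f = Pr (\<lambda>z. b z * Qr (Jflip f) z)"

definition TH :: "(complex \<Rightarrow> complex) \<Rightarrow> (complex \<Rightarrow> complex) \<Rightarrow> (complex \<Rightarrow> complex) \<Rightarrow> (complex \<Rightarrow> complex)" where
  "TH a b f = (\<lambda>z. Toep a f z + Hank b f z)"

definition lincomb :: "(int \<Rightarrow> complex) set \<Rightarrow> ((int \<Rightarrow> complex) \<Rightarrow> complex) \<Rightarrow> int \<Rightarrow> complex" where
  "lincomb K u = (\<lambda>j. \<Sum>v\<in>K. u v * v j)"

definition cspan :: "(int \<Rightarrow> complex) set \<Rightarrow> (int \<Rightarrow> complex) set" where
  "cspan K = {lincomb K u | u. True}"

definition cindep :: "(int \<Rightarrow> complex) set \<Rightarrow> bool" where
  "cindep K \<longleftrightarrow> (\<forall>u. lincomb K u = (\<lambda>_. 0) \<longrightarrow> (\<forall>v\<in>K. u v = 0))"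

text \<open>Elements of H^p are identified with their Fourier coefficient sequences
  (an L^p function is determined a.e. by its Fourier coefficients).\<close>

definition ker_seq :: "real \<Rightarrow> ((complex \<Rightarrow> complex) \<Rightarrow> (complex \<Rightarrow> complex)) \<Rightarrow> (int \<Rightarrow> complex) set" where
  "ker_seq p A = {fc f | f. f \<in> Hp p \<and> ae_eq (A f) (\<lambda>_. 0)}"

definition ran_seq :: "real \<Rightarrow> ((complex \<Rightarrow> complex) \<Rightarrow> (complex \<Rightarrow> complex)) \<Rightarrow> (int \<Rightarrow> complex) set" where
  "ran_seq p A = {fc (A f) | f. f \<in> Hp p}"

definition closed_range :: "real \<Rightarrow> ((complex \<Rightarrow> complex) \<Rightarrow> (complex \<Rightarrow> complex)) \<Rightarrow> bool" where
  "closed_range p A \<longleftrightarrow>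
     (\<forall>F g. (\<forall>k. F k \<in> Hp p) \<and> g \<in> Lp p \<and>
            (\<lambda>k. pnorm p (\<lambda>z. A (F k) z - g z)) \<longlonglongrightarrow> 0
        \<longrightarrow> (\<exists>h\<in>Hp p. ae_eq (A h) g))"

definition fredholm_index :: "real \<Rightarrow> ((complex \<Rightarrow> complex) \<Rightarrow> (complex \<Rightarrow> complex)) \<Rightarrow> int \<Rightarrow> bool" where
  "fredholm_index p A \<kappa> \<longleftrightarrow> closed_range p A \<and>
     (\<exists>K C. finite K \<and> finite C \<and> cindep K \<and> cspan K = ker_seq p A \<and>
            cindep C \<and> C \<subseteq> fc ` Hp p \<and>
            {(\<lambda>j. r j + s j) | r s. r \<in> ran_seq p A \<and> s \<in> cspan C} = fc ` Hp p \<and>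
            cspan C \<inter> ran_seq p A = {\<lambda>_. 0} \<and>
            \<kappa> = int (card K) - int (card C))"

definition bounded_op :: "real \<Rightarrow> ((complex \<Rightarrow> complex) \<Rightarrow> (complex \<Rightarrow> complex)) \<Rightarrow> bool" where
  "bounded_op p B \<longleftrightarrow>
     (\<forall>f\<in>Hp p. B f \<in> Hp p) \<and>
     (\<forall>f\<in>Hp p. \<forall>g\<in>Hp p. ae_eq f g \<longrightarrow> ae_eq (B f) (B g)) \<and>
     (\<forall>f\<in>Hp p. \<forall>g\<in>Hp p. ae_eq (B (\<lambda>z. f z + g z)) (\<lambda>z. B f z + B g z)) \<and>
     (\<forall>f\<in>Hp p. \<forall>c. ae_eq (B (\<lambda>z. c * f z)) (\<lambda>z. c * B f z)) \<and>
     (\<exists>M. \<forall>f\<in>Hp p. pnorm p (B f) \<le> M * pnorm p f)"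

definition left_invertible :: "real \<Rightarrow> ((complex \<Rightarrow> complex) \<Rightarrow> (complex \<Rightarrow> complex)) \<Rightarrow> bool" where
  "left_invertible p A \<longleftrightarrow> (\<exists>B. bounded_op p B \<and> (\<forall>f\<in>Hp p. ae_eq (B (A f)) f))"

definition right_invertible :: "real \<Rightarrow> ((complex \<Rightarrow> complex) \<Rightarrow> (complex \<Rightarrow> complex)) \<Rightarrow> bool" where
  "right_invertible p A \<longleftrightarrow> (\<exists>B. bounded_op p B \<and> (\<forall>f\<in>Hp p. ae_eq (A (B f)) f))"

definition invertible_op :: "real \<Rightarrow> ((complex \<Rightarrow> complex) \<Rightarrow> (complex \<Rightarrow> complex)) \<Rightarrow> bool" where
  "invertible_op p A \<longleftrightarrow> (\<exists>B. bounded_op p B \<and> (\<forall>f\<in>Hp p. ae_eq (B (A f)) f)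
                                            \<and> (\<forall>f\<in>Hp p. ae_eq (A (B f)) f))"

definition matching_pair :: "(complex \<Rightarrow> complex) \<Rightarrow> (complex \<Rightarrow> complex) \<Rightarrow> bool" where
  "matching_pair a b \<longleftrightarrow> a \<in> GLinf \<and> b \<in> Linf \<and>
     ae_eq (\<lambda>t. a t * tld a t) (\<lambda>t. b t * tld b t)"

definition sub_c :: "(complex \<Rightarrow> complex) \<Rightarrow> (complex \<Rightarrow> complex) \<Rightarrow> (complex \<Rightarrow> complex)" where
  "sub_c a b = (\<lambda>t. a t / b t)"

definition sub_d :: "(complex \<Rightarrow> complex) \<Rightarrow> (complex \<Rightarrow> complex) \<Rightarrow> (complex \<Rightarrow> complex)" where
  "sub_d a b = (\<lambda>t. a t / tld b t)"

definition F_TH :: "real \<Rightarrow> int \<Rightarrow> int \<Rightarrow> (complex \<Rightarrow> complex) \<Rightarrow> (complex \<Rightarrow> complex) \<Rightarrow> bool" where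
  "F_TH p \<kappa>1 \<kappa>2 a b \<longleftrightarrow> matching_pair a b \<and>
     fredholm_index p (Toep (sub_c a b)) \<kappa>1 \<and> fredholm_index p (Toep (sub_d a b)) \<kappa>2"

definition trig_poly :: "(complex \<Rightarrow> complex) \<Rightarrow> bool" where
  "trig_poly \<phi> \<longleftrightarrow> (\<exists>S c. finite S \<and> \<phi> = (\<lambda>z. \<Sum>j\<in>S. c j * z powi j))"

definition conj_exp :: "real \<Rightarrow> real" where
  "conj_exp p = p / (p - 1)"

definition wh_fact :: "real \<Rightarrow> (complex \<Rightarrow> complex) \<Rightarrow> (complex \<Rightarrow> complex) \<Rightarrow> int \<Rightarrow> (complex \<Rightarrow> complex) \<Rightarrow> bool" where
  "wh_fact p a am m ap \<longleftrightarrow>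
     ae_eq a (\<lambda>t. am t * t powi m * ap t) \<and>
     ap \<in> Hp (conj_exp p) \<and> (\<lambda>t. inverse (ap t)) \<in> Hp p \<and>
     am \<in> Hbar p \<and> (\<lambda>t. inverse (am t)) \<in> Hbar (conj_exp p) \<and>
     (\<exists>c. \<forall>\<phi>. trig_poly \<phi> \<longrightarrow>
        pnorm p (\<lambda>t. inverse (ap t) * Pr (\<lambda>z. ap z * \<phi> z) t) \<le> c * pnorm p \<phi>)"

text \<open>Plus factor of the factorization normalised by am(infinity) = 1, i.e. the
  zeroth Fourier coefficient of the minus factor equals 1.\<close>
definition wh_plus :: "real \<Rightarrow> (complex \<Rightarrow> complex) \<Rightarrow> (complex \<Rightarrow> complex)" where
  "wh_plus p g = (case (SOME (am, m, ap). wh_fact p g am m ap \<and> fc am 0 = 1) of (am, m, ap) \<Rightarrow> ap)"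

text \<open>Factorization signature sigma(g) = g_+(0).\<close>
definition wh_sigma :: "real \<Rightarrow> (complex \<Rightarrow> complex) \<Rightarrow> complex" where
  "wh_sigma p g = fc (wh_plus p g) 0"

definition Tinv :: "real \<Rightarrow> (complex \<Rightarrow> complex) \<Rightarrow> (complex \<Rightarrow> complex) \<Rightarrow> (complex \<Rightarrow> complex)" where
  "Tinv p g h = (SOME f. f \<in> Hp p \<and> ae_eq (Toep g f) h)"

definition omega :: "real \<Rightarrow> nat \<Rightarrow> (complex \<Rightarrow> complex) \<Rightarrow> (complex \<Rightarrow> complex) \<Rightarrow> nat \<Rightarrow> (complex \<Rightarrow> complex)" where
  "omega p n a b k =
     (let c = sub_c a b; d = sub_d a b; dp = wh_plus p d; s = wh_sigma p d in
      Tinv p (\<lambda>t. c t * t powi (- (2 * int n)))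
        (Toep (\<lambda>t. inverse (tld a t) * t powi (- int n))
           (\<lambda>t. inverse (dp t) * (t ^ (n - k - 1) + s * t ^ (n + k)))))"

definition Wmat :: "real \<Rightarrow> nat \<Rightarrow> (complex \<Rightarrow> complex) \<Rightarrow> (complex \<Rightarrow> complex) \<Rightarrow> complex mat" where
  "Wmat p n a b = Matrix.mat n n (\<lambda>(j, k). fc (omega p n a b k) (int j))"

end

theory Submission
  imports Defs "HOL-Complex_Analysis.Complex_Analysis"
begin

text \<open>
  Put \<open>c = a / b\<close> and \<open>d = a / tld b\<close>. Writing \<open>(T(a) + H(b)) f = g\<close> as \<open>a f + b J f = g + J u\<close> with an unknown \<open>u\<close> in \<open>H\<^sup>p\<close>,
  one finds that \<open>u\<close> solves \<open>d u - J u = g - d J g\<close> and that \<open>f\<close> solves \<open>c f + J f = (g + J u) / b\<close>.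
  The first equation is always solvable, and its homogeneous solutions are spanned by the functions
  \<open>d\<^sub>+\<^sup>-\<^sup>1 (t\<^bsup>n-k-1\<^esup> + \<sigma>(d) t\<^bsup>n+k\<^esup>)\<close>. The second one has at most one solution, and it has one exactly when the first
  \<open>n\<close> coefficients of an explicit function vanish. Adjusting \<open>u\<close> by a homogeneous solution changes these coefficients by
  the matrix \<open>W\<^sub>n(a, b)\<close>. Hence \<open>T(a) + H(b)\<close> is invertible if \<open>W\<^sub>n(a, b)\<close> is nondegenerate, and has a nontrivial kernel otherwise.
  The statements on right invertibility follow by passing to the adjoint \<open>T(cnj a) + H(cnj (tld b))\<close> on \<open>H\<^sup>q\<close>.

  The functions enter modulo null sets: \<open>mk F\<close> is the class of \<open>F\<close>, and \<open>cst\<close>, \<open>zp k\<close>, \<open>cj\<close>, \<open>fl\<close>, \<open>av\<close>, \<open>co\<close> stand for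
  constants, \<open>t\<^sup>k\<close>, conjugation, \<open>f(1/t)\<close>, the mean value and the Fourier coefficients.
\<close>

section \<open>The spaces \<open>L\<^sup>p\<close> of complex functions\<close>

text \<open>One determinant decides because two halvings meet. \<open>T(d)\<close> has a kernel of
  dimension \<open>2n\<close>, of which the symmetry \<open>J u = d u\<close> keeps
  \<open>n\<close>; the \<open>2n\<close> solvability conditions attached to \<open>T(c)\<close> are
  halved by the symmetry \<open>c J w = w\<close> of the right-hand side. What remains is a square
  \<open>n\<close> by \<open>n\<close> system, for which uniqueness and solvability are the same
  thing. Hence left, right and two-sided invertibility of \<open>T(a) + H(b)\<close> coincide. The
  obstacle is analytic. The projection, the plus factor and the inverse of
  \<open>T(c t^(-2n))\<close> are given by choice, and the hypotheses only offer closed ranges and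
  finite sets of coefficient sequences. An index becomes an invertible operator through Coburn's
  alternative and a shift of the symbol. The adjoint needs an inverse as well, which calls for a
  representation of functionals on \<open>L^p\<close>; Fejer means and uniform convexity provide it
  in place of weak compactness. The same inverse yields the factorization: \<open>x\<close> solves
  \<open>T(g) x = 1\<close>, and the reciprocal of \<open>x\<close> is built from the solution of
  the adjoint equation.\<close>

definition Lpm :: "'a measure \<Rightarrow> real \<Rightarrow> ('a \<Rightarrow> complex) set" where
  "Lpm M p = {f \<in> borel_measurable M. integrable M (\<lambda>x. norm (f x) powr p)}"

definition Nrm :: "'a measure \<Rightarrow> real \<Rightarrow> ('a \<Rightarrow> complex) \<Rightarrow> real" where
  "Nrm M p f = (LINT x|M. norm (f x) powr p) powr (1 / p)"

lemma bernoulli_powr_strict: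
  fixes u p :: real
  assumes "1 < p" "0 \<le> u" "u \<noteq> 1"
  shows "1 + p * (u - 1) < u powr p"
proof -
  consider "u = 0" | "0 < u" "u < 1" | "1 < u" using assms by linarith
  then show ?thesis
  proof cases
    case 1 then show ?thesis using assms by simp
  next
    case 2
    have d: "\<And>x. u \<le> x \<Longrightarrow> x \<le> 1 \<Longrightarrow> ((\<lambda>x. x powr p) has_real_derivative p * x powr (p - 1)) (at x)"
      using 2 by (auto intro!: derivative_eq_intros)
    obtain z where z: "u < z" "z < 1" "1 powr p - u powr p = (1 - u) * (p * z powr (p - 1))"
      using MVT2[OF 2(2) d] by blast
    have "z powr (p - 1) < 1 powr (p - 1)" using z 2 assms by (intro powr_less_mono2) auto
    then have "z powr (p - 1) < 1" by simp
    then have "(1 - u) * (p * z powr (p - 1)) < (1 - u) * (p * 1)"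
      using 2 assms by (intro mult_strict_left_mono) auto
    then show ?thesis using z by (simp add: algebra_simps)
  next
    case 3
    have d: "\<And>x. 1 \<le> x \<Longrightarrow> x \<le> u \<Longrightarrow> ((\<lambda>x. x powr p) has_real_derivative p * x powr (p - 1)) (at x)"
      by (auto intro!: derivative_eq_intros)
    obtain z where z: "1 < z" "z < u" "u powr p - 1 powr p = (u - 1) * (p * z powr (p - 1))"
      using MVT2[OF 3 d] by blast
    have "1 < z powr (p - 1)" using z assms by (simp add: gr_one_powr)
    then have "(u - 1) * (p * 1) < (u - 1) * (p * z powr (p - 1))"
      using 3 assms by (intro mult_strict_left_mono) auto
    then show ?thesis using z by (simp add: algebra_simps)
  qed
qed

lemma powr_tangent_strict:
  fixes x m p :: real
  assumes "1 < p" "0 \<le> x" "0 < m" "x \<noteq> m"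
  shows "m powr p + p * m powr (p - 1) * (x - m) < x powr p"
proof -
  have "1 + p * (x / m - 1) < (x / m) powr p"
    using assms by (intro bernoulli_powr_strict) auto
  then have "(1 + p * (x / m - 1)) * m powr p < (x / m) powr p * m powr p"
    using assms by (intro mult_strict_right_mono) auto
  moreover have "(x / m) powr p * m powr p = x powr p"
    using assms by (simp flip: powr_mult)
  moreover have "(1 + p * (x / m - 1)) * m powr p = m powr p + p * m powr (p - 1) * (x - m)"
  proof -
    have "m powr p = m * m powr (p - 1)" using assms by (simp add: powr_mult_base)
    then show ?thesis using assms by (simp add: field_simps)
  qed
  ultimately show ?thesis by simp
qed

lemma powr_tangent:
  fixes x m p :: real
  assumes "1 < p" "0 \<le> x" "0 \<le> m"
  shows "m powr p + p * m powr (p - 1) * (x - m) \<le> x powr p"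
proof (cases "m = 0 \<or> x = m")
  case False
  then show ?thesis using powr_tangent_strict[of p x m] assms by simp
qed auto

lemma powr_convex_nonneg:
  fixes x y t p :: real
  assumes "1 < p" "0 \<le> x" "0 \<le> y" "0 \<le> t" "t \<le> 1"
  shows "(t * x + (1 - t) * y) powr p \<le> t * x powr p + (1 - t) * y powr p"
proof -
  define m where "m = t * x + (1 - t) * y"
  have m: "0 \<le> m" using assms by (simp add: m_def)
  have "t * (m powr p + p * m powr (p - 1) * (x - m)) \<le> t * x powr p"
    using assms m powr_tangent[of p x m] by (intro mult_left_mono) auto
  moreover have "(1 - t) * (m powr p + p * m powr (p - 1) * (y - m)) \<le> (1 - t) * y powr p"
    using assms m powr_tangent[of p y m] by (intro mult_left_mono) auto
  moreover have "t * (m powr p + p * m powr (p - 1) * (x - m)) + (1 - t) * (m powr p + p * m powr (p - 1) * (y - m))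
     = m powr p + p * m powr (p - 1) * (t * x + (1 - t) * y - m)"
    by (simp add: algebra_simps)
  ultimately show ?thesis by (simp add: m_def)
qed

text \<open>If the moduli differ, strict convexity of \<open>x powr p\<close> decides; if they
  agree, the parallelogram law makes the midpoint strictly shorter.\<close>

lemma norm_midpoint_powr_strict:
  fixes a b :: complex
  assumes "1 < p" "a \<noteq> b"
  shows "norm ((a + b) / 2) powr p < (norm a powr p + norm b powr p) / 2"
proof -
  define m where "m = (norm a + norm b) / 2"
  have m: "0 < m" using assms unfolding m_def
    by (cases "a = 0") (auto simp: add_pos_nonneg)
  have le: "norm ((a + b) / 2) \<le> m" unfolding m_def using norm_triangle_ineq[of a b] by (simp add: norm_divide)
  show ?thesis
  proof (cases "norm a = norm b")
    case True
    have "(norm (a + b))\<^sup>2 + (norm (a - b))\<^sup>2 = 2 * (norm a)\<^sup>2 + 2 * (norm b)\<^sup>2"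
      by (simp add: cmod_power2) (simp add: power2_eq_square algebra_simps)
    moreover have "0 < (norm (a - b))\<^sup>2" using assms by simp
    ultimately have "(norm (a + b))\<^sup>2 < (2 * norm a)\<^sup>2" using True by (simp add: power2_eq_square)
    then have "norm (a + b) < 2 * norm a" by (rule power_less_imp_less_base) simp
    then have "norm ((a + b) / 2) < norm a" by (simp add: norm_divide)
    then have "norm ((a + b) / 2) powr p < norm a powr p" using assms by (intro powr_less_mono2) auto
    then show ?thesis using True by simp
  next
    case False
    then have "norm a \<noteq> m" "norm b \<noteq> m" unfolding m_def by (auto simp: field_simps)
    then have 1: "m powr p + p * m powr (p - 1) * (norm a - m) < norm a powr p"
      and 2: "m powr p + p * m powr (p - 1) * (norm b - m) < norm b powr p"
      using assms m by (auto intro!: powr_tangent_strict)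
    define X where "X = p * m powr (p - 1) * (norm b - m)"
    have "norm a - m = - (norm b - m)" by (simp add: m_def field_simps)
    then have "p * m powr (p - 1) * (norm a - m) = - X" unfolding X_def by (metis mult_minus_right)
    then have "m powr p < (norm a powr p + norm b powr p) / 2"
      using 1 2 unfolding X_def[symmetric] by simp
    moreover have "norm ((a + b) / 2) powr p \<le> m powr p" using le assms by (intro powr_mono2) auto
    ultimately show ?thesis by linarith
  qed
qed

lemma norm_midpoint_powr:
  fixes a b :: complex
  assumes "1 < p"
  shows "norm ((a + b) / 2) powr p \<le> (norm a powr p + norm b powr p) / 2"
  using norm_midpoint_powr_strict[OF assms, of a b] by (cases "a = b") auto

text \<open>Both sides are homogeneous of degree \<open>p\<close>, so pairs with
  \<open>norm a powr p + norm b powr p = 1\<close> suffice. On the compact set of such pairs with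
  \<open>norm (a - b) powr p \<ge> \<epsilon>\<close> the defect of the midpoint inequality has a
  positive minimum; off it the first term alone is enough. The estimate is linear in the
  \<open>p\<close>-th powers so that it can be integrated, which gives the uniform convexity of
  \<open>L^p\<close> for all \<open>p > 1\<close> at once.\<close>

lemma uniform_convexity_pointwise:
  assumes p: "1 < p" and e: "0 < \<epsilon>"
  shows "\<exists>C\<ge>0. \<forall>a b :: complex. norm (a - b) powr p \<le> \<epsilon> * (norm a powr p + norm b powr p)
     + C * ((norm a powr p + norm b powr p) / 2 - norm ((a + b) / 2) powr p)"
proof -
  define D where "D = (\<lambda>z :: complex \<times> complex. (norm (fst z) powr p + norm (snd z) powr p) / 2 - norm ((fst z + snd z) / 2) powr p)"
  define S where "S = {z :: complex \<times> complex. norm (fst z) powr p + norm (snd z) powr p = 1 \<and> \<epsilon> \<le> norm (fst z - snd z) powr p}"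
  have contp: "continuous_on UNIV (\<lambda>z. norm (g z) powr p)" if "continuous_on UNIV g" for g :: "complex \<times> complex \<Rightarrow> complex"
    using that p by (intro continuous_on_powr' continuous_intros) auto
  have contD: "continuous_on UNIV D"
    unfolding D_def
    by (intro continuous_on_diff continuous_on_divide continuous_on_add continuous_on_const contp
        continuous_on_fst continuous_on_snd continuous_on_id) auto
  have "closed {z :: complex \<times> complex. norm (fst z) powr p + norm (snd z) powr p = 1}"
    by (intro closed_Collect_eq continuous_intros contp)
  moreover have "closed {z :: complex \<times> complex. \<epsilon> \<le> norm (fst z - snd z) powr p}"
    by (intro closed_Collect_le continuous_intros contp)
  ultimately have clS: "closed S" unfolding S_def by (auto intro: closed_Collect_conj)
  have le1: "norm a \<le> 1" if "norm a powr p + norm b powr p = 1" for a b :: complex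
  proof (rule ccontr)
    assume "\<not> norm a \<le> 1"
    then have "1 < norm a powr p" using p by (simp add: gr_one_powr)
    then show False using that by (smt (verit) powr_ge_zero)
  qed
  have bS: "norm (fst z) \<le> 1" "norm (snd z) \<le> 1" if "z \<in> S" for z
    using that le1[of "fst z" "snd z"] le1[of "snd z" "fst z"] by (auto simp: S_def add.commute)
  have "bounded S"
  proof (rule boundedI)
    fix z assume "z \<in> S"
    then show "norm z \<le> 2" using bS[of z] norm_Pair_le[of "fst z" "snd z"] by simp
  qed
  then have compS: "compact S" using clS by (simp add: compact_eq_bounded_closed)
  have posD: "0 < D z" if "z \<in> S" for z
  proof -
    have "fst z \<noteq> snd z" using that e by (auto simp: S_def)
    then show ?thesis using norm_midpoint_powr_strict[OF p, of "fst z" "snd z"] by (simp add: D_def)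
  qed
  obtain \<delta> where \<delta>: "0 < \<delta>" "\<And>z. z \<in> S \<Longrightarrow> \<delta> \<le> D z"
  proof (cases "S = {}")
    case True then show ?thesis using that[of 1] by auto
  next
    case False
    obtain w where "w \<in> S" "\<forall>z\<in>S. D w \<le> D z"
      using continuous_attains_inf[OF compS False continuous_on_subset[OF contD]] by auto
    then show ?thesis using that[of "D w"] posD by auto
  qed
  \<comment> \<open>On \<open>S\<close> the left side is at most \<open>2 powr p\<close>, while the
    defect is at least \<open>\<delta>\<close>.\<close>
  define C where "C = 2 powr p / \<delta>"
  have C0: "0 \<le> C" using \<delta> by (simp add: C_def)
  show ?thesis
  proof (intro exI[of _ C] conjI allI)
    show "0 \<le> C" by (rule C0)
    fix a b :: complex
    define s where "s = norm a powr p + norm b powr p"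
    show "norm (a - b) powr p \<le> \<epsilon> * (norm a powr p + norm b powr p)
     + C * ((norm a powr p + norm b powr p) / 2 - norm ((a + b) / 2) powr p)"
    proof (cases "s = 0")
      case True
      then have "norm a powr p = 0" "norm b powr p = 0" unfolding s_def
        by (smt (verit) powr_ge_zero)+
      then show ?thesis by simp
    next
      case False
      then have s: "0 < s" unfolding s_def by (smt (verit) powr_ge_zero)
      define r where "r = s powr (1 / p)"
      have r: "0 < r" "r powr p = s" using s p by (auto simp: r_def powr_powr)
      define z where "z = (a / of_real r, b / of_real r)"
      have sc: "norm (c / of_real r) powr p = norm c powr p / s" for c :: complex
        using r by (simp add: norm_divide powr_divide)
      have d1: "D z = ((norm a powr p + norm b powr p) / 2 - norm ((a + b) / 2) powr p) / s"
      proof -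
        have "(fst z + snd z) / 2 = ((a + b) / 2) / of_real r" by (simp add: z_def add_divide_distrib mult.commute)
        then show ?thesis using sc[of "(a + b) / 2"] unfolding D_def
          by (simp add: z_def sc diff_divide_distrib add_divide_distrib)
      qed
      have d2: "norm (fst z - snd z) powr p = norm (a - b) powr p / s"
        using sc[of "a - b"] by (simp add: z_def diff_divide_distrib)
      have n1: "norm (fst z) powr p + norm (snd z) powr p = 1"
        using s by (simp add: z_def sc s_def flip: add_divide_distrib)
      have Dn: "0 \<le> D z" using norm_midpoint_powr[OF p, of "fst z" "snd z"] by (simp add: D_def)
      have "norm (fst z - snd z) powr p \<le> \<epsilon> + C * D z"
      proof (cases "z \<in> S")
        case True
        have "norm (fst z - snd z) \<le> 2"
          using norm_triangle_ineq4[of "fst z" "snd z"] bS[OF True] by linarith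
        then have "norm (fst z - snd z) powr p \<le> 2 powr p" using p by (intro powr_mono2) auto
        also have "\<dots> = C * \<delta>" using \<delta> by (simp add: C_def)
        also have "\<dots> \<le> C * D z" using \<delta>(2)[OF True] C0 by (intro mult_left_mono) auto
        finally show ?thesis using e by linarith
      next
        case False
        then have "norm (fst z - snd z) powr p < \<epsilon>" using n1 by (auto simp: S_def)
        then show ?thesis using C0 Dn by (smt (verit) mult_nonneg_nonneg)
      qed
      then have "norm (a - b) powr p / s * s \<le> (\<epsilon> + C * D z) * s"
        unfolding d2 using s by (intro mult_right_mono) auto
      moreover have "norm (a - b) powr p / s * s = norm (a - b) powr p" using s by simp
      moreover have "(\<epsilon> + C * D z) * s = \<epsilon> * s + C * (s / 2 - norm ((a + b) / 2) powr p)"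
        using s unfolding d1 by (simp only: s_def[symmetric]) (simp add: field_simps)
      ultimately show ?thesis by (simp only: s_def)
    qed
  qed
qed

lemma norm_add_powr_le:
  fixes a b :: complex
  assumes "0 \<le> p"
  shows "norm (a + b) powr p \<le> 2 powr p * (norm a powr p + norm b powr p)"
proof -
  have "norm (a + b) \<le> 2 * max (norm a) (norm b)" using norm_triangle_ineq[of a b] by linarith
  then have "norm (a + b) powr p \<le> (2 * max (norm a) (norm b)) powr p"
    using assms by (intro powr_mono2) auto
  also have "\<dots> = 2 powr p * (max (norm a) (norm b)) powr p" by (simp add: powr_mult)
  also have "\<dots> \<le> 2 powr p * (norm a powr p + norm b powr p)"
    by (intro mult_left_mono) (auto simp: max_def)
  finally show ?thesis .
qed

section \<open>Linear structure, Minkowski's and Hoelder's inequalities\<close>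

lemma Lpm_measurable: "f \<in> Lpm M p \<Longrightarrow> f \<in> borel_measurable M"
  and Lpm_integrable: "f \<in> Lpm M p \<Longrightarrow> integrable M (\<lambda>x. norm (f x) powr p)"
  by (auto simp: Lpm_def)

lemma powr_le_scaled:
  fixes u v C p :: real
  assumes "u \<le> C * v" "0 \<le> u" "0 \<le> v" "0 \<le> p" "0 \<le> C"
  shows "u powr p \<le> C powr p * v powr p"
proof -
  have "u powr p \<le> (C * v) powr p" using assms by (intro powr_mono2) auto
  then show ?thesis using assms by (simp add: powr_mult)
qed

lemma Lpm_bound:
  assumes "g \<in> Lpm M p" "f \<in> borel_measurable M" "AE x in M. norm (f x) \<le> C * norm (g x)" "0 \<le> p" "0 \<le> C"
  shows "f \<in> Lpm M p"
proof -
  have [measurable]: "f \<in> borel_measurable M" by (rule assms(2))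
  have "integrable M (\<lambda>x. norm (f x) powr p)"
  proof (rule Bochner_Integration.integrable_bound)
    show "integrable M (\<lambda>x. C powr p * norm (g x) powr p)" using Lpm_integrable[OF assms(1)] by simp
    show "(\<lambda>x. norm (f x) powr p) \<in> borel_measurable M" by measurable
    show "AE x in M. norm (norm (f x) powr p) \<le> norm (C powr p * norm (g x) powr p)"
      using assms(3) by eventually_elim (simp add: powr_le_scaled assms(4,5))
  qed
  then show ?thesis using assms(2) by (simp add: Lpm_def)
qed

lemma Lpm_add:
  assumes "f \<in> Lpm M p" "g \<in> Lpm M p" "0 \<le> p"
  shows "(\<lambda>x. f x + g x) \<in> Lpm M p"
proof -
  have [measurable]: "f \<in> borel_measurable M" "g \<in> borel_measurable M" using assms Lpm_measurable by auto
  have "integrable M (\<lambda>x. 2 powr p * (norm (f x) powr p + norm (g x) powr p))"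
    using Lpm_integrable[OF assms(1)] Lpm_integrable[OF assms(2)] by simp
  then have "integrable M (\<lambda>x. norm (f x + g x) powr p)"
    by (rule Bochner_Integration.integrable_bound) (use norm_add_powr_le[OF assms(3)] in auto)
  then show ?thesis by (simp add: Lpm_def)
qed

lemma Lpm_scale:
  assumes "f \<in> Lpm M p" "0 \<le> p"
  shows "(\<lambda>x. c * f x) \<in> Lpm M p"
proof (rule Lpm_bound[OF assms(1), where C="norm c"])
  have [measurable]: "f \<in> borel_measurable M" using assms Lpm_measurable by blast
  show "(\<lambda>x. c * f x) \<in> borel_measurable M" by measurable
qed (use assms in \<open>simp_all add: norm_mult\<close>)

lemma Lpm_diff:
  assumes "f \<in> Lpm M p" "g \<in> Lpm M p" "0 \<le> p"
  shows "(\<lambda>x. f x - g x) \<in> Lpm M p"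
  using Lpm_add[OF assms(1) Lpm_scale[OF assms(2,3), of "-1"] assms(3)] by simp

lemma Nrm_nonneg: "0 \<le> Nrm M p f" by (simp add: Nrm_def)

lemma Nrm_powr: "p > 0 \<Longrightarrow> Nrm M p f powr p = (LINT x|M. norm (f x) powr p)"
  by (simp add: Nrm_def powr_powr integral_nonneg_AE)

lemma Nrm_scale: "p > 0 \<Longrightarrow> Nrm M p (\<lambda>x. c * f x) = norm c * Nrm M p f"
  by (simp add: Nrm_def norm_mult powr_mult powr_powr)

lemma Nrm_eq_0:
  assumes "f \<in> Lpm M p" "p > 0" "Nrm M p f = 0"
  shows "AE x in M. f x = 0"
proof -
  have "(LINT x|M. norm (f x) powr p) = 0" using Nrm_powr[of p M f] assms by simp
  then have "AE x in M. norm (f x) powr p = 0"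
    using assms Lpm_integrable by (subst (asm) integral_nonneg_eq_0_iff_AE) auto
  then show ?thesis by simp
qed

lemma Nrm_mono:
  assumes "g \<in> Lpm M p" "f \<in> borel_measurable M" "AE x in M. norm (f x) \<le> C * norm (g x)" "0 < p" "0 \<le> C"
  shows "Nrm M p f \<le> C * Nrm M p g"
proof -
  have fL: "f \<in> Lpm M p" using assms by (intro Lpm_bound[OF assms(1-3)]) auto
  have "(LINT x|M. norm (f x) powr p) \<le> (LINT x|M. C powr p * norm (g x) powr p)"
  proof (rule integral_mono_AE)
    show "AE x in M. norm (f x) powr p \<le> C powr p * norm (g x) powr p"
      using assms(3) by eventually_elim (simp add: powr_le_scaled assms(5) less_imp_le[OF assms(4)])
  qed (use fL assms(1) Lpm_integrable in auto)
  also have "\<dots> = (C * Nrm M p g) powr p"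
    using assms by (simp add: powr_mult Nrm_powr)
  finally have "(LINT x|M. norm (f x) powr p) powr (1/p) \<le> ((C * Nrm M p g) powr p) powr (1/p)"
    using assms by (intro powr_mono2) (auto intro: integral_nonneg_AE)
  then show ?thesis using assms Nrm_nonneg[of M p g] by (simp add: powr_powr flip: Nrm_def)
qed

lemma Nrm_cong_AE:
  assumes "AE x in M. f x = g x" "f \<in> borel_measurable M" "g \<in> borel_measurable M"
  shows "Nrm M p f = Nrm M p g"
proof -
  have [measurable]: "f \<in> borel_measurable M" "g \<in> borel_measurable M" using assms by auto
  have "(LINT x|M. norm (f x) powr p) = (LINT x|M. norm (g x) powr p)"
    using assms by (intro integral_cong_AE) auto
  then show ?thesis by (simp add: Nrm_def)
qed

text \<open>Minkowski's inequality as a case of convexity: \<open>f + g\<close> is the convex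
  combination of \<open>f / t\<close> and \<open>g / (1 - t)\<close>, and the weight
  \<open>t = A / (A + B)\<close> gives both of them the norm \<open>A + B\<close>. A vanishing norm
  is treated apart because \<open>t\<close> must lie strictly between 0 and 1.\<close>

lemma Nrm_triangle:
  assumes f: "f \<in> Lpm M p" and g: "g \<in> Lpm M p" and p: "1 < p"
  shows "Nrm M p (\<lambda>x. f x + g x) \<le> Nrm M p f + Nrm M p g"
proof -
  have [measurable]: "f \<in> borel_measurable M" "g \<in> borel_measurable M" using f g Lpm_measurable by auto
  define A where "A = Nrm M p f" define B where "B = Nrm M p g"
  have AB: "0 \<le> A" "0 \<le> B" by (auto simp: A_def B_def Nrm_nonneg)
  consider "A = 0" | "B = 0" | "0 < A" "0 < B" using AB by linarith
  then show ?thesis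
  proof cases
    case 1
    then have "AE x in M. f x = 0" using Nrm_eq_0[OF f] p by (simp add: A_def)
    then have "AE x in M. f x + g x = g x" by eventually_elim simp
    then have "Nrm M p (\<lambda>x. f x + g x) = Nrm M p g" by (intro Nrm_cong_AE) auto
    then show ?thesis by (simp add: Nrm_nonneg)
  next
    case 2
    then have "AE x in M. g x = 0" using Nrm_eq_0[OF g] p by (simp add: B_def)
    then have "AE x in M. f x + g x = f x" by eventually_elim simp
    then have "Nrm M p (\<lambda>x. f x + g x) = Nrm M p f" by (intro Nrm_cong_AE) auto
    then show ?thesis by (simp add: Nrm_nonneg)
  next
    case 3
    define t where "t = A / (A + B)"
    have t: "0 < t" "t < 1" "1 - t = B / (A + B)" using 3 by (auto simp: t_def field_simps)
    have pt: "norm (f x + g x) powr p \<le> t * (norm (f x) / t) powr p + (1 - t) * (norm (g x) / (1 - t)) powr p" for x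
    proof -
      have "norm (f x + g x) powr p \<le> (t * (norm (f x) / t) + (1 - t) * (norm (g x) / (1 - t))) powr p"
        using t p norm_triangle_ineq[of "f x" "g x"] by (intro powr_mono2) auto
      also have "\<dots> \<le> t * (norm (f x) / t) powr p + (1 - t) * (norm (g x) / (1 - t)) powr p"
        using t(1,2) p by (intro powr_convex_nonneg) auto
      finally show ?thesis .
    qed
    have pd: "(norm (h x) / s) powr p = norm (h x) powr p / s powr p" if "0 < s" for h :: "'a \<Rightarrow> complex" and s x
      using that by (simp add: powr_divide)
    have "(LINT x|M. norm (f x + g x) powr p) \<le>
        (LINT x|M. t * (norm (f x) powr p / t powr p) + (1 - t) * (norm (g x) powr p / (1 - t) powr p))"
    proof (rule integral_mono)
      show "integrable M (\<lambda>x. norm (f x + g x) powr p)"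
        using Lpm_integrable[OF Lpm_add[OF f g]] p by simp
      show "integrable M (\<lambda>x. t * (norm (f x) powr p / t powr p) + (1 - t) * (norm (g x) powr p / (1 - t) powr p))"
        using Lpm_integrable[OF f] Lpm_integrable[OF g] by auto
      fix x show "norm (f x + g x) powr p \<le> t * (norm (f x) powr p / t powr p) + (1 - t) * (norm (g x) powr p / (1 - t) powr p)"
        using pt[of x] t(1,2) by (simp add: pd)
    qed
    also have "\<dots> = t * (A powr p / t powr p) + (1 - t) * (B powr p / (1 - t) powr p)"
      using Lpm_integrable[OF f] Lpm_integrable[OF g] p by (simp add: A_def B_def Nrm_powr)
    also have "\<dots> = t * (A + B) powr p + (1 - t) * (A + B) powr p"
    proof -
      have "A powr p / t powr p = (A + B) powr p"
        using 3 by (simp add: t_def powr_divide)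
      moreover have "B powr p / (1 - t) powr p = (A + B) powr p"
        unfolding t(3) using 3 by (simp add: powr_divide)
      ultimately show ?thesis by simp
    qed
    also have "\<dots> = (A + B) powr p" by (simp add: algebra_simps)
    finally have "Nrm M p (\<lambda>x. f x + g x) \<le> ((A + B) powr p) powr (1/p)"
      unfolding Nrm_def using p by (intro powr_mono2) (auto intro: integral_nonneg_AE)
    then show ?thesis using p AB by (simp add: powr_powr A_def B_def)
  qed
qed

lemma Holder:
  assumes f: "f \<in> Lpm M p" and g: "g \<in> Lpm M q" and pq: "1 < p" "1 < q" "1/p + 1/q = 1"
  shows "integrable M (\<lambda>x. f x * g x)"
    and "(LINT x|M. norm (f x * g x)) \<le> Nrm M p f * Nrm M q g"
proof -
  have [measurable]: "f \<in> borel_measurable M" "g \<in> borel_measurable M" using f g Lpm_measurable by auto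
  note fi = Lpm_integrable[OF f] and gi = Lpm_integrable[OF g]
  have Y: "norm (u * v) \<le> norm u powr p / p + norm v powr q / q" for u v :: complex
    using Youngs_inequality[OF pq, of "norm u" "norm v"] by (simp add: norm_mult)
  show int: "integrable M (\<lambda>x. f x * g x)"
  proof (rule Bochner_Integration.integrable_bound)
    show "integrable M (\<lambda>x. norm (f x) powr p / p + norm (g x) powr q / q)" using fi gi by auto
    show "AE x in M. norm (f x * g x) \<le> norm (norm (f x) powr p / p + norm (g x) powr q / q)"
    proof (intro AE_I2)
      fix x
      have "norm (f x * g x) \<le> norm (f x) powr p / p + norm (g x) powr q / q" by (rule Y)
      also have "\<dots> \<le> \<bar>norm (f x) powr p / p + norm (g x) powr q / q\<bar>" by (rule abs_ge_self)
      finally show "norm (f x * g x) \<le> norm (norm (f x) powr p / p + norm (g x) powr q / q)" by simp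
    qed
  qed auto
  define A where "A = Nrm M p f" define B where "B = Nrm M q g"
  have AB: "0 \<le> A" "0 \<le> B" by (auto simp: A_def B_def Nrm_nonneg)
  show "(LINT x|M. norm (f x * g x)) \<le> Nrm M p f * Nrm M q g"
  proof (cases "A = 0 \<or> B = 0")
    case True
    then have "AE x in M. norm (f x * g x) = 0"
      using Nrm_eq_0[OF f] Nrm_eq_0[OF g] pq by (auto simp: A_def B_def)
    then have "(LINT x|M. norm (f x * g x)) = (LINT x|M. 0)" by (intro integral_cong_AE) auto
    then show ?thesis by (simp add: Nrm_nonneg)
  next
    case False
    then have ab: "0 < A" "0 < B" using AB by auto
    have "(LINT x|M. norm (f x * g x)) \<le> (LINT x|M. A * B * ((norm (f x) powr p / A powr p) / p + (norm (g x) powr q / B powr q) / q))"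
    proof (rule integral_mono)
      show "integrable M (\<lambda>x. A * B * ((norm (f x) powr p / A powr p) / p + (norm (g x) powr q / B powr q) / q))"
        using fi gi by auto
      fix x
      have "norm (f x) / A * (norm (g x) / B) \<le> (norm (f x) / A) powr p / p + (norm (g x) / B) powr q / q"
        using ab by (intro Youngs_inequality[OF pq]) auto
      then have "A * B * (norm (f x) / A * (norm (g x) / B)) \<le> A * B * ((norm (f x) / A) powr p / p + (norm (g x) / B) powr q / q)"
        using ab by (intro mult_left_mono) auto
      then show "norm (f x * g x) \<le> A * B * ((norm (f x) powr p / A powr p) / p + (norm (g x) powr q / B powr q) / q)"
        using ab by (simp add: norm_mult powr_divide)
    qed (use int in auto)
    also have "\<dots> = A * B * ((A powr p / A powr p) / p + (B powr q / B powr q) / q)"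
      using fi gi pq by (simp add: A_def B_def Nrm_powr)
    also have "\<dots> = A * B" using ab pq by simp
    finally show ?thesis by (simp add: A_def B_def)
  qed
qed

section \<open>Uniform convexity, completeness and extremal functions in \<open>L^p\<close>\<close>

lemma Nrm_uniform_convexity:
  assumes p: "1 < p" and e: "0 < \<epsilon>"
  shows "\<exists>C\<ge>0. \<forall>f\<in>Lpm M p. \<forall>g\<in>Lpm M p. Nrm M p (\<lambda>x. f x - g x) powr p \<le> \<epsilon> * (Nrm M p f powr p + Nrm M p g powr p)
     + C * ((Nrm M p f powr p + Nrm M p g powr p) / 2 - Nrm M p (\<lambda>x. (f x + g x) / 2) powr p)"
proof -
  obtain C where C: "0 \<le> C" "\<And>a b :: complex. norm (a - b) powr p \<le> \<epsilon> * (norm a powr p + norm b powr p)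
     + C * ((norm a powr p + norm b powr p) / 2 - norm ((a + b) / 2) powr p)"
    using uniform_convexity_pointwise[OF p e] by blast
  show ?thesis
  proof (intro exI[of _ C] conjI ballI C(1))
    fix f g assume f: "f \<in> Lpm M p" and g: "g \<in> Lpm M p"
    have h: "(\<lambda>x. (f x + g x) / 2) \<in> Lpm M p"
      using Lpm_scale[OF Lpm_add[OF f g], of "1/2"] p by simp
    have d: "(\<lambda>x. f x - g x) \<in> Lpm M p" using Lpm_diff[OF f g] p by simp
    note i = Lpm_integrable[OF f] Lpm_integrable[OF g] Lpm_integrable[OF h] Lpm_integrable[OF d]
    have "(LINT x|M. norm (f x - g x) powr p) \<le> (LINT x|M. \<epsilon> * (norm (f x) powr p + norm (g x) powr p)
     + C * ((norm (f x) powr p + norm (g x) powr p) / 2 - norm ((f x + g x) / 2) powr p))"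
      using i C(2) by (intro integral_mono) auto
    also have "\<dots> = \<epsilon> * ((LINT x|M. norm (f x) powr p) + (LINT x|M. norm (g x) powr p))
     + C * (((LINT x|M. norm (f x) powr p) + (LINT x|M. norm (g x) powr p)) / 2 - (LINT x|M. norm ((f x + g x) / 2) powr p))"
      using i by simp
    finally show "Nrm M p (\<lambda>x. f x - g x) powr p \<le> \<epsilon> * (Nrm M p f powr p + Nrm M p g powr p)
     + C * ((Nrm M p f powr p + Nrm M p g powr p) / 2 - Nrm M p (\<lambda>x. (f x + g x) / 2) powr p)"
      using p by (simp add: Nrm_powr)
  qed
qed

lemma Lpm_bounded:
  assumes "finite_measure M" "f \<in> borel_measurable M" "AE x in M. norm (f x) \<le> C" "0 \<le> p"
  shows "f \<in> Lpm M p"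
proof -
  interpret finite_measure M by fact
  have [measurable]: "f \<in> borel_measurable M" by fact
  have "AE x in M. norm (norm (f x) powr p) \<le> C powr p"
    using assms(3) by eventually_elim (use assms in \<open>auto intro: powr_mono2\<close>)
  then have "integrable M (\<lambda>x. norm (f x) powr p)" by (intro integrable_const_bound) auto
  then show ?thesis by (simp add: Lpm_def)
qed

lemma Lpm_imp_L1:
  assumes "finite_measure M" "f \<in> Lpm M p" "1 < p"
  shows "integrable M f"
    and "(LINT x|M. norm (f x)) \<le> Nrm M p f * Nrm M (p / (p - 1)) (\<lambda>_. 1)"
proof -
  have 1: "(\<lambda>_. 1) \<in> Lpm M (p / (p - 1))"
    by (rule Lpm_bounded[where C=1]) (use assms(1,3) in simp_all)
  have q: "1 < p / (p - 1)" "1 / p + 1 / (p / (p - 1)) = 1"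
    using assms(3) by (auto simp: divide_simps)
  have "integrable M (\<lambda>x. f x * 1)" by (rule Holder(1)[OF assms(2) 1 assms(3) q])
  then show "integrable M f" by simp
  have "(LINT x|M. norm (f x * 1)) \<le> Nrm M p f * Nrm M (p / (p - 1)) (\<lambda>_. 1)"
    by (rule Holder(2)[OF assms(2) 1 assms(3) q])
  then show "(LINT x|M. norm (f x)) \<le> Nrm M p f * Nrm M (p / (p - 1)) (\<lambda>_. 1)" by simp
qed

lemma Nrm_fatou:
  assumes G: "\<And>k. G k \<in> Lpm M p" and e: "\<And>k. Nrm M p (G k) \<le> e" and p: "0 < p"
    and lim: "AE x in M. (\<lambda>k. G k x) \<longlonglongrightarrow> g x" and g[measurable]: "g \<in> borel_measurable M"
  shows "g \<in> Lpm M p" and "Nrm M p g \<le> e"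
proof -
  have [measurable]: "G k \<in> borel_measurable M" for k using G Lpm_measurable by blast
  have e0: "0 \<le> e" using e[of 0] Nrm_nonneg[of M p "G 0"] by linarith
  have "AE x in M. ennreal (norm (g x) powr p) = liminf (\<lambda>k. ennreal (norm (G k x) powr p))"
    using lim
  proof eventually_elim
    case (elim x)
    have "(\<lambda>k. norm (G k x) powr p) \<longlonglongrightarrow> norm (g x) powr p"
      using tendsto_powr'[OF tendsto_norm[OF elim] tendsto_const[of p]] p by simp
    then have "(\<lambda>k. ennreal (norm (G k x) powr p)) \<longlonglongrightarrow> ennreal (norm (g x) powr p)"
      by (rule tendsto_ennrealI)
    then show ?case by (rule lim_imp_Liminf[OF sequentially_bot, symmetric])
  qed
  then have "(\<integral>\<^sup>+x. ennreal (norm (g x) powr p) \<partial>M) = (\<integral>\<^sup>+x. liminf (\<lambda>k. ennreal (norm (G k x) powr p)) \<partial>M)"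
    by (rule nn_integral_cong_AE)
  also have "\<dots> \<le> liminf (\<lambda>k. \<integral>\<^sup>+x. ennreal (norm (G k x) powr p) \<partial>M)"
    by (rule nn_integral_liminf) measurable
  also have "\<dots> \<le> liminf (\<lambda>k::nat. ennreal (e powr p))"
  proof (rule Liminf_mono, rule always_eventually, rule allI)
    fix k
    have "(\<integral>\<^sup>+x. ennreal (norm (G k x) powr p) \<partial>M) = ennreal (Nrm M p (G k) powr p)"
      using Lpm_integrable[OF G] p by (simp add: nn_integral_eq_integral Nrm_powr)
    also have "\<dots> \<le> ennreal (e powr p)"
      using e[of k] p Nrm_nonneg[of M p "G k"] by (intro ennreal_leI powr_mono2) auto
    finally show "(\<integral>\<^sup>+x. ennreal (norm (G k x) powr p) \<partial>M) \<le> ennreal (e powr p)" .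
  qed
  also have "\<dots> = ennreal (e powr p)" by (simp add: Liminf_const)
  finally have fin: "(\<integral>\<^sup>+x. ennreal (norm (g x) powr p) \<partial>M) \<le> ennreal (e powr p)" .
  then have int: "integrable M (\<lambda>x. norm (g x) powr p)"
    by (intro integrableI_bounded) (auto intro: le_less_trans)
  then show gL: "g \<in> Lpm M p" using g by (simp add: Lpm_def)
  have "ennreal (LINT x|M. norm (g x) powr p) \<le> ennreal (e powr p)"
    using fin int by (simp add: nn_integral_eq_integral)
  then have "(LINT x|M. norm (g x) powr p) \<le> e powr p" by (simp add: ennreal_le_iff)
  then have "Nrm M p g \<le> (e powr p) powr (1/p)"
    unfolding Nrm_def using p by (intro powr_mono2) (auto intro: integral_nonneg_AE)
  then show "Nrm M p g \<le> e" using p e0 by (simp add: powr_powr)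
qed

text \<open>The Cauchy property in \<open>L^1\<close> gives an almost everywhere convergent
  subsequence, and Fatou's lemma upgrades this to convergence in norm. The limit is displayed as a
  pointwise \<open>lim\<close> because it must later be a function on the circle: if the sequence
  has the form \<open>F k (cis x)\<close>, then this formula visibly depends on \<open>cis x\<close>
  only.\<close>

lemma Lpm_complete:
  assumes fin: "finite_measure M" and p: "1 < p" and F: "\<And>n. F n \<in> Lpm M p"
    and C: "\<And>e. 0 < e \<Longrightarrow> \<exists>N. \<forall>m\<ge>N. \<forall>n\<ge>N. Nrm M p (\<lambda>x. F m x - F n x) < e"
  shows "\<exists>r. (\<lambda>x. lim (\<lambda>k. F (r k) x)) \<in> Lpm M p \<and> (\<lambda>n. Nrm M p (\<lambda>x. F n x - lim (\<lambda>k. F (r k) x))) \<longlonglongrightarrow> 0"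
proof -
  have [measurable]: "F k \<in> borel_measurable M" for k using F Lpm_measurable by blast
  define K where "K = Nrm M (p / (p - 1)) (\<lambda>_. 1) + 1"
  have K: "0 < K" using Nrm_nonneg[of M "p / (p - 1)" "\<lambda>_. 1"] by (simp add: K_def)
  have D: "(\<lambda>x. F m x - F n x) \<in> Lpm M p" for m n using Lpm_diff[OF F F] p by simp
  have le: "(LINT x|M. norm (F m x - F n x)) \<le> Nrm M p (\<lambda>x. F m x - F n x) * K" for m n
  proof -
    have "(LINT x|M. norm (F m x - F n x)) \<le> Nrm M p (\<lambda>x. F m x - F n x) * (K - 1)"
      using Lpm_imp_L1(2)[OF fin D p] by (simp add: K_def)
    also have "\<dots> \<le> Nrm M p (\<lambda>x. F m x - F n x) * K" by (intro mult_left_mono) (auto simp: Nrm_nonneg)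
    finally show ?thesis .
  qed
  obtain r where r: "strict_mono r" "AE x in M. Cauchy (\<lambda>i. F (r i) x)"
  proof (rule cauchy_L1_AE_cauchy_subseq[of M F])
    show "integrable M (F n)" for n by (rule Lpm_imp_L1(1)[OF fin F p])
    fix e :: real assume "0 < e"
    then obtain N where N: "\<forall>m\<ge>N. \<forall>n\<ge>N. Nrm M p (\<lambda>x. F m x - F n x) < e / K" using C[of "e / K"] K by auto
    show "\<exists>N. \<forall>i\<ge>N. \<forall>j\<ge>N. (LINT x|M. norm (F i x - F j x)) < e"
    proof (intro exI[of _ N] allI impI)
      fix i j assume "N \<le> i" "N \<le> j"
      then have "Nrm M p (\<lambda>x. F i x - F j x) * K < e" using N K by (simp add: field_simps)
      then show "(LINT x|M. norm (F i x - F j x)) < e" using le[of i j] by linarith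
    qed
  qed (rule that)
  define f where "f = (\<lambda>x. lim (\<lambda>k. F (r k) x))"
  have [measurable]: "f \<in> borel_measurable M" unfolding f_def by measurable
  have conv: "AE x in M. (\<lambda>k. F (r k) x) \<longlonglongrightarrow> f x"
    using r(2) by eventually_elim (simp add: f_def Cauchy_convergent_iff convergent_LIMSEQ_iff)
  have key: "(\<lambda>x. F n x - f x) \<in> Lpm M p \<and> Nrm M p (\<lambda>x. F n x - f x) \<le> e"
    if N: "\<forall>m\<ge>N. \<forall>n\<ge>N. Nrm M p (\<lambda>x. F m x - F n x) < e" and n: "N \<le> n" for N n e
  proof -
    have rk: "N \<le> r (k + N)" for k using seq_suble[OF r(1), of "k + N"] by linarith
    have lm: "AE x in M. (\<lambda>k. F n x - F (r (k + N)) x) \<longlonglongrightarrow> F n x - f x"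
      using conv by eventually_elim (intro tendsto_intros LIMSEQ_ignore_initial_segment)
    have b: "Nrm M p (\<lambda>x. F n x - F (r (k + N)) x) \<le> e" for k
      using N n rk[of k] by (auto intro: less_imp_le)
    have p0: "0 < p" using p by simp
    show ?thesis
      using Nrm_fatou[of "\<lambda>k x. F n x - F (r (k + N)) x" M p e "\<lambda>x. F n x - f x", OF D b p0 lm] by simp
  qed
  obtain N1 where N1: "\<forall>m\<ge>N1. \<forall>n\<ge>N1. Nrm M p (\<lambda>x. F m x - F n x) < 1" using C[of 1] by auto
  have d: "(\<lambda>x. F N1 x - f x) \<in> Lpm M p" using key[OF N1] by simp
  have "(\<lambda>x. F N1 x - (F N1 x - f x)) \<in> Lpm M p" using Lpm_diff[OF F[of N1] d] p by simp
  then have fL: "f \<in> Lpm M p" by simp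
  have "(\<lambda>n. Nrm M p (\<lambda>x. F n x - f x)) \<longlonglongrightarrow> 0"
  proof (rule LIMSEQ_I)
    fix e :: real assume "0 < e"
    then obtain N where N: "\<forall>m\<ge>N. \<forall>n\<ge>N. Nrm M p (\<lambda>x. F m x - F n x) < e / 2" using C[of "e/2"] by auto
    show "\<exists>no. \<forall>n\<ge>no. norm (Nrm M p (\<lambda>x. F n x - f x) - 0) < e"
    proof (intro exI[of _ N] allI impI)
      fix n assume "N \<le> n"
      then have "Nrm M p (\<lambda>x. F n x - f x) \<le> e / 2" using key[OF N] by simp
      then show "norm (Nrm M p (\<lambda>x. F n x - f x) - 0) < e"
        using \<open>0 < e\<close> Nrm_nonneg[of M p "\<lambda>x. F n x - f x"] by simp
    qed
  qed
  then show ?thesis using fL unfolding f_def by blast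
qed

lemma conj_exp_props:
  assumes "1 < p"
  shows "1 < conj_exp p" "1 / p + 1 / conj_exp p = 1" "conj_exp (conj_exp p) = p"
  using assms by (auto simp: conj_exp_def divide_simps)

lemma cnj_measurable [measurable (raw)]:
  "f \<in> borel_measurable M \<Longrightarrow> (\<lambda>x. cnj (f x)) \<in> borel_measurable M"
  by (rule measurable_compose[OF _ borel_measurable_continuous_onI]) (auto intro: continuous_intros)

lemma of_real_measurable [measurable (raw)]:
  "f \<in> borel_measurable M \<Longrightarrow> (\<lambda>x. complex_of_real (f x)) \<in> borel_measurable M"
  by (rule measurable_compose[OF _ borel_measurable_continuous_onI]) (auto intro: continuous_intros)

text \<open>The function for which equality holds in Hoelder's inequality. Its formula is part of
  the conclusion so that for \<open>f x = F (cis x)\<close> it can be read as a function on the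
  circle. If \<open>f\<close> has norm zero, the division by zero makes \<open>\<psi>\<close> vanish
  and the claims stay true.\<close>

lemma converse_Holder:
  assumes f: "f \<in> Lpm M p" and p: "1 < p"
  shows "\<exists>\<psi>\<in>Lpm M (conj_exp p). Nrm M (conj_exp p) \<psi> \<le> 1 \<and> (LINT x|M. f x * \<psi> x) = complex_of_real (Nrm M p f)
    \<and> \<psi> = (\<lambda>x. cnj (f x) * of_real (norm (f x) powr (p - 2) / Nrm M p f powr (p - 1)))"
proof -
  define q where "q = conj_exp p"
  have q: "1 < q" "(p - 1) * q = p" using conj_exp_props[OF p] p by (auto simp: q_def conj_exp_def)
  have [measurable]: "f \<in> borel_measurable M" using f Lpm_measurable by blast
  define A where "A = Nrm M p f"
  define \<psi> where "\<psi> = (\<lambda>x. cnj (f x) * of_real (norm (f x) powr (p - 2) / A powr (p - 1)))"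
  have [measurable]: "\<psi> \<in> borel_measurable M" unfolding \<psi>_def by measurable
  have A0: "0 \<le> A" by (simp add: A_def Nrm_nonneg)
  have np: "norm z * norm z powr (p - 2) = norm z powr (p - 1)" for z :: complex
    using powr_mult_base[of "norm z" "p - 2"] by (cases "z = 0") auto
  have n\<psi>: "norm (\<psi> x) = norm (f x) powr (p - 1) / A powr (p - 1)" for x
    unfolding \<psi>_def by (simp add: norm_mult np A0 norm_divide)
  have n\<psi>q: "norm (\<psi> x) powr q = norm (f x) powr p / A powr p" for x
    unfolding n\<psi> using A0 by (simp add: powr_divide powr_powr q)
  have psiL: "\<psi> \<in> Lpm M q" using Lpm_integrable[OF f] by (simp add: Lpm_def n\<psi>q)
  have "Nrm M q \<psi> = (A powr p / A powr p) powr (1/q)"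
    unfolding Nrm_def n\<psi>q using p by (simp add: A_def Nrm_powr)
  then have N1: "Nrm M q \<psi> \<le> 1" by (cases "A = 0") auto
  have prod: "f x * \<psi> x = complex_of_real (norm (f x) powr p / A powr (p - 1))" for x
  proof -
    have "norm (f x) * (norm (f x) * norm (f x) powr (p - 2)) = norm (f x) powr p"
      unfolding np using powr_mult_base[of "norm (f x)" "p - 1"] p by (cases "f x = 0") auto
    moreover have "f x * cnj (f x) = complex_of_real (norm (f x) * norm (f x))"
      using complex_norm_square[of "f x"] by (simp add: power2_eq_square)
    ultimately show ?thesis unfolding \<psi>_def
      by (simp add: mult.assoc[symmetric] flip: of_real_mult)
  qed
  have "(LINT x|M. f x * \<psi> x) = complex_of_real (LINT x|M. norm (f x) powr p / A powr (p - 1))"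
    unfolding prod by simp
  also have "(LINT x|M. norm (f x) powr p / A powr (p - 1)) = A powr p / A powr (p - 1)"
    using p by (simp add: A_def Nrm_powr)
  also have "\<dots> = A" using A0 p by (cases "A = 0") (auto simp flip: powr_diff)
  finally have "(LINT x|M. f x * \<psi> x) = complex_of_real A" .
  then show ?thesis using psiL N1 unfolding q_def A_def \<psi>_def by blast
qed

section \<open>The circle\<close>

lemma finite_measure_TM: "finite_measure TM"
  by (rule finite_measure_lebesgue_on) auto

lemma TM_reflect_measurable: "(\<lambda>x. 2 * pi - x) \<in> TM \<rightarrow>\<^sub>M TM"
proof -
  have "(\<lambda>x::real. 2 * pi + (-1) * x) \<in> lebesgue \<rightarrow>\<^sub>M lebesgue"
    using lebesgue_affine_measurable[where c= "\<lambda>x::real. -1" and t = "2 * pi"] by simp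
  then have "(\<lambda>x::real. 2 * pi - x) \<in> lebesgue \<rightarrow>\<^sub>M lebesgue" by simp
  then show ?thesis
    by (intro measurable_restrict_space3) auto
qed

text \<open>In the parametrisation by angles the inversion \<open>t \<mapsto> 1/t\<close> is this
  reflection of the interval; its invariance makes \<open>fl\<close> well defined on classes and
  isometric.\<close>

lemma TM_reflect: "distr TM TM (\<lambda>x. 2 * pi - x) = TM"
proof (rule measure_eqI)
  fix A assume "A \<in> sets (distr TM TM (\<lambda>x. 2 * pi - x))"
  then have A: "A \<in> sets TM" by simp
  then have A': "A \<in> sets lebesgue" "A \<subseteq> {0..2*pi}" by (auto simp: sets_restrict_space)
  have im: "(\<lambda>x. 2 * pi - x) -` A \<inter> space TM = (\<lambda>x. (-1) *\<^sub>R x + 2 * pi) ` A"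
    using A'(2) by (auto simp: image_iff intro!: bexI[where x="2 * pi - _"])
  have "emeasure (distr TM TM (\<lambda>x. 2 * pi - x)) A = emeasure TM ((\<lambda>x. 2 * pi - x) -` A \<inter> space TM)"
    by (rule emeasure_distr[OF TM_reflect_measurable A])
  also have "\<dots> = emeasure lebesgue ((\<lambda>x. 2 * pi - x) -` A \<inter> space TM)"
    using measurable_sets[OF TM_reflect_measurable A] by (intro emeasure_restrict_space) (auto simp: sets_restrict_space)
  also have "\<dots> = emeasure lebesgue A"
    unfolding im by (subst emeasure_lebesgue_affine) simp
  also have "\<dots> = emeasure TM A" using A' by (intro emeasure_restrict_space[symmetric]) auto
  finally show "emeasure (distr TM TM (\<lambda>x. 2 * pi - x)) A = emeasure TM A" .
qed simp

lemma cis_2pi_minus: "cis (2 * pi - \<theta>) = inverse (cis \<theta>)"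
  by (simp add: cis_inverse complex_eq_iff)

lemma circ_tld: "circ (tld f) \<theta> = circ f (2 * pi - \<theta>)"
  by (simp add: circ_def tld_def cis_2pi_minus)

lemma circ_tld_measurable:
  assumes "circ f \<in> borel_measurable TM" shows "circ (tld f) \<in> borel_measurable TM"
  using measurable_compose[OF TM_reflect_measurable assms] by (simp add: circ_tld[abs_def])

lemma AE_tld:
  assumes "AE \<theta> in TM. P (cis \<theta>)" shows "AE \<theta> in TM. P (inverse (cis \<theta>))"
proof -
  have "AE \<theta> in distr TM TM (\<lambda>x. 2 * pi - x). P (cis \<theta>)" unfolding TM_reflect by (rule assms)
  then have "AE \<theta> in TM. P (cis (2 * pi - \<theta>))" by (rule AE_distrD[OF TM_reflect_measurable])
  then show ?thesis by (simp add: cis_2pi_minus)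
qed

lemma LINT_tld:
  fixes h :: "complex \<Rightarrow> 'b::{banach, second_countable_topology}"
  assumes "(\<lambda>\<theta>. h (cis \<theta>)) \<in> borel_measurable TM"
  shows "(LINT \<theta>|TM. h (inverse (cis \<theta>))) = (LINT \<theta>|TM. h (cis \<theta>))"
proof -
  have "(LINT \<theta>|TM. h (cis \<theta>)) = (LINT \<theta>|distr TM TM (\<lambda>x. 2 * pi - x). h (cis \<theta>))" by (simp add: TM_reflect)
  also have "\<dots> = (LINT \<theta>|TM. h (cis (2 * pi - \<theta>)))" by (rule integral_distr[OF TM_reflect_measurable assms])
  also have "\<dots> = (LINT \<theta>|TM. h (inverse (cis \<theta>)))" by (simp add: cis_2pi_minus)
  finally show ?thesis by simp
qed

lemma integrable_tld:
  fixes h :: "complex \<Rightarrow> 'b::{banach, second_countable_topology}"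
  assumes "integrable TM (\<lambda>\<theta>. h (cis \<theta>))"
  shows "integrable TM (\<lambda>\<theta>. h (inverse (cis \<theta>)))"
proof -
  have "integrable (distr TM TM (\<lambda>x. 2 * pi - x)) (\<lambda>\<theta>. h (cis \<theta>))" using assms by (simp add: TM_reflect)
  then have "integrable TM (\<lambda>\<theta>. h (cis (2 * pi - \<theta>)))" by (rule integrable_distr[OF TM_reflect_measurable])
  then show ?thesis by (simp add: cis_2pi_minus)
qed

lemma cis_measurable [measurable]: "cis \<in> borel_measurable TM"
proof -
  have "cis \<in> borel_measurable borel" by (intro borel_measurable_continuous_onI continuous_intros)
  then have "cis \<in> borel_measurable lebesgue" by (rule measurable_completion[of cis lborel borel, simplified])
  then show ?thesis by (rule measurable_restrict_space1)
qed

lemma circ_continuous_measurable: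
  assumes "continuous_on (sphere 0 1) f" shows "circ f \<in> borel_measurable TM"
proof -
  have "continuous_on UNIV (\<lambda>x. f (cis x))"
    by (rule continuous_on_compose2[OF assms]) (auto intro!: continuous_intros)
  then have "(\<lambda>x. f (cis x)) \<in> borel_measurable borel" by (rule borel_measurable_continuous_onI)
  then have "(\<lambda>x. f (cis x)) \<in> borel_measurable lebesgue" by (rule measurable_completion[of _ lborel borel, simplified])
  then show ?thesis unfolding circ_def by (rule measurable_restrict_space1)
qed

lemma circ_monom_measurable [measurable]: "circ (\<lambda>t. t powi k) \<in> borel_measurable TM"
  by (intro circ_continuous_measurable continuous_intros) auto

lemma LINT_cis_powi: "(LINT \<theta>|TM. cis \<theta> powi k) = (if k = 0 then 2 * pi else 0)"
proof (cases "k = 0")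
  case True
  then show ?thesis by (simp add: measure_restrict_space scaleR_conv_of_real)
next
  case False
  have c: "continuous_on {0..2*pi} (\<lambda>\<theta>. cis (of_int k * \<theta>))" by (intro continuous_intros)
  have i: "integrable TM (\<lambda>\<theta>. cis (of_int k * \<theta>))"
  proof (rule finite_measure.integrable_const_bound[OF finite_measure_TM, of _ 1])
    show "(\<lambda>\<theta>. cis (of_int k * \<theta>)) \<in> borel_measurable TM"
      using circ_monom_measurable[of k] by (simp add: circ_def[abs_def] cis_power_int)
  qed simp
  have "((\<lambda>\<theta>. cis (of_int k * \<theta>)) has_integral (cis (of_int k * (2 * pi)) / (\<i> * of_int k) - cis (of_int k * 0) / (\<i> * of_int k))) {0..2*pi}"
  proof (rule fundamental_theorem_of_calculus)
    fix x :: real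
    have "((\<lambda>\<theta>. exp (\<i> * of_real (of_int k * \<theta>)) / (\<i> * of_int k)) has_vector_derivative exp (\<i> * of_real (of_int k * x))) (at x within {0..2*pi})"
      using False by (auto intro!: derivative_eq_intros has_vector_derivative_real_field simp: field_simps)
    then show "((\<lambda>\<theta>. cis (of_int k * \<theta>) / (\<i> * of_int k)) has_vector_derivative cis (of_int k * x)) (at x within {0..2*pi})"
      by (simp add: cis_conv_exp)
  qed simp
  moreover have "cis (of_int k * (2 * pi)) = 1" using cis_multiple_2pi[of "of_int k"] by (simp add: mult.commute)
  ultimately have "((\<lambda>\<theta>. cis (of_int k * \<theta>)) has_integral 0) {0..2*pi}" by simp
  then have "integral {0..2*pi} (\<lambda>\<theta>. cis (of_int k * \<theta>)) = 0" by (rule integral_unique)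
  moreover have "(LINT \<theta>|TM. cis (of_int k * \<theta>)) = integral {0..2*pi} (\<lambda>\<theta>. cis (of_int k * \<theta>))"
    by (rule lebesgue_integral_eq_integral[OF i]) simp
  ultimately show ?thesis using False by (simp add: cis_power_int)
qed

section \<open>Measurable functions on the circle modulo null sets\<close>

definition cm :: "(complex \<Rightarrow> complex) \<Rightarrow> bool" where
  "cm f \<longleftrightarrow> circ f \<in> borel_measurable TM"

lemma cm_measurable: "cm f \<Longrightarrow> (\<lambda>\<theta>. f (cis \<theta>)) \<in> borel_measurable TM"
  by (simp add: cm_def circ_def[abs_def])

lemma cmI: "(\<lambda>\<theta>. f (cis \<theta>)) \<in> borel_measurable TM \<Longrightarrow> cm f"
  by (simp add: cm_def circ_def[abs_def])

lemma cm_intros [simp]: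
  "cm (\<lambda>_. c)" "cm (\<lambda>t. t powi k)"
  "cm f \<Longrightarrow> cm g \<Longrightarrow> cm (\<lambda>z. f z + g z)" "cm f \<Longrightarrow> cm g \<Longrightarrow> cm (\<lambda>z. f z - g z)"
  "cm f \<Longrightarrow> cm g \<Longrightarrow> cm (\<lambda>z. f z * g z)" "cm f \<Longrightarrow> cm (\<lambda>z. - f z)"
  "cm f \<Longrightarrow> cm (\<lambda>z. inverse (f z))" "cm f \<Longrightarrow> cm (\<lambda>z. cnj (f z))" "cm f \<Longrightarrow> cm (\<lambda>z. f (inverse z))"
  "cm (\<lambda>t. t)" "cm f \<Longrightarrow> cm g \<Longrightarrow> cm (\<lambda>z. f z / g z)" "cm f \<Longrightarrow> cm (\<lambda>z. f z powi k)"
  subgoal by (rule cmI) simp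
  subgoal using circ_monom_measurable by (simp add: cm_def)
  subgoal by (rule cmI, rule borel_measurable_add; erule cm_measurable)
  subgoal by (rule cmI, rule borel_measurable_diff; erule cm_measurable)
  subgoal by (rule cmI, rule borel_measurable_times; erule cm_measurable)
  subgoal by (rule cmI, rule borel_measurable_uminus; erule cm_measurable)
  subgoal by (rule cmI, rule borel_measurable_inverse; erule cm_measurable)
  subgoal by (rule cmI, rule cnj_measurable; erule cm_measurable)
  subgoal using circ_tld_measurable[of f] by (simp add: cm_def tld_def)
  subgoal by (rule cmI, rule cis_measurable)
  subgoal by (rule cmI, rule borel_measurable_divide; erule cm_measurable)
  subgoal unfolding power_int_def
    by (rule cmI, cases "0 \<le> k"; simp; intro borel_measurable_power borel_measurable_inverse; erule cm_measurable)
  done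

lemma cm_tld [simp]: "cm f \<Longrightarrow> cm (tld f)" by (simp add: tld_def)

lemma ae_eq_refl [simp]: "ae_eq f f" by (simp add: ae_eq_def)
lemma ae_eq_sym: "ae_eq f g \<Longrightarrow> ae_eq g f" unfolding ae_eq_def by (erule eventually_mono) simp
lemma ae_eq_trans: "ae_eq f g \<Longrightarrow> ae_eq g h \<Longrightarrow> ae_eq f h"
  unfolding ae_eq_def by (erule (1) eventually_elim2) simp
lemma ae_eq_cong1: "ae_eq f f' \<Longrightarrow> ae_eq (\<lambda>z. h (f z)) (\<lambda>z. h (f' z))"
  unfolding ae_eq_def by (erule eventually_mono) simp
lemma ae_eq_cong2: "ae_eq f f' \<Longrightarrow> ae_eq g g' \<Longrightarrow> ae_eq (\<lambda>z. h (f z) (g z)) (\<lambda>z. h (f' z) (g' z))"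
  unfolding ae_eq_def by (erule (1) eventually_elim2) simp

quotient_type mfun = "complex \<Rightarrow> complex" / partial: "\<lambda>f g. cm f \<and> cm g \<and> ae_eq f g"
proof (rule part_equivpI)
  show "\<exists>f. cm f \<and> cm f \<and> ae_eq f f" by (rule exI[of _ "\<lambda>_. 0"]) simp
qed (auto simp: symp_def transp_def intro: ae_eq_sym ae_eq_trans)

definition mk :: "(complex \<Rightarrow> complex) \<Rightarrow> mfun" where "mk = abs_mfun"

lemma mk_eq_iff: "cm f \<Longrightarrow> cm g \<Longrightarrow> mk f = mk g \<longleftrightarrow> ae_eq f g"
  using Quotient3_rel[OF Quotient3_mfun, of f g] by (simp add: mk_def)

lemma mfun_rep: obtains F where "cm F" "f = mk F"
  using Quotient3_rep_reflp[OF Quotient3_mfun, of f] Quotient3_abs_rep[OF Quotient3_mfun, of f] that[of "rep_mfun f"]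
  by (simp add: mk_def)

instantiation mfun :: comm_ring_1
begin
lift_definition zero_mfun :: mfun is "\<lambda>_. 0" by simp
lift_definition one_mfun :: mfun is "\<lambda>_. 1" by simp
lift_definition plus_mfun :: "mfun \<Rightarrow> mfun \<Rightarrow> mfun" is "\<lambda>f g z. f z + g z"
  by (simp add: ae_eq_cong2)
lift_definition minus_mfun :: "mfun \<Rightarrow> mfun \<Rightarrow> mfun" is "\<lambda>f g z. f z - g z"
  by (simp add: ae_eq_cong2)
lift_definition times_mfun :: "mfun \<Rightarrow> mfun \<Rightarrow> mfun" is "\<lambda>f g z. f z * g z"
  by (simp add: ae_eq_cong2)
lift_definition uminus_mfun :: "mfun \<Rightarrow> mfun" is "\<lambda>f z. - f z"
  by (simp add: ae_eq_cong1)
instance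
proof
  fix f g h :: mfun
  obtain F where F: "cm F" "f = mk F" by (rule mfun_rep)
  obtain G where G: "cm G" "g = mk G" by (rule mfun_rep)
  obtain H where H: "cm H" "h = mk H" by (rule mfun_rep)
  note s = F G H mk_def plus_mfun.abs_eq times_mfun.abs_eq minus_mfun.abs_eq uminus_mfun.abs_eq
    zero_mfun.abs_eq[symmetric] one_mfun.abs_eq[symmetric] one_mfun.abs_eq zero_mfun.abs_eq
  have z: "0 = mk (\<lambda>_. 0)" "1 = mk (\<lambda>_. 1)" by (simp_all add: mk_def zero_mfun_def one_mfun_def)
  have P: "mk A + mk B = mk (\<lambda>z. A z + B z)" if "cm A" "cm B" for A B
    using that by (simp add: mk_def plus_mfun.abs_eq)
  have T: "mk A * mk B = mk (\<lambda>z. A z * B z)" if "cm A" "cm B" for A B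
    using that by (simp add: mk_def times_mfun.abs_eq)
  have M: "mk A - mk B = mk (\<lambda>z. A z - B z)" if "cm A" "cm B" for A B
    using that by (simp add: mk_def minus_mfun.abs_eq)
  have U: "- mk A = mk (\<lambda>z. - A z)" if "cm A" for A
    using that by (simp add: mk_def uminus_mfun.abs_eq)
  note pt = F G H P T M U z
  show "f + g + h = f + (g + h)" by (simp add: pt add.assoc)
  show "f + g = g + f" by (simp add: pt add.commute)
  show "0 + f = f" by (simp add: pt)
  show "- f + f = 0" by (simp add: pt)
  show "f - g = f + - g" by (simp add: pt)
  show "f * g * h = f * (g * h)" by (simp add: pt mult.assoc)
  show "f * g = g * f" by (simp add: pt mult.commute)
  show "1 * f = f" by (simp add: pt)
  show "(f + g) * h = f * h + g * h" by (simp add: pt algebra_simps)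
  show "(0::mfun) \<noteq> 1"
  proof
    assume "(0::mfun) = 1"
    then have "AE \<theta> in TM. False" by (simp add: z mk_eq_iff ae_eq_def)
    then have "emeasure TM (space TM) = 0" by (simp add: ae_filter_eq_bot_iff eventually_False)
    then show False by (simp add: emeasure_restrict_space)
  qed
qed
end

instantiation mfun :: inverse
begin
lift_definition inverse_mfun :: "mfun \<Rightarrow> mfun" is "\<lambda>f z. inverse (f z)"
  by (simp add: ae_eq_cong1)
definition divide_mfun :: "mfun \<Rightarrow> mfun \<Rightarrow> mfun" where "divide_mfun f g = f * inverse g"
instance ..
end

section \<open>Operations, norms and mean values on classes\<close>

lift_definition cst :: "complex \<Rightarrow> mfun" is "\<lambda>c _. c" by simp
lift_definition zp :: "int \<Rightarrow> mfun" is "\<lambda>k t. t powi k" by simp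
lift_definition cj :: "mfun \<Rightarrow> mfun" is "\<lambda>f z. cnj (f z)"
  by (simp add: ae_eq_cong1)
lift_definition fl :: "mfun \<Rightarrow> mfun" is "\<lambda>f z. f (inverse z)"
proof -
  fix f g :: "complex \<Rightarrow> complex" assume a: "cm f \<and> cm g \<and> ae_eq f g"
  then show "cm (\<lambda>z. f (inverse z)) \<and> cm (\<lambda>z. g (inverse z)) \<and> ae_eq (\<lambda>z. f (inverse z)) (\<lambda>z. g (inverse z))"
    using AE_tld[of "\<lambda>z. f z = g z"] by (simp add: ae_eq_def)
qed
lift_definition av :: "mfun \<Rightarrow> complex" is "\<lambda>f. (1 / (2 * complex_of_real pi)) * (LINT \<theta>|TM. f (cis \<theta>))"
proof -
  fix f g :: "complex \<Rightarrow> complex" assume a: "cm f \<and> cm g \<and> ae_eq f g"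
  then have "(LINT \<theta>|TM. f (cis \<theta>)) = (LINT \<theta>|TM. g (cis \<theta>))"
    by (intro integral_cong_AE) (auto simp: ae_eq_def cm_measurable)
  then show "(1 / (2 * complex_of_real pi)) * (LINT \<theta>|TM. f (cis \<theta>)) = (1 / (2 * complex_of_real pi)) * (LINT \<theta>|TM. g (cis \<theta>))" by simp
qed
lift_definition nm :: "real \<Rightarrow> mfun \<Rightarrow> real" is "\<lambda>p f. Nrm TM p (\<lambda>\<theta>. f (cis \<theta>))"
  by (intro Nrm_cong_AE) (auto simp: ae_eq_def cm_measurable)
lift_definition memL :: "real \<Rightarrow> mfun \<Rightarrow> bool" is "\<lambda>p f. (\<lambda>\<theta>. f (cis \<theta>)) \<in> Lpm TM p"
proof -
  fix p :: real and f g :: "complex \<Rightarrow> complex" assume a: "cm f \<and> cm g \<and> ae_eq f g"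
  have [measurable]: "(\<lambda>\<theta>. f (cis \<theta>)) \<in> borel_measurable TM" "(\<lambda>\<theta>. g (cis \<theta>)) \<in> borel_measurable TM"
    using a cm_measurable by auto
  have "AE \<theta> in TM. norm (f (cis \<theta>)) powr p = norm (g (cis \<theta>)) powr p"
    using a[THEN conjunct2, THEN conjunct2, unfolded ae_eq_def] by eventually_elim simp
  then have "integrable TM (\<lambda>\<theta>. norm (f (cis \<theta>)) powr p) = integrable TM (\<lambda>\<theta>. norm (g (cis \<theta>)) powr p)"
    by (intro integrable_cong_AE) auto
  then show "((\<lambda>\<theta>. f (cis \<theta>)) \<in> Lpm TM p) = ((\<lambda>\<theta>. g (cis \<theta>)) \<in> Lpm TM p)"
    by (simp add: Lpm_def)
qed
lift_definition bdC :: "real \<Rightarrow> mfun \<Rightarrow> bool" is "\<lambda>C f. AE \<theta> in TM. norm (f (cis \<theta>)) \<le> C"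
proof -
  fix C :: real and f g :: "complex \<Rightarrow> complex" assume a: "cm f \<and> cm g \<and> ae_eq f g"
  then have "AE \<theta> in TM. (norm (f (cis \<theta>)) \<le> C) = (norm (g (cis \<theta>)) \<le> C)"
    unfolding ae_eq_def by (elim conjE eventually_mono) simp
  then show "(AE \<theta> in TM. norm (f (cis \<theta>)) \<le> C) = (AE \<theta> in TM. norm (g (cis \<theta>)) \<le> C)"
    by (rule eventually_subst)
qed

definition LL :: "real \<Rightarrow> mfun set" where "LL p = {f. memL p f}"
definition Bd :: "mfun set" where "Bd = {f. \<exists>C. bdC C f}"
definition co :: "mfun \<Rightarrow> int \<Rightarrow> complex" where "co f j = av (f * zp (- j))"

lemma mk_simps:
  "0 = mk (\<lambda>_. 0)" "1 = mk (\<lambda>_. 1)"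
  "cm A \<Longrightarrow> cm B \<Longrightarrow> mk A + mk B = mk (\<lambda>z. A z + B z)"
  "cm A \<Longrightarrow> cm B \<Longrightarrow> mk A * mk B = mk (\<lambda>z. A z * B z)"
  "cm A \<Longrightarrow> cm B \<Longrightarrow> mk A - mk B = mk (\<lambda>z. A z - B z)"
  "cm A \<Longrightarrow> - mk A = mk (\<lambda>z. - A z)"
  "cm A \<Longrightarrow> inverse (mk A) = mk (\<lambda>z. inverse (A z))"
  "cst c = mk (\<lambda>_. c)" "zp k = mk (\<lambda>t. t powi k)"
  "cm A \<Longrightarrow> cj (mk A) = mk (\<lambda>z. cnj (A z))"
  "cm A \<Longrightarrow> fl (mk A) = mk (\<lambda>z. A (inverse z))"
  "cm A \<Longrightarrow> av (mk A) = (1 / (2 * complex_of_real pi)) * (LINT \<theta>|TM. A (cis \<theta>))"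
  "cm A \<Longrightarrow> nm p (mk A) = Nrm TM p (\<lambda>\<theta>. A (cis \<theta>))"
  "cm A \<Longrightarrow> mk A \<in> LL p \<longleftrightarrow> (\<lambda>\<theta>. A (cis \<theta>)) \<in> Lpm TM p"
  "cm A \<Longrightarrow> bdC C (mk A) \<longleftrightarrow> (AE \<theta> in TM. norm (A (cis \<theta>)) \<le> C)"
  unfolding mk_def
  subgoal by (simp add: zero_mfun_def)
  subgoal by (simp add: one_mfun_def)
  subgoal by (simp add: plus_mfun.abs_eq)
  subgoal by (simp add: times_mfun.abs_eq)
  subgoal by (simp add: minus_mfun.abs_eq)
  subgoal by (simp add: uminus_mfun.abs_eq)
  subgoal by (simp add: inverse_mfun.abs_eq)
  subgoal by (simp add: cst_def)
  subgoal by (simp add: zp_def)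
  subgoal by (simp add: cj.abs_eq)
  subgoal by (simp add: fl.abs_eq)
  subgoal by (simp add: av.abs_eq)
  subgoal by (simp add: nm.abs_eq)
  subgoal by (simp add: LL_def memL.abs_eq)
  subgoal by (simp add: bdC.abs_eq)
  done

lemma mk_eqI: "cm f \<Longrightarrow> cm g \<Longrightarrow> (\<And>\<theta>. f (cis \<theta>) = g (cis \<theta>)) \<Longrightarrow> mk f = mk g"
  by (simp add: mk_eq_iff ae_eq_def)

lemma cst_simps:
  "cst 0 = 0" "cst 1 = 1" "cst (a + b) = cst a + cst b" "cst (a * b) = cst a * cst b" "cst (- a) = - cst a" "cst (a - b) = cst a - cst b"
  by (simp_all add: mk_simps)

lemma zp_simps: "zp 0 = 1" "zp a * zp b = zp (a + b)" "zp a * (zp b * f) = zp (a + b) * f"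
proof -
  show "zp 0 = 1" by (simp add: mk_simps)
  show e: "zp a * zp b = zp (a + b)" by (simp add: mk_simps) (rule mk_eqI, simp_all add: power_int_add)
  show "zp a * (zp b * f) = zp (a + b) * f" by (simp add: mult.assoc[symmetric] e)
qed

lemma cj_simps [simp]:
  "cj 0 = 0" "cj 1 = 1" "cj (f + g) = cj f + cj g" "cj (f - g) = cj f - cj g" "cj (f * g) = cj f * cj g" "cj (- f) = - cj f"
  "cj (cj f) = f" "cj (cst c) = cst (cnj c)" "cj (zp k) = zp (- k)" "cj (inverse f) = inverse (cj f)" "fl (cj f) = cj (fl f)"
proof -
  obtain F where F: "cm F" "f = mk F" by (rule mfun_rep)
  obtain G where G: "cm G" "g = mk G" by (rule mfun_rep)
  show "cj 0 = 0" "cj 1 = 1" "cj (f + g) = cj f + cj g" "cj (f - g) = cj f - cj g" "cj (f * g) = cj f * cj g" "cj (- f) = - cj f"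
    "cj (cj f) = f" "cj (cst c) = cst (cnj c)" "cj (inverse f) = inverse (cj f)" "fl (cj f) = cj (fl f)"
    by (simp_all add: mk_simps F G)
  show "cj (zp k) = zp (- k)"
    by (simp add: mk_simps) (rule mk_eqI, simp_all add: cis_power_int cis_cnj)
qed

lemma fl_simps [simp]:
  "fl 0 = 0" "fl 1 = 1" "fl (f + g) = fl f + fl g" "fl (f - g) = fl f - fl g" "fl (f * g) = fl f * fl g" "fl (- f) = - fl f"
  "fl (fl f) = f" "fl (cst c) = cst c" "fl (zp k) = zp (- k)" "fl (inverse f) = inverse (fl f)"
proof -
  obtain F where F: "cm F" "f = mk F" by (rule mfun_rep)
  obtain G where G: "cm G" "g = mk G" by (rule mfun_rep)
  show "fl 0 = 0" "fl 1 = 1" "fl (f + g) = fl f + fl g" "fl (f - g) = fl f - fl g" "fl (f * g) = fl f * fl g" "fl (- f) = - fl f"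
    "fl (fl f) = f" "fl (cst c) = cst c" "fl (inverse f) = inverse (fl f)"
    by (simp_all add: mk_simps F G)
  show "fl (zp k) = zp (- k)"
    by (simp add: mk_simps) (rule mk_eqI, simp_all add: cis_power_int cis_inverse)
qed

lemma LL_add: "f \<in> LL p \<Longrightarrow> g \<in> LL p \<Longrightarrow> 0 \<le> p \<Longrightarrow> f + g \<in> LL p"
  by (rule mfun_rep[of f], rule mfun_rep[of g]) (simp add: mk_simps Lpm_add)

lemma LL_diff: "f \<in> LL p \<Longrightarrow> g \<in> LL p \<Longrightarrow> 0 \<le> p \<Longrightarrow> f - g \<in> LL p"
  by (rule mfun_rep[of f], rule mfun_rep[of g]) (simp add: mk_simps Lpm_diff)

lemma LL_cst: "f \<in> LL p \<Longrightarrow> 0 \<le> p \<Longrightarrow> cst c * f \<in> LL p"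
  by (rule mfun_rep[of f]) (simp add: mk_simps Lpm_scale)

lemma LL_uminus: "f \<in> LL p \<Longrightarrow> 0 \<le> p \<Longrightarrow> - f \<in> LL p"
  using LL_cst[of f p "-1"] by (simp add: cst_simps)

lemma nm_cst: "0 < p \<Longrightarrow> nm p (cst c * f) = norm c * nm p f"
  by (rule mfun_rep[of f]) (simp add: mk_simps Nrm_scale)

lemma nm_uminus: "0 < p \<Longrightarrow> nm p (- f) = nm p f"
  using nm_cst[of p "-1" f] by (simp add: cst_simps)

lemma nm_nonneg [simp]: "0 \<le> nm p f"
  by (rule mfun_rep[of f]) (simp add: mk_simps Nrm_nonneg)

lemma nm_0: "0 < p \<Longrightarrow> nm p 0 = 0"
  using nm_cst[of p 0 0] by (simp add: cst_simps)

lemma nm_eq_0: "f \<in> LL p \<Longrightarrow> 0 < p \<Longrightarrow> nm p f = 0 \<Longrightarrow> f = 0"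
  by (rule mfun_rep[of f]) (simp add: mk_simps mk_eq_iff ae_eq_def Nrm_eq_0)

lemma nm_triangle: "f \<in> LL p \<Longrightarrow> g \<in> LL p \<Longrightarrow> 1 < p \<Longrightarrow> nm p (f + g) \<le> nm p f + nm p g"
  by (rule mfun_rep[of f], rule mfun_rep[of g]) (simp add: mk_simps Nrm_triangle)

lemma nm_triangle_diff: "f \<in> LL p \<Longrightarrow> g \<in> LL p \<Longrightarrow> 1 < p \<Longrightarrow> nm p (f - g) \<le> nm p f + nm p g"
  using nm_triangle[of f p "- g"] LL_uminus[of g p] by (simp add: nm_uminus)

lemma nm_minus_commute: "0 < p \<Longrightarrow> nm p (f - g) = nm p (g - f)"
  using nm_uminus[of p "f - g"] by simp

lemma LL_mult_bdC:
  assumes "bdC C g" "f \<in> LL p" "0 < p" "0 \<le> C"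
  shows "g * f \<in> LL p" "nm p (g * f) \<le> C * nm p f"
proof -
  obtain F where F: "cm F" "f = mk F" by (rule mfun_rep)
  obtain G where G: "cm G" "g = mk G" by (rule mfun_rep)
  have fL: "(\<lambda>\<theta>. F (cis \<theta>)) \<in> Lpm TM p" using assms F by (simp add: mk_simps)
  have m: "(\<lambda>\<theta>. G (cis \<theta>) * F (cis \<theta>)) \<in> borel_measurable TM" using F G by (auto intro: borel_measurable_times cm_measurable)
  have "AE \<theta> in TM. norm (G (cis \<theta>)) \<le> C" using assms G by (simp add: mk_simps)
  then have b: "AE \<theta> in TM. norm (G (cis \<theta>) * F (cis \<theta>)) \<le> C * norm (F (cis \<theta>))"
    by eventually_elim (simp add: norm_mult mult_right_mono)
  show "g * f \<in> LL p" using Lpm_bound[OF fL m b] assms F G by (simp add: mk_simps)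
  show "nm p (g * f) \<le> C * nm p f" using Nrm_mono[OF fL m b] assms F G by (simp add: mk_simps)
qed

lemma bdC_mono: "bdC C f \<Longrightarrow> C \<le> D \<Longrightarrow> bdC D f"
  by (rule mfun_rep[of f]) (simp add: mk_simps, elim eventually_mono, simp)

lemma Bd_E: assumes "g \<in> Bd" obtains C where "0 \<le> C" "bdC C g"
proof -
  obtain C where "bdC C g" using assms by (auto simp: Bd_def)
  then show ?thesis using that[of "max 0 C"] bdC_mono[of C g "max 0 C"] by simp
qed

lemma LL_Bd_mult: "g \<in> Bd \<Longrightarrow> f \<in> LL p \<Longrightarrow> 0 < p \<Longrightarrow> g * f \<in> LL p"
  by (meson Bd_E LL_mult_bdC(1))

lemma LL_Bd_mult': "g \<in> Bd \<Longrightarrow> f \<in> LL p \<Longrightarrow> 0 < p \<Longrightarrow> f * g \<in> LL p"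
  using LL_Bd_mult[of g f p] by (simp add: mult.commute)

lemma bdC_zp: "bdC 1 (zp k)" by (simp add: mk_simps norm_power_int)
lemma bdC_cst: "bdC (norm c) (cst c)" by (simp add: mk_simps)
lemma bdC_mult: "bdC C f \<Longrightarrow> bdC D g \<Longrightarrow> 0 \<le> C \<Longrightarrow> bdC (C * D) (f * g)"
proof -
  assume a: "bdC C f" "bdC D g" "0 \<le> C"
  obtain F where F: "cm F" "f = mk F" by (rule mfun_rep)
  obtain G where G: "cm G" "g = mk G" by (rule mfun_rep)
  have "AE \<theta> in TM. norm (F (cis \<theta>)) \<le> C" "AE \<theta> in TM. norm (G (cis \<theta>)) \<le> D" using a F G by (simp_all add: mk_simps)
  then have "AE \<theta> in TM. norm (F (cis \<theta>) * G (cis \<theta>)) \<le> C * D"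
    by eventually_elim (simp add: norm_mult mult_mono a)
  then show ?thesis using F G by (simp add: mk_simps)
qed
lemma bdC_add: "bdC C f \<Longrightarrow> bdC D g \<Longrightarrow> bdC (C + D) (f + g)"
proof -
  assume a: "bdC C f" "bdC D g"
  obtain F where F: "cm F" "f = mk F" by (rule mfun_rep)
  obtain G where G: "cm G" "g = mk G" by (rule mfun_rep)
  have "AE \<theta> in TM. norm (F (cis \<theta>)) \<le> C" "AE \<theta> in TM. norm (G (cis \<theta>)) \<le> D" using a F G by (simp_all add: mk_simps)
  then have "AE \<theta> in TM. norm (F (cis \<theta>) + G (cis \<theta>)) \<le> C + D"
    by eventually_elim (rule norm_triangle_mono)
  then show ?thesis using F G by (simp add: mk_simps)
qed
lemma bdC_cj [simp]: "bdC C (cj f) \<longleftrightarrow> bdC C f"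
  by (rule mfun_rep[of f]) (simp add: mk_simps)
lemma bdC_fl: "bdC C f \<Longrightarrow> bdC C (fl f)"
proof -
  assume a: "bdC C f"
  obtain F where F: "cm F" "f = mk F" by (rule mfun_rep)
  show ?thesis using a F AE_tld[of "\<lambda>z. norm (F z) \<le> C"] by (simp add: mk_simps)
qed
lemma Bd_intros [simp]: "zp k \<in> Bd" "cst c \<in> Bd" "0 \<in> Bd" "1 \<in> Bd" "f \<in> Bd \<Longrightarrow> g \<in> Bd \<Longrightarrow> f * g \<in> Bd"
  "f \<in> Bd \<Longrightarrow> g \<in> Bd \<Longrightarrow> f + g \<in> Bd" "f \<in> Bd \<Longrightarrow> cj f \<in> Bd" "f \<in> Bd \<Longrightarrow> fl f \<in> Bd"
proof -
  show "zp k \<in> Bd" "cst c \<in> Bd" using bdC_zp bdC_cst by (auto simp: Bd_def)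
  then show "0 \<in> Bd" "1 \<in> Bd" using bdC_cst[of 0] bdC_cst[of 1] unfolding cst_simps by (auto simp: Bd_def)
  show "f \<in> Bd \<Longrightarrow> g \<in> Bd \<Longrightarrow> f * g \<in> Bd" by (metis (mono_tags, lifting) Bd_E Bd_def bdC_mult mem_Collect_eq)
  show "f \<in> Bd \<Longrightarrow> g \<in> Bd \<Longrightarrow> f + g \<in> Bd" using bdC_add unfolding Bd_def by blast
  show "f \<in> Bd \<Longrightarrow> cj f \<in> Bd" "f \<in> Bd \<Longrightarrow> fl f \<in> Bd" using bdC_fl by (auto simp: Bd_def)
qed
lemma Bd_uminus [simp]: "f \<in> Bd \<Longrightarrow> - f \<in> Bd"
  using Bd_intros(5)[OF Bd_intros(2)[of "-1"]] by (simp add: cst_simps)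

lemma Bd_LL: "f \<in> Bd \<Longrightarrow> 0 \<le> p \<Longrightarrow> f \<in> LL p"
proof -
  assume a: "f \<in> Bd" "0 \<le> p"
  obtain F where F: "cm F" "f = mk F" by (rule mfun_rep)
  obtain C where "AE \<theta> in TM. norm (F (cis \<theta>)) \<le> C" using a F by (auto simp: Bd_def mk_simps)
  then show ?thesis using Lpm_bounded[OF finite_measure_TM cm_measurable[OF F(1)]] a F by (simp add: mk_simps)
qed

lemma LL_zp: "f \<in> LL p \<Longrightarrow> 0 < p \<Longrightarrow> zp k * f \<in> LL p" by (simp add: LL_Bd_mult)

lemma nm_zp: assumes "f \<in> LL p" "0 < p" shows "nm p (zp k * f) = nm p f"
proof (rule antisym)
  show "nm p (zp k * f) \<le> nm p f" using LL_mult_bdC(2)[OF bdC_zp assms] by simp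
  have "nm p (zp (- k) * (zp k * f)) \<le> nm p (zp k * f)"
    using LL_mult_bdC(2)[OF bdC_zp LL_zp[OF assms] assms(2)] by simp
  then show "nm p f \<le> nm p (zp k * f)" by (simp add: zp_simps)
qed

lemma LL_cj: "f \<in> LL p \<Longrightarrow> cj f \<in> LL p" and nm_cj: "nm p (cj f) = nm p f"
proof -
  obtain F where F: "cm F" "f = mk F" by (rule mfun_rep)
  show "nm p (cj f) = nm p f" using F by (simp add: mk_simps Nrm_def)
  assume "f \<in> LL p" then show "cj f \<in> LL p" using F
    by (simp add: mk_simps) (simp add: Lpm_def cnj_measurable)
qed

lemma LL_fl: "f \<in> LL p \<Longrightarrow> fl f \<in> LL p" and nm_fl: "nm p (fl f) = nm p f"
proof -
  obtain F where F: "cm F" "f = mk F" by (rule mfun_rep)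
  have m: "(\<lambda>\<theta>. norm (F (cis \<theta>)) powr p) \<in> borel_measurable TM" using cm_measurable[OF F(1)] by measurable
  show "nm p (fl f) = nm p f" using F LINT_tld[OF m] by (simp add: mk_simps Nrm_def)
  assume "f \<in> LL p"
  then have "(\<lambda>\<theta>. F (cis \<theta>)) \<in> Lpm TM p" using F by (simp add: mk_simps)
  then have "integrable TM (\<lambda>\<theta>. norm (F (inverse (cis \<theta>))) powr p)"
    using integrable_tld[of "\<lambda>z. norm (F z) powr p"] by (simp add: Lpm_def)
  moreover have "(\<lambda>\<theta>. F (inverse (cis \<theta>))) \<in> borel_measurable TM" using cm_measurable[OF cm_intros(9)[OF F(1)]] .
  ultimately show "fl f \<in> LL p" using F by (simp add: mk_simps Lpm_def)
qed

lemma LL1_iff: "cm F \<Longrightarrow> mk F \<in> LL 1 \<longleftrightarrow> integrable TM (\<lambda>\<theta>. F (cis \<theta>))"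
  by (simp add: mk_simps Lpm_def cm_measurable integrable_norm_iff)

lemma av_add: "f \<in> LL 1 \<Longrightarrow> g \<in> LL 1 \<Longrightarrow> av (f + g) = av f + av g"
  by (rule mfun_rep[of f], rule mfun_rep[of g]) (simp add: LL1_iff, simp add: mk_simps algebra_simps)

lemma av_diff: "f \<in> LL 1 \<Longrightarrow> g \<in> LL 1 \<Longrightarrow> av (f - g) = av f - av g"
  by (rule mfun_rep[of f], rule mfun_rep[of g]) (simp add: LL1_iff, simp add: mk_simps algebra_simps)

lemma av_cst: "av (cst c * f) = c * av f"
  by (rule mfun_rep[of f]) (simp add: mk_simps)

lemma av_cj: "av (cj f) = cnj (av f)"
  by (rule mfun_rep[of f]) (simp add: mk_simps)

lemma av_fl: "av (fl f) = av f"
proof -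
  obtain F where F: "cm F" "f = mk F" by (rule mfun_rep)
  show ?thesis using LINT_tld[OF cm_measurable[OF F(1)]] F by (simp add: mk_simps)
qed

lemma av_zp: "av (zp k) = (if k = 0 then 1 else 0)"
  by (simp add: mk_simps LINT_cis_powi)

lemma av_0 [simp]: "av 0 = 0" by (simp add: mk_simps)

lemma LL_Holder:
  assumes "f \<in> LL p" "g \<in> LL (conj_exp p)" "1 < p"
  shows "f * g \<in> LL 1" "norm (av (f * g)) \<le> nm p f * nm (conj_exp p) g"
proof -
  obtain F where F: "cm F" "f = mk F" by (rule mfun_rep)
  obtain G where G: "cm G" "g = mk G" by (rule mfun_rep)
  have L: "(\<lambda>\<theta>. F (cis \<theta>)) \<in> Lpm TM p" "(\<lambda>\<theta>. G (cis \<theta>)) \<in> Lpm TM (conj_exp p)" using assms F G by (auto simp: mk_simps)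
  note H = Holder[OF L assms(3) conj_exp_props(1,2)[OF assms(3)]]
  show "f * g \<in> LL 1" using H(1) F G by (simp add: mk_simps(4) LL1_iff)
  have "norm (LINT \<theta>|TM. F (cis \<theta>) * G (cis \<theta>)) \<le> (LINT \<theta>|TM. norm (F (cis \<theta>) * G (cis \<theta>)))"
    by (rule integral_norm_bound)
  also note H(2)
  finally have le: "norm (LINT \<theta>|TM. F (cis \<theta>) * G (cis \<theta>)) \<le> nm p f * nm (conj_exp p) g" using F G by (simp add: mk_simps)
  have "norm (av (f * g)) = norm (LINT \<theta>|TM. F (cis \<theta>) * G (cis \<theta>)) / (2 * pi)"
    using F G by (simp add: mk_simps norm_mult norm_divide)
  also have "\<dots> \<le> norm (LINT \<theta>|TM. F (cis \<theta>) * G (cis \<theta>)) / 1"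
    using pi_gt3 by (intro divide_left_mono) auto
  finally show "norm (av (f * g)) \<le> nm p f * nm (conj_exp p) g" using le by simp
qed

lemma LL_imp_LL1: "f \<in> LL p \<Longrightarrow> 1 < p \<Longrightarrow> f \<in> LL 1"
  using LL_Holder(1)[of f p 1] Bd_LL[of 1 "conj_exp p"] conj_exp_props(1)[of p] by simp

text \<open>The norm is taken with respect to arc length, the mean value \<open>av\<close> with
  respect to the normalised measure. This is the origin of the factors \<open>2 * pi\<close> in all
  duality estimates.\<close>

lemma LL_converse_Holder:
  assumes "f \<in> LL p" "1 < p"
  shows "\<exists>\<psi>\<in>LL (conj_exp p). nm (conj_exp p) \<psi> \<le> 1 \<and> av (f * \<psi>) = complex_of_real (nm p f / (2 * pi))"
proof -
  obtain F where F: "cm F" "f = mk F" by (rule mfun_rep)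
  have L: "(\<lambda>\<theta>. F (cis \<theta>)) \<in> Lpm TM p" using assms F by (auto simp: mk_simps)
  define N where "N = Nrm TM p (\<lambda>\<theta>. F (cis \<theta>))"
  define \<psi> where "\<psi> = (\<lambda>z. cnj (F z) * of_real (norm (F z) powr (p - 2) / N powr (p - 1)))"
  have c: "cm \<psi>" unfolding \<psi>_def by (rule cmI) (use cm_measurable[OF F(1)] in measurable)
  have "(\<lambda>\<theta>. \<psi> (cis \<theta>)) \<in> Lpm TM (conj_exp p)" "Nrm TM (conj_exp p) (\<lambda>\<theta>. \<psi> (cis \<theta>)) \<le> 1"
     "(LINT \<theta>|TM. F (cis \<theta>) * \<psi> (cis \<theta>)) = complex_of_real N"
    using converse_Holder[OF L assms(2)] unfolding \<psi>_def N_def by blast+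
  then show ?thesis using c F by (intro bexI[of _ "mk \<psi>"]) (simp_all add: mk_simps N_def)
qed

lemma LL_uniform_convexity:
  assumes "1 < p" "0 < \<epsilon>"
  shows "\<exists>C\<ge>0. \<forall>f\<in>LL p. \<forall>g\<in>LL p. nm p (f - g) powr p \<le> \<epsilon> * (nm p f powr p + nm p g powr p)
     + C * ((nm p f powr p + nm p g powr p) / 2 - nm p (cst (1/2) * (f + g)) powr p)"
proof -
  obtain C where C: "0 \<le> C" "\<forall>f\<in>Lpm TM p. \<forall>g\<in>Lpm TM p. Nrm TM p (\<lambda>x. f x - g x) powr p \<le> \<epsilon> * (Nrm TM p f powr p + Nrm TM p g powr p)
     + C * ((Nrm TM p f powr p + Nrm TM p g powr p) / 2 - Nrm TM p (\<lambda>x. (f x + g x) / 2) powr p)"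
    using Nrm_uniform_convexity[OF assms] by blast
  show ?thesis
  proof (intro exI[of _ C] conjI ballI C(1))
    fix f g assume fg: "f \<in> LL p" "g \<in> LL p"
    obtain F where F: "cm F" "f = mk F" by (rule mfun_rep)
    obtain G where G: "cm G" "g = mk G" by (rule mfun_rep)
    have L: "(\<lambda>\<theta>. F (cis \<theta>)) \<in> Lpm TM p" "(\<lambda>\<theta>. G (cis \<theta>)) \<in> Lpm TM p" using fg F G by (auto simp: mk_simps)
    show "nm p (f - g) powr p \<le> \<epsilon> * (nm p f powr p + nm p g powr p)
     + C * ((nm p f powr p + nm p g powr p) / 2 - nm p (cst (1/2) * (f + g)) powr p)"
      using C(2)[rule_format, OF L] F G by (simp add: mk_simps)
  qed
qed

lemma LL_complete:
  assumes p: "1 < p" and f: "\<And>n. f n \<in> LL p"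
    and C: "\<And>e. 0 < e \<Longrightarrow> \<exists>N. \<forall>m\<ge>N. \<forall>n\<ge>N. nm p (f m - f n) < e"
  shows "\<exists>g\<in>LL p. (\<lambda>n. nm p (f n - g)) \<longlonglongrightarrow> 0"
proof -
  have "\<exists>F. cm F \<and> f n = mk F" for n by (rule mfun_rep[of "f n"]) auto
  then obtain F where F: "\<And>n. cm (F n)" "\<And>n. f n = mk (F n)" by metis
  define Fc where "Fc n = (\<lambda>\<theta>. F n (cis \<theta>))" for n
  have L: "Fc n \<in> Lpm TM p" for n using f[of n] F by (simp add: mk_simps Fc_def)
  have C': "\<And>e. 0 < e \<Longrightarrow> \<exists>N. \<forall>m\<ge>N. \<forall>n\<ge>N. Nrm TM p (\<lambda>x. Fc m x - Fc n x) < e"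
    using C by (simp add: F mk_simps Fc_def)
  obtain r where r: "(\<lambda>x. lim (\<lambda>k. Fc (r k) x)) \<in> Lpm TM p"
    "(\<lambda>n. Nrm TM p (\<lambda>x. Fc n x - lim (\<lambda>k. Fc (r k) x))) \<longlonglongrightarrow> 0"
    using Lpm_complete[OF finite_measure_TM p L C'] by blast
  define G where "G = (\<lambda>z. lim (\<lambda>k. F (r k) z))"
  have c: "cm G" using r(1) by (intro cmI) (simp add: G_def Fc_def Lpm_def)
  show ?thesis
    using r c by (intro bexI[of _ "mk G"]) (simp_all add: F mk_simps G_def Fc_def)
qed

section \<open>Fourier coefficients of classes and the dictionary to representatives\<close>

lemma co_add: "f \<in> LL 1 \<Longrightarrow> g \<in> LL 1 \<Longrightarrow> co (f + g) j = co f j + co g j"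
  by (simp add: co_def distrib_right av_add LL_Bd_mult')

lemma co_diff: "f \<in> LL 1 \<Longrightarrow> g \<in> LL 1 \<Longrightarrow> co (f - g) j = co f j - co g j"
  by (simp add: co_def left_diff_distrib av_diff LL_Bd_mult')

lemma co_cst: "co (cst c * f) j = c * co f j"
  by (simp add: co_def mult.assoc av_cst)

lemma co_0 [simp]: "co 0 j = 0" by (simp add: co_def)

lemma co_zp_mult: "co (zp k * f) j = co f (j - k)"
proof -
  have "zp k * f * zp (- j) = f * (zp k * zp (- j))" by (simp only: ac_simps)
  then show ?thesis by (simp add: co_def zp_simps)
qed

lemma co_zp: "co (zp k) j = (if k = j then 1 else 0)"
  by (simp add: co_def zp_simps av_zp)

lemma co_fl: "co (fl f) j = co f (- j)"
  using av_fl[of "f * zp j"] by (simp add: co_def)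

lemma co_cj: "co (cj f) j = cnj (co f (- j))"
  using av_cj[of "f * zp j"] by (simp add: co_def)

lemma co_bound: "f \<in> LL p \<Longrightarrow> 1 < p \<Longrightarrow> norm (co f j) \<le> nm p f * nm (conj_exp p) 1"
proof -
  assume a: "f \<in> LL p" "1 < p"
  have q: "1 < conj_exp p" using conj_exp_props a by blast
  have "norm (co f j) \<le> nm p f * nm (conj_exp p) (zp (- j))"
    unfolding co_def using a q by (intro LL_Holder) (auto simp: Bd_LL)
  also have "nm (conj_exp p) (zp (- j)) = nm (conj_exp p) 1"
    using nm_zp[of 1 "conj_exp p" "- j"] q by (simp add: Bd_LL)
  finally show ?thesis .
qed

lemma co_tendsto:
  assumes p: "1 < p" and f: "\<And>n. f n \<in> LL p" and g: "g \<in> LL p" and l: "(\<lambda>n. nm p (f n - g)) \<longlonglongrightarrow> 0"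
  shows "(\<lambda>n. co (f n) j) \<longlonglongrightarrow> co g j"
proof -
  have "(\<lambda>n. nm p (f n - g) * nm (conj_exp p) 1) \<longlonglongrightarrow> 0 * nm (conj_exp p) 1" by (intro tendsto_intros l)
  then have "(\<lambda>n. nm p (f n - g) * nm (conj_exp p) 1) \<longlonglongrightarrow> 0" by simp
  moreover have "norm (co (f n) j - co g j) \<le> nm p (f n - g) * nm (conj_exp p) 1" for n
    using co_bound[OF LL_diff[OF f[of n] g] p, of j] p co_diff[OF LL_imp_LL1[OF f[of n] p] LL_imp_LL1[OF g p], of j] by simp
  ultimately have "(\<lambda>n. co (f n) j - co g j) \<longlonglongrightarrow> 0"
    by (metis (no_types, lifting) Lim_null_comparison always_eventually)
  then show ?thesis by (rule LIM_zero_cancel)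
qed

lemma fc_co: "cm F \<Longrightarrow> fc F j = co (mk F) j"
  by (simp add: fc_def co_def mk_simps cis_power_int)

lemma Lp_iff: "F \<in> Lp p \<longleftrightarrow> cm F \<and> mk F \<in> LL p"
proof (cases "cm F")
  case True
  then show ?thesis using cm_measurable[OF True]
    by (simp add: Lp_def mk_simps Lpm_def circ_def[abs_def])
qed (simp add: Lp_def cm_def)

lemma pnorm_nm: "cm F \<Longrightarrow> pnorm p F = nm p (mk F)"
  by (simp add: pnorm_def mk_simps Nrm_def circ_def)

section \<open>Fejer means, density of trigonometric polynomials, uniqueness of Fourier coefficients\<close>

text \<open>Generated by adding one monomial at a time, which turns every linear statement about
  trigonometric polynomials into a one-step induction.\<close>

inductive_set TP :: "mfun set" where
  TP_0: "0 \<in> TP"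
| TP_step: "f \<in> TP \<Longrightarrow> cst c * zp k + f \<in> TP"

lemma TP_monom: "cst c * zp k \<in> TP"
  using TP_step[OF TP_0] by simp

lemma TP_add: "f \<in> TP \<Longrightarrow> g \<in> TP \<Longrightarrow> f + g \<in> TP"
  by (induction rule: TP.induct) (auto simp: add.assoc intro: TP.intros)

lemma TP_sum: "(\<And>i. i \<in> I \<Longrightarrow> f i \<in> TP) \<Longrightarrow> sum f I \<in> TP"
  by (induction I rule: infinite_finite_induct) (auto intro: TP_0 TP_add)

lemma TP_cst: "f \<in> TP \<Longrightarrow> cst c * f \<in> TP"
proof (induction rule: TP.induct)
  case (TP_step f d k)
  have "cst c * (cst d * zp k + f) = cst (c * d) * zp k + cst c * f" by (simp add: algebra_simps cst_simps)
  then show ?case using TP_step TP.TP_step by simp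
qed (simp add: TP_0)

lemma TP_Bd: "f \<in> TP \<Longrightarrow> f \<in> Bd"
  by (induction rule: TP.induct) auto

lemma TP_LL: "f \<in> TP \<Longrightarrow> 0 \<le> p \<Longrightarrow> f \<in> LL p"
  by (simp add: TP_Bd Bd_LL)

lemma av_mult_TP:
  assumes "u \<in> TP" "f \<in> LL 1" "\<And>j. co f j = 0"
  shows "av (f * u) = 0"
  using assms(1)
proof (induction rule: TP.induct)
  case (TP_step g c k)
  have "f * (cst c * zp k + g) = cst c * (f * zp k) + f * g" by (simp add: algebra_simps)
  moreover have "av (f * zp k) = 0" using assms(3)[of "- k"] by (simp add: co_def)
  ultimately show ?case
    using TP_step assms(2) by (simp add: av_add av_cst LL_Bd_mult' LL_cst TP_Bd)
qed simp

section \<open>The Fejer kernel and Fejer means\<close>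

definition KN :: "nat \<Rightarrow> complex \<Rightarrow> real" where
  "KN N \<zeta> = (norm (\<Sum>j<N. \<zeta> ^ j))\<^sup>2 / real N"

text \<open>The Fejer mean as the double sum that arises from expanding the squared modulus in
  \<open>KN\<close>. The pairs with \<open>j - l = m\<close> together give the \<open>m\<close>-th
  coefficient the weight \<open>cN N m\<close>, which for \<open>N \<ge> 1\<close> is
  \<open>max 0 (1 - abs m / N)\<close>.\<close>

definition sgv :: "nat \<Rightarrow> (complex \<Rightarrow> complex) \<Rightarrow> complex \<Rightarrow> complex" where
  "sgv N F z = (\<Sum>j<N. \<Sum>l<N. fc F (int j - int l) / of_nat N * z powi (int j - int l))"

definition sg :: "nat \<Rightarrow> mfun \<Rightarrow> mfun" where
  "sg N f = (\<Sum>j<N. \<Sum>l<N. cst (co f (int j - int l) / of_nat N) * zp (int j - int l))"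

definition cN :: "nat \<Rightarrow> int \<Rightarrow> real" where
  "cN N m = real (card {j\<in>{..<N}. 0 \<le> int j - m \<and> int j - m < int N}) / real N"

lemma KN_nonneg [simp]: "0 \<le> KN N \<zeta>" by (simp add: KN_def)

lemma sg_TP: "sg N f \<in> TP"
  unfolding sg_def by (intro TP_sum TP_monom)

lemma cm_sum: "(\<And>i. i \<in> I \<Longrightarrow> cm (f i)) \<Longrightarrow> cm (\<lambda>z. \<Sum>i\<in>I. f i z)"
  by (induction I rule: infinite_finite_induct) auto

lemma mk_sum: "(\<And>i. i \<in> I \<Longrightarrow> cm (f i)) \<Longrightarrow> (\<Sum>i\<in>I. mk (f i)) = mk (\<lambda>z. \<Sum>i\<in>I. f i z)"
proof (induction I rule: infinite_finite_induct)
  case (insert x I)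
  then show ?case by (simp add: cm_sum mk_simps(3))
qed (simp_all add: mk_simps(1))

lemma cm_sgv: "cm (sgv N F)"
  unfolding sgv_def[abs_def] by (intro cm_sum) simp

lemma sg_mk: "cm F \<Longrightarrow> sg N (mk F) = mk (sgv N F)"
proof -
  assume F: "cm F"
  have "cst c * zp k = mk (\<lambda>z. c * z powi k)" for c k by (simp add: mk_simps)
  then show ?thesis
    unfolding sg_def sgv_def[abs_def] using F by (simp add: mk_sum cm_sum fc_co)
qed

lemma KN_expand:
  assumes z: "norm z = 1"
  shows "complex_of_real (KN N (z * cis (- \<theta>))) =
    (\<Sum>j<N. \<Sum>l<N. z powi (int j - int l) * cis (- (of_int (int j - int l) * \<theta>)) / of_nat N)"
proof -
  define \<zeta> where "\<zeta> = z * cis (- \<theta>)"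
  have n: "norm \<zeta> = 1" using z by (simp add: \<zeta>_def norm_mult)
  then have z0: "\<zeta> \<noteq> 0" by auto
  have c: "cnj \<zeta> = inverse \<zeta>" using n z0 complex_norm_square[of \<zeta>] by (simp add: field_simps)
  have t: "\<zeta> ^ j * cnj \<zeta> ^ l = z powi (int j - int l) * cis (- (of_int (int j - int l) * \<theta>))" for j l :: nat
  proof -
    have "\<zeta> ^ j * cnj \<zeta> ^ l = \<zeta> powi (int j - int l)"
      unfolding c using z0 by (simp add: power_int_diff power_int_of_nat field_simps power_inverse)
    also have "\<dots> = z powi (int j - int l) * cis (- \<theta>) powi (int j - int l)"
      unfolding \<zeta>_def by (rule power_int_mult_distrib)
    also have "cis (- \<theta>) powi (int j - int l) = cis (- (of_int (int j - int l) * \<theta>))" by (simp only: cis_power_int) (simp add: algebra_simps)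
    finally show ?thesis .
  qed
  have "complex_of_real (KN N \<zeta>) = (\<Sum>j<N. \<zeta> ^ j) * cnj (\<Sum>j<N. \<zeta> ^ j) / of_nat N"
    unfolding KN_def using complex_norm_square[of "\<Sum>j<N. \<zeta> ^ j"] by simp
  also have "\<dots> = (\<Sum>j<N. \<Sum>l<N. \<zeta> ^ j * cnj \<zeta> ^ l / of_nat N)"
    by (simp add: sum_product sum_divide_distrib)
  finally have "complex_of_real (KN N \<zeta>) = (\<Sum>j<N. \<Sum>l<N. \<zeta> ^ j * cnj \<zeta> ^ l / of_nat N)" .
  then show ?thesis by (simp only: t) (simp only: \<zeta>_def)
qed

lemma integrable_mult_cis:
  assumes "integrable TM F" shows "integrable TM (\<lambda>\<theta>. F \<theta> * cis (r * \<theta>))"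
proof (rule Bochner_Integration.integrable_bound[OF assms])
  have c: "(\<lambda>\<theta>. cis (r * \<theta>)) \<in> borel_measurable borel" by (intro borel_measurable_continuous_onI continuous_intros)
  then have "(\<lambda>\<theta>. cis (r * \<theta>)) \<in> borel_measurable lebesgue" by (rule measurable_completion[of _ lborel borel, simplified])
  then have "(\<lambda>\<theta>. cis (r * \<theta>)) \<in> borel_measurable TM" by (rule measurable_restrict_space1)
  then show "(\<lambda>\<theta>. F \<theta> * cis (r * \<theta>)) \<in> borel_measurable TM" using assms by (intro borel_measurable_times) auto
qed (simp add: norm_mult)

lemma sgv_integral:
  assumes F: "integrable TM (\<lambda>\<theta>. F (cis \<theta>))" and z: "norm z = 1"
  shows "integrable TM (\<lambda>\<theta>. F (cis \<theta>) * complex_of_real (KN N (z * cis (- \<theta>))))"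
    and "sgv N F z = (LINT \<theta>|TM. F (cis \<theta>) * complex_of_real (KN N (z * cis (- \<theta>)))) / (2 * pi)"
proof -
  have i: "integrable TM (\<lambda>\<theta>. F (cis \<theta>) * cis (- (r * \<theta>)))" for r
    using integrable_mult_cis[OF F, of "- r"] by simp
  have e: "F (cis \<theta>) * complex_of_real (KN N (z * cis (- \<theta>))) =
    (\<Sum>j<N. \<Sum>l<N. (z powi (int j - int l) / of_nat N) * (F (cis \<theta>) * cis (- (of_int (int j - int l) * \<theta>))))" for \<theta>
    unfolding KN_expand[OF z] by (simp add: sum_distrib_left sum_distrib_right mult_ac)
  show "integrable TM (\<lambda>\<theta>. F (cis \<theta>) * complex_of_real (KN N (z * cis (- \<theta>))))"
    unfolding e by (intro Bochner_Integration.integrable_sum integrable_mult_right i)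
  have "(LINT \<theta>|TM. F (cis \<theta>) * complex_of_real (KN N (z * cis (- \<theta>)))) =
    (\<Sum>j<N. \<Sum>l<N. (z powi (int j - int l) / of_nat N) * (LINT \<theta>|TM. F (cis \<theta>) * cis (- (of_int (int j - int l) * \<theta>))))"
    unfolding e by (simp only: Bochner_Integration.integral_sum Bochner_Integration.integrable_sum integrable_mult_right i integral_mult_right_zero)
  then show "sgv N F z = (LINT \<theta>|TM. F (cis \<theta>) * complex_of_real (KN N (z * cis (- \<theta>)))) / (2 * pi)"
    unfolding sgv_def fc_def by (simp add: sum_divide_distrib mult_ac)
qed

lemma sum_diff_delta:
  fixes x :: complex
  shows "(\<Sum>j<N. \<Sum>l<N. if int j - int l = m then x else 0) = complex_of_real (cN N m) * (of_nat N * x)"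
proof -
  have inner: "(\<Sum>l<N. if int j - int l = m then x else 0) = (if 0 \<le> int j - m \<and> int j - m < int N then x else 0)" for j
  proof (cases "0 \<le> int j - m \<and> int j - m < int N")
    case True
    have "(\<Sum>l<N. if int j - int l = m then x else 0) = (\<Sum>l<N. if nat (int j - m) = l then x else 0)"
      using True by (intro sum.cong) auto
    then show ?thesis using True by (auto simp: sum.delta')
  next
    case False
    then have "\<And>l. l < N \<Longrightarrow> int j - int l \<noteq> m" by auto
    then have "(\<Sum>l<N. if int j - int l = m then x else 0) = (\<Sum>l<N. 0)" by (intro sum.cong) auto
    then show ?thesis unfolding if_not_P[OF False] by simp
  qed
  have "(\<Sum>j<N. \<Sum>l<N. if int j - int l = m then x else 0) = (\<Sum>j<N. if 0 \<le> int j - m \<and> int j - m < int N then x else 0)"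
    by (simp only: inner)
  also have "\<dots> = (\<Sum>j\<in>{j\<in>{..<N}. 0 \<le> int j - m \<and> int j - m < int N}. x)"
    by (intro sum.inter_filter[symmetric]) simp
  also have "\<dots> = complex_of_real (cN N m) * (of_nat N * x)"
    by (cases "N = 0") (simp_all add: cN_def)
  finally show ?thesis .
qed

lemma sgv_monom: "1 \<le> N \<Longrightarrow> sgv N (\<lambda>w. w powi k) z = complex_of_real (cN N k) * z powi k"
proof -
  assume N: "1 \<le> N"
  have fz: "fc (\<lambda>w. w powi k) m = (if m = k then 1 else 0)" for m
    using co_zp[of k m] by (simp add: fc_co[OF cm_intros(2)] mk_simps(9)[symmetric])
  have "sgv N (\<lambda>w. w powi k) z = (\<Sum>j<N. \<Sum>l<N. if int j - int l = k then z powi k / of_nat N else 0)"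
    unfolding sgv_def fz by (intro sum.cong) auto
  also have "\<dots> = complex_of_real (cN N k) * z powi k" unfolding sum_diff_delta using N by simp
  finally show ?thesis .
qed

lemma co_sg: "co (sg N f) m = complex_of_real (cN N m) * co f m"
proof -
  have s1: "co (\<Sum>i\<in>I. h i) m = (\<Sum>i\<in>I. co (h i) m)" if "\<And>i. i \<in> I \<Longrightarrow> h i \<in> TP" for I :: "nat set" and h
    using that by (induction I rule: infinite_finite_induct) (auto simp: co_add TP_LL TP_sum)
  have "co (sg N f) m = (\<Sum>j<N. \<Sum>l<N. co (cst (co f (int j - int l) / of_nat N) * zp (int j - int l)) m)"
    unfolding sg_def by (simp add: s1 TP_sum TP_monom)
  also have "\<dots> = (\<Sum>j<N. \<Sum>l<N. if int j - int l = m then co f m / of_nat N else 0)"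
    by (intro sum.cong) (auto simp: co_cst co_zp)
  also have "\<dots> = complex_of_real (cN N m) * co f m"
    unfolding sum_diff_delta by (cases "N = 0") (simp_all add: cN_def)
  finally show ?thesis .
qed

lemma cN_bounds: "0 \<le> cN N m" "cN N m \<le> 1" "1 \<le> N \<Longrightarrow> 1 - \<bar>real_of_int m\<bar> / real N \<le> cN N m"
proof -
  define A where "A = {j\<in>{..<N}. 0 \<le> int j - m \<and> int j - m < int N}"
  have fA: "finite A" "A \<subseteq> {..<N}" by (auto simp: A_def)
  have cA: "card A \<le> N" using card_mono[OF _ fA(2)] by simp
  show "0 \<le> cN N m" by (simp add: cN_def)
  show "cN N m \<le> 1" using cA unfolding cN_def A_def[symmetric] by (cases "N = 0") (auto simp: field_simps)
  assume N: "1 \<le> N"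
  have "card ({..<N} - A) \<le> nat \<bar>m\<bar>"
  proof (cases "0 \<le> m")
    case True
    have "{..<N} - A \<subseteq> {..<nat m}" using True by (auto simp: A_def)
    then have "card ({..<N} - A) \<le> nat m" using card_mono[of "{..<nat m}"] by simp
    then show ?thesis using True by simp
  next
    case False
    have "{..<N} - A \<subseteq> {N - nat (- m)..<N}" using False by (auto simp: A_def)
    then have "card ({..<N} - A) \<le> card {N - nat (- m)..<N}" by (intro card_mono) auto
    then show ?thesis using False by simp
  qed
  moreover have "card ({..<N} - A) = N - card A" using fA by (simp add: card_Diff_subset)
  ultimately have "int N - \<bar>m\<bar> \<le> int (card A)" using cA by linarith
  then have "real_of_int (int N - \<bar>m\<bar>) \<le> real_of_int (int (card A))" by (simp only: of_int_le_iff)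
  then have "real N - \<bar>real_of_int m\<bar> \<le> real (card A)" by simp
  then have "(real N - \<bar>real_of_int m\<bar>) / real N \<le> real (card A) / real N" by (rule divide_right_mono) simp
  then show "1 - \<bar>real_of_int m\<bar> / real N \<le> cN N m" using N unfolding cN_def A_def[symmetric] by (simp add: diff_divide_distrib)
qed

lemma cN_0: "1 \<le> N \<Longrightarrow> cN N 0 = 1"
  using cN_bounds[of N 0] by simp

lemma cN_tendsto: "(\<lambda>N. cN N m) \<longlonglongrightarrow> 1"
proof (rule tendsto_sandwich)
  show "\<forall>\<^sub>F N in sequentially. 1 - \<bar>real_of_int m\<bar> / real N \<le> cN N m"
    using cN_bounds(3)[of _ m] by (auto simp: eventually_sequentially)
  show "\<forall>\<^sub>F N in sequentially. cN N m \<le> 1" using cN_bounds(2) by simp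
  show "(\<lambda>N. 1 - \<bar>real_of_int m\<bar> / real N) \<longlonglongrightarrow> 1"
    using tendsto_diff[OF tendsto_const[of 1] lim_const_over_n[of "\<bar>real_of_int m\<bar>"]] by simp
qed simp

lemma KN_mass:
  assumes "norm z = 1" "1 \<le> N"
  shows "integrable TM (\<lambda>\<theta>. KN N (z * cis (- \<theta>)))" "(LINT \<theta>|TM. KN N (z * cis (- \<theta>))) = 2 * pi"
proof -
  have i1: "integrable TM (\<lambda>\<theta>. (\<lambda>_. 1::complex) (cis \<theta>))"
    using finite_measure.integrable_const[OF finite_measure_TM] by simp
  note s = sgv_integral[OF i1 assms(1), of N]
  have "integrable TM (\<lambda>\<theta>. complex_of_real (KN N (z * cis (- \<theta>))))" using s(1) by simp
  then show "integrable TM (\<lambda>\<theta>. KN N (z * cis (- \<theta>)))" by (simp only: complex_of_real_integrable_eq)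
  have "sgv N (\<lambda>w. w powi 0) z = 1" unfolding sgv_monom[OF assms(2)] using assms by (simp add: cN_0)
  then have "sgv N (\<lambda>_. 1) z = 1" by simp
  then have "complex_of_real (LINT \<theta>|TM. KN N (z * cis (- \<theta>))) = complex_of_real (2 * pi)"
    using s(2) by (simp add: field_simps)
  then show "(LINT \<theta>|TM. KN N (z * cis (- \<theta>))) = 2 * pi" by (simp only: of_real_eq_iff)
qed

lemma sgv_norm_le:
  assumes F: "integrable TM (\<lambda>\<theta>. F (cis \<theta>))" and z: "norm z = 1"
  shows "integrable TM (\<lambda>\<theta>. norm (F (cis \<theta>)) * KN N (z * cis (- \<theta>)))"
    "norm (sgv N F z) \<le> (LINT \<theta>|TM. norm (F (cis \<theta>)) * KN N (z * cis (- \<theta>))) / (2 * pi)"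
proof -
  note s = sgv_integral[OF F z, of N]
  show "integrable TM (\<lambda>\<theta>. norm (F (cis \<theta>)) * KN N (z * cis (- \<theta>)))"
    using integrable_norm[OF s(1)] by (simp add: norm_mult)
  have "norm (LINT \<theta>|TM. F (cis \<theta>) * complex_of_real (KN N (z * cis (- \<theta>)))) \<le>
     (LINT \<theta>|TM. norm (F (cis \<theta>) * complex_of_real (KN N (z * cis (- \<theta>)))))" by (rule integral_norm_bound)
  then show "norm (sgv N F z) \<le> (LINT \<theta>|TM. norm (F (cis \<theta>)) * KN N (z * cis (- \<theta>))) / (2 * pi)"
    unfolding s(2) by (simp add: norm_divide norm_mult divide_right_mono)
qed

lemma sgv_bounded:
  assumes F: "integrable TM (\<lambda>\<theta>. F (cis \<theta>))" and z: "norm z = 1" and N: "1 \<le> N"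
    and b: "\<And>\<theta>. norm (F (cis \<theta>)) \<le> B"
  shows "norm (sgv N F z) \<le> B"
proof -
  have "(LINT \<theta>|TM. norm (F (cis \<theta>)) * KN N (z * cis (- \<theta>))) \<le> (LINT \<theta>|TM. B * KN N (z * cis (- \<theta>)))"
    using sgv_norm_le(1)[OF F z] KN_mass(1)[OF z N] by (intro integral_mono) (auto intro: mult_right_mono b)
  also have "\<dots> = B * (2 * pi)" using KN_mass[OF z N] by simp
  finally have "(LINT \<theta>|TM. norm (F (cis \<theta>)) * KN N (z * cis (- \<theta>))) / (2 * pi) \<le> B"
    by (simp add: field_simps)
  then show ?thesis using sgv_norm_le(2)[OF F z, of N] by linarith
qed

lemma LINT_sgv:
  assumes "1 \<le> N" "cm F" shows "(LINT \<theta>|TM. sgv N F (cis \<theta>)) = (LINT \<theta>|TM. F (cis \<theta>))"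
proof -
  have "co (sg N (mk F)) 0 = co (mk F) 0" using assms by (simp add: co_sg cN_0)
  then have "av (mk (sgv N F)) = av (mk F)" using assms by (simp add: co_def zp_simps sg_mk)
  then show ?thesis using assms by (simp add: mk_simps cm_sgv)
qed

text \<open>Jensen's inequality for the probability density \<open>KN / (2 pi)\<close>: the tangent
  inequality at the mean \<open>a\<close> of \<open>norm F\<close> is integrated. The right side is
  again a Fejer mean, so its integral over \<open>z\<close> is read off the zeroth coefficient in
  \<open>nm_sg\<close>, with no exchange of integrals.\<close>

lemma sgv_Jensen:
  assumes F: "(\<lambda>\<theta>. F (cis \<theta>)) \<in> Lpm TM p" and p: "1 < p" and z: "norm z = 1" and N: "1 \<le> N"
  shows "norm (sgv N F z) powr p \<le> Re (sgv N (\<lambda>z. complex_of_real (norm (F z) powr p)) z)"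
proof -
  have iF: "integrable TM (\<lambda>\<theta>. F (cis \<theta>))" by (rule Lpm_imp_L1(1)[OF finite_measure_TM F p])
  have iP: "integrable TM (\<lambda>\<theta>. (\<lambda>z. complex_of_real (norm (F z) powr p)) (cis \<theta>))" using Lpm_integrable[OF F] by simp
  define k where "k = (\<lambda>\<theta>. KN N (z * cis (- \<theta>)))"
  define a where "a = (LINT \<theta>|TM. norm (F (cis \<theta>)) * k \<theta>) / (2 * pi)"
  have k0: "0 \<le> k \<theta>" for \<theta> by (simp add: k_def)
  have a0: "0 \<le> a" unfolding a_def using k0 by (intro divide_nonneg_pos integral_nonneg_AE) auto
  have i1: "integrable TM k" "(LINT \<theta>|TM. k \<theta>) = 2 * pi" using KN_mass[OF z N] by (auto simp: k_def)
  have i2: "integrable TM (\<lambda>\<theta>. norm (F (cis \<theta>)) * k \<theta>)" using sgv_norm_le(1)[OF iF z] by (simp add: k_def)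
  have i3': "integrable TM (\<lambda>\<theta>. complex_of_real (norm (F (cis \<theta>)) powr p) * complex_of_real (k \<theta>))"
    using sgv_integral(1)[OF iP z, of N] by (simp add: k_def)
  then have i3: "integrable TM (\<lambda>\<theta>. norm (F (cis \<theta>)) powr p * k \<theta>)"
    by (simp only: of_real_mult[symmetric] complex_of_real_integrable_eq)
  have val: "sgv N (\<lambda>z. complex_of_real (norm (F z) powr p)) z = complex_of_real ((LINT \<theta>|TM. norm (F (cis \<theta>)) powr p * k \<theta>) / (2 * pi))"
    unfolding sgv_integral(2)[OF iP z] by (simp add: k_def flip: of_real_mult)
  define c1 where "c1 = p * a powr (p - 1)"
  have "(LINT \<theta>|TM. a powr p * k \<theta> + c1 * (norm (F (cis \<theta>)) * k \<theta> - a * k \<theta>)) \<le> (LINT \<theta>|TM. norm (F (cis \<theta>)) powr p * k \<theta>)"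
  proof (rule integral_mono)
    fix \<theta>
    have "(a powr p + p * a powr (p - 1) * (norm (F (cis \<theta>)) - a)) * k \<theta> \<le> norm (F (cis \<theta>)) powr p * k \<theta>"
      using powr_tangent[OF p norm_ge_zero a0, of "F (cis \<theta>)"] k0 by (intro mult_right_mono) auto
    then show "a powr p * k \<theta> + c1 * (norm (F (cis \<theta>)) * k \<theta> - a * k \<theta>) \<le> norm (F (cis \<theta>)) powr p * k \<theta>"
      by (simp add: algebra_simps c1_def)
  qed (use i1 i2 i3 in auto)
  moreover have "(LINT \<theta>|TM. a powr p * k \<theta> + c1 * (norm (F (cis \<theta>)) * k \<theta> - a * k \<theta>)) = a powr p * (2 * pi)"
    using i1 i2 by (simp add: a_def)
  ultimately have "a powr p \<le> (LINT \<theta>|TM. norm (F (cis \<theta>)) powr p * k \<theta>) / (2 * pi)" by (simp add: field_simps)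
  moreover have "norm (sgv N F z) powr p \<le> a powr p"
    using sgv_norm_le(2)[OF iF z, of N] p by (intro powr_mono2) (auto simp: a_def k_def)
  ultimately show ?thesis unfolding val by simp
qed

lemma nm_sg:
  assumes f: "f \<in> LL p" and p: "1 < p" and N: "1 \<le> N"
  shows "nm p (sg N f) \<le> nm p f"
proof -
  obtain F where F: "cm F" "f = mk F" by (rule mfun_rep)
  have L: "(\<lambda>\<theta>. F (cis \<theta>)) \<in> Lpm TM p" using f F by (simp add: mk_simps)
  define H where "H = (\<lambda>z. complex_of_real (norm (F z) powr p))"
  have cH: "cm H" unfolding H_def
    by (rule cmI, rule of_real_measurable) (use Lpm_integrable[OF L] in auto)
  have sL: "(\<lambda>\<theta>. sgv N F (cis \<theta>)) \<in> Lpm TM p"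
    using TP_LL[OF sg_TP[of N f], of p] p F by (simp add: sg_mk mk_simps cm_sgv)
  have iH: "integrable TM (\<lambda>\<theta>. sgv N H (cis \<theta>))"
    using TP_LL[OF sg_TP[of N "mk H"], of 1] cH by (simp add: sg_mk LL1_iff cm_sgv)
  have "(LINT \<theta>|TM. norm (sgv N F (cis \<theta>)) powr p) \<le> (LINT \<theta>|TM. Re (sgv N H (cis \<theta>)))"
    using Lpm_integrable[OF sL] iH sgv_Jensen[OF L p _ N] by (intro integral_mono) (auto simp: H_def)
  also have "\<dots> = Re (LINT \<theta>|TM. sgv N H (cis \<theta>))" using iH by simp
  also have "\<dots> = Re (LINT \<theta>|TM. H (cis \<theta>))" using LINT_sgv[OF N cH] by simp
  also have "\<dots> = (LINT \<theta>|TM. norm (F (cis \<theta>)) powr p)" by (simp add: H_def)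
  finally have "Nrm TM p (\<lambda>\<theta>. sgv N F (cis \<theta>)) \<le> Nrm TM p (\<lambda>\<theta>. F (cis \<theta>))"
    unfolding Nrm_def using p by (intro powr_mono2) (auto intro: integral_nonneg_AE)
  then show ?thesis using F by (simp add: sg_mk mk_simps cm_sgv)
qed

text \<open>Korovkin's argument: the second moment of the Fejer kernel about \<open>z\<close> is \<open>2 (1 - cN N (- 1))\<close>.\<close>

lemma sgv_uniform:
  assumes u: "continuous_on (sphere 0 1) u" and e: "0 < e"
  shows "\<exists>N\<ge>1. \<forall>z\<in>sphere 0 1. norm (sgv N u z - u z) < e"
proof -
  have cu: "cm u" using circ_continuous_measurable[OF u] by (simp add: cm_def)
  have "compact (u ` sphere 0 1)" using u by (intro compact_continuous_image) auto
  then obtain B where B: "0 < B" "\<And>z. z \<in> sphere 0 1 \<Longrightarrow> norm (u z) \<le> B"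
    using compact_imp_bounded[of "u ` sphere 0 1"] by (auto simp: bounded_pos)
  have "uniformly_continuous_on (sphere 0 1) u" using u by (intro compact_uniformly_continuous) auto
  then obtain \<delta> where \<delta>: "0 < \<delta>" "\<And>x y. x \<in> sphere 0 1 \<Longrightarrow> y \<in> sphere 0 1 \<Longrightarrow> dist y x < \<delta> \<Longrightarrow> dist (u y) (u x) < e / 2"
    using e unfolding uniformly_continuous_on_def by (metis half_gt_zero)
  \<comment> \<open>At distance at least \<open>\<delta>\<close> from \<open>z\<close> the quantity
    \<open>D * norm (\<zeta> - z)^2\<close> is at least \<open>2 * B\<close>, which bounds
    \<open>norm (u \<zeta> - u z)\<close>.\<close>
  define D where "D = 2 * B / \<delta>\<^sup>2"
  have D0: "0 < D" using B \<delta> by (simp add: D_def)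
  have "(\<lambda>N. D * (2 * (1 - cN N (-1)))) \<longlonglongrightarrow> D * (2 * (1 - 1))" by (intro tendsto_intros cN_tendsto)
  then have "\<forall>\<^sub>F N in sequentially. D * (2 * (1 - cN N (-1))) < e / 2"
    using e by (intro order_tendstoD(2)) auto
  then obtain N where N: "1 \<le> N" "D * (2 * (1 - cN N (-1))) < e / 2"
    using eventually_happens'[OF sequentially_bot eventually_conj[OF eventually_ge_at_top[of 1]]] by blast
  show ?thesis
  proof (intro exI[of _ N] conjI ballI N(1))
    fix z :: complex assume zs: "z \<in> sphere 0 1"
    then have z: "norm z = 1" by simp
    define v where "v = (\<lambda>w. u w - u z)"
    define k where "k = (\<lambda>\<theta>. KN N (z * cis (- \<theta>)))"
    define C where "C = (\<lambda>\<theta>. complex_of_real (k \<theta>) * (z * cis (- \<theta>)))"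
    define R where "R = (\<lambda>\<theta>. Re (C \<theta>))"
    have k0: "0 \<le> k \<theta>" for \<theta> by (simp add: k_def)
    have iu: "integrable TM (\<lambda>\<theta>. u (cis \<theta>))"
      by (rule finite_measure.integrable_const_bound[OF finite_measure_TM, of _ B]) (use B cm_measurable[OF cu] in auto)
    have iv: "integrable TM (\<lambda>\<theta>. v (cis \<theta>))"
      using iu finite_measure.integrable_const[OF finite_measure_TM] by (simp add: v_def)
    have ik: "integrable TM k" "(LINT \<theta>|TM. k \<theta>) = 2 * pi" using KN_mass[OF z N(1)] by (auto simp: k_def)
    have mass: "(LINT \<theta>|TM. complex_of_real (k \<theta>)) = complex_of_real (2 * pi)"
      "integrable TM (\<lambda>\<theta>. complex_of_real (k \<theta>))"
      using ik by simp_all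
    have "sgv N v z = sgv N u z - u z"
      unfolding sgv_integral(2)[OF iu z] sgv_integral(2)[OF iv z]
      using sgv_integral(1)[OF iu z, of N] mass unfolding k_def
      by (simp add: v_def left_diff_distrib diff_divide_distrib)
    then have n1: "norm (sgv N u z - u z) \<le> (LINT \<theta>|TM. norm (v (cis \<theta>)) * k \<theta>) / (2 * pi)"
      using sgv_norm_le(2)[OF iv z, of N] by (simp add: k_def)
    have iC: "integrable TM C"
    proof -
      have "integrable TM (\<lambda>\<theta>. z * (complex_of_real (k \<theta>) * cis (-1 * \<theta>)))"
        by (rule integrable_mult_right[OF integrable_mult_cis[OF mass(2)]])
      then show ?thesis by (simp add: mult_ac C_def[abs_def])
    qed
    then have iR: "integrable TM R" unfolding R_def by (rule integrable_Re)
    have iw: "integrable TM (\<lambda>\<theta>. (\<lambda>w. w powi (-1)) (cis \<theta>))"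
      using Bd_LL[OF Bd_intros(1)[of "-1"], of 1] by (simp only: mk_simps(9) LL1_iff[OF cm_intros(2)])
    \<comment> \<open>Up to the factors \<open>z\<close> and \<open>2 pi\<close> this is the Fejer
      mean of \<open>w powi (-1)\<close> at \<open>z\<close>; hence the first moment of the kernel
      is the weight \<open>cN N (-1)\<close>.\<close>
    have "(LINT \<theta>|TM. C \<theta>) = complex_of_real (2 * pi * cN N (-1))"
    proof -
      have e: "C \<theta> = z * (cis \<theta> powi (-1) * complex_of_real (KN N (z * cis (- \<theta>))))" for \<theta>
        by (simp add: C_def k_def cis_inverse mult_ac)
      have "(LINT \<theta>|TM. C \<theta>) = z * (LINT \<theta>|TM. cis \<theta> powi (-1) * complex_of_real (KN N (z * cis (- \<theta>))))"
        unfolding e by (rule integral_mult_right_zero)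
      also have "\<dots> = z * (2 * pi * sgv N (\<lambda>w. w powi (-1)) z)"
        using sgv_integral(2)[OF iw z, of N] by (simp only:) simp
      also have "\<dots> = complex_of_real (2 * pi * cN N (-1))"
      proof -
        have "z * z powi (-1) = 1" using z by (cases "z = 0") auto
        then show ?thesis unfolding sgv_monom[OF N(1)] by (simp add: mult_ac)
      qed
      finally show ?thesis .
    qed
    then have LR: "(LINT \<theta>|TM. R \<theta>) = 2 * pi * cN N (-1)" unfolding R_def integral_Re[OF iC] by simp
    have "(LINT \<theta>|TM. norm (v (cis \<theta>)) * k \<theta>) \<le> (LINT \<theta>|TM. e / 2 * k \<theta> + D * (2 * k \<theta> - 2 * R \<theta>))"
    proof (rule integral_mono)
      show "integrable TM (\<lambda>\<theta>. norm (v (cis \<theta>)) * k \<theta>)" using sgv_norm_le(1)[OF iv z] by (simp add: k_def)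
      show "integrable TM (\<lambda>\<theta>. e / 2 * k \<theta> + D * (2 * k \<theta> - 2 * R \<theta>))" using ik iR by simp
      fix \<theta>
      define \<zeta> where "\<zeta> = cis \<theta>"
      have n2: "(norm (\<zeta> - z))\<^sup>2 = 2 - 2 * Re (z * cis (- \<theta>))"
      proof -
        have "(norm (\<zeta> - z))\<^sup>2 = (norm \<zeta>)\<^sup>2 + (norm z)\<^sup>2 - 2 * Re (z * cnj \<zeta>)"
          unfolding cmod_power2 by (simp add: power2_eq_square algebra_simps)
        then show ?thesis using z by (simp add: \<zeta>_def cis_cnj)
      qed
      have "norm (v \<zeta>) \<le> e / 2 + D * (norm (\<zeta> - z))\<^sup>2"
      proof (cases "dist \<zeta> z < \<delta>")
        case True
        then have "norm (v \<zeta>) < e / 2" using \<delta>(2)[of z \<zeta>] zs by (simp add: v_def dist_norm \<zeta>_def)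
        moreover have "0 \<le> D * (norm (\<zeta> - z))\<^sup>2" using D0 by simp
        ultimately show ?thesis by linarith
      next
        case False
        then have "\<delta>\<^sup>2 \<le> (norm (\<zeta> - z))\<^sup>2" using \<delta>(1) by (intro power_mono) (auto simp: dist_norm)
        then have "D * \<delta>\<^sup>2 \<le> D * (norm (\<zeta> - z))\<^sup>2" using D0 by (intro mult_left_mono) auto
        moreover have "D * \<delta>\<^sup>2 = 2 * B" using \<delta>(1) by (simp add: D_def)
        moreover have "norm (v \<zeta>) \<le> B + B"
          unfolding v_def using B(2)[of \<zeta>] B(2)[OF zs] norm_triangle_ineq4[of "u \<zeta>" "u z"] by (simp add: \<zeta>_def)
        ultimately show ?thesis using e by linarith
      qed
      then have "norm (v \<zeta>) * k \<theta> \<le> (e / 2 + D * (2 - 2 * Re (z * cis (- \<theta>)))) * k \<theta>"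
        unfolding n2 using k0 by (intro mult_right_mono) auto
      moreover have "R \<theta> = Re (z * cis (- \<theta>)) * k \<theta>" by (simp add: R_def C_def)
      ultimately show "norm (v (cis \<theta>)) * k \<theta> \<le> e / 2 * k \<theta> + D * (2 * k \<theta> - 2 * R \<theta>)"
        by (simp only: \<zeta>_def) (simp add: algebra_simps)
    qed
    also have "\<dots> = (e / 2 + D * (2 * (1 - cN N (-1)))) * (2 * pi)"
      using ik iR LR by (simp add: field_simps)
    finally have "(LINT \<theta>|TM. norm (v (cis \<theta>)) * k \<theta>) / (2 * pi) \<le> e / 2 + D * (2 * (1 - cN N (-1)))"
      by (simp add: pos_divide_le_eq)
    then show "norm (sgv N u z - u z) < e" using n1 N(2) by linarith
  qed
qed

section \<open>Density of trigonometric polynomials and uniqueness of coefficients\<close>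

lemma Nrm_dominated:
  assumes G[measurable]: "\<And>n. G n \<in> borel_measurable M" and lim: "AE x in M. (\<lambda>n. G n x) \<longlonglongrightarrow> 0"
    and bd: "\<And>n. AE x in M. norm (G n x) \<le> w x" and w: "integrable M (\<lambda>x. w x powr p)" and p: "0 < p"
  shows "(\<lambda>n. Nrm M p (G n)) \<longlonglongrightarrow> 0"
proof -
  have "(\<lambda>n. LINT x|M. norm (G n x) powr p) \<longlonglongrightarrow> (LINT x|M. 0)"
  proof (rule integral_dominated_convergence[where w="\<lambda>x. w x powr p"])
    show "AE x in M. (\<lambda>n. norm (G n x) powr p) \<longlonglongrightarrow> 0"
      using lim
    proof eventually_elim
      case (elim x)
      show ?case using tendsto_powr'[OF tendsto_norm[OF elim] tendsto_const[of p]] p by simp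
    qed
    show "AE x in M. norm (norm (G n x) powr p) \<le> w x powr p" for n
      using bd[of n]
    proof eventually_elim
      case (elim x)
      then show ?case using p by (simp add: powr_mono2)
    qed
    show "(\<lambda>x. norm (G n x) powr p) \<in> borel_measurable M" for n by measurable
  qed (use w in simp_all)
  then have "(\<lambda>n. LINT x|M. norm (G n x) powr p) \<longlonglongrightarrow> 0" by simp
  then have "(\<lambda>n. (LINT x|M. norm (G n x) powr p) powr (1/p)) \<longlonglongrightarrow> 0 powr (1/p)"
    by (rule tendsto_powr'[OF _ tendsto_const]) (use p in \<open>simp add: integral_nonneg_AE\<close>)
  then show ?thesis unfolding Nrm_def using p by simp
qed

text \<open>Continuous approximants on the interval are carried to the circle by
  \<open>Arg2pi\<close>, which jumps at the point 1. The cutoff \<open>ch n\<close> vanishes near 1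
  and removes the jump; the retraction \<open>cl\<close> onto the unit disc enforces the bound
  without moving the values of \<open>F\<close>.\<close>

lemma continuous_approx:
  assumes F: "cm F" and b: "\<And>\<theta>. norm (F (cis \<theta>)) \<le> 1"
  shows "\<exists>u. (\<forall>n. continuous_on (sphere 0 1) (u n)) \<and> (\<forall>n z. norm (u n z) \<le> 1) \<and>
     (AE \<theta> in TM. (\<lambda>n. u n (cis \<theta>)) \<longlonglongrightarrow> F (cis \<theta>))"
proof -
  have "(\<lambda>\<theta>. F (cis \<theta>)) measurable_on {0..2*pi}"
    using cm_measurable[OF F] by (simp add: measurable_on_iff_borel_measurable)
  then obtain N g where N: "negligible N" and g: "\<And>n. continuous_on UNIV (g n)"
    and gl: "\<And>x. x \<notin> N \<Longrightarrow> (\<lambda>n. g n x) \<longlonglongrightarrow> (if x \<in> {0..2*pi} then F (cis x) else 0)"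
    unfolding measurable_on_def by blast
  define cl where "cl = (\<lambda>w::complex. w / of_real (max 1 (norm w)))"
  define ch where "ch n z = max 0 (min 1 (real n * norm (z - 1) - 1))" for n :: nat and z :: complex
  define u where "u n z = of_real (ch n z) * cl (g n (Arg2pi z))" for n z
  have cl1: "norm (cl w) \<le> 1" for w by (simp add: cl_def norm_divide field_simps)
  have clc: "isCont cl w" for w unfolding cl_def by (intro continuous_intros) (auto simp: max_def)
  have ch1: "0 \<le> ch n z" "ch n z \<le> 1" for n z by (auto simp: ch_def)
  have chc: "isCont (ch n) z" for n z unfolding ch_def by (intro continuous_intros)
  have "norm (u n z) \<le> 1" for n z
    using mult_mono[OF ch1(2)[of n z] cl1[of "g n (Arg2pi z)"]] ch1(1)[of n z] by (simp add: u_def norm_mult)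
  moreover have "continuous_on (sphere 0 1) (u n)" for n
  proof (rule continuous_at_imp_continuous_on, rule ballI)
    fix z :: complex assume z: "z \<in> sphere 0 1"
    show "isCont (u n) z"
    proof (cases "z = 1")
      case True
      have "\<forall>\<^sub>F w in nhds z. u n w = 0"
      proof -
        have "\<forall>\<^sub>F w in nhds (1::complex). dist w 1 < 1 / (real n + 1)"
          by (rule eventually_nhds_metric[THEN iffD2]) (auto intro!: exI[of _ "1 / (real n + 1)"])
        then show ?thesis unfolding True
        proof eventually_elim
          case (elim w)
          then have "(real n + 1) * norm (w - 1) < 1" by (simp add: dist_norm field_simps)
          then have "real n * norm (w - 1) + norm (w - 1) < 1" by (simp add: algebra_simps)
          then have "real n * norm (w - 1) - 1 < 0" using norm_ge_zero[of "w - 1"] by linarith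
          then show ?case by (simp add: u_def ch_def)
        qed
      qed
      then show ?thesis using isCont_cong[of "u n" "\<lambda>_. 0" z] by simp
    next
      case False
      have "z \<notin> \<real>\<^sub>\<ge>\<^sub>0"
      proof
        assume "z \<in> \<real>\<^sub>\<ge>\<^sub>0"
        then obtain r where "z = of_real r" "0 \<le> r" by (auto elim: nonneg_Reals_cases)
        then show False using z False by auto
      qed
      then have a: "isCont Arg2pi z" by (rule continuous_at_Arg2pi)
      have gc: "isCont (g n) x" for x using g[of n] by (simp add: continuous_on_eq_continuous_at)
      have "isCont (\<lambda>z. g n (Arg2pi z)) z" by (rule isCont_o2[OF a gc])
      then have "isCont (\<lambda>z. cl (g n (Arg2pi z))) z" by (rule isCont_o2[OF _ clc])
      then show ?thesis unfolding u_def[abs_def] by (intro continuous_intros chc)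
    qed
  qed
  moreover have "AE \<theta> in TM. (\<lambda>n. u n (cis \<theta>)) \<longlonglongrightarrow> F (cis \<theta>)"
  proof -
    \<comment> \<open>The endpoints join the null set: both are mapped to the point 1, where every
      \<open>u n\<close> vanishes.\<close>
    have "negligible (N \<union> {0, 2*pi})" using N by (simp add: negligible_insert)
    then have "N \<union> {0, 2*pi} \<in> null_sets lebesgue" by (simp add: negligible_iff_null_sets)
    then have "AE \<theta> in lebesgue. \<theta> \<notin> N \<union> {0, 2*pi}" by (rule AE_not_in)
    then have "AE \<theta> in lebesgue. \<theta> \<in> {0..2*pi} \<longrightarrow> (\<lambda>n. u n (cis \<theta>)) \<longlonglongrightarrow> F (cis \<theta>)"
    proof eventually_elim
      case (elim \<theta>)
      show ?case
      proof
        assume th: "\<theta> \<in> {0..2*pi}"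
        then have th': "0 < \<theta>" "\<theta> < 2 * pi" using elim by auto
        have A: "Arg2pi (cis \<theta>) = \<theta>" by (rule Arg2pi_unique[of 1]) (use th' in \<open>auto simp: cis_conv_exp\<close>)
        have ne: "cis \<theta> \<noteq> 1"
        proof
          assume "cis \<theta> = 1"
          then have "Arg2pi (cis \<theta>) = 0" by (simp add: Arg2pi_of_real[of 1, simplified])
          then show False using A th' by simp
        qed
        define r where "r = norm (cis \<theta> - 1)"
        have r: "0 < r" using ne by (simp add: r_def)
        have "(\<lambda>n. ch n (cis \<theta>)) \<longlonglongrightarrow> 1"
        proof (rule tendsto_eventually)
          obtain n0 :: nat where n0: "2 / r \<le> real n0" using real_arch_simple by blast
          have "ch n (cis \<theta>) = 1" if "n0 \<le> n" for n
          proof -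
            have "2 \<le> real n0 * r" using n0 r by (simp add: field_simps)
            also have "\<dots> \<le> real n * r" using that r by (intro mult_right_mono) auto
            finally show ?thesis by (simp add: ch_def r_def)
          qed
          then show "\<forall>\<^sub>F n in sequentially. ch n (cis \<theta>) = 1" by (auto simp: eventually_sequentially)
        qed
        moreover have "(\<lambda>n. cl (g n \<theta>)) \<longlonglongrightarrow> cl (F (cis \<theta>))"
          using gl[of \<theta>] elim th by (intro isCont_tendsto_compose[OF clc]) auto
        moreover have "cl (F (cis \<theta>)) = F (cis \<theta>)" using b[of \<theta>] by (simp add: cl_def)
        ultimately have "(\<lambda>n. complex_of_real (ch n (cis \<theta>)) * cl (g n \<theta>)) \<longlonglongrightarrow> of_real 1 * F (cis \<theta>)"
          by (intro tendsto_mult tendsto_of_real) auto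
        then show "(\<lambda>n. u n (cis \<theta>)) \<longlonglongrightarrow> F (cis \<theta>)" by (simp add: u_def A)
      qed
    qed
    then show ?thesis by (simp add: AE_restrict_space_iff)
  qed
  ultimately show ?thesis by blast
qed

text \<open>Each continuous approximant is replaced by a Fejer mean within
  \<open>1 / (n + 1)\<close> of it, which keeps the limit. The kernel is positive with total mass
  \<open>2 pi\<close>, so the bound 1 survives; dominated convergence needs exactly this
  bound.\<close>

lemma trig_approx:
  assumes F: "cm F" and b: "\<And>\<theta>. norm (F (cis \<theta>)) \<le> 1"
  shows "\<exists>u. (\<forall>n. cm (u n) \<and> mk (u n) \<in> TP) \<and> (\<forall>n \<theta>. norm (u n (cis \<theta>)) \<le> 1) \<and>
     (AE \<theta> in TM. (\<lambda>n. u n (cis \<theta>)) \<longlonglongrightarrow> F (cis \<theta>))"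
proof -
  obtain v where v: "\<And>n. continuous_on (sphere 0 1) (v n)" "\<And>n z. norm (v n z) \<le> 1"
    and vl: "AE \<theta> in TM. (\<lambda>n. v n (cis \<theta>)) \<longlonglongrightarrow> F (cis \<theta>)"
    using continuous_approx[OF assms] by blast
  have "\<forall>n. \<exists>N\<ge>1. \<forall>z\<in>sphere 0 1. norm (sgv N (v n) z - v n z) < 1 / (real n + 1)"
    using sgv_uniform[OF v(1)] by simp
  then obtain N where N: "\<And>n. 1 \<le> N n" "\<And>n z. z \<in> sphere 0 1 \<Longrightarrow> norm (sgv (N n) (v n) z - v n z) < 1 / (real n + 1)"
    by metis
  have cv: "cm (v n)" for n using circ_continuous_measurable[OF v(1)] by (simp add: cm_def)
  have iv: "integrable TM (\<lambda>\<theta>. v n (cis \<theta>))" for n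
    by (rule finite_measure.integrable_const_bound[OF finite_measure_TM, of _ 1]) (use v(2) cm_measurable[OF cv] in auto)
  define u where "u n = sgv (N n) (v n)" for n
  have 1: "cm (u n) \<and> mk (u n) \<in> TP" for n
    using sg_TP[of "N n" "mk (v n)"] by (simp add: u_def cm_sgv sg_mk cv)
  have 2: "norm (u n (cis \<theta>)) \<le> 1" for n \<theta>
    unfolding u_def by (rule sgv_bounded[OF iv _ N(1)]) (use v(2) in auto)
  have 3: "AE \<theta> in TM. (\<lambda>n. u n (cis \<theta>)) \<longlonglongrightarrow> F (cis \<theta>)"
    using vl
  proof eventually_elim
    case (elim \<theta>)
    have l: "(\<lambda>n. 1 / (real n + 1)) \<longlonglongrightarrow> 0"
      using LIMSEQ_inverse_real_of_nat by (simp add: inverse_eq_divide add.commute)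
    have "norm (u n (cis \<theta>) - v n (cis \<theta>)) \<le> 1 / (real n + 1)" for n
      unfolding u_def using N(2)[of "cis \<theta>" n] by simp
    then have "(\<lambda>n. u n (cis \<theta>) - v n (cis \<theta>)) \<longlonglongrightarrow> 0"
      using l by (metis (no_types, lifting) Lim_null_comparison always_eventually)
    then show ?case using tendsto_add[OF _ elim] by fastforce
  qed
  show ?thesis using 1 2 3 by blast
qed

text \<open>\<open>f\<close> is paired with trigonometric polynomials that are bounded by 1 and tend
  almost everywhere to the conjugate sign \<open>S\<close> of \<open>f\<close>. All pairings vanish,
  and dominated convergence turns them into the integral of \<open>norm f\<close>. The result has to
  reach \<open>L^1\<close>, since the product of an \<open>H^p\<close> and an \<open>H^q\<close>
  function lies only there.\<close>

theorem co_unique: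
  assumes f: "f \<in> LL 1" and 0: "\<And>j. co f j = 0" shows "f = 0"
proof -
  obtain F where F: "cm F" "f = mk F" by (rule mfun_rep)
  have iF: "integrable TM (\<lambda>\<theta>. F (cis \<theta>))" using f F by (simp add: LL1_iff)
  define S where "S = (\<lambda>z. cnj (F z) * of_real (inverse (norm (F z))))"
  have "cm (\<lambda>z. of_real (norm (F z)))"
    by (rule cmI) (use cm_measurable[OF F(1)] in measurable)
  then have cS: "cm S" unfolding S_def using F(1) by simp
  have "norm (S (cis \<theta>)) \<le> 1" for \<theta>
    by (cases "F (cis \<theta>) = 0") (simp_all add: S_def norm_mult norm_inverse)
  then obtain u where u: "\<And>n. cm (u n)" "\<And>n. mk (u n) \<in> TP" "\<And>n \<theta>. norm (u n (cis \<theta>)) \<le> 1"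
    and ul: "AE \<theta> in TM. (\<lambda>n. u n (cis \<theta>)) \<longlonglongrightarrow> S (cis \<theta>)"
    using trig_approx[OF cS] by blast
  have z: "(LINT \<theta>|TM. F (cis \<theta>) * u n (cis \<theta>)) = 0" for n
    using av_mult_TP[OF u(2)[of n] f 0] F u(1)[of n] by (simp add: mk_simps)
  have "(\<lambda>n. LINT \<theta>|TM. F (cis \<theta>) * u n (cis \<theta>)) \<longlonglongrightarrow> (LINT \<theta>|TM. F (cis \<theta>) * S (cis \<theta>))"
  proof (rule integral_dominated_convergence[where w="\<lambda>\<theta>. norm (F (cis \<theta>))"])
    show "(\<lambda>\<theta>. F (cis \<theta>) * S (cis \<theta>)) \<in> borel_measurable TM"
      by (rule borel_measurable_times[OF cm_measurable[OF F(1)] cm_measurable[OF cS]])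
    show "(\<lambda>\<theta>. F (cis \<theta>) * u n (cis \<theta>)) \<in> borel_measurable TM" for n
      by (rule borel_measurable_times[OF cm_measurable[OF F(1)] cm_measurable[OF u(1)]])
    show "integrable TM (\<lambda>\<theta>. norm (F (cis \<theta>)))" using iF by (rule integrable_norm)
    show "AE \<theta> in TM. (\<lambda>n. F (cis \<theta>) * u n (cis \<theta>)) \<longlonglongrightarrow> F (cis \<theta>) * S (cis \<theta>)"
      using ul by eventually_elim (intro tendsto_intros)
    show "AE \<theta> in TM. norm (F (cis \<theta>) * u n (cis \<theta>)) \<le> norm (F (cis \<theta>))" for n
      using u(3)[of n] by (intro AE_I2) (simp add: norm_mult mult_left_le)
  qed
  then have "(LINT \<theta>|TM. F (cis \<theta>) * S (cis \<theta>)) = 0" by (simp add: z LIMSEQ_const_iff)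
  moreover have "F w * S w = of_real (norm (F w))" for w
  proof (cases "F w = 0")
    case False
    have "F w * S w = of_real ((norm (F w))\<^sup>2) * of_real (inverse (norm (F w)))"
      unfolding S_def using complex_norm_square[of "F w"] by simp
    also have "\<dots> = of_real (norm (F w))" using False by (simp add: power2_eq_square)
    finally show ?thesis .
  qed (simp add: S_def)
  ultimately have "complex_of_real (LINT \<theta>|TM. norm (F (cis \<theta>))) = 0" by simp
  then have "(LINT \<theta>|TM. norm (F (cis \<theta>))) = 0" by simp
  then have "AE \<theta> in TM. norm (F (cis \<theta>)) = 0"
    using integral_nonneg_eq_0_iff_AE[OF integrable_norm[OF iF]] by simp
  then have "AE \<theta> in TM. F (cis \<theta>) = 0" by simp
  then show ?thesis using F by (simp add: mk_simps mk_eq_iff ae_eq_def)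
qed

lemma co_eqI: "f \<in> LL 1 \<Longrightarrow> g \<in> LL 1 \<Longrightarrow> (\<And>j. co f j = co g j) \<Longrightarrow> f = g"
  using co_unique[of "f - g"] LL_diff[of f 1 g] by (simp add: co_diff)

text \<open>Truncation at height \<open>M\<close> followed by division by \<open>M\<close> makes
  \<open>trig_approx\<close> applicable; both errors tend to zero in norm by dominated
  convergence.\<close>

theorem TP_dense:
  assumes f: "f \<in> LL p" and p: "1 < p" and e: "0 < e"
  shows "\<exists>u\<in>TP. nm p (f - u) < e"
proof -
  have p0: "0 < p" using p by simp
  obtain F where F: "cm F" "f = mk F" by (rule mfun_rep)
  have L: "(\<lambda>\<theta>. F (cis \<theta>)) \<in> Lpm TM p" using f F by (simp add: mk_simps)
  note mF = cm_measurable[OF F(1)]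
  define T where "T M = (\<lambda>z. if norm (F z) \<le> real M then F z else 0)" for M :: nat
  have cT: "cm (T M)" for M unfolding T_def
    by (rule cmI) (use mF in measurable)
  have cD: "(\<lambda>\<theta>. F (cis \<theta>) - T M (cis \<theta>)) \<in> borel_measurable TM" for M
    by (rule borel_measurable_diff[OF mF cm_measurable[OF cT]])
  have "(\<lambda>M. Nrm TM p (\<lambda>\<theta>. F (cis \<theta>) - T M (cis \<theta>))) \<longlonglongrightarrow> 0"
  proof (rule Nrm_dominated[OF cD _ _ Lpm_integrable[OF L] p0])
    show "AE \<theta> in TM. (\<lambda>M. F (cis \<theta>) - T M (cis \<theta>)) \<longlonglongrightarrow> 0"
    proof (rule AE_I2, rule tendsto_eventually)
      fix \<theta>
      obtain M0 :: nat where "norm (F (cis \<theta>)) \<le> real M0" using real_arch_simple by blast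
      then have "F (cis \<theta>) - T M (cis \<theta>) = 0" if "M0 \<le> M" for M
        unfolding T_def using that by simp
      then show "\<forall>\<^sub>F M in sequentially. F (cis \<theta>) - T M (cis \<theta>) = 0" by (auto simp: eventually_sequentially)
    qed
    show "AE \<theta> in TM. norm (F (cis \<theta>) - T M (cis \<theta>)) \<le> norm (F (cis \<theta>))" for M
      by (rule AE_I2) (simp add: T_def)
  qed
  then have "\<forall>\<^sub>F M in sequentially. Nrm TM p (\<lambda>\<theta>. F (cis \<theta>) - T M (cis \<theta>)) < e / 2"
    using e by (intro order_tendstoD(2)) auto
  then obtain M where M: "1 \<le> M" "Nrm TM p (\<lambda>\<theta>. F (cis \<theta>) - T M (cis \<theta>)) < e / 2"
    using eventually_happens'[OF sequentially_bot eventually_conj[OF eventually_ge_at_top[of 1]]] by blast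
  define G where "G = (\<lambda>z. T M z / of_real (real M))"
  have cG: "cm G" unfolding G_def using cT by simp
  have "norm (G (cis \<theta>)) \<le> 1" for \<theta> using M(1) by (simp add: G_def T_def norm_divide)
  then obtain u where u: "\<And>n. cm (u n)" "\<And>n. mk (u n) \<in> TP" "\<And>n \<theta>. norm (u n (cis \<theta>)) \<le> 1"
    and ul: "AE \<theta> in TM. (\<lambda>n. u n (cis \<theta>)) \<longlonglongrightarrow> G (cis \<theta>)"
    using trig_approx[OF cG] by blast
  have b1: "norm (G (cis \<theta>)) \<le> 1" for \<theta> using M(1) by (simp add: G_def T_def norm_divide)
  have "(\<lambda>n. Nrm TM p (\<lambda>\<theta>. G (cis \<theta>) - u n (cis \<theta>))) \<longlonglongrightarrow> 0"
  proof (rule Nrm_dominated[where w="\<lambda>_. 2"])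
    show "(\<lambda>\<theta>. G (cis \<theta>) - u n (cis \<theta>)) \<in> borel_measurable TM" for n
      by (rule borel_measurable_diff[OF cm_measurable[OF cG] cm_measurable[OF u(1)]])
    show "AE \<theta> in TM. (\<lambda>n. G (cis \<theta>) - u n (cis \<theta>)) \<longlonglongrightarrow> 0"
      using ul
    proof eventually_elim
      case (elim \<theta>)
      show ?case using tendsto_diff[OF tendsto_const[of "G (cis \<theta>)"] elim] by simp
    qed
    show "AE \<theta> in TM. norm (G (cis \<theta>) - u n (cis \<theta>)) \<le> 2" for n
    proof (rule AE_I2)
      fix \<theta>
      show "norm (G (cis \<theta>) - u n (cis \<theta>)) \<le> 2"
        using norm_triangle_ineq4[of "G (cis \<theta>)" "u n (cis \<theta>)"] b1[of \<theta>] u(3)[of n \<theta>] by linarith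
    qed
    show "integrable TM (\<lambda>_. 2 powr p)" using finite_measure.integrable_const[OF finite_measure_TM] .
  qed (rule p0)
  then have "\<forall>\<^sub>F n in sequentially. Nrm TM p (\<lambda>\<theta>. G (cis \<theta>) - u n (cis \<theta>)) < e / (2 * real M)"
    using e M(1) by (intro order_tendstoD(2)) auto
  then obtain n where n: "Nrm TM p (\<lambda>\<theta>. G (cis \<theta>) - u n (cis \<theta>)) < e / (2 * real M)"
    using eventually_happens'[OF sequentially_bot] by blast
  define c where "c = complex_of_real (real M)"
  have eq: "f - cst c * mk (u n) = (f - mk (T M)) + cst c * (mk G - mk (u n))"
  proof -
    have "cst c * mk G = mk (T M)" using M(1) cG by (simp add: mk_simps c_def G_def)
    then show ?thesis by (simp add: algebra_simps)
  qed
  have l1: "f - mk (T M) \<in> LL p"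
  proof -
    have "bdC (real M) (mk (T M))" using cT by (simp add: mk_simps T_def)
    then have "mk (T M) \<in> Bd" by (auto simp: Bd_def)
    then show ?thesis using f p0 by (intro LL_diff) (auto intro: Bd_LL)
  qed
  have l2: "cst c * (mk G - mk (u n)) \<in> LL p"
  proof -
    have "bdC 1 (mk G)" using cG b1 by (simp add: mk_simps)
    then have "mk G \<in> Bd" by (auto simp: Bd_def)
    then show ?thesis using u(2) p0 by (intro LL_cst LL_diff) (auto intro: Bd_LL TP_LL)
  qed
  have "nm p (f - cst c * mk (u n)) \<le> nm p (f - mk (T M)) + nm p (cst c * (mk G - mk (u n)))"
    unfolding eq by (rule nm_triangle[OF l1 l2 p])
  also have "nm p (f - mk (T M)) < e / 2" using M(2) F cT by (simp add: mk_simps)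
  also have "nm p (cst c * (mk G - mk (u n))) < e / 2"
  proof -
    have "nm p (cst c * (mk G - mk (u n))) = real M * Nrm TM p (\<lambda>\<theta>. G (cis \<theta>) - u n (cis \<theta>))"
      using cG u(1) by (simp add: nm_cst[OF p0] c_def) (simp add: mk_simps)
    also have "\<dots> < real M * (e / (2 * real M))" using n M(1) by (intro mult_strict_left_mono) auto
    finally show ?thesis using M(1) by simp
  qed
  finally show ?thesis using u(2) by (intro bexI[of _ "cst c * mk (u n)"]) (auto intro: TP_cst)
qed

text \<open>Near-minimisers of the norm over the shrinking convex sets of functions with almost
  prescribed Fourier coefficients form a Cauchy sequence, by uniform convexity.\<close>

theorem weak_closure:
  assumes p: "1 < p" and M: "0 \<le> M"
    and Y: "\<And>N::nat. \<exists>Y\<in>LL p. nm p Y \<le> M \<and> (\<forall>j. \<bar>j\<bar> \<le> int N \<longrightarrow> norm (co Y j - y j) \<le> 1 / (real N + 1))"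
  shows "\<exists>Z\<in>LL p. nm p Z \<le> M \<and> (\<forall>j. co Z j = y j)"
proof -
  have p0: "0 < p" using p by simp
  define K where "K N = {Y\<in>LL p. nm p Y \<le> M \<and> (\<forall>j. \<bar>j\<bar> \<le> int N \<longrightarrow> norm (co Y j - y j) \<le> 1 / (real N + 1))}" for N :: nat
  define d where "d N = Inf ((\<lambda>Y. nm p Y powr p) ` K N)" for N
  have Kne: "K N \<noteq> {}" for N using Y[of N] by (auto simp: K_def)
  have bb: "bdd_below ((\<lambda>Y. nm p Y powr p) ` K N)" for N by (rule bdd_belowI[of _ 0]) auto
  have dle: "d N \<le> nm p Y powr p" if "Y \<in> K N" for N Y
    unfolding d_def using that bb by (intro cInf_lower) auto
  have Kdec: "K n \<subseteq> K m" if "m \<le> n" for m n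
  proof
    fix Y assume Y: "Y \<in> K n"
    have le: "1 / (real n + 1) \<le> 1 / (real m + 1)" using that by (intro divide_left_mono) auto
    have "norm (co Y j - y j) \<le> 1 / (real m + 1)" if "\<bar>j\<bar> \<le> int m" for j
    proof -
      have "norm (co Y j - y j) \<le> 1 / (real n + 1)" using Y that \<open>m \<le> n\<close> by (simp add: K_def)
      then show ?thesis using le by linarith
    qed
    then show "Y \<in> K m" using Y by (simp add: K_def)
  qed
  have dmono: "d m \<le> d n" if "m \<le> n" for m n
    unfolding d_def using Kdec[OF that] Kne[of n] bb by (intro cInf_superset_mono) auto
  have dM: "d N \<le> M powr p" for N
  proof -
    obtain Y where Y: "Y \<in> K N" using Kne by blast
    then have "nm p Y powr p \<le> M powr p" using p0 by (intro powr_mono2) (auto simp: K_def)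
    then show ?thesis using dle[OF Y] by linarith
  qed
  have "\<exists>Y\<in>K N. nm p Y powr p < d N + 1 / (real N + 1)" for N
  proof -
    have "d N < d N + 1 / (real N + 1)" by simp
    then show ?thesis unfolding d_def using Kne[of N] cInf_lessD[of "(\<lambda>Y. nm p Y powr p) ` K N"] by blast
  qed
  then obtain Z where Z: "\<And>N. Z N \<in> K N" "\<And>N. nm p (Z N) powr p < d N + 1 / (real N + 1)" by metis
  have ZL: "Z N \<in> LL p" for N using Z(1)[of N] by (simp add: K_def)
  have ZM: "nm p (Z N) \<le> M" for N using Z(1)[of N] by (simp add: K_def)
  have mid: "cst (1/2) * (Z n + Z m) \<in> K N" if "N \<le> n" "N \<le> m" for n m N
  proof -
    have a: "Z n \<in> K N" "Z m \<in> K N" using Z(1) Kdec that by blast+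
    have L: "cst (1/2) * (Z n + Z m) \<in> LL p" using ZL p0 by (intro LL_cst LL_add) auto
    have "nm p (cst (1/2) * (Z n + Z m)) = 1/2 * nm p (Z n + Z m)" using p0 by (simp add: nm_cst)
    also have "\<dots> \<le> 1/2 * (M + M)"
      using nm_triangle[OF ZL ZL p, of n m] ZM[of n] ZM[of m] by (intro mult_left_mono) auto
    finally have b: "nm p (cst (1/2) * (Z n + Z m)) \<le> M" by simp
    have "norm (co (cst (1/2) * (Z n + Z m)) j - y j) \<le> 1 / (real N + 1)" if "\<bar>j\<bar> \<le> int N" for j
    proof -
      have "co (cst (1/2) * (Z n + Z m)) j - y j = 1/2 * ((co (Z n) j - y j) + (co (Z m) j - y j))"
        unfolding co_cst co_add[OF LL_imp_LL1[OF ZL p] LL_imp_LL1[OF ZL p]] by (simp add: field_simps)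
      then have "norm (co (cst (1/2) * (Z n + Z m)) j - y j) = norm (1/2 * ((co (Z n) j - y j) + (co (Z m) j - y j)))"
        by (rule arg_cong)
      also have "\<dots> = 1/2 * norm ((co (Z n) j - y j) + (co (Z m) j - y j))"
        unfolding norm_mult by simp
      also have "\<dots> \<le> 1/2 * (1 / (real N + 1) + 1 / (real N + 1))"
        using a \<open>\<bar>j\<bar> \<le> int N\<close> by (intro mult_left_mono norm_triangle_mono) (auto simp: K_def)
      finally show ?thesis by simp
    qed
    then show ?thesis using L b by (simp add: K_def)
  qed
  obtain D where D: "d \<longlonglongrightarrow> D"
    by (rule incseq_convergent[of d "M powr p"]) (use dmono dM in \<open>auto simp: incseq_def\<close>)
  have dD: "d N \<le> D" for N by (rule incseq_le[OF _ D]) (simp add: incseq_def dmono)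
  have Cauchy: "\<exists>N. \<forall>m\<ge>N. \<forall>n\<ge>N. nm p (Z m - Z n) < e" if e: "0 < e" for e
  proof -
    \<comment> \<open>With this choice \<open>\<epsilon> * (2 * M powr p)\<close> is at most
      \<open>e powr p / 2\<close>; the summand 1 keeps the denominator positive for
      \<open>M = 0\<close>.\<close>
    define \<epsilon> where "\<epsilon> = e powr p / (4 * M powr p + 1)"
    have Mp: "0 \<le> M powr p" by simp
    have Mp1: "0 < 4 * M powr p + 1" using Mp by linarith
    have e0: "0 < \<epsilon>" using e Mp1 unfolding \<epsilon>_def by (intro divide_pos_pos) auto
    obtain C where C: "0 \<le> C" and UC: "\<And>f g. f \<in> LL p \<Longrightarrow> g \<in> LL p \<Longrightarrow>
       nm p (f - g) powr p \<le> \<epsilon> * (nm p f powr p + nm p g powr p)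
       + C * ((nm p f powr p + nm p g powr p) / 2 - nm p (cst (1/2) * (f + g)) powr p)"
      using LL_uniform_convexity[OF p e0] by blast
    have "(\<lambda>N. C * (D + 1 / (real N + 1) - d N)) \<longlonglongrightarrow> C * (D + 0 - D)"
      using LIMSEQ_inverse_real_of_nat by (intro tendsto_intros D) (simp add: inverse_eq_divide add.commute)
    then have "\<forall>\<^sub>F N in sequentially. C * (D + 1 / (real N + 1) - d N) < e powr p / 2"
      using e by (intro order_tendstoD(2)) auto
    then obtain N where N: "C * (D + 1 / (real N + 1) - d N) < e powr p / 2"
      using eventually_happens'[OF sequentially_bot] by blast
    show ?thesis
    proof (intro exI[of _ N] allI impI)
      fix m n assume mn: "N \<le> m" "N \<le> n"
      have z: "nm p (Z k) powr p \<le> D + 1 / (real N + 1)" if "N \<le> k" for k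
      proof -
        have "1 / (real k + 1) \<le> 1 / (real N + 1)" using that by (intro divide_left_mono) auto
        then show ?thesis using Z(2)[of k] dD[of k] by linarith
      qed
      have zM: "nm p (Z k) powr p \<le> M powr p" for k using ZM[of k] p0 by (intro powr_mono2) auto
      have "nm p (Z m - Z n) powr p \<le> \<epsilon> * (nm p (Z m) powr p + nm p (Z n) powr p)
       + C * ((nm p (Z m) powr p + nm p (Z n) powr p) / 2 - nm p (cst (1/2) * (Z m + Z n)) powr p)"
        by (rule UC[OF ZL ZL])
      also have "\<dots> \<le> \<epsilon> * (M powr p + M powr p) + C * (D + 1 / (real N + 1) - d N)"
      proof (intro add_mono mult_left_mono)
        show "nm p (Z m) powr p \<le> M powr p" "nm p (Z n) powr p \<le> M powr p" by (rule zM)+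
        show "(nm p (Z m) powr p + nm p (Z n) powr p) / 2 - nm p (cst (1/2) * (Z m + Z n)) powr p \<le> D + 1 / (real N + 1) - d N"
          using z[OF mn(1)] z[OF mn(2)] dle[OF mid[OF mn]] by argo
      qed (use e0 C in auto)
      also have "\<dots> < e powr p"
      proof -
        have "\<epsilon> * (M powr p + M powr p) \<le> e powr p / 2"
        proof -
          have "\<epsilon> * (4 * M powr p + 1) = e powr p" using Mp1 unfolding \<epsilon>_def by simp
          then show ?thesis using e0 by (simp add: algebra_simps)
        qed
        then show ?thesis using N by linarith
      qed
      finally show "nm p (Z m - Z n) < e" using e p0 powr_mono2[of p e "nm p (Z m - Z n)"] by (meson leI less_le_not_le less_imp_le)
    qed
  qed
  obtain W where W: "W \<in> LL p" "(\<lambda>n. nm p (Z n - W)) \<longlonglongrightarrow> 0"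
    using LL_complete[OF p ZL Cauchy] by blast
  have "co W j = y j" for j
  proof (rule LIMSEQ_unique)
    show "(\<lambda>n. co (Z n) j) \<longlonglongrightarrow> co W j" by (rule co_tendsto[OF p ZL W])
    have l: "(\<lambda>n. 1 / (real n + 1)) \<longlonglongrightarrow> 0"
      using LIMSEQ_inverse_real_of_nat by (simp add: inverse_eq_divide add.commute)
    have "\<forall>\<^sub>F n in sequentially. norm (co (Z n) j - y j) \<le> 1 / (real n + 1)"
      using Z(1) by (auto simp: eventually_sequentially K_def intro!: exI[of _ "nat \<bar>j\<bar>"])
    then have "(\<lambda>n. co (Z n) j - y j) \<longlonglongrightarrow> 0" using l by (rule Lim_null_comparison)
    then show "(\<lambda>n. co (Z n) j) \<longlonglongrightarrow> y j" by (rule LIM_zero_cancel)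
  qed
  moreover have "nm p W \<le> M"
  proof (rule LIMSEQ_le_const)
    show "(\<lambda>n. nm p (Z n - W) + M) \<longlonglongrightarrow> M" using tendsto_add[OF W(2) tendsto_const[of M]] by simp
    have "nm p W \<le> nm p (Z n - W) + M" for n
    proof -
      have "nm p W = nm p (Z n - (Z n - W))" by simp
      also have "\<dots> \<le> nm p (Z n) + nm p (Z n - W)" using ZL W p0 p by (intro nm_triangle_diff LL_diff) auto
      finally show ?thesis using ZM[of n] by linarith
    qed
    then show "\<exists>N. \<forall>n\<ge>N. nm p W \<le> nm p (Z n - W) + M" by blast
  qed
  ultimately show ?thesis using W(1) by blast
qed

section \<open>The theorem of M. Riesz and duality\<close>

text \<open>For \<open>p > 1\<close> the angle \<open>p * \<theta>\<close> passes
  \<open>pi / 2\<close> before \<open>\<theta>\<close> does, so \<open>cos (p * \<theta>)\<close> is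
  negative where \<open>cos \<theta>\<close> is small. Beyond a threshold \<open>t\<close> strictly
  between \<open>pi / (2 * p)\<close> and \<open>pi / 2\<close> the term with \<open>B\<close> alone
  contributes 1; below \<open>t\<close> the cosine stays away from zero and a large \<open>A\<close>
  suffices. The bound \<open>p \<le> 2\<close> keeps \<open>p * \<theta>\<close> in the interval
  where the cosine decreases.\<close>

lemma cos_powr_inequality:
  assumes p: "1 < p" "p \<le> 2"
  shows "\<exists>A\<ge>0. \<exists>B\<ge>0. \<forall>\<theta>. \<bar>\<theta>\<bar> \<le> pi / 2 \<longrightarrow> 1 \<le> A * cos \<theta> powr p - B * cos (p * \<theta>)"
proof -
  define t where "t = (pi / (2 * p) + pi / 2) / 2"
  have h: "pi / (2 * p) < pi / 2" using p pi_gt_zero by (simp add: field_simps)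
  then have t: "pi / (2 * p) < t" "t < pi / 2" by (auto simp: t_def)
  have t0: "0 < t" using t(1) p pi_gt_zero by (smt (verit) divide_pos_pos)
  have pt: "pi / 2 < p * t" using t(1) p by (simp add: field_simps)
  have pt2: "p * t \<le> pi"
  proof -
    have "p * t \<le> 2 * (pi / 2)" using p t t0 by (intro mult_mono) auto
    then show ?thesis by simp
  qed
  have c0: "cos (p * t) < 0" using pt pt2 cos_monotone_0_pi[of "pi/2" "p * t"] by simp
  have ct: "0 < cos t" using t0 t(2) by (intro cos_gt_zero) auto
  define B where "B = - 1 / cos (p * t)"
  have B: "0 \<le> B" using c0 by (simp add: B_def divide_nonneg_neg)
  define A where "A = (1 + B) / cos t powr p"
  have A: "0 \<le> A" using B ct by (simp add: A_def)
  have main: "1 \<le> A * cos \<theta> powr p - B * cos (p * \<theta>)" if th: "0 \<le> \<theta>" "\<theta> \<le> pi / 2" for \<theta>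
  proof (cases "\<theta> \<le> t")
    case True
    have "cos t \<le> cos \<theta>" using True th t by (intro cos_monotone_0_pi_le) auto
    then have "cos t powr p \<le> cos \<theta> powr p" using ct p by (intro powr_mono2) auto
    then have "A * cos t powr p \<le> A * cos \<theta> powr p" using A by (rule mult_left_mono)
    moreover have "A * cos t powr p = 1 + B" using ct by (simp add: A_def)
    moreover have "B * cos (p * \<theta>) \<le> B * 1" using B by (intro mult_left_mono) auto
    ultimately show ?thesis by linarith
  next
    case False
    have "p * \<theta> \<le> 2 * (pi / 2)" using p th by (intro mult_mono) auto
    then have "cos (p * \<theta>) \<le> cos (p * t)" using False p t0
      by (intro cos_monotone_0_pi_le) (auto intro: mult_left_mono)
    then have "B * cos (p * \<theta>) \<le> B * cos (p * t)" using B by (rule mult_left_mono)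
    moreover have "B * cos (p * t) = - 1" using c0 by (simp add: B_def)
    moreover have "0 \<le> A * cos \<theta> powr p" using A by simp
    ultimately show ?thesis by linarith
  qed
  have "1 \<le> A * cos \<theta> powr p - B * cos (p * \<theta>)" if "\<bar>\<theta>\<bar> \<le> pi / 2" for \<theta>
    using main[of "\<bar>\<theta>\<bar>"] that by (cases "0 \<le> \<theta>") auto
  then show ?thesis using A B by blast
qed

text \<open>The trigonometric inequality times \<open>norm w powr p\<close>. The point of the form
  \<open>exp (p * Ln w)\<close> is that it is holomorphic on the right half-plane, so that its mean
  over the circle is known.\<close>

lemma half_plane_powr_inequality:
  assumes AB: "\<And>\<theta>. \<bar>\<theta>\<bar> \<le> pi / 2 \<Longrightarrow> 1 \<le> A * cos \<theta> powr p - B * cos (p * \<theta>)" and w: "0 < Re w"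
  shows "norm w powr p \<le> A * Re w powr p - B * Re (exp (of_real p * Ln w))"
proof -
  define \<theta> where "\<theta> = Im (Ln w)"
  have w0: "w \<noteq> 0" using w by auto
  then have n: "0 < norm w" by simp
  have th: "\<bar>\<theta>\<bar> < pi / 2" using Re_Ln_pos_lt_imp[OF w] by (simp add: \<theta>_def)
  have c: "0 < cos \<theta>" using th by (intro cos_gt_zero_pi) auto
  have R: "Re w = norm w * cos \<theta>"
    using Re_exp[of "Ln w"] n w0 by (simp add: \<theta>_def)
  have E: "Re (exp (of_real p * Ln w)) = norm w powr p * cos (p * \<theta>)"
    using n by (simp add: Re_exp \<theta>_def w0 powr_def)
  have "norm w powr p * 1 \<le> norm w powr p * (A * cos \<theta> powr p - B * cos (p * \<theta>))"
    using AB[of \<theta>] th by (intro mult_left_mono) auto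
  then show ?thesis unfolding E R using n c by (simp add: powr_mult algebra_simps)
qed

lemma mean_value_circle:
  fixes G :: "complex \<Rightarrow> complex"
  assumes G: "G holomorphic_on cball 0 1"
  shows "integrable TM (\<lambda>\<theta>. G (cis \<theta>))" "(LINT \<theta>|TM. G (cis \<theta>)) = 2 * pi * G 0"
proof -
  have "continuous_on (sphere 0 1) G"
    using holomorphic_on_imp_continuous_on[OF G] by (rule continuous_on_subset) auto
  then have c: "cm G" using circ_continuous_measurable by (simp add: cm_def)
  have "compact (G ` cball 0 1)" using holomorphic_on_imp_continuous_on[OF G] by (intro compact_continuous_image) auto
  then obtain B where "\<forall>w\<in>G ` cball 0 1. norm w \<le> B"
    using compact_imp_bounded[of "G ` cball 0 1"] unfolding bounded_iff by blast
  then have B: "\<And>z. z \<in> cball 0 1 \<Longrightarrow> norm (G z) \<le> B" by blast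
  show i: "integrable TM (\<lambda>\<theta>. G (cis \<theta>))"
    by (rule finite_measure.integrable_const_bound[OF finite_measure_TM, of _ B]) (use B cm_measurable[OF c] in auto)
  have "((\<lambda>u. G u / (u - 0)) has_contour_integral (2 * of_real pi * \<i> * G 0)) (part_circlepath 0 1 0 (2 * pi))"
    using Cauchy_integral_circlepath_simple[OF G, of 0] by (simp add: circlepath_def)
  then have "((\<lambda>t. G (0 + of_real 1 * cis t) / (0 + of_real 1 * cis t - 0) * of_real 1 * \<i> * cis t) has_integral (2 * of_real pi * \<i> * G 0)) {0..2*pi}"
    by (subst (asm) has_contour_integral_part_circlepath_iff) auto
  then have "((\<lambda>t. G (cis t) * \<i>) has_integral (2 * of_real pi * \<i> * G 0)) {0..2*pi}" by simp
  then have "((\<lambda>t. G (cis t) * \<i> * (- \<i>)) has_integral (2 * of_real pi * \<i> * G 0 * (- \<i>))) {0..2*pi}" by (rule has_integral_mult_left)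
  moreover have "2 * of_real pi * \<i> * G 0 * (- \<i>) = 2 * of_real pi * G 0" by (simp add: complex_eq_iff)
  ultimately have "((\<lambda>t. G (cis t)) has_integral (2 * of_real pi * G 0)) {0..2*pi}" by (simp only:) (simp add: mult.assoc)
  then have "integral {0..2*pi} (\<lambda>t. G (cis t)) = 2 * of_real pi * G 0" by (rule integral_unique)
  then show "(LINT \<theta>|TM. G (cis \<theta>)) = 2 * pi * G 0"
    using lebesgue_integral_eq_integral[OF i] by simp
qed

lemma half_plane_norm_bound:
  assumes AB: "\<And>\<theta>. \<bar>\<theta>\<bar> \<le> pi / 2 \<Longrightarrow> 1 \<le> A * cos \<theta> powr p - B * cos (p * \<theta>)" "0 \<le> A" "0 \<le> B" and p: "1 < p"
    and F: "F holomorphic_on UNIV" and e: "0 < \<epsilon>" and R: "\<And>\<theta>. \<epsilon> \<le> Re (F (cis \<theta>))" and F0: "Im (F 0) = 0"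
  shows "Nrm TM p (\<lambda>\<theta>. F (cis \<theta>)) \<le> A powr (1 / p) * Nrm TM p (\<lambda>\<theta>. complex_of_real (Re (F (cis \<theta>))))"
proof -
  have Rin: "\<epsilon> \<le> Re (F z)" if "z \<in> cball 0 1" for z
  proof -
    have "Re (- F z) \<le> - \<epsilon>"
    proof (rule maximum_real_frontier[of "\<lambda>z. - F z" "cball 0 1" "- \<epsilon>" z])
      show "(\<lambda>z. - F z) holomorphic_on interior (cball 0 1)"
        using F by (auto intro!: holomorphic_intros intro: holomorphic_on_subset)
      show "continuous_on (closure (cball 0 1)) (\<lambda>z. - F z)"
        using holomorphic_on_imp_continuous_on[OF F] by (auto intro!: continuous_intros intro: continuous_on_subset)
      fix w :: complex assume "w \<in> frontier (cball 0 1)"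
      then have "norm w = 1" by (simp add: frontier_cball)
      then obtain \<theta> where "w = cis \<theta>" by (metis complex_norm_eq_1_exp cis_conv_exp)
      then show "Re (- F w) \<le> - \<epsilon>" using R[of \<theta>] by simp
    qed (use that in auto)
    then show ?thesis by simp
  qed
  have pos: "0 < Re (F z)" if "z \<in> cball 0 1" for z using Rin[OF that] e by linarith
  define G where "G = (\<lambda>z. exp (of_real p * Ln (F z)))"
  have nn: "F z \<notin> \<real>\<^sub>\<le>\<^sub>0" if "z \<in> cball 0 1" for z
    using pos[OF that] by (auto simp: complex_nonpos_Reals_iff)
  have hG: "G holomorphic_on cball 0 1"
    unfolding G_def using nn by (auto intro!: holomorphic_intros holomorphic_on_subset[OF F])
  note mv = mean_value_circle[OF hG]
  have cF: "continuous_on (sphere 0 1) F"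
    using holomorphic_on_imp_continuous_on[OF F] by (rule continuous_on_subset) auto
  have cmF: "cm F" using circ_continuous_measurable[OF cF] by (simp add: cm_def)
  note mF = cm_measurable[OF cmF]
  have "compact (F ` sphere 0 1)" using cF by (intro compact_continuous_image) auto
  then obtain C where "\<forall>w\<in>F ` sphere 0 1. norm w \<le> C"
    using compact_imp_bounded[of "F ` sphere 0 1"] unfolding bounded_iff by blast
  then have C: "\<And>z. z \<in> sphere 0 1 \<Longrightarrow> norm (F z) \<le> C" by blast
  have bC: "norm (F (cis \<theta>)) \<le> C" for \<theta> by (rule C) simp
  have LF: "(\<lambda>\<theta>. F (cis \<theta>)) \<in> Lpm TM p"
    by (rule Lpm_bounded[OF finite_measure_TM mF, of C]) (use bC p in auto)
  have LR: "(\<lambda>\<theta>. complex_of_real (Re (F (cis \<theta>)))) \<in> Lpm TM p"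
  proof (rule Lpm_bound[OF LF, where C=1])
    show "(\<lambda>\<theta>. complex_of_real (Re (F (cis \<theta>)))) \<in> borel_measurable TM" using mF by measurable
  qed (use p abs_Re_le_cmod in auto)
  have "(LINT \<theta>|TM. norm (F (cis \<theta>)) powr p) \<le>
     (LINT \<theta>|TM. A * norm (complex_of_real (Re (F (cis \<theta>)))) powr p - B * Re (G (cis \<theta>)))"
  proof (rule integral_mono)
    show "integrable TM (\<lambda>\<theta>. A * norm (complex_of_real (Re (F (cis \<theta>)))) powr p - B * Re (G (cis \<theta>)))"
      using Lpm_integrable[OF LR] integrable_Re[OF mv(1)] by (intro Bochner_Integration.integrable_diff integrable_mult_right)
    fix \<theta>
    have "0 < Re (F (cis \<theta>))" by (rule pos) simp
    then show "norm (F (cis \<theta>)) powr p \<le> A * norm (complex_of_real (Re (F (cis \<theta>)))) powr p - B * Re (G (cis \<theta>))"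
      using half_plane_powr_inequality[OF AB(1), of "F (cis \<theta>)"] by (simp add: G_def)
  qed (use Lpm_integrable[OF LF] in auto)
  also have "\<dots> = A * (LINT \<theta>|TM. norm (complex_of_real (Re (F (cis \<theta>)))) powr p) - B * Re (LINT \<theta>|TM. G (cis \<theta>))"
    using Lpm_integrable[OF LR] integrable_Re[OF mv(1)] mv(1)
    by (subst Bochner_Integration.integral_diff) (auto simp del: norm_of_real)
  also have "\<dots> \<le> A * (LINT \<theta>|TM. norm (complex_of_real (Re (F (cis \<theta>)))) powr p)"
  proof -
    have "F 0 = of_real (Re (F 0))" using F0 by (simp add: complex_eq_iff)
    moreover have "0 < Re (F 0)" by (rule pos) simp
    ultimately have "G 0 = of_real (exp (p * ln (Re (F 0))))" unfolding G_def
      by (metis Ln_of_real exp_of_real of_real_mult)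
    then have "0 \<le> Re (LINT \<theta>|TM. G (cis \<theta>))" unfolding mv(2) by simp
    then show ?thesis using AB(3) by (simp add: mult_nonneg_nonneg)
  qed
  also have "\<dots> = A * Nrm TM p (\<lambda>\<theta>. complex_of_real (Re (F (cis \<theta>)))) powr p"
    using p by (simp add: Nrm_powr)
  finally have "Nrm TM p (\<lambda>\<theta>. F (cis \<theta>)) \<le> (A * Nrm TM p (\<lambda>\<theta>. complex_of_real (Re (F (cis \<theta>)))) powr p) powr (1/p)"
    unfolding Nrm_def[of TM p "\<lambda>\<theta>. F (cis \<theta>)"] using p by (intro powr_mono2) (auto intro: integral_nonneg_AE)
  also have "\<dots> = A powr (1/p) * Nrm TM p (\<lambda>\<theta>. complex_of_real (Re (F (cis \<theta>))))"
    using p AB(2) Nrm_nonneg[of TM p "\<lambda>\<theta>. complex_of_real (Re (F (cis \<theta>)))"] by (simp add: powr_mult powr_powr)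
  finally show ?thesis .
qed

text \<open>The Fejer mean of a sequence that is not yet known to consist of Fourier coefficients;
  uniform norm bounds on these means are what proves that it does, see
  \<open>Fejer_limit\<close>.\<close>

definition FJ :: "nat \<Rightarrow> (int \<Rightarrow> complex) \<Rightarrow> mfun" where
  "FJ N y = (\<Sum>j<N. \<Sum>l<N. cst (y (int j - int l) / of_nat N) * zp (int j - int l))"

definition pos :: "(int \<Rightarrow> complex) \<Rightarrow> int \<Rightarrow> complex" where
  "pos y j = (if 0 \<le> j then y j else 0)"

lemma sg_FJ: "sg N f = FJ N (co f)" by (simp add: sg_def FJ_def)

lemma FJ_TP: "FJ N y \<in> TP" unfolding FJ_def by (intro TP_sum TP_monom)

lemma co_sum_TP: "(\<And>i. i \<in> I \<Longrightarrow> h i \<in> TP) \<Longrightarrow> co (\<Sum>i\<in>I. h i) m = (\<Sum>i\<in>I. co (h i) m)"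
  by (induction I rule: infinite_finite_induct) (auto simp: co_add TP_LL TP_sum)

lemma co_FJ: "co (FJ N y) m = complex_of_real (cN N m) * y m"
proof -
  have "co (FJ N y) m = (\<Sum>j<N. \<Sum>l<N. co (cst (y (int j - int l) / of_nat N) * zp (int j - int l)) m)"
    unfolding FJ_def by (simp add: co_sum_TP TP_sum TP_monom)
  also have "\<dots> = (\<Sum>j<N. \<Sum>l<N. if int j - int l = m then y m / of_nat N else 0)"
    by (intro sum.cong) (auto simp: co_cst co_zp)
  also have "\<dots> = complex_of_real (cN N m) * y m"
    unfolding sum_diff_delta by (cases "N = 0") (simp_all add: cN_def)
  finally show ?thesis .
qed

lemma av_sum: "finite I \<Longrightarrow> (\<And>i. i \<in> I \<Longrightarrow> h i \<in> LL 1) \<Longrightarrow> (\<Sum>i\<in>I. h i) \<in> LL 1 \<and> av (\<Sum>i\<in>I. h i) = (\<Sum>i\<in>I. av (h i))"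
  by (induction I rule: finite_induct) (auto simp: av_add intro: LL_add Bd_LL)

lemma av_FJ: assumes "\<psi> \<in> LL 1"
  shows "av (FJ N y * \<psi>) = (\<Sum>j<N. \<Sum>l<N. y (int j - int l) / of_nat N * co \<psi> (int l - int j))"
proof -
  have t: "av (cst c * zp k * \<psi>) = c * co \<psi> (- k)" for c k
  proof -
    have "cst c * zp k * \<psi> = cst c * (\<psi> * zp k)" by (simp only: ac_simps)
    then show ?thesis unfolding co_def by (simp only: av_cst) simp
  qed
  have L: "cst c * zp k * \<psi> \<in> LL 1" for c k using assms by (simp add: LL_Bd_mult)
  have in1: "(\<Sum>l<N. cst (y (int j - int l) / of_nat N) * zp (int j - int l) * \<psi>) \<in> LL 1 \<and>
    av (\<Sum>l<N. cst (y (int j - int l) / of_nat N) * zp (int j - int l) * \<psi>) = (\<Sum>l<N. av (cst (y (int j - int l) / of_nat N) * zp (int j - int l) * \<psi>))" for j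
    by (rule av_sum) (auto intro: L)
  have "FJ N y * \<psi> = (\<Sum>j<N. \<Sum>l<N. cst (y (int j - int l) / of_nat N) * zp (int j - int l) * \<psi>)"
    unfolding FJ_def by (simp add: sum_distrib_right)
  then have "av (FJ N y * \<psi>) = (\<Sum>j<N. av (\<Sum>l<N. cst (y (int j - int l) / of_nat N) * zp (int j - int l) * \<psi>))"
    using av_sum[of "{..<N}" "\<lambda>j. \<Sum>l<N. cst (y (int j - int l) / of_nat N) * zp (int j - int l) * \<psi>"] in1 by simp
  also have "\<dots> = (\<Sum>j<N. \<Sum>l<N. y (int j - int l) / of_nat N * co \<psi> (int l - int j))"
    using in1 by (simp add: t)
  finally show ?thesis .
qed

lemma FJ_add: "FJ N (\<lambda>j. y j + y' j) = FJ N y + FJ N y'"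
  by (simp add: FJ_def add_divide_distrib cst_simps distrib_right sum.distrib)

lemma FJ_scale: "FJ N (\<lambda>j. c * y j) = cst c * FJ N y"
proof -
  have "cst (c * y (int j - int l) / of_nat N) = cst c * cst (y (int j - int l) / of_nat N)" for j l
    by (simp flip: cst_simps)
  then show ?thesis by (simp add: FJ_def sum_distrib_left mult.assoc)
qed

lemma Fejer_limit:
  assumes p: "1 < p" and M: "0 \<le> M" and B: "\<And>j. norm (y j) \<le> B"
    and Y: "\<And>N. 1 \<le> N \<Longrightarrow> nm p (FJ N y) \<le> M"
  shows "\<exists>Z\<in>LL p. nm p Z \<le> M \<and> (\<forall>j. co Z j = y j)"
proof (rule weak_closure[OF p M])
  fix n :: nat
  have B0: "0 \<le> B" using B[of 0] norm_ge_zero[of "y 0"] by linarith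
  \<comment> \<open>For \<open>\<bar>j\<bar> \<le> n\<close> the weight \<open>cN N j\<close>
    differs from 1 by at most \<open>n / N\<close>; \<open>N\<close> is taken so large that the
    error \<open>(n / N) * B\<close> falls below the tolerance of
    \<open>weak_closure\<close>.\<close>
  obtain N0 :: nat where N0: "real n * B * (real n + 1) \<le> real N0" using real_arch_simple by blast
  define N where "N = N0 + 1"
  have N: "1 \<le> N" "real n * B * (real n + 1) \<le> real N" using N0 by (auto simp: N_def)
  have "norm (co (FJ N y) j - y j) \<le> 1 / (real n + 1)" if "\<bar>j\<bar> \<le> int n" for j
  proof -
    have "co (FJ N y) j - y j = - (complex_of_real (1 - cN N j) * y j)" by (simp add: co_FJ algebra_simps)
    then have "norm (co (FJ N y) j - y j) = (1 - cN N j) * norm (y j)"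
      using cN_bounds(2)[of N j] by (simp add: norm_mult del: of_real_diff)
    also have "\<dots> \<le> (\<bar>real_of_int j\<bar> / real N) * B"
      using cN_bounds(2,3)[of N j] N(1) B[of j] by (intro mult_mono) auto
    also have "\<dots> \<le> (real n / real N) * B"
      using that B0 by (intro mult_right_mono divide_right_mono) auto
    also have "\<dots> \<le> 1 / (real n + 1)"
      using N by (simp add: field_simps)
    finally show ?thesis .
  qed
  then show "\<exists>Y\<in>LL p. nm p Y \<le> M \<and> (\<forall>j. \<bar>j\<bar> \<le> int n \<longrightarrow> norm (co Y j - y j) \<le> 1 / (real n + 1))"
    using Y[OF N(1)] TP_LL[OF FJ_TP] p by (intro bexI[of _ "FJ N y"]) auto
qed

text \<open>The analytic part of a Fejer mean, written with natural powers: a polynomial that is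
  defined on the whole plane and can be evaluated at the centre of the disc.\<close>

definition psv :: "nat \<Rightarrow> (complex \<Rightarrow> complex) \<Rightarrow> complex \<Rightarrow> complex" where
  "psv N F z = (\<Sum>j<N. \<Sum>l<N. if l \<le> j then fc F (int j - int l) / of_nat N * z ^ (j - l) else 0)"

lemma psv_mk: "cm F \<Longrightarrow> cm (psv N F) \<and> FJ N (pos (co (mk F))) = mk (psv N F)"
proof -
  assume F: "cm F"
  have pc: "cm (\<lambda>z. z ^ k)" for k using cm_intros(2)[of "int k"] by simp
  have c: "cm (\<lambda>z. if l \<le> j then fc F (int j - int l) / of_nat N * z ^ (j - l) else 0)" for j l
    by (cases "l \<le> j") (simp_all add: pc)
  have t: "cst (pos (co (mk F)) (int j - int l) / of_nat N) * zp (int j - int l) =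
      mk (\<lambda>z. if l \<le> j then fc F (int j - int l) / of_nat N * z ^ (j - l) else 0)" for j l
  proof (cases "l \<le> j")
    case True
    have e: "z powi (int j - int l) = z ^ (j - l)" for z :: complex
      using True power_int_of_nat[of z "j - l"] by (simp add: of_nat_diff)
    show ?thesis using True F by (simp add: pos_def fc_co mk_simps e pc)
  next
    case False
    then show ?thesis by (simp add: pos_def cst_simps mk_simps(1)[symmetric])
  qed
  show ?thesis unfolding psv_def[abs_def] FJ_def t using c by (simp add: mk_sum cm_sum)
qed

lemma psv_holomorphic: "psv N F holomorphic_on S"
proof -
  have "(\<lambda>x. if l \<le> j then fc F (int j - int l) / of_nat N * x ^ (j - l) else 0) holomorphic_on S" for j l
    by (cases "l \<le> j") (auto intro!: holomorphic_intros)
  then show ?thesis unfolding psv_def[abs_def] by (intro holomorphic_on_sum)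
qed

lemma cj_mk_real:
  assumes "cm F" "\<And>\<theta>. F (cis \<theta>) = of_real (Re (F (cis \<theta>)))" shows "cj (mk F) = mk F"
proof -
  have c: "cnj (F (cis \<theta>)) = F (cis \<theta>)" for \<theta> by (metis assms(2) complex_cnj_complex_of_real)
  show ?thesis unfolding mk_simps(10)[OF assms(1)] by (rule mk_eqI) (use assms(1) c in auto)
qed

lemma psv_0: "1 \<le> N \<Longrightarrow> psv N F 0 = fc F 0"
proof -
  assume N: "1 \<le> N"
  have "psv N F 0 = (\<Sum>j<N. \<Sum>l<N. if j = l then fc F 0 / of_nat N else 0)"
    unfolding psv_def by (intro sum.cong) (auto simp: power_0_left)
  also have "\<dots> = fc F 0" using N by (simp add: sum.delta)
  finally show ?thesis .
qed

text \<open>The coefficients of a real function are conjugate symmetric, so \<open>psv\<close> plus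
  its conjugate is the full Fejer mean with the diagonal \<open>j = l\<close> counted twice.\<close>

lemma psv_Re:
  assumes F: "cm F" and R: "\<And>\<theta>. F (cis \<theta>) = of_real (Re (F (cis \<theta>)))" and N: "1 \<le> N" and z: "norm z = 1"
  shows "of_real (2 * Re (psv N F z)) = sgv N F z + fc F 0"
proof -
  have "cj (mk F) = mk F" by (rule cj_mk_real[OF F R])
  then have sym: "fc F (- m) = cnj (fc F m)" for m using co_cj[of "mk F" "- m"] F by (simp add: fc_co)
  have zc: "cnj z = inverse z" using z complex_norm_square[of z] by (cases "z = 0") (auto simp: field_simps)
  define t where "t j l = fc F (int j - int l) / of_nat N * z powi (int j - int l)" for j l :: nat
  have ts: "cnj (t j l) = t l j" for j l
  proof -
    have "cnj (t j l) = cnj (fc F (int j - int l)) / of_nat N * (cnj z) powi (int j - int l)" by (simp add: t_def)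
    also have "cnj (fc F (int j - int l)) = fc F (int l - int j)" using sym[of "int j - int l"] by simp
    also have "(cnj z) powi (int j - int l) = z powi (int l - int j)"
      unfolding zc using power_int_minus[of z "int j - int l"] by (simp add: power_int_inverse)
    finally show ?thesis by (simp add: t_def)
  qed
  have P: "psv N F z = (\<Sum>j<N. \<Sum>l<N. if l \<le> j then t j l else 0)"
  proof -
    have "z powi (int j - int l) = z ^ (j - l)" if "l \<le> j" for j l
    proof -
      have "int j - int l = int (j - l)" using that by simp
      then show ?thesis by (simp only: power_int_of_nat)
    qed
    then show ?thesis unfolding psv_def t_def by (intro sum.cong) auto
  qed
  have "cnj (psv N F z) = (\<Sum>j<N. \<Sum>l<N. if l \<le> j then t l j else 0)"
    unfolding P cnj_sum by (intro sum.cong) (auto simp: ts)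
  also have "\<dots> = (\<Sum>l<N. \<Sum>j<N. if l \<le> j then t l j else 0)" by (rule sum.swap)
  finally have Pc: "cnj (psv N F z) = (\<Sum>j<N. \<Sum>l<N. if j \<le> l then t j l else 0)" .
  have "psv N F z + cnj (psv N F z) = (\<Sum>j<N. \<Sum>l<N. t j l + (if j = l then fc F 0 / of_nat N else 0))"
    by (subst Pc, subst P, unfold sum.distrib[symmetric], intro sum.cong) (auto simp: t_def)
  also have "\<dots> = sgv N F z + (\<Sum>j<N. \<Sum>l<N. if j = l then fc F 0 / of_nat N else 0)"
    by (simp add: sum.distrib sgv_def t_def)
  also have "(\<Sum>j<N. \<Sum>l<N. if j = l then fc F 0 / of_nat N else 0) = fc F 0" using N by (simp add: sum.delta)
  finally show ?thesis by (simp add: complex_add_cnj)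
qed

text \<open>For \<open>F \<ge> 0\<close> the polynomial \<open>H = 2 psv - f0 + \<epsilon>\<close>
  has on the circle the Fejer mean of \<open>F\<close> plus \<open>\<epsilon>\<close> as its real
  part, so \<open>half_plane_norm_bound\<close> applies to it and the analytic part is controlled by
  a Fejer mean.\<close>

lemma Riesz_nonneg:
  assumes p: "1 < p" "p \<le> 2"
  shows "\<exists>C\<ge>0. \<forall>F N. cm F \<longrightarrow> mk F \<in> LL p \<longrightarrow> (\<forall>\<theta>. F (cis \<theta>) = of_real (Re (F (cis \<theta>))) \<and> 0 \<le> Re (F (cis \<theta>))) \<longrightarrow> 1 \<le> N \<longrightarrow>
     nm p (FJ N (pos (co (mk F)))) \<le> C * nm p (mk F)"
proof -
  obtain A B where AB: "0 \<le> A" "0 \<le> B" "\<And>\<theta>. \<bar>\<theta>\<bar> \<le> pi / 2 \<Longrightarrow> 1 \<le> A * cos \<theta> powr p - B * cos (p * \<theta>)"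
    using cos_powr_inequality[OF p] by blast
  define K where "K = nm p 1"
  define K' where "K' = nm (conj_exp p) 1"
  define C where "C = 1/2 * (A powr (1/p) * (1 + K) + (K' * K + K))"
  have p0: "0 < p" using p by simp
  have C0: "0 \<le> C" by (simp add: C_def K_def K'_def)
  have "nm p (FJ N (pos (co (mk F)))) \<le> C * nm p (mk F)"
    if F: "cm F" "mk F \<in> LL p" "\<And>\<theta>. F (cis \<theta>) = of_real (Re (F (cis \<theta>)))" "\<And>\<theta>. 0 \<le> Re (F (cis \<theta>))" and N: "1 \<le> N" for F N
  proof (cases "nm p (mk F) = 0")
    case True
    then have "mk F = 0" using nm_eq_0[OF F(2) p0] by simp
    moreover have "pos (co 0) = (\<lambda>_. 0)" by (rule ext) (simp add: pos_def)
    ultimately have "FJ N (pos (co (mk F))) = 0" by (simp add: FJ_def cst_simps)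
    then show ?thesis using True nm_0[OF p0] by simp
  next
    case False
    \<comment> \<open>A positive \<open>\<epsilon>\<close> is needed to stay inside the half-plane;
      the norm of \<open>F\<close> makes all constants that it introduces multiples of that
      norm.\<close>
    define \<epsilon> where "\<epsilon> = nm p (mk F)"
    have e: "0 < \<epsilon>" using False by (simp add: \<epsilon>_def less_le)
    note psv = psv_mk[OF F(1), of N]
    have iF: "integrable TM (\<lambda>\<theta>. F (cis \<theta>))" using LL_imp_LL1[OF F(2) p(1)] F(1) by (simp add: LL1_iff)
    define f0 where "f0 = Re (fc F 0)"
    have f0: "fc F 0 = of_real f0"
    proof -
      have "cj (mk F) = mk F" by (rule cj_mk_real[OF F(1,3)])
      then have "cnj (fc F 0) = fc F 0" using co_cj[of "mk F" 0] F by (simp add: fc_co)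
      then show ?thesis unfolding f0_def by (simp add: complex_eq_iff)
    qed
    have sR: "sgv N F z = of_real (Re (sgv N F z)) \<and> 0 \<le> Re (sgv N F z)" if z: "norm z = 1" for z
    proof -
      have e1: "F (cis \<theta>) * complex_of_real (KN N (z * cis (- \<theta>))) = complex_of_real (Re (F (cis \<theta>)) * KN N (z * cis (- \<theta>)))" for \<theta>
        by (subst F(3)) simp
      have "sgv N F z = of_real ((LINT \<theta>|TM. Re (F (cis \<theta>)) * KN N (z * cis (- \<theta>))) / (2 * pi))"
        unfolding sgv_integral(2)[OF iF z] e1 integral_complex_of_real by simp
      moreover have "0 \<le> (LINT \<theta>|TM. Re (F (cis \<theta>)) * KN N (z * cis (- \<theta>))) / (2 * pi)"
        using F(4) by (intro divide_nonneg_pos integral_nonneg_AE) auto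
      ultimately show ?thesis by simp
    qed
    define H where "H = (\<lambda>z. 2 * psv N F z - of_real f0 + of_real \<epsilon>)"
    have HR: "Re (H (cis \<theta>)) = Re (sgv N F (cis \<theta>)) + \<epsilon>" for \<theta>
    proof -
      have "complex_of_real (2 * Re (psv N F (cis \<theta>))) = sgv N F (cis \<theta>) + of_real f0"
        using psv_Re[OF F(1,3) N, of "cis \<theta>"] f0 by simp
      then have "2 * Re (psv N F (cis \<theta>)) = Re (sgv N F (cis \<theta>)) + f0" by (metis Re_complex_of_real plus_complex.sel(1))
      then show ?thesis by (simp add: H_def)
    qed
    have cH: "cm H" unfolding H_def using psv by simp
    have mkH: "mk H = cst 2 * FJ N (pos (co (mk F))) + cst (of_real (\<epsilon> - f0))"
      using psv by (simp add: mk_simps H_def algebra_simps)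
    have "Nrm TM p (\<lambda>\<theta>. H (cis \<theta>)) \<le> A powr (1 / p) * Nrm TM p (\<lambda>\<theta>. complex_of_real (Re (H (cis \<theta>))))"
    proof (rule half_plane_norm_bound[OF AB(3,1,2) p(1) _ e])
      show "H holomorphic_on UNIV" unfolding H_def by (intro holomorphic_intros psv_holomorphic)
      show "\<epsilon> \<le> Re (H (cis \<theta>))" for \<theta> using HR[of \<theta>] sR[of "cis \<theta>"] by simp
      show "Im (H 0) = 0" by (simp add: H_def psv_0[OF N] f0)
    qed
    also have "(\<lambda>\<theta>. complex_of_real (Re (H (cis \<theta>)))) = (\<lambda>\<theta>. (\<lambda>z. sgv N F z + of_real \<epsilon>) (cis \<theta>))"
    proof
      fix \<theta> show "complex_of_real (Re (H (cis \<theta>))) = (\<lambda>z. sgv N F z + of_real \<epsilon>) (cis \<theta>)"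
      proof -
        have "sgv N F (cis \<theta>) = of_real (Re (sgv N F (cis \<theta>)))" by (rule conjunct1[OF sR]) simp
        then show ?thesis unfolding HR by (metis of_real_add)
      qed
    qed
    also have "Nrm TM p (\<lambda>\<theta>. (\<lambda>z. sgv N F z + of_real \<epsilon>) (cis \<theta>)) = nm p (sg N (mk F) + cst (of_real \<epsilon>))"
      using F(1) cm_sgv by (simp add: sg_mk mk_simps)
    finally have h1: "nm p (mk H) \<le> A powr (1 / p) * nm p (sg N (mk F) + cst (of_real \<epsilon>))"
      using cH by (simp add: mk_simps)
    have c1: "nm p (cst c) = norm c * K" for c using nm_cst[OF p0, of c 1] by (simp add: K_def)
    have "nm p (sg N (mk F) + cst (of_real \<epsilon>)) \<le> nm p (sg N (mk F)) + nm p (cst (of_real \<epsilon>))"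
      using p p0 by (intro nm_triangle) (auto intro: TP_LL sg_TP Bd_LL)
    also have "\<dots> \<le> \<epsilon> + \<epsilon> * K" using nm_sg[OF F(2) p(1) N] e by (simp add: c1 \<epsilon>_def)
    finally have h2: "nm p (mk H) \<le> A powr (1 / p) * (\<epsilon> * (1 + K))"
    proof -
      assume "nm p (sg N (mk F) + cst (of_real \<epsilon>)) \<le> \<epsilon> + \<epsilon> * K"
      then have "A powr (1 / p) * nm p (sg N (mk F) + cst (of_real \<epsilon>)) \<le> A powr (1 / p) * (\<epsilon> + \<epsilon> * K)"
        by (rule mult_left_mono) simp
      then show ?thesis using h1 by (simp add: distrib_left)
    qed
    have "FJ N (pos (co (mk F))) = cst (1/2) * (mk H + cst (of_real (f0 - \<epsilon>)))"
    proof -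
      have "mk H + cst (of_real (f0 - \<epsilon>)) = cst 2 * FJ N (pos (co (mk F)))"
        unfolding mkH by (simp add: add.assoc flip: cst_simps)
      then have "cst (1/2) * (mk H + cst (of_real (f0 - \<epsilon>))) = cst (1/2 * 2) * FJ N (pos (co (mk F)))"
        by (simp only: cst_simps mult.assoc)
      then show ?thesis by (simp add: cst_simps)
    qed
    then have "nm p (FJ N (pos (co (mk F)))) = 1/2 * nm p (mk H + cst (of_real (f0 - \<epsilon>)))"
      by (simp add: nm_cst[OF p0])
    also have "\<dots> \<le> 1/2 * (nm p (mk H) + nm p (cst (of_real (f0 - \<epsilon>))))"
    proof -
      have "mk H \<in> LL p" unfolding mkH using p0 by (intro LL_add LL_cst) (auto intro: TP_LL FJ_TP Bd_LL)
      then show ?thesis using p p0 by (intro mult_left_mono nm_triangle) (auto intro: Bd_LL)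
    qed
    finally have n1: "nm p (FJ N (pos (co (mk F)))) \<le> 1/2 * (nm p (mk H) + nm p (cst (of_real (f0 - \<epsilon>))))" .
    have n2: "nm p (cst (of_real (f0 - \<epsilon>))) \<le> (\<epsilon> * K' + \<epsilon>) * K"
    proof -
      have "norm (fc F 0) \<le> \<epsilon> * K'" using co_bound[OF F(2) p(1), of 0] F(1) by (simp add: fc_co \<epsilon>_def K'_def)
      then have "\<bar>f0\<bar> \<le> \<epsilon> * K'" by (simp add: f0)
      then have "\<bar>f0 - \<epsilon>\<bar> \<le> \<epsilon> * K' + \<epsilon>" using e by linarith
      then show ?thesis unfolding c1 by (intro mult_right_mono) (auto simp: K_def simp del: of_real_diff)
    qed
    have "nm p (FJ N (pos (co (mk F)))) \<le> 1/2 * (A powr (1 / p) * (\<epsilon> * (1 + K)) + (\<epsilon> * K' + \<epsilon>) * K)"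
      by (rule order.trans[OF n1]) (intro mult_left_mono add_mono h2 n2, simp)
    also have "\<dots> = C * \<epsilon>" by (simp add: C_def algebra_simps)
    finally show ?thesis by (simp add: \<epsilon>_def)
  qed
  then show ?thesis using C0 by blast
qed

lemma Riesz_le2:
  assumes p: "1 < p" "p \<le> 2"
  shows "\<exists>C\<ge>0. \<forall>f\<in>LL p. \<forall>N\<ge>1. nm p (FJ N (pos (co f))) \<le> C * nm p f"
proof -
  obtain C where C: "0 \<le> C" and R: "\<And>F N. cm F \<Longrightarrow> mk F \<in> LL p \<Longrightarrow>
     (\<And>\<theta>. F (cis \<theta>) = of_real (Re (F (cis \<theta>))) \<and> 0 \<le> Re (F (cis \<theta>))) \<Longrightarrow> 1 \<le> N \<Longrightarrow>
     nm p (FJ N (pos (co (mk F)))) \<le> C * nm p (mk F)"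
    using Riesz_nonneg[OF p] by metis
  have p0: "0 < p" using p by simp
  have "nm p (FJ N (pos (co f))) \<le> (4 * C) * nm p f" if f: "f \<in> LL p" and N: "1 \<le> N" for f N
  proof -
    obtain F where F: "cm F" "f = mk F" by (rule mfun_rep)
    note mF = cm_measurable[OF F(1)]
    have L: "(\<lambda>\<theta>. F (cis \<theta>)) \<in> Lpm TM p" using f F by (simp add: mk_simps)
    have part: "cm G \<and> mk G \<in> LL p \<and> nm p (FJ N (pos (co (mk G)))) \<le> C * nm p f"
      if G: "G = (\<lambda>z. complex_of_real (max (h (F z)) 0))" and h: "continuous_on UNIV h" "\<And>w. \<bar>h w\<bar> \<le> norm w"
      for G and h :: "complex \<Rightarrow> real"
    proof -
      have hm: "h \<in> borel_measurable borel" using h(1) by (rule borel_measurable_continuous_onI)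
      have "(\<lambda>\<theta>. h (F (cis \<theta>))) \<in> borel_measurable TM" by (rule measurable_compose[OF mF hm])
      then have m: "(\<lambda>\<theta>. G (cis \<theta>)) \<in> borel_measurable TM" unfolding G by measurable
      have c: "cm G" by (rule cmI) (rule m)
      have b: "AE \<theta> in TM. norm (G (cis \<theta>)) \<le> 1 * norm (F (cis \<theta>))"
      proof (rule AE_I2)
        fix \<theta> show "norm (G (cis \<theta>)) \<le> 1 * norm (F (cis \<theta>))"
          using h(2)[of "F (cis \<theta>)"] unfolding G by (auto simp: max_def)
      qed
      have l: "mk G \<in> LL p" using Lpm_bound[OF L m b] p0 c by (simp add: mk_simps)
      have "nm p (FJ N (pos (co (mk G)))) \<le> C * nm p (mk G)"
        by (rule R[OF c l _ N]) (simp add: G)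
      also have "\<dots> \<le> C * nm p f"
        using Nrm_mono[OF L m b] p0 c F C by (intro mult_left_mono) (simp_all add: mk_simps)
      finally show ?thesis using c l by simp
    qed
    define F1 where "F1 = (\<lambda>z. complex_of_real (max (Re (F z)) 0))"
    define F2 where "F2 = (\<lambda>z. complex_of_real (max (- Re (F z)) 0))"
    define F3 where "F3 = (\<lambda>z. complex_of_real (max (Im (F z)) 0))"
    define F4 where "F4 = (\<lambda>z. complex_of_real (max (- Im (F z)) 0))"
    have P1: "cm F1 \<and> mk F1 \<in> LL p \<and> nm p (FJ N (pos (co (mk F1)))) \<le> C * nm p f"
      by (rule part[OF F1_def[unfolded]]) (auto intro!: continuous_intros simp: abs_Re_le_cmod)
    have P2: "cm F2 \<and> mk F2 \<in> LL p \<and> nm p (FJ N (pos (co (mk F2)))) \<le> C * nm p f"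
      by (rule part[where h="\<lambda>w. - Re w", OF F2_def]) (auto intro!: continuous_intros simp: abs_Re_le_cmod)
    have P3: "cm F3 \<and> mk F3 \<in> LL p \<and> nm p (FJ N (pos (co (mk F3)))) \<le> C * nm p f"
      by (rule part[OF F3_def]) (auto intro!: continuous_intros simp: abs_Im_le_cmod)
    have P4: "cm F4 \<and> mk F4 \<in> LL p \<and> nm p (FJ N (pos (co (mk F4)))) \<le> C * nm p f"
      by (rule part[where h="\<lambda>w. - Im w", OF F4_def]) (auto intro!: continuous_intros simp: abs_Im_le_cmod)
    have dec: "f = mk F1 + (cst (-1) * mk F2 + (cst \<i> * mk F3 + cst (-\<i>) * mk F4))"
    proof -
      have "F w = F1 w + (-1 * F2 w + (\<i> * F3 w + -\<i> * F4 w))" for w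
        unfolding F1_def F2_def F3_def F4_def by (auto simp: complex_eq_iff max_def)
      then have "F = (\<lambda>w. F1 w + (-1 * F2 w + (\<i> * F3 w + -\<i> * F4 w)))" by blast
      then have "mk F = mk (\<lambda>w. F1 w + (-1 * F2 w + (\<i> * F3 w + -\<i> * F4 w)))" by simp
      then show ?thesis using F P1 P2 P3 P4 by (simp add: mk_simps)
    qed
    have L1: "mk F1 \<in> LL 1" "mk F2 \<in> LL 1" "mk F3 \<in> LL 1" "mk F4 \<in> LL 1"
      using P1 P2 P3 P4 LL_imp_LL1 p by auto
    define A where "A G = FJ N (pos (co (mk G)))" for G
    have "FJ N (pos (co f)) = A F1 + (cst (-1) * A F2 + (cst \<i> * A F3 + cst (-\<i>) * A F4))"
    proof -
      have "pos (co f) = (\<lambda>j. pos (co (mk F1)) j + ((-1) * pos (co (mk F2)) j + (\<i> * pos (co (mk F3)) j + (-\<i>) * pos (co (mk F4)) j)))"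
        unfolding dec using L1 by (intro ext) (simp add: pos_def co_add co_cst LL_cst LL_add)
      then show ?thesis unfolding A_def by (simp only: FJ_add FJ_scale)
    qed
    moreover have "nm p (A F1 + (cst (-1) * A F2 + (cst \<i> * A F3 + cst (-\<i>) * A F4))) \<le>
       nm p (A F1) + (nm p (A F2) + (nm p (A F3) + nm p (A F4)))"
    proof -
      have AL: "A G \<in> LL p" "cst c * A G \<in> LL p" for G c unfolding A_def using p0 by (auto intro: LL_cst TP_LL[OF FJ_TP] TP_LL[OF TP_cst[OF FJ_TP]])
      have n: "nm p (cst (-1) * A G) = nm p (A G)" "nm p (cst \<i> * A G) = nm p (A G)" "nm p (cst (-\<i>) * A G) = nm p (A G)" for G
        by (simp_all add: nm_cst[OF p0])
      have t1: "nm p (cst \<i> * A F3 + cst (-\<i>) * A F4) \<le> nm p (A F3) + nm p (A F4)"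
        using nm_triangle[OF AL(2) AL(2) p(1), of \<i> F3 "-\<i>" F4] by (simp only: n)
      have L3: "cst \<i> * A F3 + cst (-\<i>) * A F4 \<in> LL p" using AL p0 by (intro LL_add) auto
      have t2: "nm p (cst (-1) * A F2 + (cst \<i> * A F3 + cst (-\<i>) * A F4)) \<le> nm p (A F2) + nm p (cst \<i> * A F3 + cst (-\<i>) * A F4)"
        using nm_triangle[OF AL(2) L3 p(1), of "-1" F2] by (simp only: n)
      have L2: "cst (-1) * A F2 + (cst \<i> * A F3 + cst (-\<i>) * A F4) \<in> LL p" using AL p0 by (intro LL_add) auto
      show ?thesis using nm_triangle[OF AL(1) L2 p(1), of F1] t1 t2 by linarith
    qed
    ultimately have "nm p (FJ N (pos (co f))) \<le> nm p (A F1) + (nm p (A F2) + (nm p (A F3) + nm p (A F4)))" by (simp only:)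
    also have "\<dots> \<le> C * nm p f + (C * nm p f + (C * nm p f + C * nm p f))"
      using P1 P2 P3 P4 unfolding A_def by (intro add_mono) auto
    finally show ?thesis by simp
  qed
  then show ?thesis using C by (intro exI[of _ "4 * C"]) auto
qed

lemma Riesz_limit:
  assumes p: "1 < p" and C: "0 \<le> C" and R: "\<And>N. 1 \<le> N \<Longrightarrow> nm p (FJ N (pos (co f))) \<le> C * nm p f" and f: "f \<in> LL p"
  shows "\<exists>g\<in>LL p. nm p g \<le> C * nm p f \<and> co g = pos (co f)"
proof -
  have b: "norm (pos (co f) j) \<le> nm p f * nm (conj_exp p) 1" for j
    using co_bound[OF f p, of j] by (simp add: pos_def)
  have "\<exists>Z\<in>LL p. nm p Z \<le> C * nm p f \<and> (\<forall>j. co Z j = pos (co f) j)"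
    using C by (intro Fejer_limit[OF p _ b R]) auto
  then show ?thesis by blast
qed

text \<open>For \<open>p > 2\<close> the bound is dual to the one for the conjugate exponent.\<close>

lemma Riesz_bound:
  assumes p: "1 < p"
  shows "\<exists>C\<ge>0. \<forall>f\<in>LL p. \<forall>N\<ge>1. nm p (FJ N (pos (co f))) \<le> C * nm p f"
proof (cases "p \<le> 2")
  case True then show ?thesis using Riesz_le2 p by blast
next
  case False
  define q where "q = conj_exp p"
  have q: "1 < q" "q \<le> 2" "conj_exp q = p"
    using conj_exp_props[OF p] False by (auto simp: q_def conj_exp_def field_simps)
  obtain C where C: "0 \<le> C" "\<And>f N. f \<in> LL q \<Longrightarrow> 1 \<le> N \<Longrightarrow> nm q (FJ N (pos (co f))) \<le> C * nm q f"
    using Riesz_le2[OF q(1,2)] by blast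
  have "nm p (FJ N (pos (co f))) \<le> (2 * pi * C) * nm p f" if f: "f \<in> LL p" and N: "1 \<le> N" for f N
  proof -
    have TL: "FJ N (pos (co f)) \<in> LL p" using p by (intro TP_LL FJ_TP) auto
    obtain \<psi> where \<psi>: "\<psi> \<in> LL q" "nm q \<psi> \<le> 1" "av (FJ N (pos (co f)) * \<psi>) = complex_of_real (nm p (FJ N (pos (co f))) / (2 * pi))"
      using LL_converse_Holder[OF TL p] unfolding q_def by blast
    \<comment> \<open>In the pairing the index \<open>m\<close> of \<open>f\<close> meets the index
      \<open>- m\<close> of \<open>\<psi>\<close>, so cutting \<open>f\<close> to nonnegative
      indices amounts to cutting \<open>\<psi>\<close> to nonpositive ones. The reflection reduces
      this to \<open>pos\<close>, for which the bound with exponent \<open>q \<le> 2\<close> is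
      known.\<close>
    have fl: "fl \<psi> \<in> LL q" using \<psi>(1) by (rule LL_fl)
    obtain g where g: "g \<in> LL q" "nm q g \<le> C * nm q (fl \<psi>)" "co g = pos (co (fl \<psi>))"
      using Riesz_limit[OF q(1) C(1) C(2)[OF fl] fl] by blast
    define G where "G = fl g"
    have G: "G \<in> LL q" "nm q G \<le> C" "co G (- m) = (if 0 \<le> m then co \<psi> (- m) else 0)" for m
    proof -
      show "G \<in> LL q" unfolding G_def using g(1) by (rule LL_fl)
      have "C * nm q (fl \<psi>) \<le> C * 1" using \<psi>(2) C(1) by (intro mult_left_mono) (auto simp: nm_fl)
      moreover have "nm q G = nm q g" by (simp add: G_def nm_fl)
      ultimately show "nm q G \<le> C" using g(2) by linarith
      show "co G (- m) = (if 0 \<le> m then co \<psi> (- m) else 0)"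
        unfolding G_def co_fl g(3) by (simp add: pos_def co_fl)
    qed
    have "av (FJ N (pos (co f)) * \<psi>) = av (sg N f * G)"
      unfolding sg_FJ av_FJ[OF LL_imp_LL1[OF \<psi>(1) q(1)]] av_FJ[OF LL_imp_LL1[OF G(1) q(1)]]
    proof (intro sum.cong refl)
      fix j l
      show "pos (co f) (int j - int l) / of_nat N * co \<psi> (int l - int j) = co f (int j - int l) / of_nat N * co G (int l - int j)"
        using G(3)[of "int j - int l"] by (simp add: pos_def)
    qed
    then have "norm (av (sg N f * G)) = \<bar>nm p (FJ N (pos (co f))) / (2 * pi)\<bar>" by (metis \<psi>(3) norm_of_real)
    then have "nm p (FJ N (pos (co f))) / (2 * pi) = norm (av (sg N f * G))" by simp
    also have "\<dots> \<le> nm p (sg N f) * nm q G"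
      unfolding q_def using p G(1) by (intro LL_Holder) (auto simp: q_def intro: TP_LL sg_TP)
    also have "\<dots> \<le> nm p f * C" using nm_sg[OF f p N] G(2) by (intro mult_mono) auto
    finally show ?thesis by (simp add: field_simps)
  qed
  then show ?thesis using C by (intro exI[of _ "2 * pi * C"]) auto
qed

section \<open>The Riesz projection on classes and representation of functionals\<close>

definition PP :: "mfun \<Rightarrow> mfun" where
  "PP f = (SOME g. g \<in> LL 1 \<and> co g = pos (co f))"

text \<open>Coefficients determine a class in \<open>L^1\<close>, so the projection does not depend
  on an exponent. This allows \<open>p\<close> and \<open>q\<close> to be mixed, as in the bound
  that belongs to the factorization.\<close>

lemma PP_unique: "g \<in> LL 1 \<Longrightarrow> co g = pos (co f) \<Longrightarrow> PP f = g"
  unfolding PP_def by (rule some_equality) (auto intro: co_eqI)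

theorem Riesz:
  assumes p: "1 < p"
  shows "\<exists>C\<ge>0. \<forall>f\<in>LL p. PP f \<in> LL p \<and> nm p (PP f) \<le> C * nm p f \<and> co (PP f) = pos (co f)"
proof -
  obtain C where C: "0 \<le> C" "\<And>f N. f \<in> LL p \<Longrightarrow> 1 \<le> N \<Longrightarrow> nm p (FJ N (pos (co f))) \<le> C * nm p f"
    using Riesz_bound[OF p] by blast
  have "PP f \<in> LL p \<and> nm p (PP f) \<le> C * nm p f \<and> co (PP f) = pos (co f)" if f: "f \<in> LL p" for f
  proof -
    obtain g where g: "g \<in> LL p" "nm p g \<le> C * nm p f" "co g = pos (co f)"
      using Riesz_limit[OF p C(1) C(2)[OF f] f] by blast
    have "PP f = g" using g LL_imp_LL1[OF g(1) p] by (intro PP_unique) auto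
    then show ?thesis using g by simp
  qed
  then show ?thesis using C(1) by blast
qed

lemma PP_LL: "f \<in> LL p \<Longrightarrow> 1 < p \<Longrightarrow> PP f \<in> LL p"
  and co_PP: "f \<in> LL p \<Longrightarrow> 1 < p \<Longrightarrow> co (PP f) j = (if 0 \<le> j then co f j else 0)"
  using Riesz[of p] by (auto simp: pos_def)

lemma PP_eqI: "g \<in> LL 1 \<Longrightarrow> (\<And>j. co g j = (if 0 \<le> j then co f j else 0)) \<Longrightarrow> PP f = g"
  by (rule PP_unique) (auto simp: pos_def)

lemma PP_LL1: "f \<in> LL p \<Longrightarrow> 1 < p \<Longrightarrow> PP f \<in> LL 1"
  by (rule LL_imp_LL1[OF PP_LL])

lemma PP_linear:
  assumes "f \<in> LL p" "g \<in> LL p" "1 < p"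
  shows PP_add: "PP (f + g) = PP f + PP g" and PP_diff: "PP (f - g) = PP f - PP g"
    and PP_cst: "PP (cst c * f) = cst c * PP f"
proof -
  note L = LL_imp_LL1[OF assms(1,3)] LL_imp_LL1[OF assms(2,3)] PP_LL1[OF assms(1,3)] PP_LL1[OF assms(2,3)]
  show "PP (f + g) = PP f + PP g"
    by (rule PP_eqI) (simp_all add: L LL_add co_add co_PP[OF assms(1,3)] co_PP[OF assms(2,3)])
  show "PP (f - g) = PP f - PP g"
    by (rule PP_eqI) (simp_all add: L LL_diff co_diff co_PP[OF assms(1,3)] co_PP[OF assms(2,3)])
  show "PP (cst c * f) = cst c * PP f"
    by (rule PP_eqI) (simp_all add: L LL_cst co_cst co_PP[OF assms(1,3)])
qed

lemma PP_0: "PP 0 = 0"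
  by (rule PP_eqI) (auto simp: Bd_LL)

text \<open>Representation of functionals on \<open>L^p\<close>, assembled from coefficients:
  \<open>\<Lambda>\<close> prescribes the sequence \<open>y j = \<Lambda> (zp (- j))\<close>, and it
  remains to bound its Fejer means. Paired with an extremal \<open>\<psi>\<close>, the mean moves
  over to \<open>\<psi>\<close>, where the bound on \<open>\<Lambda>\<close> and the contractivity
  of Fejer means apply.\<close>

theorem functional_rep:
  assumes p: "1 < p" and M: "0 \<le> M"
    and add: "\<And>f g. f \<in> TP \<Longrightarrow> g \<in> TP \<Longrightarrow> \<Lambda> (f + g) = \<Lambda> f + \<Lambda> g"
    and scale: "\<And>f c. f \<in> TP \<Longrightarrow> \<Lambda> (cst c * f) = c * \<Lambda> f"
    and bound: "\<And>f. f \<in> TP \<Longrightarrow> norm (\<Lambda> f) \<le> M * nm p f"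
  shows "\<exists>Y\<in>LL (conj_exp p). nm (conj_exp p) Y \<le> 2 * pi * M \<and> (\<forall>j. co Y j = \<Lambda> (zp (- j)))"
proof -
  define q where "q = conj_exp p"
  have q: "1 < q" "conj_exp q = p" using conj_exp_props[OF p] by (auto simp: q_def)
  have p0: "0 < p" using p by simp
  define y where "y j = \<Lambda> (zp (- j))" for j
  have zT: "zp k \<in> TP" for k using TP_monom[of 1 k] by (simp add: cst_simps)
  have sum\<Lambda>: "\<Lambda> (\<Sum>i\<in>I. h i) = (\<Sum>i\<in>I. \<Lambda> (h i))" if "\<And>i. i \<in> I \<Longrightarrow> h i \<in> TP" for h :: "nat \<Rightarrow> mfun" and I
    using that
  proof (induction I rule: infinite_finite_induct)
    case (insert x F) then show ?case by (simp add: add TP_sum)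
  qed (use scale[OF TP_0, of 0] in \<open>simp_all add: cst_simps\<close>)
  have b: "norm (y j) \<le> M * nm p 1" for j
    using bound[OF zT, of "- j"] nm_zp[of 1 p "- j"] p0 by (simp add: y_def Bd_LL)
  have Y: "nm q (FJ N y) \<le> 2 * pi * M" if N: "1 \<le> N" for N
  proof -
    have TL: "FJ N y \<in> LL q" using q by (intro TP_LL FJ_TP) auto
    obtain \<psi> where \<psi>: "\<psi> \<in> LL p" "nm p \<psi> \<le> 1" "av (FJ N y * \<psi>) = complex_of_real (nm q (FJ N y) / (2 * pi))"
      using LL_converse_Holder[OF TL q(1)] unfolding q(2) by blast
    have "av (FJ N y * \<psi>) = (\<Sum>j<N. \<Sum>l<N. y (int j - int l) / of_nat N * co \<psi> (int l - int j))"
      by (rule av_FJ[OF LL_imp_LL1[OF \<psi>(1) p]])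
    also have "\<dots> = (\<Sum>j<N. \<Sum>l<N. \<Lambda> (cst (co \<psi> (int l - int j) / of_nat N) * zp (int l - int j)))"
      by (intro sum.cong refl) (simp add: scale[OF zT] y_def)
    also have "\<dots> = (\<Sum>l<N. \<Sum>j<N. \<Lambda> (cst (co \<psi> (int l - int j) / of_nat N) * zp (int l - int j)))"
      by (rule sum.swap)
    also have "\<dots> = \<Lambda> (sg N \<psi>)"
      unfolding sg_def by (simp add: sum\<Lambda> TP_sum TP_monom)
    finally have "norm (\<Lambda> (sg N \<psi>)) = \<bar>nm q (FJ N y) / (2 * pi)\<bar>" by (metis \<psi>(3) norm_of_real)
    then have "nm q (FJ N y) / (2 * pi) = norm (\<Lambda> (sg N \<psi>))" by simp
    also have "\<dots> \<le> M * nm p (sg N \<psi>)" by (rule bound[OF sg_TP])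
    also have "\<dots> \<le> M * 1" using nm_sg[OF \<psi>(1) p N] \<psi>(2) M by (intro mult_left_mono) auto
    finally show ?thesis by (simp add: field_simps)
  qed
  have "\<exists>Z\<in>LL q. nm q Z \<le> 2 * pi * M \<and> (\<forall>j. co Z j = y j)"
    using M by (intro Fejer_limit[OF q(1) _ b Y]) auto
  then show ?thesis unfolding q_def y_def by blast
qed

section \<open>Hardy spaces\<close>

definition HH :: "real \<Rightarrow> mfun set" where "HH p = {f\<in>LL p. \<forall>j<0. co f j = 0}"
definition QQ :: "real \<Rightarrow> mfun set" where "QQ p = {f\<in>LL p. \<forall>j\<ge>0. co f j = 0}"
text \<open>This flip exchanges \<open>HH p\<close> with the complement \<open>QQ p\<close>. Hence
  \<open>Q J f = J f\<close> for \<open>f\<close> in \<open>HH p\<close>, and the Hankel operator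
  takes the form \<open>PP (b * JJ f)\<close>.\<close>

definition JJ :: "mfun \<Rightarrow> mfun" where "JJ f = zp (- 1) * fl f"

inductive_set AP :: "mfun set" where
  AP_0: "0 \<in> AP"
| AP_step: "f \<in> AP \<Longrightarrow> cst c * zp (int k) + f \<in> AP"

lemma HH_LL: "f \<in> HH p \<Longrightarrow> f \<in> LL p" by (simp add: HH_def)
lemma HH_neg: "f \<in> HH p \<Longrightarrow> j < 0 \<Longrightarrow> co f j = 0" by (simp add: HH_def)
lemma QQ_LL: "f \<in> QQ p \<Longrightarrow> f \<in> LL p" by (simp add: QQ_def)
lemma QQ_nonneg: "f \<in> QQ p \<Longrightarrow> 0 \<le> j \<Longrightarrow> co f j = 0" by (simp add: QQ_def)

lemma HH_add: "f \<in> HH p \<Longrightarrow> g \<in> HH p \<Longrightarrow> 1 < p \<Longrightarrow> f + g \<in> HH p"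
  by (auto simp: HH_def co_add LL_imp_LL1 intro: LL_add)
lemma HH_diff: "f \<in> HH p \<Longrightarrow> g \<in> HH p \<Longrightarrow> 1 < p \<Longrightarrow> f - g \<in> HH p"
  by (auto simp: HH_def co_diff LL_imp_LL1 intro: LL_diff)
lemma HH_cst: "f \<in> HH p \<Longrightarrow> 1 < p \<Longrightarrow> cst c * f \<in> HH p"
  by (auto simp: HH_def co_cst intro: LL_cst)
lemma HH_0: "1 < p \<Longrightarrow> 0 \<in> HH p" by (auto simp: HH_def Bd_LL)
lemma HH_uminus: "f \<in> HH p \<Longrightarrow> 1 < p \<Longrightarrow> - f \<in> HH p"
  using HH_cst[of f p "-1"] by (simp add: cst_simps)
lemma HH_sum: "1 < p \<Longrightarrow> (\<And>i. i \<in> I \<Longrightarrow> f i \<in> HH p) \<Longrightarrow> sum f I \<in> HH p"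
  by (induction I rule: infinite_finite_induct) (auto intro: HH_0 HH_add)
lemma HH_zp: "f \<in> HH p \<Longrightarrow> 1 < p \<Longrightarrow> 0 \<le> k \<Longrightarrow> zp k * f \<in> HH p"
  by (auto simp: HH_def co_zp_mult LL_zp)
lemma HH_monom: "1 < p \<Longrightarrow> 0 \<le> k \<Longrightarrow> zp k \<in> HH p"
  by (auto simp: HH_def co_zp Bd_LL)
lemma HH_zp_down: "f \<in> HH p \<Longrightarrow> 1 < p \<Longrightarrow> (\<And>j. 0 \<le> j \<Longrightarrow> j < k \<Longrightarrow> co f j = 0) \<Longrightarrow> zp (- k) * f \<in> HH p"
proof -
  assume a: "f \<in> HH p" "1 < p" "\<And>j. 0 \<le> j \<Longrightarrow> j < k \<Longrightarrow> co f j = 0"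
  have "co f (j + k) = 0" if "j < 0" for j
    using a(3)[of "j + k"] HH_neg[OF a(1), of "j + k"] that by (cases "0 \<le> j + k") auto
  then show ?thesis using a(1,2) by (simp add: HH_def co_zp_mult LL_zp)
qed

lemma QQ_zp: "f \<in> QQ p \<Longrightarrow> 1 < p \<Longrightarrow> k \<le> 0 \<Longrightarrow> zp k * f \<in> QQ p"
  by (auto simp: QQ_def co_zp_mult LL_zp)

lemma co_JJ: "co (JJ f) j = co f (- 1 - j)"
proof -
  have "- (j - - 1) = - 1 - j" by simp
  then show ?thesis by (simp only: JJ_def co_zp_mult co_fl)
qed
lemma JJ_LL: "f \<in> LL p \<Longrightarrow> 0 < p \<Longrightarrow> JJ f \<in> LL p"
  by (simp add: JJ_def LL_zp LL_fl)
lemma nm_JJ: "f \<in> LL p \<Longrightarrow> 0 < p \<Longrightarrow> nm p (JJ f) = nm p f"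
  by (simp add: JJ_def nm_zp LL_fl nm_fl)
lemma JJ_JJ [simp]: "JJ (JJ f) = f" by (simp add: JJ_def zp_simps)
lemma JJ_add: "JJ (f + g) = JJ f + JJ g" by (simp add: JJ_def distrib_left)
lemma JJ_diff: "JJ (f - g) = JJ f - JJ g" by (simp add: JJ_def right_diff_distrib)
lemma JJ_mult: "JJ (a * f) = fl a * JJ f" by (simp add: JJ_def ac_simps)
lemma JJ_0 [simp]: "JJ 0 = 0" by (simp add: JJ_def)
lemma JJ_HH: "f \<in> HH p \<Longrightarrow> 1 < p \<Longrightarrow> JJ f \<in> QQ p"
  by (auto simp: HH_def QQ_def co_JJ intro: JJ_LL)
lemma JJ_QQ: "f \<in> QQ p \<Longrightarrow> 1 < p \<Longrightarrow> JJ f \<in> HH p"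
  by (auto simp: HH_def QQ_def co_JJ intro: JJ_LL)

lemma PP_HH: "f \<in> LL p \<Longrightarrow> 1 < p \<Longrightarrow> PP f \<in> HH p"
  by (auto simp: HH_def PP_LL co_PP)
lemma PP_id: "f \<in> HH p \<Longrightarrow> 1 < p \<Longrightarrow> PP f = f"
  by (rule PP_eqI) (auto simp: HH_def LL_imp_LL1)
lemma PP_QQ: "f \<in> QQ p \<Longrightarrow> PP f = 0"
  by (rule PP_eqI) (auto simp: QQ_def Bd_LL)
lemma PP_compl: "f \<in> LL p \<Longrightarrow> 1 < p \<Longrightarrow> f - PP f \<in> QQ p"
  using co_diff[OF LL_imp_LL1 PP_LL1, of f p f p] by (auto simp: QQ_def PP_LL co_PP intro: LL_diff)
lemma PP_eq_0_iff: "f \<in> LL p \<Longrightarrow> 1 < p \<Longrightarrow> PP f = 0 \<longleftrightarrow> f \<in> QQ p"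
  using PP_compl[of f p] PP_QQ[of f p] by auto
lemma AP_TP: "f \<in> AP \<Longrightarrow> f \<in> TP"
  by (induction rule: AP.induct) (auto intro: TP.intros)
lemma AP_HH: "f \<in> AP \<Longrightarrow> 1 < p \<Longrightarrow> f \<in> HH p"
  by (induction rule: AP.induct) (auto intro!: HH_0 HH_add HH_cst HH_monom)
lemma PP_TP: "f \<in> TP \<Longrightarrow> PP f \<in> AP"
proof (induction rule: TP.induct)
  case (TP_step f c k)
  have 1: "PP (cst c * zp k) = (if 0 \<le> k then cst c * zp k else 0)"
    by (rule PP_eqI) (auto simp: co_cst co_zp Bd_LL)
  have "PP (cst c * zp k + f) = PP (cst c * zp k) + PP f"
    by (rule PP_add[of _ 2]) (auto intro: TP_LL TP_monom TP_step)
  also have "\<dots> \<in> AP"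
  proof (cases "0 \<le> k")
    case True
    then show ?thesis using AP.AP_step[OF TP_step.IH, of c "nat k"] by (simp add: 1)
  qed (simp add: 1 TP_step.IH)
  finally show ?case .
qed (simp add: PP_0 AP_0)

lemma AP_dense:
  assumes f: "f \<in> HH p" and p: "1 < p" and e: "0 < e"
  shows "\<exists>u\<in>AP. nm p (f - u) < e"
proof -
  obtain C where C: "0 \<le> C" "\<And>f. f \<in> LL p \<Longrightarrow> nm p (PP f) \<le> C * nm p f" using Riesz[OF p] by blast
  obtain u where u: "u \<in> TP" "nm p (f - u) < e / (C + 1)"
    using TP_dense[OF HH_LL[OF f] p, of "e / (C + 1)"] e C by auto
  have uL: "u \<in> LL p" using u p by (auto intro: TP_LL)
  have "f - PP u = PP (f - u)" using f uL p by (simp add: PP_diff[OF HH_LL[OF f]] PP_id)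
  then have "nm p (f - PP u) \<le> C * nm p (f - u)" using C(2)[of "f - u"] f uL p by (simp add: LL_diff HH_LL)
  also have "\<dots> \<le> (C + 1) * nm p (f - u)" by (intro mult_right_mono) auto
  also have "\<dots> < e" using u(2) C(1) by (simp add: field_simps)
  finally show ?thesis using PP_TP[OF u(1)] by blast
qed

text \<open>For an analytic polynomial in place of \<open>f\<close> the claims are computations with
  coefficients. They pass to the limit because, by Hoelder, every coefficient of
  \<open>f * g\<close> depends continuously on \<open>f\<close>. The multiplicativity of the zeroth
  coefficient is what fixes the signature of a factorization later.\<close>

lemma HH_mult:
  assumes f: "f \<in> HH p" and g: "g \<in> HH (conj_exp p)" and p: "1 < p"
  shows "f * g \<in> LL 1" "\<And>j. j < 0 \<Longrightarrow> co (f * g) j = 0" "co (f * g) 0 = co f 0 * co g 0"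
proof -
  define q where "q = conj_exp p"
  have q: "1 < q" using conj_exp_props[OF p] by (simp add: q_def)
  have gL: "g \<in> LL q" "g \<in> LL 1" using g q by (auto simp: HH_def q_def LL_imp_LL1)
  show fg: "f * g \<in> LL 1" using f g p by (intro LL_Holder) (auto simp: HH_def)
  have poly: "co (u * g) j = 0 \<and> co (u * g) 0 = co u 0 * co g 0" if "u \<in> AP" "j < 0" for u j
    using that(1)
  proof (induction rule: AP.induct)
    case (AP_step u c k)
    have e: "(cst c * zp (int k) + u) * g = cst c * (zp (int k) * g) + u * g" by (simp add: algebra_simps)
    have L1: "cst c * (zp (int k) * g) \<in> LL 1" using gL by (simp add: LL_cst LL_zp)
    have L2: "u * g \<in> LL 1" using gL AP_TP[OF AP_step(1)] by (simp add: LL_Bd_mult TP_Bd)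
    have L3: "cst c * zp (int k) \<in> LL 1" "u \<in> LL 1" using AP_TP[OF AP_step(1)] by (auto simp: Bd_LL TP_LL)
    show ?case unfolding e co_add[OF L1 L2] co_add[OF L3] co_cst co_zp_mult co_zp
      using AP_step.IH g that(2) by (auto simp: HH_def distrib_right)
  qed simp
  have lim: "\<exists>u\<in>AP. norm (co (f * g) j - co (u * g) j) < e \<and> nm p (f - u) < e" if e: "0 < e" for e j
  proof -
    define K where "K = nm q g + 1"
    have K: "0 < K" by (simp add: K_def add_nonneg_pos)
    obtain u where u: "u \<in> AP" "nm p (f - u) < min e (e / K)"
      using AP_dense[OF f p, of "min e (e / K)"] e K by auto
    have uL: "u \<in> LL p" using AP_HH[OF u(1) p] by (simp add: HH_def)
    have ug: "u * g \<in> LL 1" using gL AP_TP[OF u(1)] by (simp add: LL_Bd_mult TP_Bd)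
    have "co (f * g) j - co (u * g) j = av ((f - u) * (zp (- j) * g))"
    proof -
      have "(f * g - u * g) * zp (- j) = (f - u) * (zp (- j) * g)" by (simp add: algebra_simps)
      then have "co (f * g - u * g) j = av ((f - u) * (zp (- j) * g))" unfolding co_def by (simp only:)
      then show ?thesis using co_diff[OF fg ug, of j] by simp
    qed
    then have "norm (co (f * g) j - co (u * g) j) \<le> nm p (f - u) * nm q (zp (- j) * g)"
      using LL_Holder(2)[of "f - u" p "zp (- j) * g"] f uL gL p q by (simp add: q_def[symmetric] LL_diff LL_zp HH_LL)
    also have "\<dots> = nm p (f - u) * nm q g" using gL q by (simp add: nm_zp)
    also have "\<dots> \<le> nm p (f - u) * K" by (intro mult_left_mono) (auto simp: K_def)
    also have "\<dots> < e" using u(2) K by (simp add: field_simps)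
    finally show ?thesis using u by auto
  qed
  show "co (f * g) j = 0" if "j < 0" for j
  proof (rule ccontr)
    assume "co (f * g) j \<noteq> 0"
    then have "0 < norm (co (f * g) j)" by simp
    then obtain u where "u \<in> AP" "norm (co (f * g) j - co (u * g) j) < norm (co (f * g) j)" using lim[of "norm (co (f * g) j)" j] by blast
    then show False using poly[of u j] that by simp
  qed
  show "co (f * g) 0 = co f 0 * co g 0"
  proof (rule ccontr)
    assume ne: "co (f * g) 0 \<noteq> co f 0 * co g 0"
    define d where "d = norm (co (f * g) 0 - co f 0 * co g 0)"
    have d: "0 < d" using ne by (simp add: d_def)
    define K where "K = nm q 1 * norm (co g 0) + 1"
    have K: "1 \<le> K" by (simp add: K_def)
    obtain u where u: "u \<in> AP" "norm (co (f * g) 0 - co (u * g) 0) < d / (2 * K)" "nm p (f - u) < d / (2 * K)"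
      using lim[of "d / (2 * K)" 0] d K by auto
    have uL: "u \<in> LL p" using AP_HH[OF u(1) p] by (simp add: HH_def)
    have u0: "co (u * g) 0 = co u 0 * co g 0" using poly[OF u(1), of "-1"] by simp
    have "norm (co u 0 - co f 0) \<le> nm p (u - f) * nm q 1"
      using co_bound[of "u - f" p 0] uL f p co_diff[OF LL_imp_LL1[OF uL p] LL_imp_LL1[OF HH_LL[OF f] p], of 0]
      by (simp add: HH_LL LL_diff q_def)
    then have "norm (co u 0 * co g 0 - co f 0 * co g 0) \<le> nm p (f - u) * nm q 1 * norm (co g 0)"
      using p by (simp add: norm_mult nm_minus_commute[of p u f] mult_right_mono flip: left_diff_distrib)
    also have "\<dots> = nm p (f - u) * (nm q 1 * norm (co g 0))" by (simp only: mult.assoc)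
    also have "\<dots> \<le> nm p (f - u) * K" by (intro mult_left_mono) (auto simp: K_def)
    also have "\<dots> < d / 2" using u(3) K by (simp add: field_simps)
    finally have "norm (co u 0 * co g 0 - co f 0 * co g 0) < d / 2" .
    moreover have "norm (co (f * g) 0 - co (u * g) 0) < d / 2"
    proof -
      have "d / (2 * K) \<le> d / 2" using d K by (intro divide_left_mono) auto
      then show ?thesis using u(2) by linarith
    qed
    moreover have "d \<le> norm (co (f * g) 0 - co (u * g) 0) + norm (co u 0 * co g 0 - co f 0 * co g 0)"
      unfolding d_def using norm_triangle_ineq[of "co (f * g) 0 - co (u * g) 0" "co u 0 * co g 0 - co f 0 * co g 0"] u0 by simp
    ultimately show False by linarith
  qed
qed

lemma const_eqI:
  assumes "h \<in> LL 1" "\<And>j. j \<noteq> 0 \<Longrightarrow> co h j = 0" shows "h = cst (co h 0)"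
proof (rule co_eqI[OF assms(1)])
  show "cst (co h 0) \<in> LL 1" by (simp add: Bd_LL)
  show "co h j = co (cst (co h 0)) j" for j
    using assms(2)[of j] co_cst[of "co h 0" 1 j] co_zp[of 0 j] by (auto simp: zp_simps)
qed

section \<open>Toeplitz operators: bounded inverses and duality\<close>

text \<open>Completeness in the form that suits both iterations below, nested balls and successive
  approximation: the steps are bounded by the decrements of a null sequence \<open>r\<close>, so
  that \<open>r n\<close> bounds the whole tail.\<close>

lemma HH_telescoping_limit:
  fixes r :: "nat \<Rightarrow> real"
  assumes p: "1 < p" and x: "\<And>n. x n \<in> HH p" and d: "\<And>n. nm p (x (Suc n) - x n) \<le> r n - r (Suc n)" and r: "r \<longlonglongrightarrow> 0"
  shows "\<exists>l\<in>HH p. (\<forall>n. nm p (x n - l) \<le> r n) \<and> (\<lambda>n. nm p (x n - l)) \<longlonglongrightarrow> 0"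
proof -
  have p0: "0 < p" using p by simp
  have xL: "x n \<in> LL p" for n using x by (simp add: HH_def)
  have dec: "r (Suc n) \<le> r n" for n using d[of n] nm_nonneg[of p "x (Suc n) - x n"] by linarith
  have r0: "0 \<le> r n" for n by (rule decseq_ge[OF decseq_SucI r]) (rule dec)
  have D: "nm p (x (n + k) - x n) \<le> r n - r (n + k)" for n k
  proof (induction k)
    case 0 then show ?case using p0 by (simp add: nm_0)
  next
    case (Suc k)
    have "x (n + Suc k) - x n = (x (Suc (n + k)) - x (n + k)) + (x (n + k) - x n)" by simp
    then have "nm p (x (n + Suc k) - x n) \<le> nm p (x (Suc (n + k)) - x (n + k)) + nm p (x (n + k) - x n)"
      using nm_triangle[OF LL_diff[OF xL xL] LL_diff[OF xL xL] p] p0 by (metis less_imp_le)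
    then show ?case using Suc d[of "n + k"] by simp
  qed
  have D': "nm p (x m - x n) \<le> r (min m n)" for m n
  proof (cases "n \<le> m")
    case True
    then show ?thesis using D[of n "m - n"] r0[of m] by simp
  next
    case False
    then show ?thesis using D[of m "n - m"] r0[of n] nm_minus_commute[OF p0, of "x m" "x n"] by simp
  qed
  have "\<exists>N. \<forall>m\<ge>N. \<forall>n\<ge>N. nm p (x m - x n) < e" if e0: "0 < e" for e
  proof -
    obtain N where N: "\<And>n. N \<le> n \<Longrightarrow> r n < e"
      using order_tendstoD(2)[OF r e0] by (auto simp: eventually_sequentially)
    have "nm p (x m - x n) < e" if "N \<le> m" "N \<le> n" for m n
      using D'[of m n] N[of "min m n"] that by simp
    then show ?thesis by blast
  qed
  then obtain l where l: "l \<in> LL p" "(\<lambda>n. nm p (x n - l)) \<longlonglongrightarrow> 0" using LL_complete[of p x, OF p xL] by blast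
  have "co l j = 0" if "j < 0" for j
  proof (rule LIMSEQ_unique)
    show "(\<lambda>n. co (x n) j) \<longlonglongrightarrow> co l j" by (rule co_tendsto[OF p xL l])
    show "(\<lambda>n. co (x n) j) \<longlonglongrightarrow> 0" using x that by (simp add: HH_def)
  qed
  then have lH: "l \<in> HH p" using l by (simp add: HH_def)
  have "nm p (x n - l) \<le> r n" for n
  proof (rule LIMSEQ_le_const)
    show "(\<lambda>m. r n + nm p (x (m + n) - l)) \<longlonglongrightarrow> r n"
      using tendsto_add[OF tendsto_const[of "r n"] LIMSEQ_ignore_initial_segment[OF l(2), of n]] by simp
    have "nm p (x n - l) \<le> r n + nm p (x (m + n) - l)" for m
    proof -
      have "x n - l = (x n - x (m + n)) + (x (m + n) - l)" by simp
      then have "nm p (x n - l) \<le> nm p (x n - x (m + n)) + nm p (x (m + n) - l)"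
        using nm_triangle[OF LL_diff[OF xL xL] LL_diff[OF xL l(1)] p] p0 by (metis less_imp_le)
      then show ?thesis using D'[of n "m + n"] by simp
    qed
    then show "\<exists>N. \<forall>m\<ge>N. nm p (x n - l) \<le> r n + nm p (x (m + n) - l)" by blast
  qed
  then show ?thesis using lH l(2) by blast
qed

lemma half_powers_tendsto: "(\<lambda>n. c / 2 ^ n) \<longlonglongrightarrow> (0::real)"
  using tendsto_mult[OF tendsto_const[of c] LIMSEQ_power_zero[of "1/2::real"]] by (simp add: power_divide)

context
  fixes p :: real and T :: "mfun \<Rightarrow> mfun" and C :: real
  assumes p: "1 < p" and maps: "\<And>f. f \<in> HH p \<Longrightarrow> T f \<in> HH p"
    and add: "\<And>f g. f \<in> HH p \<Longrightarrow> g \<in> HH p \<Longrightarrow> T (f + g) = T f + T g"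
    and scale: "\<And>f c. f \<in> HH p \<Longrightarrow> T (cst c * f) = cst c * T f"
    and bound: "\<And>f. f \<in> HH p \<Longrightarrow> nm p (T f) \<le> C * nm p f"
begin

lemma T_diff: "f \<in> HH p \<Longrightarrow> g \<in> HH p \<Longrightarrow> T (f - g) = T f - T g"
  using add[of f "- g"] scale[of g "-1"] HH_uminus[of g p] p by (simp add: cst_simps)

text \<open>Baire's argument with explicit balls: if the image of no ball were dense in an open set,
  nested balls could be chosen, each new one missing the image of the ball of radius
  \<open>n\<close>. Their common point would have no preimage.\<close>

lemma baire_step:
  assumes surj: "\<And>h. h \<in> HH p \<Longrightarrow> \<exists>f\<in>HH p. T f = h"
  shows "\<exists>n::nat. \<exists>x\<in>HH p. \<exists>r>0. \<forall>y\<in>HH p. nm p (y - x) < r \<longrightarrow> (\<forall>\<delta>>0. \<exists>f\<in>HH p. nm p f \<le> real n \<and> nm p (y - T f) < \<delta>)"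
proof (rule ccontr)
  assume neg: "\<not> ?thesis"
  define P where "P = (\<lambda>z :: mfun \<times> real. fst z \<in> HH p \<and> 0 < snd z)"
  define Q where "Q = (\<lambda>(n::nat) (z :: mfun \<times> real) (w :: mfun \<times> real). nm p (fst w - fst z) \<le> snd z / 2 \<and> snd w \<le> snd z / 2
     \<and> (\<forall>f\<in>HH p. nm p f \<le> real n \<longrightarrow> snd w < nm p (fst w - T f)))"
  have "\<exists>S. \<forall>n. P (S n) \<and> Q n (S n) (S (Suc n))"
  proof (rule dependent_nat_choice)
    show "\<exists>z. P z" using HH_0[OF p] by (intro exI[of _ "(0, 1)"]) (simp add: P_def)
    fix z n assume z: "P z"
    then have z1: "fst z \<in> HH p" "0 < snd z / 2" by (auto simp: P_def)
    have "\<not> (\<forall>y\<in>HH p. nm p (y - fst z) < snd z / 2 \<longrightarrow> (\<forall>\<delta>>0. \<exists>f\<in>HH p. nm p f \<le> real n \<and> nm p (y - T f) < \<delta>))"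
      using neg z1 by blast
    then obtain y \<delta> where y: "y \<in> HH p" "nm p (y - fst z) < snd z / 2" "0 < \<delta>" "\<And>f. f \<in> HH p \<Longrightarrow> nm p f \<le> real n \<Longrightarrow> \<delta> \<le> nm p (y - T f)"
      by (meson not_less)
    \<comment> \<open>Half of the old radius nests the new ball, and half of \<open>\<delta>\<close>
      keeps it away from every \<open>T f\<close> with \<open>nm p f \<le> real n\<close>.\<close>
    define s where "s = min (snd z / 2) (\<delta> / 2)"
    have s: "0 < s" "s < \<delta>" "s \<le> snd z / 2" using y(3) z1 by (auto simp: s_def)
    show "\<exists>w. P w \<and> Q n z w"
    proof (intro exI[of _ "(y, s)"] conjI)
      show "P (y, s)" using y s by (simp add: P_def)
      show "Q n z (y, s)" unfolding Q_def using y s by (auto intro: less_le_trans less_imp_le)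
    qed
  qed
  then obtain S where S: "\<And>n. P (S n)" "\<And>n. Q n (S n) (S (Suc n))" by blast
  define x where "x n = fst (S n)" for n
  define r where "r n = snd (S n)" for n
  have x: "x n \<in> HH p" and r0: "0 < r n" for n using S(1)[of n] by (auto simp: P_def x_def r_def)
  have q1: "nm p (x (Suc n) - x n) \<le> r n / 2" and q2: "r (Suc n) \<le> r n / 2"
    and q3: "\<And>f. f \<in> HH p \<Longrightarrow> nm p f \<le> real n \<Longrightarrow> r (Suc n) < nm p (x (Suc n) - T f)" for n
    using S(2)[of n] by (auto simp: Q_def x_def r_def)
  have "nm p (x (Suc n) - x n) \<le> r n - r (Suc n)" for n using q1[of n] q2[of n] by simp
  moreover have "r n \<le> r 0 / 2 ^ n" for n
  proof (induction n)
    case (Suc n) then show ?case using q2[of n] by simp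
  qed simp
  then have "r \<longlonglongrightarrow> 0"
    using r0 by (intro tendsto_sandwich[OF _ _ tendsto_const half_powers_tendsto[of "r 0"]]) (auto intro: always_eventually less_imp_le)
  ultimately obtain l where l: "l \<in> HH p" "\<And>n. nm p (x n - l) \<le> r n"
    using HH_telescoping_limit[of p x r, OF p x] by blast
  obtain f where f: "f \<in> HH p" "T f = l" using surj l by blast
  obtain n :: nat where n: "nm p f \<le> real n" using real_arch_simple by blast
  show False using q3[OF f(1) n] l(2)[of "Suc n"] f(2) by simp
qed

text \<open>Subtracting an approximate preimage of \<open>x\<close> from one of
  \<open>x + y'\<close> moves the density from the ball about \<open>x\<close> to a ball about 0,
  and scaling then reaches every \<open>y\<close>. The two preimages have norm at most
  \<open>n\<close> each and \<open>y'\<close> has norm \<open>r / 2\<close>; this gives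
  \<open>K = 4 * n / r\<close>.\<close>

lemma approx_inverse:
  assumes surj: "\<And>h. h \<in> HH p \<Longrightarrow> \<exists>f\<in>HH p. T f = h"
  shows "\<exists>K\<ge>0. \<forall>y\<in>HH p. \<forall>\<delta>>0. \<exists>f\<in>HH p. nm p f \<le> K * nm p y \<and> nm p (y - T f) < \<delta>"
proof -
  have p0: "0 < p" using p by simp
  obtain n :: nat and x r where x: "x \<in> HH p" "0 < r"
    and B: "\<And>y \<delta>. y \<in> HH p \<Longrightarrow> nm p (y - x) < r \<Longrightarrow> 0 < \<delta> \<Longrightarrow> \<exists>f\<in>HH p. nm p f \<le> real n \<and> nm p (y - T f) < \<delta>"
    using baire_step[OF surj] by blast
  define K where "K = 4 * real n / r"
  have "\<exists>f\<in>HH p. nm p f \<le> K * nm p y \<and> nm p (y - T f) < \<delta>" if y: "y \<in> HH p" and \<delta>: "0 < \<delta>" for y \<delta>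
  proof (cases "nm p y = 0")
    case True
    have "T 0 = 0" using scale[OF HH_0[OF p], of 0] by (simp add: cst_simps)
    then show ?thesis using True \<delta> HH_0[OF p] p0 by (intro bexI[of _ 0]) (simp_all add: nm_0)
  next
    case False
    then have ny: "0 < nm p y" by (simp add: less_le)
    define c where "c = r / (2 * nm p y)"
    have c: "0 < c" using x ny by (simp add: c_def)
    define y' where "y' = cst (of_real c) * y"
    have y': "y' \<in> HH p" using y p by (simp add: y'_def HH_cst)
    have ny': "nm p y' = r / 2" unfolding y'_def nm_cst[OF p0] norm_of_real using c ny x(2) by (simp add: c_def)
    have h: "0 < c * \<delta> / 2" using c \<delta> by simp
    obtain f1 where f1: "f1 \<in> HH p" "nm p f1 \<le> real n" "nm p (x + y' - T f1) < c * \<delta> / 2"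
      using B[OF HH_add[OF x(1) y' p] _ h] ny' x(2) by auto
    obtain f2 where f2: "f2 \<in> HH p" "nm p f2 \<le> real n" "nm p (x - T f2) < c * \<delta> / 2"
      using B[OF x(1) _ h] x(2) p0 by (auto simp: nm_0)
    define f where "f = cst (of_real (1 / c)) * (f1 - f2)"
    have d12: "f1 - f2 \<in> HH p" using f1 f2 p by (simp add: HH_diff)
    have f: "f \<in> HH p" unfolding f_def using d12 p by (rule HH_cst)
    have nf: "nm p f = (1 / c) * nm p (f1 - f2)" unfolding f_def nm_cst[OF p0] norm_of_real using c by simp
    have "nm p (f1 - f2) \<le> real n + real n" using nm_triangle_diff[OF HH_LL[OF f1(1)] HH_LL[OF f2(1)] p] f1 f2 by linarith
    then have "nm p f \<le> (1 / c) * (real n + real n)" unfolding nf using c by (intro mult_left_mono) auto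
    then have 1: "nm p f \<le> K * nm p y" using x(2) ny by (simp add: c_def K_def field_simps)
    have "cst (of_real (1 / c)) * y' = y" using c by (simp add: y'_def cst_simps(2) mult.assoc[symmetric] flip: cst_simps(4) of_real_mult)
    then have e: "y - T f = cst (of_real (1 / c)) * ((x + y' - T f1) - (x - T f2))"
      unfolding f_def scale[OF d12] T_diff[OF f1(1) f2(1)] by (simp add: algebra_simps)
    have L1: "x + y' - T f1 \<in> LL p" "x - T f2 \<in> LL p"
      using x y' f1 f2 maps p by (auto intro!: HH_LL HH_diff HH_add)
    have "nm p (y - T f) = (1 / c) * nm p ((x + y' - T f1) - (x - T f2))" unfolding e nm_cst[OF p0] norm_of_real using c by simp
    also have "\<dots> \<le> (1 / c) * (nm p (x + y' - T f1) + nm p (x - T f2))"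
      using c L1 p by (intro mult_left_mono nm_triangle_diff) auto
    also have "\<dots> < (1 / c) * (c * \<delta>)" using c f1(3) f2(3) by (intro mult_strict_left_mono) auto
    finally have 2: "nm p (y - T f) < \<delta>" using c by simp
    show ?thesis using f 1 2 by blast
  qed
  moreover have "0 \<le> K" using x(2) by (simp add: K_def)
  ultimately show ?thesis by blast
qed

text \<open>Banach's theorem on the inverse: the residual \<open>y - T F\<close> is approximately
  inverted again and again and halved each time. The corrections add up to a preimage of norm at
  most \<open>2 * K\<close> times the norm of \<open>y\<close>, and injectivity identifies it with
  \<open>g\<close>.\<close>

theorem bounded_inverse:
  assumes surj: "\<And>h. h \<in> HH p \<Longrightarrow> \<exists>f\<in>HH p. T f = h"
    and inj: "\<And>f. f \<in> HH p \<Longrightarrow> T f = 0 \<Longrightarrow> f = 0"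
  shows "\<exists>M\<ge>0. \<forall>f\<in>HH p. nm p f \<le> M * nm p (T f)"
proof -
  have p0: "0 < p" using p by simp
  obtain K where K: "0 \<le> K" "\<And>y \<delta>. y \<in> HH p \<Longrightarrow> 0 < \<delta> \<Longrightarrow> \<exists>f\<in>HH p. nm p f \<le> K * nm p y \<and> nm p (y - T f) < \<delta>"
    using approx_inverse[OF surj] by blast
  have T0: "T 0 = 0" using scale[OF HH_0[OF p], of 0] by (simp add: cst_simps)
  have "nm p g \<le> 2 * K * nm p (T g)" if g: "g \<in> HH p" for g
  proof (cases "nm p (T g) = 0")
    case True
    then have "T g = 0" using nm_eq_0[OF HH_LL[OF maps[OF g]] p0] by simp
    then have "g = 0" using inj g by blast
    then show ?thesis using p0 T0 by (simp add: nm_0)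
  next
    case False
    define y where "y = T g"
    define \<eta> where "\<eta> = nm p y"
    have y: "y \<in> HH p" using maps g by (simp add: y_def)
    have \<eta>: "0 < \<eta>" using False by (simp add: \<eta>_def y_def less_le)
    \<comment> \<open>The clause for \<open>k = 0\<close> carries the starting value 0 through the
      dependent choice; without it the distance bound \<open>r 0\<close> would say nothing about the
      norm of the limit.\<close>
    define P where "P k F \<longleftrightarrow> F \<in> HH p \<and> nm p (y - T F) \<le> \<eta> / 2 ^ k \<and> (k = 0 \<longrightarrow> F = 0)" for k :: nat and F
    have "\<exists>F. \<forall>k. P k (F k) \<and> nm p (F (Suc k) - F k) \<le> K * (\<eta> / 2 ^ k)"
    proof (rule dependent_nat_choice)
      show "\<exists>F. P 0 F" using HH_0[OF p] T0 by (intro exI[of _ 0]) (simp add: P_def \<eta>_def)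
      fix F k assume F: "P k F"
      have r: "y - T F \<in> HH p" using F y maps p by (simp add: P_def HH_diff)
      obtain f where f: "f \<in> HH p" "nm p f \<le> K * nm p (y - T F)" "nm p (y - T F - T f) < \<eta> / 2 ^ Suc k"
      proof -
        have "0 < \<eta> / 2 ^ Suc k" using \<eta> by simp
        then show thesis using K(2)[OF r] that by blast
      qed
      have "P (Suc k) (F + f)"
      proof -
        have FH: "F \<in> HH p" using F by (simp add: P_def)
        have "nm p (y - T (F + f)) \<le> \<eta> / 2 ^ Suc k"
          using f(3) unfolding add[OF FH f(1)] diff_diff_eq by (rule less_imp_le)
        then show ?thesis using HH_add[OF FH f(1) p] unfolding P_def by simp
      qed
      moreover have "nm p (F + f - F) \<le> K * (\<eta> / 2 ^ k)"
      proof -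
        have "K * nm p (y - T F) \<le> K * (\<eta> / 2 ^ k)" using F K(1) by (intro mult_left_mono) (auto simp: P_def)
        then show ?thesis using f(2) by simp
      qed
      ultimately show "\<exists>G. P (Suc k) G \<and> nm p (G - F) \<le> K * (\<eta> / 2 ^ k)" by blast
    qed
    then obtain F where F: "\<And>k. P k (F k)" "\<And>k. nm p (F (Suc k) - F k) \<le> K * (\<eta> / 2 ^ k)" by blast
    have FH: "F k \<in> HH p" for k using F(1)[of k] by (simp add: P_def)
    define r where "r k = 2 * K * \<eta> / 2 ^ k" for k :: nat
    have "nm p (F (Suc k) - F k) \<le> r k - r (Suc k)" for k
    proof -
      have "r k - r (Suc k) = K * (\<eta> / 2 ^ k)" by (simp add: r_def)
      then show ?thesis using F(2)[of k] by simp
    qed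
    note d = this
    have rl: "r \<longlonglongrightarrow> 0" unfolding r_def by (rule half_powers_tendsto)
    obtain l where l: "l \<in> HH p" "\<And>n. nm p (F n - l) \<le> r n" "(\<lambda>n. nm p (F n - l)) \<longlonglongrightarrow> 0"
      using HH_telescoping_limit[of p F r, OF p FH d rl] by blast
    have "nm p (y - T l) = 0"
    proof (rule antisym)
      show "nm p (y - T l) \<le> 0"
      proof (rule LIMSEQ_le_const)
        show "(\<lambda>n. \<eta> / 2 ^ n + C * nm p (F n - l)) \<longlonglongrightarrow> 0"
          using tendsto_add[OF half_powers_tendsto[of \<eta>] tendsto_mult[OF tendsto_const[of C] l(3)]] by simp
        have "nm p (y - T l) \<le> \<eta> / 2 ^ n + C * nm p (F n - l)" for n
        proof -
          have dn: "F n - l \<in> HH p" using FH l p by (simp add: HH_diff)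
          have e: "y - T l = (y - T (F n)) + T (F n - l)" using FH l by (simp add: T_diff)
          have "nm p (y - T l) \<le> nm p (y - T (F n)) + nm p (T (F n - l))"
            unfolding e using FH y maps dn p by (intro nm_triangle) (auto intro!: HH_LL HH_diff)
          also have "\<dots> \<le> \<eta> / 2 ^ n + C * nm p (F n - l)" using F(1)[of n] bound[OF dn] by (intro add_mono) (auto simp: P_def)
          finally show ?thesis .
        qed
        then show "\<exists>N. \<forall>n\<ge>N. nm p (y - T l) \<le> \<eta> / 2 ^ n + C * nm p (F n - l)" by blast
      qed
    qed simp
    then have "y - T l = 0" using y l maps p p0 by (intro nm_eq_0[of _ p]) (auto intro!: HH_LL HH_diff)
    then have "T (g - l) = 0" using g l by (simp add: T_diff y_def)
    then have "g = l" using inj[of "g - l"] g l p by (simp add: HH_diff)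
    moreover have "nm p l \<le> r 0" using l(2)[of 0] F(1)[of 0] p0 by (simp add: P_def nm_uminus)
    ultimately show ?thesis by (simp add: r_def \<eta>_def y_def)
  qed
  then show ?thesis using K(1) by (intro exI[of _ "2 * K"]) auto
qed

end

section \<open>Toeplitz operators, their inverses and adjoints\<close>

definition TT :: "mfun \<Rightarrow> mfun \<Rightarrow> mfun" where "TT g f = PP (g * f)"

text \<open>The lower bound is included because the duality argument works with a bounded inverse;
  \<open>Inv_I\<close> obtains it from bijectivity.\<close>

definition Inv :: "real \<Rightarrow> mfun \<Rightarrow> bool" where
  "Inv p g \<longleftrightarrow> (\<exists>M\<ge>0. \<forall>f\<in>HH p. nm p f \<le> M * nm p (TT g f)) \<and> (\<forall>h\<in>HH p. \<exists>f\<in>HH p. TT g f = h)"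

lemma Bd_mult_LL: "g \<in> Bd \<Longrightarrow> f \<in> HH p \<Longrightarrow> 1 < p \<Longrightarrow> g * f \<in> LL p"
  by (simp add: LL_Bd_mult HH_LL)

lemma TT_HH: "g \<in> Bd \<Longrightarrow> f \<in> HH p \<Longrightarrow> 1 < p \<Longrightarrow> TT g f \<in> HH p"
  unfolding TT_def by (intro PP_HH Bd_mult_LL)

lemma TT_add: "g \<in> Bd \<Longrightarrow> f \<in> HH p \<Longrightarrow> h \<in> HH p \<Longrightarrow> 1 < p \<Longrightarrow> TT g (f + h) = TT g f + TT g h"
  unfolding TT_def distrib_left by (rule PP_add[of _ p]) (simp_all add: Bd_mult_LL)

lemma TT_diff: "g \<in> Bd \<Longrightarrow> f \<in> HH p \<Longrightarrow> h \<in> HH p \<Longrightarrow> 1 < p \<Longrightarrow> TT g (f - h) = TT g f - TT g h"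
  unfolding TT_def right_diff_distrib by (rule PP_diff[of _ p]) (simp_all add: Bd_mult_LL)

lemma TT_cst: "g \<in> Bd \<Longrightarrow> f \<in> HH p \<Longrightarrow> 1 < p \<Longrightarrow> TT g (cst c * f) = cst c * TT g f"
  unfolding TT_def mult.left_commute[of g "cst c"] by (rule PP_cst[of _ p f]) (simp_all add: Bd_mult_LL HH_LL)

lemma TT_bound:
  assumes "g \<in> Bd" "1 < p"
  shows "\<exists>C\<ge>0. \<forall>f\<in>LL p. nm p (TT g f) \<le> C * nm p f"
proof -
  obtain B where B: "0 \<le> B" "bdC B g" using Bd_E[OF assms(1)] by blast
  obtain C where C: "0 \<le> C" "\<And>f. f \<in> LL p \<Longrightarrow> nm p (PP f) \<le> C * nm p f" using Riesz[OF assms(2)] by blast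
  have "nm p (TT g f) \<le> (C * B) * nm p f" if f: "f \<in> LL p" for f
  proof -
    have "nm p (TT g f) \<le> C * nm p (g * f)" unfolding TT_def using assms f by (intro C(2)) (simp add: LL_Bd_mult)
    also have "\<dots> \<le> C * (B * nm p f)" using LL_mult_bdC(2)[OF B(2) f] assms B C by (intro mult_left_mono) auto
    finally show ?thesis by (simp add: mult.assoc)
  qed
  then show ?thesis using B C by (intro exI[of _ "C * B"]) auto
qed

lemma Inv_inj: "Inv p g \<Longrightarrow> f \<in> HH p \<Longrightarrow> TT g f = 0 \<Longrightarrow> 1 < p \<Longrightarrow> f = 0"
proof -
  assume a: "Inv p g" "f \<in> HH p" "TT g f = 0" "1 < p"
  obtain M where "nm p f \<le> M * nm p (TT g f)" using conjunct1[OF a(1)[unfolded Inv_def]] a(2) by blast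
  then have "nm p f \<le> 0" using a by (simp add: nm_0)
  then have "nm p f = 0" using nm_nonneg[of p f] by (rule antisym)
  then show ?thesis using nm_eq_0[OF HH_LL[OF a(2)]] a(4) by simp
qed

lemma Inv_I:
  assumes "g \<in> Bd" "1 < p" "\<And>f. f \<in> HH p \<Longrightarrow> TT g f = 0 \<Longrightarrow> f = 0" "\<And>h. h \<in> HH p \<Longrightarrow> \<exists>f\<in>HH p. TT g f = h"
  shows "Inv p g"
proof -
  obtain C where C: "\<And>f. f \<in> LL p \<Longrightarrow> nm p (TT g f) \<le> C * nm p f" using TT_bound[OF assms(1,2)] by blast
  have "\<exists>M\<ge>0. \<forall>f\<in>HH p. nm p f \<le> M * nm p (TT g f)"
    by (rule bounded_inverse[of p "TT g" C]) (use assms C in \<open>auto simp: TT_HH TT_add TT_cst HH_LL\<close>)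
  then show ?thesis using assms(4) unfolding Inv_def by blast
qed

lemma Inv_inverse:
  assumes "Inv p g" "g \<in> Bd" "1 < p"
  shows "\<exists>S M. 0 \<le> M \<and> (\<forall>h\<in>HH p. S h \<in> HH p \<and> TT g (S h) = h \<and> nm p (S h) \<le> M * nm p h) \<and>
     (\<forall>f\<in>HH p. S (TT g f) = f) \<and> (\<forall>h\<in>HH p. \<forall>k\<in>HH p. S (h + k) = S h + S k) \<and> (\<forall>h\<in>HH p. \<forall>c. S (cst c * h) = cst c * S h)"
proof -
  obtain M where M: "0 \<le> M" "\<And>f. f \<in> HH p \<Longrightarrow> nm p f \<le> M * nm p (TT g f)"
    using conjunct1[OF assms(1)[unfolded Inv_def]] by blast
  have "\<forall>h\<in>HH p. \<exists>f. f \<in> HH p \<and> TT g f = h" using conjunct2[OF assms(1)[unfolded Inv_def]] by blast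
  then have "\<exists>S. \<forall>h\<in>HH p. S h \<in> HH p \<and> TT g (S h) = h" by (rule bchoice)
  then obtain S where S: "\<And>h. h \<in> HH p \<Longrightarrow> S h \<in> HH p" "\<And>h. h \<in> HH p \<Longrightarrow> TT g (S h) = h" by blast
  have u: "f = f'" if "f \<in> HH p" "f' \<in> HH p" "TT g f = TT g f'" for f f'
    using Inv_inj[OF assms(1), of "f - f'"] that assms by (simp add: TT_diff HH_diff)
  show ?thesis
  proof (intro exI[of _ S] exI[of _ M] conjI ballI allI M(1))
    show "S (TT g f) = f" if "f \<in> HH p" for f by (rule u) (use that assms in \<open>simp_all add: S TT_HH\<close>)
    show "S (h + k) = S h + S k" if "h \<in> HH p" "k \<in> HH p" for h k
      by (rule u) (use that assms in \<open>simp_all add: S TT_add[of g _ p] HH_add\<close>)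
    show "S (cst c * h) = cst c * S h" if "h \<in> HH p" for h c
      by (rule u) (use that assms in \<open>simp_all add: S TT_cst[of g _ p] HH_cst\<close>)
    show "nm p (S h) \<le> M * nm p h" if "h \<in> HH p" for h using M(2)[OF S(1)[OF that]] S(2)[OF that] by simp
  qed (auto simp: S)
qed

text \<open>After a reflection the pairing is a negative coefficient of a product of an
  \<open>H^p\<close> and an \<open>H^q\<close> function.\<close>

lemma av_QQ_HH:
  assumes k: "k \<in> QQ p" and h: "h \<in> HH (conj_exp p)" and p: "1 < p"
  shows "av (k * cj h) = 0"
proof -
  have q: "1 < conj_exp p" using conj_exp_props p by blast
  define k' where "k' = JJ k"
  have k': "k' \<in> HH p" "k = JJ k'" using JJ_QQ[OF k p] by (auto simp: k'_def)
  define h' where "h' = fl (cj h)"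
  have h': "h' \<in> HH (conj_exp p)" using h by (auto simp: h'_def HH_def LL_cj LL_fl co_fl co_cj simp del: cj_simps(11))
  have e: "k * cj h = fl (k' * h') * zp (- 1)"
    unfolding k'(2) JJ_def h'_def by (simp add: ac_simps)
  have "av (k * cj h) = co (fl (k' * h')) 1" unfolding e by (simp add: co_def)
  also have "\<dots> = 0" unfolding co_fl using HH_mult(2)[OF k'(1) h' p, of "- 1"] by simp
  finally show ?thesis .
qed

lemma av_PP_left:
  assumes f: "f \<in> LL p" and h: "h \<in> HH (conj_exp p)" and p: "1 < p"
  shows "av (PP f * cj h) = av (f * cj h)"
proof -
  have hL: "cj h \<in> LL (conj_exp p)" using h by (simp add: LL_cj HH_LL)
  have "f * cj h = PP f * cj h + (f - PP f) * cj h" by (simp add: algebra_simps)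
  then have "av (f * cj h) = av (PP f * cj h) + av ((f - PP f) * cj h)"
    using LL_Holder(1)[OF PP_LL[OF f p] hL p] LL_Holder(1)[OF LL_diff[OF f PP_LL[OF f p]] hL p] p by (simp add: av_add)
  then show ?thesis using av_QQ_HH[OF PP_compl[OF f p] h p] by simp
qed

lemma av_PP_right:
  assumes f: "f \<in> HH p" and h: "h \<in> LL (conj_exp p)" and p: "1 < p"
  shows "av (f * cj (PP h)) = av (f * cj h)"
proof -
  note q = conj_exp_props(1,3)[OF p]
  have "av (PP h * cj f) = av (h * cj f)" using av_PP_left[OF h _ q(1), of f] f q by simp
  then have "cnj (av (PP h * cj f)) = cnj (av (h * cj f))" by simp
  then show ?thesis unfolding av_cj[symmetric] by (simp add: mult.commute)
qed

lemma TT_adjoint: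
  assumes g: "g \<in> Bd" and f: "f \<in> HH p" and h: "h \<in> HH (conj_exp p)" and p: "1 < p"
  shows "av (TT g f * cj h) = av (f * cj (TT (cj g) h))"
proof -
  note q = conj_exp_props(1)[OF p]
  have "av (TT g f * cj h) = av (g * f * cj h)" unfolding TT_def by (rule av_PP_left[OF Bd_mult_LL[OF g f p] h p])
  also have "g * f * cj h = f * cj (cj g * h)" by (simp add: ac_simps)
  also have "av \<dots> = av (f * cj (TT (cj g) h))"
    unfolding TT_def by (rule av_PP_right[OF f Bd_mult_LL[OF _ h q] p, symmetric]) (use g in simp)
  finally show ?thesis .
qed

text \<open>The extremal function for Hoelder's inequality lies in \<open>L^p\<close> only;
  projecting it to \<open>HH p\<close> leaves the pairing with \<open>h\<close> unchanged and costs
  the constant of the Riesz projection.\<close>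

lemma HH_dual_norm:
  assumes p: "1 < p"
  shows "\<exists>C\<ge>0. \<forall>h\<in>HH (conj_exp p). \<exists>f\<in>HH p. nm p f \<le> C \<and> norm (av (f * cj h)) = nm (conj_exp p) h / (2 * pi)"
proof -
  note q = conj_exp_props(1,3)[OF p]
  obtain C where C: "0 \<le> C" "\<And>f. f \<in> LL p \<Longrightarrow> nm p (PP f) \<le> C * nm p f" using Riesz[OF p] by blast
  have "\<exists>f\<in>HH p. nm p f \<le> C \<and> norm (av (f * cj h)) = nm (conj_exp p) h / (2 * pi)" if h: "h \<in> HH (conj_exp p)" for h
  proof -
    obtain \<psi> where \<psi>: "\<psi> \<in> LL p" "nm p \<psi> \<le> 1" "av (h * \<psi>) = complex_of_real (nm (conj_exp p) h / (2 * pi))"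
      using LL_converse_Holder[OF HH_LL[OF h] q(1)] unfolding q(2) by blast
    have cL: "cj \<psi> \<in> LL p" using \<psi>(1) by (rule LL_cj)
    have "av (PP (cj \<psi>) * cj h) = av (cj \<psi> * cj h)" by (rule av_PP_left[OF cL h p])
    also have "\<dots> = cnj (av (h * \<psi>))" unfolding av_cj[symmetric] by (simp add: mult.commute)
    finally have "norm (av (PP (cj \<psi>) * cj h)) = norm (complex_of_real (nm (conj_exp p) h / (2 * pi)))" using \<psi>(3) by simp
    then have 1: "norm (av (PP (cj \<psi>) * cj h)) = nm (conj_exp p) h / (2 * pi)" unfolding norm_of_real by simp
    have "nm p (PP (cj \<psi>)) \<le> C * nm p \<psi>" using C(2)[OF cL] by (simp add: nm_cj)
    also have "\<dots> \<le> C * 1" using \<psi>(2) C(1) by (rule mult_left_mono)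
    finally show ?thesis using 1 PP_HH[OF cL p] by (intro bexI[of _ "PP (cj \<psi>)"]) auto
  qed
  then show ?thesis using C(1) by blast
qed

text \<open>For the lower bound, an almost extremal \<open>f\<close> is written as
  \<open>TT g (S f)\<close> and the operator is moved to \<open>h\<close>. For surjectivity, the
  functional belonging to the inverse is represented by some \<open>h\<close>, identified on
  analytic polynomials and extended by density.\<close>

theorem Inv_dual:
  assumes I: "Inv p g" and g: "g \<in> Bd" and p: "1 < p"
  shows "Inv (conj_exp p) (cj g)"
proof -
  define q where "q = conj_exp p"
  have q: "1 < q" "conj_exp q = p" using conj_exp_props[OF p] by (auto simp: q_def)
  have gc: "cj g \<in> Bd" using g by simp
  obtain S M where SM: "0 \<le> M \<and> (\<forall>h\<in>HH p. S h \<in> HH p \<and> TT g (S h) = h \<and> nm p (S h) \<le> M * nm p h) \<and>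
     (\<forall>f\<in>HH p. S (TT g f) = f) \<and> (\<forall>h\<in>HH p. \<forall>k\<in>HH p. S (h + k) = S h + S k) \<and> (\<forall>h\<in>HH p. \<forall>c. S (cst c * h) = cst c * S h)"
    using Inv_inverse[OF I g p] by (elim exE)
  have M: "0 \<le> M" and S: "\<And>h. h \<in> HH p \<Longrightarrow> S h \<in> HH p" "\<And>h. h \<in> HH p \<Longrightarrow> TT g (S h) = h"
     "\<And>h. h \<in> HH p \<Longrightarrow> nm p (S h) \<le> M * nm p h" "\<And>f. f \<in> HH p \<Longrightarrow> S (TT g f) = f"
     "\<And>h k. h \<in> HH p \<Longrightarrow> k \<in> HH p \<Longrightarrow> S (h + k) = S h + S k" "\<And>h c. h \<in> HH p \<Longrightarrow> S (cst c * h) = cst c * S h"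
    using SM by simp_all
  obtain C where C: "0 \<le> C" "\<And>h. h \<in> HH q \<Longrightarrow> \<exists>f\<in>HH p. nm p f \<le> C \<and> norm (av (f * cj h)) = nm q h / (2 * pi)"
    using HH_dual_norm[OF p] unfolding q_def by blast
  have below: "nm q h \<le> (2 * pi * (M * C)) * nm q (TT (cj g) h)" if h: "h \<in> HH q" for h
  proof -
    obtain f where f: "f \<in> HH p" "nm p f \<le> C" "norm (av (f * cj h)) = nm q h / (2 * pi)" using C(2)[OF h] by blast
    have T: "TT (cj g) h \<in> HH q" using gc h q by (intro TT_HH)
    have "av (f * cj h) = av (S f * cj (TT (cj g) h))"
      using TT_adjoint[OF g S(1)[OF f(1)] _ p, of h] S(2)[OF f(1)] h by (simp add: q_def)
    then have "nm q h / (2 * pi) \<le> nm p (S f) * nm q (TT (cj g) h)"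
      using LL_Holder(2)[OF HH_LL[OF S(1)[OF f(1)]] _ p, of "cj (TT (cj g) h)"] LL_cj[OF HH_LL[OF T]] f(3)
      by (simp add: q_def nm_cj)
    also have "\<dots> \<le> (M * C) * nm q (TT (cj g) h)"
    proof (rule mult_right_mono)
      show "nm p (S f) \<le> M * C" using S(3)[OF f(1)] mult_left_mono[OF f(2) M] by linarith
    qed simp
    finally show ?thesis by (simp add: field_simps)
  qed
  have surj: "\<exists>h\<in>HH q. TT (cj g) h = k" if k: "k \<in> HH q" for k
  proof -
    \<comment> \<open>Forced by the equation: pairing \<open>TT (cj g) h = k\<close> with
      \<open>S f\<close> shows that a solution \<open>h\<close> must satisfy
      \<open>av (f * cj h) = av (S f * cj k)\<close>.\<close>
    define \<Lambda> where "\<Lambda> f = av (S f * cj k)" for f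
    have kL: "cj k \<in> LL (conj_exp p)" using k by (simp add: q_def LL_cj HH_LL)
    have \<Lambda>b: "norm (\<Lambda> f) \<le> M * nm q k * nm p f" if "f \<in> HH p" for f
    proof -
      have "norm (\<Lambda> f) \<le> nm p (S f) * nm q k"
        unfolding \<Lambda>_def using LL_Holder(2)[OF HH_LL[OF S(1)[OF that]] kL p] by (simp add: q_def nm_cj)
      also have "\<dots> \<le> (M * nm p f) * nm q k" using S(3)[OF that] by (rule mult_right_mono) simp
      finally show ?thesis by (simp add: ac_simps)
    qed
    have \<Lambda>1: "\<Lambda> (f + f') = \<Lambda> f + \<Lambda> f'" if "f \<in> HH p" "f' \<in> HH p" for f f'
      unfolding \<Lambda>_def S(5)[OF that] distrib_right using that S(1) kL p by (intro av_add LL_Holder(1)[where p=p]) (auto intro: HH_LL)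
    have \<Lambda>2: "\<Lambda> (cst c * f) = c * \<Lambda> f" if "f \<in> HH p" for f c
      unfolding \<Lambda>_def S(6)[OF that] mult.assoc by (rule av_cst)
    obtain CP where CP: "0 \<le> CP" "\<And>f. f \<in> LL p \<Longrightarrow> nm p (PP f) \<le> CP * nm p f" using Riesz[OF p] by blast
    have TPp: "f \<in> LL p" if "f \<in> TP" for f using that p by (auto intro: TP_LL)
    have PH: "PP f \<in> HH p" if "f \<in> TP" for f using TPp[OF that] p by (rule PP_HH)
    have "\<exists>Y\<in>LL (conj_exp p). nm (conj_exp p) Y \<le> 2 * pi * (M * nm q k * CP) \<and> (\<forall>j. co Y j = \<Lambda> (PP (zp (- j))))"
    proof (rule functional_rep[OF p, of _ "\<lambda>f. \<Lambda> (PP f)"])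
      show "0 \<le> M * nm q k * CP" using M CP by simp
      show "\<Lambda> (PP (f + f')) = \<Lambda> (PP f) + \<Lambda> (PP f')" if "f \<in> TP" "f' \<in> TP" for f f'
        using that by (simp add: PP_add[OF TPp TPp p] \<Lambda>1 PH)
      show "\<Lambda> (PP (cst c * f)) = c * \<Lambda> (PP f)" if "f \<in> TP" for f c
        using that by (simp add: PP_cst[OF TPp TPp p] \<Lambda>2 PH)
      show "norm (\<Lambda> (PP f)) \<le> M * nm q k * CP * nm p f" if "f \<in> TP" for f
        using \<Lambda>b[OF PH[OF that]] mult_left_mono[OF CP(2)[OF TPp[OF that]], of "M * nm q k"] M by (simp add: mult.assoc)
    qed
    then obtain Y where Y: "Y \<in> LL q" "\<And>j. co Y j = \<Lambda> (PP (zp (- j)))" unfolding q_def by blast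
    define h where "h = PP (cj Y)"
    have cY: "cj Y \<in> LL (conj_exp p)" using Y(1) by (simp add: q_def LL_cj)
    have h: "h \<in> HH q" unfolding h_def using Y(1) q by (intro PP_HH LL_cj)
    have hL: "cj h \<in> LL (conj_exp p)" using h by (simp add: q_def LL_cj HH_LL)
    have repA: "av (f * cj h) = \<Lambda> f" if "f \<in> AP" for f
      using that
    proof (induction rule: AP.induct)
      case AP_0 show ?case using \<Lambda>2[OF HH_0[OF p], of 0] by (simp add: cst_simps)
    next
      case (AP_step u c j)
      have zH: "zp (int j) \<in> HH p" using p by (simp add: HH_monom)
      have uH: "u \<in> HH p" using AP_step p by (simp add: AP_HH)
      have czH: "cst c * zp (int j) \<in> HH p" using zH p by (rule HH_cst)
      have "av (zp (int j) * cj h) = av (zp (int j) * cj (cj Y))" unfolding h_def by (rule av_PP_right[OF zH cY p])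
      also have "\<dots> = co Y (- int j)" by (simp add: co_def mult.commute)
      also have "\<dots> = \<Lambda> (zp (int j))" unfolding Y(2) by (simp add: PP_id[OF zH p])
      finally have z: "av (zp (int j) * cj h) = \<Lambda> (zp (int j))" .
      have "(cst c * zp (int j) + u) * cj h = cst c * (zp (int j) * cj h) + u * cj h" by (simp add: algebra_simps)
      then have "av ((cst c * zp (int j) + u) * cj h) = c * av (zp (int j) * cj h) + av (u * cj h)"
        using LL_Holder(1)[OF HH_LL[OF zH] hL p] LL_Holder(1)[OF HH_LL[OF uH] hL p] by (simp add: av_add av_cst LL_cst)
      then show ?case unfolding \<Lambda>1[OF czH uH] \<Lambda>2[OF zH] z AP_step.IH .
    qed
    have rep: "av (f * cj h) = \<Lambda> f" if f: "f \<in> HH p" for f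
    proof (rule ccontr)
      assume ne: "av (f * cj h) \<noteq> \<Lambda> f"
      define d where "d = norm (av (f * cj h) - \<Lambda> f)"
      have d: "0 < d" using ne by (simp add: d_def)
      define K where "K = nm q h + M * nm q k + 1"
      have K: "0 < K" using M by (simp add: K_def add_nonneg_pos)
      obtain u where u: "u \<in> AP" "nm p (f - u) < d / K" using AP_dense[OF f p, of "d / K"] d K by auto
      have uH: "u \<in> HH p" using u p by (simp add: AP_HH)
      have fu: "f - u \<in> HH p" using f uH p by (rule HH_diff)
      have "av (f * cj h) = av ((f - u) * cj h) + av (u * cj h)"
      proof -
        have "f * cj h = (f - u) * cj h + u * cj h" by (simp add: algebra_simps)
        then show ?thesis using LL_Holder(1)[OF HH_LL[OF fu] hL p] LL_Holder(1)[OF HH_LL[OF uH] hL p] by (simp add: av_add)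
      qed
      moreover have "\<Lambda> f = \<Lambda> (f - u) + \<Lambda> u" using \<Lambda>1[OF fu uH] by simp
      ultimately have "d = norm (av ((f - u) * cj h) - \<Lambda> (f - u))" unfolding d_def repA[OF u(1)] by simp
      also have "\<dots> \<le> norm (av ((f - u) * cj h)) + norm (\<Lambda> (f - u))" by (rule norm_triangle_ineq4)
      also have "\<dots> \<le> nm p (f - u) * nm q h + M * nm q k * nm p (f - u)"
        using LL_Holder(2)[OF HH_LL[OF fu] hL p] \<Lambda>b[OF fu] by (intro add_mono) (auto simp: q_def nm_cj)
      also have "\<dots> \<le> nm p (f - u) * K" by (simp add: K_def algebra_simps)
      also have "\<dots> < d" using u(2) K by (simp add: field_simps)
      finally show False by simp
    qed
    have "TT (cj g) h = k"
    proof (rule co_eqI)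
      have T: "TT (cj g) h \<in> HH q" using gc h q by (intro TT_HH)
      show "TT (cj g) h \<in> LL 1" "k \<in> LL 1" using T k LL_imp_LL1[OF HH_LL q(1)] by auto
      fix j
      show "co (TT (cj g) h) j = co k j"
      proof (cases "j < 0")
        case True then show ?thesis using T k by (simp add: HH_def)
      next
        case False
        then have zH: "zp j \<in> HH p" using p by (simp add: HH_monom)
        have cc: "av (zp j * cj v) = cnj (co v j)" for v
          unfolding co_def av_cj[symmetric] by (simp add: mult.commute)
        have "av (zp j * cj (TT (cj g) h)) = av (TT g (zp j) * cj h)"
          using TT_adjoint[OF g zH _ p, of h] h by (simp add: q_def)
        also have "\<dots> = \<Lambda> (TT g (zp j))" by (rule rep) (use g zH p in \<open>simp add: TT_HH\<close>)
        also have "\<dots> = av (zp j * cj k)" unfolding \<Lambda>_def by (simp add: S(4)[OF zH])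
        finally have "cnj (co (TT (cj g) h) j) = cnj (co k j)" unfolding cc .
        then show ?thesis by simp
      qed
    qed
    then show ?thesis using h by blast
  qed
  have "0 \<le> 2 * pi * (M * C)" using M C(1) by simp
  then show ?thesis unfolding Inv_def q_def[symmetric] using below surj by blast
qed

section \<open>From the Fredholm index to invertibility\<close>

lemma Linf_iff: "F \<in> Linf \<longleftrightarrow> cm F \<and> mk F \<in> Bd"
  by (auto simp: Linf_def cm_def Bd_def circ_def mk_simps(15)[unfolded cm_def])

lemma Hp_iff: "F \<in> Hp p \<longleftrightarrow> cm F \<and> mk F \<in> HH p"
  by (auto simp: Hp_def HH_def Lp_iff fc_co)

lemma HH_rep: assumes "f \<in> HH p" obtains F where "F \<in> Hp p" "cm F" "f = mk F"
  using mfun_rep[of f] assms by (metis Hp_iff)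

text \<open>The choice in \<open>Pr\<close> is determined up to null sets, since it fixes all
  Fourier coefficients of an \<open>L^1\<close> function.\<close>

lemma Pr_mk:
  assumes F: "cm F" "mk F \<in> LL p" and p: "1 < p"
  shows "cm (Pr F)" "mk (Pr F) = PP (mk F)"
proof -
  obtain G where G: "cm G" "PP (mk F) = mk G" by (rule mfun_rep)
  have ex: "G \<in> Lp 1 \<and> (\<forall>j. fc G j = (if j \<ge> 0 then fc F j else 0))"
    using PP_LL1[OF F(2) p] co_PP[OF F(2) p] F G by (simp add: Lp_iff fc_co)
  have sm: "Pr F \<in> Lp 1 \<and> (\<forall>j. fc (Pr F) j = (if j \<ge> 0 then fc F j else 0))"
    unfolding Pr_def by (rule someI[of _ G]) (rule ex)
  then show c: "cm (Pr F)" by (simp add: Lp_iff)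
  show "mk (Pr F) = PP (mk F)"
    by (rule PP_eqI[symmetric]) (use sm c F in \<open>auto simp: Lp_iff fc_co\<close>)
qed

lemma Toep_mk:
  assumes "cm a" "mk a \<in> Bd" "F \<in> Hp p" "1 < p"
  shows "cm (Toep a F)" "mk (Toep a F) = TT (mk a) (mk F)"
proof -
  have F: "cm F" "mk F \<in> HH p" using assms(3) by (auto simp: Hp_iff)
  have e: "mk (\<lambda>z. a z * F z) = mk a * mk F" using assms F by (simp add: mk_simps)
  have L: "mk (\<lambda>z. a z * F z) \<in> LL p" unfolding e by (rule Bd_mult_LL[OF assms(2) F(2) assms(4)])
  have c: "cm (\<lambda>z. a z * F z)" using assms F by simp
  show "cm (Toep a F)" "mk (Toep a F) = TT (mk a) (mk F)"
    using Pr_mk[OF c L assms(4)] unfolding Toep_def TT_def e by auto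
qed

section \<open>Kernels, ranges and closed subspaces\<close>

definition kerS :: "real \<Rightarrow> mfun \<Rightarrow> (int \<Rightarrow> complex) set" where
  "kerS p g = {co f | f. f \<in> HH p \<and> TT g f = 0}"
definition ranS :: "real \<Rightarrow> mfun \<Rightarrow> (int \<Rightarrow> complex) set" where
  "ranS p g = {co (TT g f) | f. f \<in> HH p}"
definition closedS :: "real \<Rightarrow> mfun set \<Rightarrow> bool" where
  "closedS p S \<longleftrightarrow> S \<subseteq> HH p \<and> 0 \<in> S \<and> (\<forall>f\<in>S. \<forall>g\<in>S. f + g \<in> S) \<and> (\<forall>f\<in>S. \<forall>c. cst c * f \<in> S) \<and>
     (\<forall>f h. (\<forall>k. f k \<in> S) \<longrightarrow> h \<in> LL p \<longrightarrow> (\<lambda>k. nm p (f k - h)) \<longlonglongrightarrow> 0 \<longrightarrow> h \<in> S)"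

lemma closedS_I:
  assumes "S \<subseteq> HH p" "0 \<in> S" "\<And>f g. f \<in> S \<Longrightarrow> g \<in> S \<Longrightarrow> f + g \<in> S" "\<And>f c. f \<in> S \<Longrightarrow> cst c * f \<in> S"
    "\<And>f h. (\<And>k. f k \<in> S) \<Longrightarrow> h \<in> LL p \<Longrightarrow> (\<lambda>k. nm p (f k - h)) \<longlonglongrightarrow> 0 \<Longrightarrow> h \<in> S"
  shows "closedS p S"
  unfolding closedS_def
proof (intro conjI ballI allI impI)
  show "h \<in> S" if "\<forall>k. f k \<in> S" "h \<in> LL p" "(\<lambda>k. nm p (f k - h)) \<longlonglongrightarrow> 0" for f h
    by (rule assms(5)[OF _ that(2,3)]) (use that(1) in simp)
qed (rule assms(1-4); assumption)+

lemma closedS_D: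
  assumes "closedS p S"
  shows "S \<subseteq> HH p" "0 \<in> S" "\<And>f g. f \<in> S \<Longrightarrow> g \<in> S \<Longrightarrow> f + g \<in> S" "\<And>f c. f \<in> S \<Longrightarrow> cst c * f \<in> S"
    "\<And>f h. (\<And>k. f k \<in> S) \<Longrightarrow> h \<in> LL p \<Longrightarrow> (\<lambda>k. nm p (f k - h)) \<longlonglongrightarrow> 0 \<Longrightarrow> h \<in> S"
proof -
  note c = assms[unfolded closedS_def]
  show "S \<subseteq> HH p" "0 \<in> S" "\<And>f g. f \<in> S \<Longrightarrow> g \<in> S \<Longrightarrow> f + g \<in> S" "\<And>f c. f \<in> S \<Longrightarrow> cst c * f \<in> S"
    using c by simp_all
  show "h \<in> S" if "\<And>k. f k \<in> S" "h \<in> LL p" "(\<lambda>k. nm p (f k - h)) \<longlonglongrightarrow> 0" for f h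
    using c[THEN conjunct2, THEN conjunct2, THEN conjunct2, THEN conjunct2, rule_format, of f h] that by simp
qed

lemma fredholm_data:
  assumes F: "fredholm_index p (Toep a) \<kappa>" and a: "cm a" "mk a \<in> Bd" and p: "1 < p"
  shows "closedS p (TT (mk a) ` HH p)"
    and "\<exists>K C. finite K \<and> finite C \<and> cindep K \<and> cspan K = kerS p (mk a) \<and> cindep C \<and> C \<subseteq> co ` HH p \<and>
      {(\<lambda>j. r j + s j) | r s. r \<in> ranS p (mk a) \<and> s \<in> cspan C} = co ` HH p \<and>
      cspan C \<inter> ranS p (mk a) = {\<lambda>_. 0} \<and> \<kappa> = int (card K) - int (card C)"
proof -
  define g where "g = mk a"
  have T: "cm (Toep a F) \<and> mk (Toep a F) = TT g (mk F)" if "F \<in> Hp p" for F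
    using Toep_mk[OF a that p] by (simp add: g_def)
  have g: "g \<in> Bd" using a by (simp add: g_def)
  have fcHp: "fc ` Hp p = co ` HH p"
  proof (intro Set.set_eqI iffI)
    fix y assume "y \<in> fc ` Hp p"
    then obtain F where F: "F \<in> Hp p" "y = fc F" by blast
    then have "y = co (mk F)" "mk F \<in> HH p" by (auto simp: Hp_iff fc_co fun_eq_iff)
    then show "y \<in> co ` HH p" by blast
  next
    fix y assume "y \<in> co ` HH p"
    then obtain f where f: "f \<in> HH p" "y = co f" by blast
    obtain F where F: "F \<in> Hp p" "cm F" "f = mk F" using HH_rep[OF f(1)] .
    have "y = fc F" using f F by (auto simp: fc_co fun_eq_iff)
    then show "y \<in> fc ` Hp p" using F by blast
  qed
  have ker: "ker_seq p (Toep a) = kerS p g"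
  proof (intro Set.set_eqI iffI)
    fix y assume "y \<in> ker_seq p (Toep a)"
    then obtain F where F: "F \<in> Hp p" "y = fc F" "ae_eq (Toep a F) (\<lambda>_. 0)" by (auto simp: ker_seq_def)
    have "mk (Toep a F) = 0" using conjunct1[OF T[OF F(1)]] F(3) by (simp add: mk_simps(1) mk_eq_iff)
    moreover have "y = co (mk F)" using F by (auto simp: Hp_iff fc_co fun_eq_iff)
    ultimately show "y \<in> kerS p g" using T[OF F(1)] F(1) by (auto simp: kerS_def Hp_iff)
  next
    fix y assume "y \<in> kerS p g"
    then obtain f where f: "f \<in> HH p" "y = co f" "TT g f = 0" by (auto simp: kerS_def)
    obtain F where F: "F \<in> Hp p" "cm F" "f = mk F" using HH_rep[OF f(1)] .
    have "ae_eq (Toep a F) (\<lambda>_. 0)" using T[OF F(1)] f F by (simp add: mk_simps(1) mk_eq_iff[symmetric])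
    moreover have "y = fc F" using f F by (auto simp: fc_co fun_eq_iff)
    ultimately show "y \<in> ker_seq p (Toep a)" using F by (auto simp: ker_seq_def)
  qed
  have ran: "ran_seq p (Toep a) = ranS p g"
  proof (intro Set.set_eqI iffI)
    fix y assume "y \<in> ran_seq p (Toep a)"
    then obtain F where F: "F \<in> Hp p" "y = fc (Toep a F)" by (auto simp: ran_seq_def)
    then have "y = co (TT g (mk F))" using T[OF F(1)] by (auto simp: fc_co fun_eq_iff)
    then show "y \<in> ranS p g" using F by (auto simp: ranS_def Hp_iff)
  next
    fix y assume "y \<in> ranS p g"
    then obtain f where f: "f \<in> HH p" "y = co (TT g f)" by (auto simp: ranS_def)
    obtain F where F: "F \<in> Hp p" "cm F" "f = mk F" using HH_rep[OF f(1)] .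
    have "y = fc (Toep a F)" using f F T[OF F(1)] by (auto simp: fc_co fun_eq_iff)
    then show "y \<in> ran_seq p (Toep a)" using F by (auto simp: ran_seq_def)
  qed
  show "\<exists>K C. finite K \<and> finite C \<and> cindep K \<and> cspan K = kerS p (mk a) \<and> cindep C \<and> C \<subseteq> co ` HH p \<and>
      {(\<lambda>j. r j + s j) | r s. r \<in> ranS p (mk a) \<and> s \<in> cspan C} = co ` HH p \<and>
      cspan C \<inter> ranS p (mk a) = {\<lambda>_. 0} \<and> \<kappa> = int (card K) - int (card C)"
    using F unfolding fredholm_index_def ker ran fcHp g_def by (elim conjE) assumption
  have cl: "closed_range p (Toep a)" using F by (simp add: fredholm_index_def)
  have "\<exists>e\<in>HH p. TT g e = h" if f: "\<And>k. f k \<in> TT g ` HH p" and h: "h \<in> LL p" and l: "(\<lambda>k. nm p (f k - h)) \<longlonglongrightarrow> 0" for f h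
  proof -
    have "\<exists>F. F \<in> Hp p \<and> f k = mk (Toep a F)" for k
    proof -
      obtain e where "e \<in> HH p" "f k = TT g e" using f[of k] by blast
      then show ?thesis using T HH_rep[of e p] by metis
    qed
    then obtain F where Fk: "\<And>k. F k \<in> Hp p" "\<And>k. f k = mk (Toep a (F k))" by metis
    obtain H where H: "cm H" "h = mk H" by (rule mfun_rep)
    have "pnorm p (\<lambda>z. Toep a (F k) z - H z) = nm p (f k - h)" for k
      using T[OF Fk(1)[of k]] H unfolding Fk(2)[of k] by (simp add: pnorm_nm mk_simps(5)[symmetric])
    then have "(\<lambda>k. pnorm p (\<lambda>z. Toep a (F k) z - H z)) \<longlonglongrightarrow> 0" using l by simp
    moreover have "H \<in> Lp p" using h H by (simp add: Lp_iff)
    ultimately obtain E where E: "E \<in> Hp p" "ae_eq (Toep a E) H" using cl Fk(1) unfolding closed_range_def by blast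
    then have "TT g (mk E) = h" using T[OF E(1)] H by (metis mk_eq_iff)
    then show ?thesis using E by (auto simp: Hp_iff)
  qed
  note lim = this
  show "closedS p (TT (mk a) ` HH p)" unfolding g_def[symmetric]
  proof (rule closedS_I)
    show "h \<in> TT g ` HH p" if "\<And>k. f k \<in> TT g ` HH p" "h \<in> LL p" "(\<lambda>k. nm p (f k - h)) \<longlonglongrightarrow> 0" for f h
      using lim[OF that] by blast
    show "TT g ` HH p \<subseteq> HH p" using g p by (auto simp: TT_HH)
    show "0 \<in> TT g ` HH p" using HH_0[OF p] PP_0 by (auto simp: TT_def image_iff intro!: bexI[of _ 0])
    show "x + y \<in> TT g ` HH p" if "x \<in> TT g ` HH p" "y \<in> TT g ` HH p" for x y
      using that g p by (auto simp: TT_add[symmetric] HH_add)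
    show "cst c * x \<in> TT g ` HH p" if "x \<in> TT g ` HH p" for x c
      using that g p by (auto simp: TT_cst[symmetric] HH_cst)
  qed
qed

text \<open>Coburn's argument: if \<open>f\<close> is a nonzero kernel element, then \<open>m = g f\<close> is a nonzero anti-analytic function, and
  the functions \<open>P (z^k m)\<close> span all analytic polynomials.\<close>

lemma Coburn:
  assumes g: "g \<in> Bd" "g * g' = 1" and f: "f \<in> HH p" "f \<noteq> 0" "TT g f = 0" and p: "1 < p" and u: "u \<in> AP"
  shows "u \<in> TT g ` HH p"
proof -
  define m where "m = g * f"
  have mL: "m \<in> LL p" unfolding m_def by (rule Bd_mult_LL[OF g(1) f(1) p])
  have mQ: "m \<in> QQ p" using f(3) mL p by (simp add: TT_def m_def PP_eq_0_iff)
  have "m \<noteq> 0"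
  proof
    assume "m = 0"
    moreover have "g' * m = (g * g') * f" by (simp only: m_def ac_simps)
    ultimately show False using f(2) g(2) by simp
  qed
  then obtain j where "co m j \<noteq> 0" using co_unique[OF LL_imp_LL1[OF mL p]] by blast
  then have "\<exists>i::nat. co m (- int i) \<noteq> 0"
  proof -
    assume j: "co m j \<noteq> 0"
    then have "\<not> 0 \<le> j" using QQ_nonneg[OF mQ, of j] by blast
    then have "- int (nat (- j)) = j" by simp
    then show ?thesis using j by metis
  qed
  \<comment> \<open>\<open>- int i0\<close> is the highest index that occurs in \<open>m\<close>.
    Multiplication by \<open>zp (int (i0 + k))\<close> moves this top coefficient to index
    \<open>k\<close>, so \<open>v k\<close> is a polynomial of exact degree \<open>k\<close>, and
    the elimination in \<open>main\<close> is triangular.\<close>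
  define i0 where "i0 = (LEAST i::nat. co m (- int i) \<noteq> 0)"
  have i0: "co m (- int i0) \<noteq> 0" unfolding i0_def using \<open>\<exists>i::nat. co m (- int i) \<noteq> 0\<close> by (rule LeastI_ex)
  have i1: "co m (- int i) = 0" if "i < i0" for i
    using not_less_Least[of i "\<lambda>i. co m (- int i) \<noteq> 0"] that unfolding i0_def by simp
  have top: "co m j = 0" if "- int i0 < j" for j
  proof (cases "0 \<le> j")
    case False
    then have "- int (nat (- j)) = j" "nat (- j) < i0" using that by auto
    then show ?thesis using i1[of "nat (- j)"] by simp
  qed (rule QQ_nonneg[OF mQ])
  define v where "v k = TT g (zp (int (i0 + k)) * f)" for k :: nat
  have vH: "v k \<in> HH p" and vR: "v k \<in> TT g ` HH p" for k
  proof -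
    have "zp (int (i0 + k)) * f \<in> HH p" using f p by (intro HH_zp) auto
    then show "v k \<in> HH p" "v k \<in> TT g ` HH p" unfolding v_def using g p by (auto simp: TT_HH)
  qed
  have cv: "co (v k) j = (if 0 \<le> j then co m (j - int (i0 + k)) else 0)" for k j
  proof -
    have "g * (zp (int (i0 + k)) * f) = zp (int (i0 + k)) * m" by (simp add: m_def ac_simps)
    then have "v k = PP (zp (int (i0 + k)) * m)" by (simp add: v_def TT_def)
    moreover have "zp (int (i0 + k)) * m \<in> LL p" using mL p by (simp add: LL_zp)
    ultimately show ?thesis using p by (simp add: co_PP co_zp_mult)
  qed
  have R: "x + y \<in> TT g ` HH p" "cst c * x \<in> TT g ` HH p" if xy: "x \<in> TT g ` HH p" "y \<in> TT g ` HH p" for x y c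
  proof -
    obtain e e' where e: "e \<in> HH p" "x = TT g e" "e' \<in> HH p" "y = TT g e'" using xy by blast
    show "x + y \<in> TT g ` HH p" using TT_add[OF g(1) e(1,3) p] HH_add[OF e(1,3) p] e by (metis image_eqI)
    show "cst c * x \<in> TT g ` HH p" using TT_cst[OF g(1) e(1) p] HH_cst[OF e(1) p] e by (metis image_eqI)
  qed
  have main: "w \<in> TT g ` HH p" if "w \<in> HH p" "\<And>j. int k \<le> j \<Longrightarrow> co w j = 0" for k w
    using that
  proof (induction k arbitrary: w)
    case 0
    have "co w j = 0" for j using 0 HH_neg[OF 0(1), of j] by (cases "0 \<le> j") auto
    then have "w = 0" using co_unique[OF LL_imp_LL1[OF HH_LL[OF 0(1)] p]] by blast
    then show ?case using HH_0[OF p] PP_0 by (auto simp: TT_def image_iff intro!: bexI[of _ 0])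
  next
    case (Suc k)
    define c where "c = co w (int k) / co m (- int i0)"
    define w' where "w' = w - cst c * v k"
    have w'H: "w' \<in> HH p" unfolding w'_def using Suc(2) vH p by (intro HH_diff HH_cst)
    have "co w' j = 0" if "int k \<le> j" for j
    proof -
      have L1: "w \<in> LL 1" "cst c * v k \<in> LL 1"
        using LL_imp_LL1[OF HH_LL[OF Suc(2)] p] LL_imp_LL1[OF HH_LL[OF HH_cst[OF vH[of k] p, of c]] p] by auto
      have e: "co w' j = co w j - c * co m (j - int (i0 + k))"
        unfolding w'_def co_diff[OF L1] co_cst cv using that by simp
      show ?thesis
      proof (cases "j = int k")
        case True then show ?thesis unfolding e using i0 by (simp add: c_def)
      next
        case False
        then show ?thesis unfolding e using that Suc(3)[of j] top[of "j - int (i0 + k)"] by simp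
      qed
    qed
    then have "w' \<in> TT g ` HH p" using Suc.IH[OF w'H] by blast
    then have "w' + cst c * v k \<in> TT g ` HH p" using R(1)[OF _ R(2)[OF vR vR]] by simp
    then show ?case by (simp add: w'_def)
  qed
  have "\<exists>k. \<forall>j\<ge>int k. co u j = 0" using u
  proof (induction rule: AP.induct)
    case (AP_step w c i)
    then obtain k where k: "\<forall>j\<ge>int k. co w j = 0" by blast
    have L1: "cst c * zp (int i) \<in> LL 1" "w \<in> LL 1" using AP_TP[OF AP_step(1)] by (auto simp: Bd_LL TP_LL)
    show ?case using k by (intro exI[of _ "max k (Suc i)"]) (auto simp: co_add[OF L1] co_cst co_zp)
  qed simp
  then show ?thesis using main[OF AP_HH[OF u p]] by blast
qed

lemma closedS_dense_full:
  assumes S: "closedS p S" and A: "AP \<subseteq> S" and p: "1 < p" and h: "h \<in> HH p"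
  shows "h \<in> S"
proof -
  have "\<exists>u\<in>AP. nm p (u - h) < 1 / (real n + 1)" for n :: nat
    using AP_dense[OF h p, of "1 / (real n + 1)"] p by (auto simp: nm_minus_commute[of p h])
  then obtain u where u: "\<And>n. u n \<in> AP" "\<And>n. nm p (u n - h) < 1 / (real n + 1)" by metis
  have "(\<lambda>n. nm p (u n - h)) \<longlonglongrightarrow> 0"
  proof (rule tendsto_sandwich[OF _ _ tendsto_const])
    show "(\<lambda>n. 1 / (real n + 1)) \<longlonglongrightarrow> 0"
      using LIMSEQ_inverse_real_of_nat by (simp add: inverse_eq_divide add.commute)
  qed (use u(2) in \<open>auto intro!: always_eventually less_imp_le\<close>)
  then show ?thesis using closedS_D(5)[OF S _ HH_LL[OF h]] u(1) A by blast
qed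

text \<open>If \<open>v\<close> lies outside \<open>S\<close>, it has a positive distance
  \<open>\<delta>\<close> from \<open>S\<close>. The coefficients of \<open>v\<close> along a
  convergent sequence then form a Cauchy sequence, so both parts of the sum converge
  separately.\<close>

lemma closedS_add_vector:
  assumes S: "closedS p S" and v: "v \<in> HH p" and p: "1 < p"
  shows "closedS p {s + cst c * v | s c. s \<in> S}"
proof -
  have p0: "0 < p" using p by simp
  note SH = closedS_D(1)[OF S] and S0 = closedS_D(2)[OF S] and Sa = closedS_D(3)[OF S]
    and Sc = closedS_D(4)[OF S] and Sl = closedS_D(5)[OF S]
  define S' where "S' = {s + cst c * v | s c. s \<in> S}"
  have 1: "S' \<subseteq> HH p" unfolding S'_def using SH v p by (auto intro!: HH_add HH_cst)
  have 2: "0 \<in> S'" unfolding S'_def using S0 by (auto intro!: exI[of _ 0] simp: cst_simps)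
  have 3: "f + g \<in> S'" if fg: "f \<in> S'" "g \<in> S'" for f g
  proof -
    obtain s c t d where "f = s + cst c * v" "s \<in> S" "g = t + cst d * v" "t \<in> S" using fg unfolding S'_def by blast
    then have "f + g = (s + t) + cst (c + d) * v" "s + t \<in> S" using Sa by (auto simp: cst_simps algebra_simps)
    then show ?thesis unfolding S'_def by blast
  qed
  have 4: "cst c * f \<in> S'" if fS: "f \<in> S'" for f c
  proof -
    obtain s d where "f = s + cst d * v" "s \<in> S" using fS unfolding S'_def by blast
    then have "cst c * f = cst c * s + cst (c * d) * v" "cst c * s \<in> S" using Sc by (auto simp: cst_simps algebra_simps)
    then show ?thesis unfolding S'_def by blast
  qed
  have 5: "h \<in> S'" if f: "\<And>k. f k \<in> S'" and h: "h \<in> LL p" and l: "(\<lambda>k. nm p (f k - h)) \<longlonglongrightarrow> 0" for f h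
  proof (cases "v \<in> S")
    case True
    have "S' \<subseteq> S" unfolding S'_def using True Sa Sc by auto
    then have "f k \<in> S" for k using f[of k] by blast
    then have "h \<in> S" by (rule Sl[of f, OF _ h l])
    moreover have "h = h + cst 0 * v" by (simp add: cst_simps)
    ultimately show ?thesis unfolding S'_def by blast
  next
    case False
    have "\<exists>\<delta>>0. \<forall>s\<in>S. \<delta> \<le> nm p (s - v)"
    proof (rule ccontr)
      assume neg: "\<not> (\<exists>\<delta>>0. \<forall>s\<in>S. \<delta> \<le> nm p (s - v))"
      have "\<exists>s\<in>S. nm p (s - v) < 1 / (real n + 1)" for n :: nat
      proof -
        have "0 < 1 / (real n + 1)" by simp
        then have "\<not> (\<forall>s\<in>S. 1 / (real n + 1) \<le> nm p (s - v))" using neg by blast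
        then show ?thesis by (simp add: not_le)
      qed
      then obtain s where s: "\<And>n. s n \<in> S" "\<And>n. nm p (s n - v) < 1 / (real n + 1)" by metis
      have "(\<lambda>n. nm p (s n - v)) \<longlonglongrightarrow> 0"
      proof (rule tendsto_sandwich[OF _ _ tendsto_const])
        show "(\<lambda>n. 1 / (real n + 1)) \<longlonglongrightarrow> 0"
          using LIMSEQ_inverse_real_of_nat by (simp add: inverse_eq_divide add.commute)
      qed (use s(2) in \<open>auto intro!: always_eventually less_imp_le\<close>)
      then have "v \<in> S" using Sl[of s v, OF s(1) HH_LL[OF v]] by blast
      then show False using False by blast
    qed
    then obtain \<delta> where \<delta>: "0 < \<delta>" "\<And>s. s \<in> S \<Longrightarrow> \<delta> \<le> nm p (s - v)" by blast
    have "\<exists>s c. f k = s + cst c * v \<and> s \<in> S" for k using f[of k] by (auto simp: S'_def)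
    then obtain s c where sc: "\<And>k. f k = s k + cst (c k) * v" "\<And>k. s k \<in> S" by metis
    have fL: "f k \<in> LL p" for k using f 1 HH_LL by blast
    have est: "norm (c k - c l) * \<delta> \<le> nm p (f k - f l)" for k l
    proof (cases "c k = c l")
      case False
      define \<mu> where "\<mu> = c k - c l"
      have l0: "\<mu> \<noteq> 0" using False by (simp add: \<mu>_def)
      define t where "t = cst (- 1 / \<mu>) * (s k + cst (-1) * s l)"
      have tS: "t \<in> S" unfolding t_def by (intro Sa Sc sc)
      have "f k - f l = cst (- \<mu>) * (t - v)"
      proof -
        have "cst (- \<mu>) * t = s k - s l"
          unfolding t_def mult.assoc[symmetric] cst_simps(4)[symmetric] using l0 by (simp add: cst_simps)
        moreover have "f k - f l = s k - s l + cst \<mu> * v"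
          unfolding sc \<mu>_def by (simp add: cst_simps algebra_simps)
        ultimately show ?thesis by (simp add: right_diff_distrib cst_simps)
      qed
      then have "nm p (f k - f l) = norm \<mu> * nm p (t - v)" by (simp add: nm_cst[OF p0])
      then show ?thesis using \<delta>(2)[OF tS] by (simp add: \<mu>_def mult_left_mono)
    qed simp
    have "Cauchy c"
    proof (rule metric_CauchyI)
      fix e :: real assume e: "0 < e"
      have "\<forall>\<^sub>F k in sequentially. nm p (f k - h) < e * \<delta> / 2" using e \<delta> by (intro order_tendstoD(2)[OF l]) simp
      then obtain N where N: "\<And>k. N \<le> k \<Longrightarrow> nm p (f k - h) < e * \<delta> / 2" by (auto simp: eventually_sequentially)
      have "dist (c m) (c n) < e" if "N \<le> m" "N \<le> n" for m n
      proof -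
        have "f m - f n = (f m - h) - (f n - h)" by simp
        then have "nm p (f m - f n) \<le> nm p (f m - h) + nm p (f n - h)"
          using nm_triangle_diff[OF LL_diff[OF fL h] LL_diff[OF fL h] p] p0 by (metis less_imp_le)
        also have "\<dots> < e * \<delta>" using N[OF that(1)] N[OF that(2)] by linarith
        finally have "norm (c m - c n) * \<delta> < e * \<delta>" using est[of m n] by linarith
        then show ?thesis using \<delta> by (simp add: dist_norm)
      qed
      then show "\<exists>N. \<forall>m\<ge>N. \<forall>n\<ge>N. dist (c m) (c n) < e" by blast
    qed
    then obtain c0 where c0: "c \<longlonglongrightarrow> c0" using Cauchy_convergent[of c] unfolding convergent_def by blast
    have "h - cst c0 * v \<in> S"
    proof (rule Sl[of s])
      show "s k \<in> S" for k by (rule sc)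
      show "h - cst c0 * v \<in> LL p" using p by (intro LL_diff LL_cst h HH_LL[OF v]) auto
      show "(\<lambda>k. nm p (s k - (h - cst c0 * v))) \<longlonglongrightarrow> 0"
      proof (rule tendsto_sandwich[OF _ _ tendsto_const])
        have "(\<lambda>k. norm (c k - c0)) \<longlonglongrightarrow> 0" using c0 by (simp add: LIM_zero tendsto_norm_zero)
        then show "(\<lambda>k. nm p (f k - h) + norm (c k - c0) * nm p v) \<longlonglongrightarrow> 0"
          using tendsto_add[OF l tendsto_mult[OF _ tendsto_const[of "nm p v"]]] by fastforce
        have "nm p (s k - (h - cst c0 * v)) \<le> nm p (f k - h) + norm (c k - c0) * nm p v" for k
        proof -
          have e: "s k - (h - cst c0 * v) = (f k - h) - cst (c k - c0) * v"
            unfolding sc(1) by (simp add: cst_simps algebra_simps)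
          have "nm p (s k - (h - cst c0 * v)) \<le> nm p (f k - h) + nm p (cst (c k - c0) * v)"
            unfolding e using fL h v p p0 by (intro nm_triangle_diff LL_diff LL_cst) (auto intro: HH_LL)
          then show ?thesis by (simp add: nm_cst[OF p0])
        qed
        then show "\<forall>\<^sub>F k in sequentially. nm p (s k - (h - cst c0 * v)) \<le> nm p (f k - h) + norm (c k - c0) * nm p v" by simp
      qed simp
    qed
    moreover have "h = (h - cst c0 * v) + cst c0 * v" by simp
    ultimately show ?thesis unfolding S'_def by blast
  qed
  show ?thesis unfolding S'_def[symmetric] by (rule closedS_I[OF 1 2 3 4 5])
qed

section \<open>Finite linear combinations and square systems\<close>

definition lc :: "nat \<Rightarrow> (nat \<Rightarrow> complex) \<Rightarrow> (nat \<Rightarrow> mfun) \<Rightarrow> mfun" where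
  "lc m x e = (\<Sum>i<m. cst (x i) * e i)"

lemma lc_Suc: "lc (Suc m) x e = lc m x e + cst (x m) * e m" by (simp add: lc_def)
lemma lc_0 [simp]: "lc 0 x e = 0" by (simp add: lc_def)

lemma lc_cong: "(\<And>i. i < m \<Longrightarrow> x i = y i) \<Longrightarrow> (\<And>i. i < m \<Longrightarrow> e i = f i) \<Longrightarrow> lc m x e = lc m y f"
  unfolding lc_def by (intro sum.cong) auto

lemma lc_zero: "(\<And>i. i < m \<Longrightarrow> x i = 0) \<Longrightarrow> lc m x e = 0"
  unfolding lc_def by (intro sum.neutral) (auto simp: cst_simps)

lemma lc_unit: "k < m \<Longrightarrow> lc m (\<lambda>i. if i = k then 1 else 0) e = e k"
proof -
  assume k: "k < m"
  have "lc m (\<lambda>i. if i = k then 1 else 0) e = (\<Sum>i<m. if i = k then e i else 0)"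
    unfolding lc_def by (intro sum.cong) (auto simp: cst_simps)
  then show ?thesis using k by simp
qed

lemma lc_add: "lc m x (\<lambda>i. e i + f i) = lc m x e + lc m x f"
  by (simp add: lc_def distrib_left sum.distrib)
lemma lc_mult: "z * lc m x e = lc m x (\<lambda>i. z * e i)"
  by (simp add: lc_def sum_distrib_left mult.left_commute)
lemma lc_diff_coeff: "lc m (\<lambda>i. x i - y i) e = lc m x e - lc m y e"
  by (simp add: lc_def cst_simps left_diff_distrib sum_subtractf)

lemma lc_lc: "lc m x (\<lambda>j. lc k (A j) h) = lc k (\<lambda>i. \<Sum>j<m. A j i * x j) h"
proof -
  have c: "cst (sum f I) = (\<Sum>i\<in>I. cst (f i))" for f and I :: "nat set"
    by (induction I rule: infinite_finite_induct) (simp_all add: cst_simps)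
  have "lc m x (\<lambda>j. lc k (A j) h) = (\<Sum>j<m. \<Sum>i<k. cst (A j i * x j) * h i)"
    unfolding lc_def sum_distrib_left by (intro sum.cong refl) (simp add: cst_simps ac_simps)
  also have "\<dots> = (\<Sum>i<k. \<Sum>j<m. cst (A j i * x j) * h i)" by (rule sum.swap)
  finally show ?thesis unfolding lc_def c sum_distrib_right .
qed

lemma lc_HH: "1 < p \<Longrightarrow> (\<And>i. i < m \<Longrightarrow> e i \<in> HH p) \<Longrightarrow> lc m x e \<in> HH p"
  unfolding lc_def by (intro HH_sum HH_cst) auto

lemma TT_0 [simp]: "TT g 0 = 0" by (simp add: TT_def PP_0)

lemma TT_lc:
  assumes "g \<in> Bd" "1 < p" "\<And>i. i < m \<Longrightarrow> e i \<in> HH p"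
  shows "TT g (lc m x e) = lc m x (\<lambda>i. TT g (e i))"
  using assms(3)
proof (induction m)
  case (Suc m)
  have "lc m x e \<in> HH p" "e m \<in> HH p" using Suc.prems assms(2) by (auto intro!: lc_HH)
  then have "TT g (lc (Suc m) x e) = TT g (lc m x e) + cst (x m) * TT g (e m)"
    unfolding lc_Suc using assms by (simp add: TT_add[of g _ p] TT_cst[of g _ p] HH_cst)
  then show ?case using Suc by (simp add: lc_Suc)
qed simp

lemma co_lc:
  assumes "1 < p" "\<And>i. i < m \<Longrightarrow> e i \<in> HH p"
  shows "co (lc m x e) j = (\<Sum>i<m. x i * co (e i) j)"
  using assms(2)
proof (induction m)
  case (Suc m)
  have H: "lc m x e \<in> HH p" "cst (x m) * e m \<in> HH p" using Suc.prems assms(1) by (auto intro!: lc_HH HH_cst)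
  have "co (lc (Suc m) x e) j = co (lc m x e) j + x m * co (e m) j"
    unfolding lc_Suc co_add[OF LL_imp_LL1[OF HH_LL[OF H(1)] assms(1)] LL_imp_LL1[OF HH_LL[OF H(2)] assms(1)]] co_cst ..
  then show ?case using Suc by simp
qed (use co_cst[of 0 0 j] in \<open>simp add: cst_simps\<close>)

lemma HH_co_eqI: "f \<in> HH p \<Longrightarrow> g \<in> HH p \<Longrightarrow> 1 < p \<Longrightarrow> (\<And>j. 0 \<le> j \<Longrightarrow> co f j = co g j) \<Longrightarrow> f = g"
  by (rule co_eqI) (auto intro: LL_imp_LL1 HH_LL simp: HH_neg linorder_not_le dest: leI, metis HH_neg linorder_not_le)

lemma closedS_add_family:
  fixes m :: nat
  assumes S: "closedS p S" and p: "1 < p" and w: "\<And>j. w j \<in> HH p"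
  shows "closedS p {s + lc m x w | s x. s \<in> S}"
proof (induction m)
  case 0
  have "{s + lc 0 x w | s x. s \<in> S} = S" by simp
  then show ?case using S by simp
next
  case (Suc m)
  have "{s + lc (Suc m) x w | s x. s \<in> S} = {s + cst c * w m | s c. s \<in> {s + lc m x w | s x. s \<in> S}}"
  proof (intro Set.set_eqI iffI)
    fix y assume "y \<in> {s + lc (Suc m) x w | s x. s \<in> S}"
    then obtain s x where "s \<in> S" "y = s + lc (Suc m) x w" by blast
    then have "y = (s + lc m x w) + cst (x m) * w m" "s \<in> S" by (simp_all add: lc_Suc add.assoc)
    then show "y \<in> {s + cst c * w m | s c. s \<in> {s + lc m x w | s x. s \<in> S}}" by blast
  next
    fix y assume "y \<in> {s + cst c * w m | s c. s \<in> {s + lc m x w | s x. s \<in> S}}"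
    then obtain s x c where s: "s \<in> S" "y = (s + lc m x w) + cst c * w m" by blast
    have "lc m (x(m := c)) w = lc m x w" by (rule lc_cong) auto
    then have "y = s + lc (Suc m) (x(m := c)) w" using s by (simp add: lc_Suc add.assoc)
    then show "y \<in> {s + lc (Suc m) x w | s x. s \<in> S}" using s by blast
  qed
  then show ?case using closedS_add_vector[OF Suc w p] by simp
qed

text \<open>Together with \<open>det_nonzero_surj\<close> this converts uniqueness for a square
  system into solvability and back; all comparisons of finite dimensions below are made this
  way.\<close>

lemma det_nonzero_inj:
  fixes A :: "nat \<Rightarrow> nat \<Rightarrow> complex"
  shows "Determinant.det (Matrix.mat m m (\<lambda>(i, j). A i j)) \<noteq> 0 \<longleftrightarrow>
    (\<forall>x. (\<forall>i<m. (\<Sum>j<m. A i j * x j) = 0) \<longrightarrow> (\<forall>j<m. x j = 0))"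
proof -
  define M where "M = Matrix.mat m m (\<lambda>(i, j). A i j)"
  have M: "M \<in> carrier_mat m m" by (simp add: M_def)
  have mv: "M *\<^sub>v Matrix.vec m x = Matrix.vec m (\<lambda>i. \<Sum>j<m. A i j * x j)" for x
    by (rule eq_vecI) (auto simp: M_def scalar_prod_def lessThan_atLeast0 intro!: sum.cong)
  show ?thesis unfolding M_def[symmetric] det_0_iff_vec_prod_zero_field[OF M]
  proof
    assume a: "\<not> (\<exists>v. v \<in> carrier_vec m \<and> v \<noteq> 0\<^sub>v m \<and> M *\<^sub>v v = 0\<^sub>v m)"
    show "\<forall>x. (\<forall>i<m. (\<Sum>j<m. A i j * x j) = 0) \<longrightarrow> (\<forall>j<m. x j = 0)"
    proof (intro allI impI)
      fix x j assume x: "\<forall>i<m. (\<Sum>j<m. A i j * x j) = 0" and j: "j < m"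
      have "M *\<^sub>v Matrix.vec m x = 0\<^sub>v m" unfolding mv using x by (intro eq_vecI) auto
      then have "Matrix.vec m x = 0\<^sub>v m" using a by (metis vec_carrier)
      then have "Matrix.vec m x $ j = 0\<^sub>v m $ j" by (rule arg_cong)
      then show "x j = 0" using j by simp
    qed
  next
    assume a: "\<forall>x. (\<forall>i<m. (\<Sum>j<m. A i j * x j) = 0) \<longrightarrow> (\<forall>j<m. x j = 0)"
    show "\<not> (\<exists>v. v \<in> carrier_vec m \<and> v \<noteq> 0\<^sub>v m \<and> M *\<^sub>v v = 0\<^sub>v m)"
    proof
      assume "\<exists>v. v \<in> carrier_vec m \<and> v \<noteq> 0\<^sub>v m \<and> M *\<^sub>v v = 0\<^sub>v m"
      then obtain v where v: "v \<in> carrier_vec m" "v \<noteq> 0\<^sub>v m" "M *\<^sub>v v = 0\<^sub>v m" by blast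
      have ve: "v = Matrix.vec m (\<lambda>j. v $ j)" using v(1) by (intro eq_vecI) auto
      have mz: "Matrix.vec m (\<lambda>i. \<Sum>j<m. A i j * v $ j) = 0\<^sub>v m" using v(3) ve mv by metis
      have "(\<Sum>j<m. A i j * v $ j) = 0" if "i < m" for i
        using arg_cong[OF mz, of "\<lambda>v. vec_index v i"] that by simp
      then have "\<forall>j<m. v $ j = 0" using a by blast
      then have "v = 0\<^sub>v m" using v(1) by (intro eq_vecI) auto
      then show False using v(2) by blast
    qed
  qed
qed

lemma det_nonzero_surj:
  fixes A :: "nat \<Rightarrow> nat \<Rightarrow> complex"
  shows "Determinant.det (Matrix.mat m m (\<lambda>(i, j). A i j)) \<noteq> 0 \<longleftrightarrow> (\<forall>b. \<exists>x. \<forall>i<m. (\<Sum>j<m. A i j * x j) = b i)"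
proof
  define M where "M = Matrix.mat m m (\<lambda>(i, j). A i j)"
  have M: "M \<in> carrier_mat m m" by (simp add: M_def)
  have mv: "M *\<^sub>v Matrix.vec m x = Matrix.vec m (\<lambda>i. \<Sum>j<m. A i j * x j)" for x
    by (rule eq_vecI) (auto simp: M_def scalar_prod_def lessThan_atLeast0 intro!: sum.cong)
  {
    assume "Determinant.det (Matrix.mat m m (\<lambda>(i, j). A i j)) \<noteq> 0"
    then have d: "Determinant.det M \<noteq> 0" by (simp add: M_def)
    show "\<forall>b. \<exists>x. \<forall>i<m. (\<Sum>j<m. A i j * x j) = b i"
    proof
      fix b :: "nat \<Rightarrow> complex"
      define v where "v = (1 / Determinant.det M) \<cdot>\<^sub>v (adj_mat M *\<^sub>v Matrix.vec m b)"
      have am: "adj_mat M \<in> carrier_mat m m" by (rule adj_mat(1)[OF M])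
      have vc: "v \<in> carrier_vec m" unfolding v_def using am by auto
      have "M *\<^sub>v v = (1 / Determinant.det M) \<cdot>\<^sub>v (M *\<^sub>v (adj_mat M *\<^sub>v Matrix.vec m b))"
        unfolding v_def using M am by (intro mult_mat_vec) auto
      also have "M *\<^sub>v (adj_mat M *\<^sub>v Matrix.vec m b) = (M * adj_mat M) *\<^sub>v Matrix.vec m b"
        using M am by (intro assoc_mult_mat_vec[symmetric]) auto
      also have "M * adj_mat M = Determinant.det M \<cdot>\<^sub>m 1\<^sub>m m" by (rule adj_mat(2)[OF M])
      also have "(Determinant.det M \<cdot>\<^sub>m 1\<^sub>m m) *\<^sub>v Matrix.vec m b = Determinant.det M \<cdot>\<^sub>v Matrix.vec m b"
        by (rule eq_vecI) (simp_all add: scalar_prod_def if_distribR mult.assoc sum_distrib_left[symmetric] if_distrib[of "\<lambda>x. x * _"] cong: if_cong)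
      finally have "M *\<^sub>v v = Matrix.vec m b" using d by (simp add: smult_smult_assoc)
      moreover have "v = Matrix.vec m (\<lambda>j. v $ j)" using vc by (intro eq_vecI) auto
      ultimately have vb: "Matrix.vec m (\<lambda>i. \<Sum>j<m. A i j * v $ j) = Matrix.vec m b" using mv by metis
      have "\<forall>i<m. (\<Sum>j<m. A i j * v $ j) = b i"
      proof (intro allI impI)
        fix i assume "i < m"
        then show "(\<Sum>j<m. A i j * v $ j) = b i" using arg_cong[OF vb, of "\<lambda>v. vec_index v i"] by simp
      qed
      then show "\<exists>x. \<forall>i<m. (\<Sum>j<m. A i j * x j) = b i" by blast
    qed
  }
  {
    assume a: "\<forall>b. \<exists>x. \<forall>i<m. (\<Sum>j<m. A i j * x j) = b i"
    have "\<forall>k. \<exists>x. \<forall>i<m. (\<Sum>j<m. A i j * x j) = (if i = k then 1 else 0)"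
    proof
      fix k show "\<exists>x. \<forall>i<m. (\<Sum>j<m. A i j * x j) = (if i = k then 1 else 0)"
        using spec[OF a, of "\<lambda>i. if i = k then 1 else 0"] .
    qed
    then obtain X where X: "\<And>k i. i < m \<Longrightarrow> (\<Sum>j<m. A i j * X k j) = (if i = k then 1 else 0)" by metis
    define N where "N = Matrix.mat m m (\<lambda>(j, k). X k j)"
    have N: "N \<in> carrier_mat m m" by (simp add: N_def)
    have "M * N = 1\<^sub>m m"
      by (rule eq_matI) (auto simp: M_def N_def scalar_prod_def X[symmetric] lessThan_atLeast0 intro!: sum.cong)
    then have "Determinant.det M * Determinant.det N = 1" using det_mult[OF M N] by simp
    then show "Determinant.det (Matrix.mat m m (\<lambda>(i, j). A i j)) \<noteq> 0" by (auto simp: M_def)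
  }
qed

text \<open>The Fredholm data come as finite sets of coefficient sequences; the matrix arguments
  need families of functions indexed by an initial segment.\<close>

lemma seq_family:
  assumes C: "finite C" "C \<subseteq> co ` HH p" and p: "1 < p"
  shows "\<exists>e. (\<forall>i<card C. e i \<in> HH p) \<and> cspan C = {co (lc (card C) x e) | x. True} \<and>
    (cindep C \<longrightarrow> (\<forall>x. lc (card C) x e = 0 \<longrightarrow> (\<forall>i<card C. x i = 0)))"
proof -
  define m where "m = card C"
  obtain h where h: "bij_betw h {..<m} C" using ex_bij_betw_nat_finite[OF C(1)] by (auto simp: m_def lessThan_atLeast0)
  have hC: "h i \<in> C" if "i < m" for i using bij_betwE[OF h] that by blast
  have "\<forall>i\<in>{..<m}. \<exists>f. f \<in> HH p \<and> co f = h i"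
  proof
    fix i assume "i \<in> {..<m}"
    then have "h i \<in> co ` HH p" using hC C(2) by blast
    then obtain f where "h i = co f" "f \<in> HH p" by (rule imageE)
    then show "\<exists>f. f \<in> HH p \<and> co f = h i" by (intro exI[of _ f]) simp
  qed
  then have "\<exists>e. \<forall>i\<in>{..<m}. e i \<in> HH p \<and> co (e i) = h i" by (rule bchoice)
  then obtain e where e: "\<And>i. i < m \<Longrightarrow> e i \<in> HH p" "\<And>i. i < m \<Longrightarrow> co (e i) = h i" by auto
  have L: "lincomb C u = co (lc m (\<lambda>i. u (h i)) e)" for u
  proof
    fix j
    have "lincomb C u j = (\<Sum>i<m. u (h i) * h i j)"
      unfolding lincomb_def by (rule sum.reindex_bij_betw[OF h, symmetric])
    moreover have "co (lc m (\<lambda>i. u (h i)) e) j = (\<Sum>i<m. u (h i) * co (e i) j)" by (rule co_lc[OF p e(1)])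
    ultimately show "lincomb C u j = co (lc m (\<lambda>i. u (h i)) e) j" using e(2) by simp
  qed
  define k where "k = inv_into {..<m} h"
  have k: "k (h i) = i" if "i < m" for i
    unfolding k_def using h that by (intro inv_into_f_f) (auto simp: bij_betw_def)
  have L': "co (lc m x e) = lincomb C (\<lambda>v. x (k v))" for x
    unfolding L using k by (intro arg_cong[where f=co] lc_cong) auto
  have "cspan C = {co (lc m x e) | x. True}"
  proof (intro Set.set_eqI iffI)
    fix y assume "y \<in> cspan C"
    then obtain u where "y = lincomb C u" unfolding cspan_def by blast
    then show "y \<in> {co (lc m x e) | x. True}" unfolding L by blast
  next
    fix y assume "y \<in> {co (lc m x e) | x. True}"
    then obtain x where "y = co (lc m x e)" by blast
    then show "y \<in> cspan C" unfolding L' cspan_def by blast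
  qed
  moreover have "x i = 0" if ci: "cindep C" and z: "lc m x e = 0" and i: "i < m" for x i
  proof -
    have "co 0 = (\<lambda>_. 0)" using co_cst[of 0 0] by (simp add: cst_simps fun_eq_iff)
    then have "lincomb C (\<lambda>v. x (k v)) = (\<lambda>_. 0)" unfolding L'[symmetric] z .
    then have "x (k (h i)) = 0" using ci hC[OF i] unfolding cindep_def by blast
    then show ?thesis using k[OF i] by simp
  qed
  ultimately show ?thesis unfolding m_def[symmetric] using e(1) by blast
qed

lemma lincomb_self: "finite K \<Longrightarrow> v \<in> K \<Longrightarrow> v \<in> cspan K"
proof -
  assume K: "finite K" "v \<in> K"
  have "lincomb K (\<lambda>w. if w = v then 1 else 0) j = v j" for j
  proof -
    have "lincomb K (\<lambda>w. if w = v then 1 else 0) j = (\<Sum>w\<in>K. if w = v then w j else 0)"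
      unfolding lincomb_def by (intro sum.cong) auto
    then show ?thesis using K by simp
  qed
  then have "v = lincomb K (\<lambda>w. if w = v then 1 else 0)" by (simp add: fun_eq_iff)
  then show ?thesis unfolding cspan_def by blast
qed

section \<open>Removing the index by a shift of the symbol\<close>

lemma fredholm_basis:
  assumes F: "fredholm_index p (Toep a) \<kappa>" and a: "cm a" "mk a \<in> Bd" and p: "1 < p" and g: "g = mk a"
  obtains k l e h where "\<kappa> = int k - int l"
    "\<And>i. i < k \<Longrightarrow> e i \<in> HH p" "\<And>i. i < k \<Longrightarrow> TT g (e i) = 0"
    "\<And>f. f \<in> HH p \<Longrightarrow> TT g f = 0 \<Longrightarrow> \<exists>x. f = lc k x e" "\<And>x i. lc k x e = 0 \<Longrightarrow> i < k \<Longrightarrow> x i = 0"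
    "\<And>i. i < l \<Longrightarrow> h i \<in> HH p" "\<And>f. f \<in> HH p \<Longrightarrow> \<exists>r\<in>HH p. \<exists>x. f = TT g r + lc l x h"
    "\<And>x r i. r \<in> HH p \<Longrightarrow> TT g r = lc l x h \<Longrightarrow> i < l \<Longrightarrow> x i = 0"
proof -
  obtain K C where K: "finite K" "cindep K" "cspan K = kerS p g" and C: "finite C" "cindep C" "C \<subseteq> co ` HH p"
    and d: "{(\<lambda>j. r j + s j) | r s. r \<in> ranS p g \<and> s \<in> cspan C} = co ` HH p"
    and i: "cspan C \<inter> ranS p g = {\<lambda>_. 0}" and \<kappa>: "\<kappa> = int (card K) - int (card C)"
    using fredholm_data(2)[OF F a p] unfolding g by blast
  have "kerS p g \<subseteq> co ` HH p" by (auto simp: kerS_def)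
  then have KH: "K \<subseteq> co ` HH p" using lincomb_self[OF K(1)] unfolding K(3) by blast
  obtain e where e: "\<forall>i<card K. e i \<in> HH p" "cspan K = {co (lc (card K) x e) | x. True}"
    "\<forall>x. lc (card K) x e = 0 \<longrightarrow> (\<forall>i<card K. x i = 0)" using seq_family[OF K(1) KH p] K(2) by blast
  obtain h where h: "\<forall>i<card C. h i \<in> HH p" "cspan C = {co (lc (card C) x h) | x. True}"
    "\<forall>x. lc (card C) x h = 0 \<longrightarrow> (\<forall>i<card C. x i = 0)" using seq_family[OF C(1) C(3) p] C(2) by blast
  have gB: "g \<in> Bd" using a g by simp
  have inj: "f = f'" if "co f = co f'" "f \<in> HH p" "f' \<in> HH p" for f f'
    using HH_co_eqI[OF that(2,3) p] that(1) by simp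
  have eH: "lc (card K) x e \<in> HH p" for x using e(1) p by (intro lc_HH) auto
  have hH: "lc (card C) x h \<in> HH p" for x using h(1) p by (intro lc_HH) auto
  show thesis
  proof (rule that[of "card K" "card C" e h])
    show "TT g (e i) = 0" if "i < card K" for i
    proof -
      have "co (lc (card K) (\<lambda>j. if j = i then 1 else 0) e) \<in> kerS p g" using e(2) K(3) by blast
      then have "co (e i) \<in> kerS p g" unfolding lc_unit[OF that] .
      then obtain f where f: "co (e i) = co f" "f \<in> HH p" "TT g f = 0" unfolding kerS_def by blast
      then have "e i = f" using inj e(1) that by blast
      then show ?thesis using f by simp
    qed
    show "\<exists>x. f = lc (card K) x e" if "f \<in> HH p" "TT g f = 0" for f
    proof -
      have "co f \<in> kerS p g" unfolding kerS_def using that by blast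
      then have "co f \<in> {co (lc (card K) x e) | x. True}" using e(2) K(3) by simp
      then obtain x where "co f = co (lc (card K) x e)" by blast
      then have "f = lc (card K) x e" using that(1) eH by (intro inj)
      then show ?thesis by blast
    qed
    show "\<exists>r\<in>HH p. \<exists>x. f = TT g r + lc (card C) x h" if f: "f \<in> HH p" for f
    proof -
      have "co f \<in> {(\<lambda>j. r j + s j) | r s. r \<in> ranS p g \<and> s \<in> cspan C}" unfolding d using f by blast
      then obtain r s where rs: "co f = (\<lambda>j. r j + s j)" "r \<in> ranS p g" "s \<in> cspan C" by blast
      obtain r' where r': "r' \<in> HH p" "r = co (TT g r')" using rs(2) unfolding ranS_def by blast
      obtain x where x: "s = co (lc (card C) x h)" using rs(3) unfolding h(2) by blast
      have T: "TT g r' \<in> HH p" using gB r' p by (intro TT_HH)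
      have "f = TT g r' + lc (card C) x h"
      proof (rule inj[OF _ f HH_add[OF T hH p]])
        show "co f = co (TT g r' + lc (card C) x h)"
          unfolding rs(1) r'(2) x
          by (rule ext) (rule co_add[symmetric]; rule LL_imp_LL1[OF HH_LL p]; rule T hH)
      qed
      then show ?thesis using r'(1) by blast
    qed
    show "x i = 0" if "r \<in> HH p" "TT g r = lc (card C) x h" "i < card C" for x r i
    proof -
      have "co (lc (card C) x h) \<in> cspan C" unfolding h(2) by blast
      moreover have "co (lc (card C) x h) \<in> ranS p g" unfolding ranS_def that(2)[symmetric] using that(1) by blast
      ultimately have "co (lc (card C) x h) \<in> cspan C \<inter> ranS p g" by (rule IntI)
      then have "co (lc (card C) x h) = (\<lambda>_. 0)" unfolding i by simp
      then have "lc (card C) x h = 0" using co_unique[OF LL_imp_LL1[OF HH_LL[OF hH] p], of x] by simp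
      then show ?thesis using h(3) that(3) by blast
    qed
  qed (use \<kappa> e h in \<open>blast\<close>)+
qed

text \<open>Coburn's alternative: a nontrivial kernel puts all analytic polynomials into the range,
  and a closed range that contains this dense set is everything.\<close>

lemma kernel_surj:
  assumes "closedS p (TT g ` HH p)" "g \<in> Bd" "g * g' = 1" "f \<in> HH p" "f \<noteq> 0" "TT g f = 0" "1 < p" "h \<in> HH p"
  shows "\<exists>r\<in>HH p. TT g r = h"
proof -
  have "AP \<subseteq> TT g ` HH p" using Coburn[OF assms(2-7)] by blast
  then have "h \<in> TT g ` HH p" using closedS_dense_full[OF assms(1) _ assms(7,8)] by blast
  then show ?thesis by blast
qed

lemma TT_zp: "TT (g * zp m) f = TT g (zp m * f)" by (simp add: TT_def mult.assoc)

text \<open>A positive index forces a kernel, so by Coburn \<open>T(g)\<close> is onto and its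
  kernel has dimension \<open>m\<close>. A nonzero \<open>f\<close> killed by the shifted operator
  would put the \<open>m + 1\<close> independent functions \<open>zp i * f\<close>,
  \<open>i \<le> m\<close>, into that kernel. For surjectivity, a solution of
  \<open>T(g) r = y\<close> must be divisible by \<open>zp (int m)\<close>; a kernel element
  corrects its first \<open>m\<close> coefficients, and the square system for the correction is
  solvable because the shifted operator is injective.\<close>

lemma Inv_of_index_pos:
  assumes F: "fredholm_index p (Toep a) (int m)" and a: "cm a" "mk a \<in> Bd" and p: "1 < p" and g: "g = mk a" "g * g' = 1"
    and m: "0 < m"
  shows "Inv p (g * zp (int m))"
proof -
  obtain k l e h where kl: "int m = int k - int l"
    and e: "\<And>i. i < k \<Longrightarrow> e i \<in> HH p" "\<And>i. i < k \<Longrightarrow> TT g (e i) = 0"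
    and es: "\<And>f. f \<in> HH p \<Longrightarrow> TT g f = 0 \<Longrightarrow> \<exists>x. f = lc k x e" and ei: "\<And>x i. lc k x e = 0 \<Longrightarrow> i < k \<Longrightarrow> x i = 0"
    and h: "\<And>i. i < l \<Longrightarrow> h i \<in> HH p" and hs: "\<And>f. f \<in> HH p \<Longrightarrow> \<exists>r\<in>HH p. \<exists>x. f = TT g r + lc l x h"
    and hi: "\<And>x r i. r \<in> HH p \<Longrightarrow> TT g r = lc l x h \<Longrightarrow> i < l \<Longrightarrow> x i = 0"
    using fredholm_basis[OF F a p g(1)] by blast
  have gB: "g \<in> Bd" using a g by simp
  have k0: "0 < k" using kl m by linarith
  have "e 0 \<noteq> 0"
  proof
    assume "e 0 = 0"
    then have "lc k (\<lambda>i. if i = 0 then 1 else 0) e = 0" using lc_unit[OF k0] by simp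
    then show False using ei[OF _ k0] by fastforce
  qed
  then have surj: "\<exists>r\<in>HH p. TT g r = y" if "y \<in> HH p" for y
    using kernel_surj[OF fredholm_data(1)[OF F a p, folded g(1)] gB g(2) e(1)[OF k0] _ e(2)[OF k0] p that] by blast
  have "l = 0"
  proof (rule ccontr)
    assume "l \<noteq> 0"
    then have l: "0 < l" by simp
    obtain r where r: "r \<in> HH p" "TT g r = h 0" using surj[OF h[OF l]] by blast
    have "TT g r = lc l (\<lambda>i. if i = 0 then 1 else 0) h" using r lc_unit[OF l] by simp
    then show False using hi[OF r(1) _ l] by fastforce
  qed
  then have km: "k = m" using kl by simp
  have inj: "f = 0" if f: "f \<in> HH p" "TT (g * zp (int m)) f = 0" for f
  proof (rule ccontr)
    assume f0: "f \<noteq> 0"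
    have "\<exists>x. zp (int i) * f = lc m x e" if i: "i < Suc m" for i
    proof -
      have zf: "zp (int i) * f \<in> HH p" using f p by (simp add: HH_zp)
      have L: "(g * zp (int m)) * f \<in> LL p" using gB f p by (intro Bd_mult_LL) auto
      have "(g * zp (int m)) * f \<in> QQ p" using f(2) PP_eq_0_iff[OF L p] by (simp add: TT_def)
      then have "zp (int i - int m) * ((g * zp (int m)) * f) \<in> QQ p" using i p by (intro QQ_zp) auto
      moreover have "zp (int i - int m) * ((g * zp (int m)) * f) = g * (zp (int i) * f)"
      proof -
        have "zp (int i - int m) * ((g * zp (int m)) * f) = g * ((zp (int i - int m) * zp (int m)) * f)" by (simp only: ac_simps)
        then show ?thesis by (simp add: zp_simps)
      qed
      ultimately have "TT g (zp (int i) * f) = 0" by (simp add: TT_def PP_QQ)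
      then show ?thesis using es[OF zf] unfolding km by blast
    qed
    then have "\<forall>i\<in>{..<Suc m}. \<exists>x. zp (int i) * f = lc m x e" by blast
    then have "\<exists>X. \<forall>i\<in>{..<Suc m}. zp (int i) * f = lc m (X i) e" by (rule bchoice)
    then obtain X where X: "\<And>i. i < Suc m \<Longrightarrow> zp (int i) * f = lc m (X i) e" by auto
    \<comment> \<open>A zero row completes the \<open>m\<close> by \<open>m + 1\<close> matrix to a
      square one. Such a matrix is not onto, hence not injective either, which gives a linear
      dependence.\<close>
    define A where "A j i = (if j < m then X i j else 0)" for j i
    have "\<not> (\<forall>b. \<exists>x. \<forall>j<Suc m. (\<Sum>i<Suc m. A j i * x i) = b j)"
    proof
      assume "\<forall>b. \<exists>x. \<forall>j<Suc m. (\<Sum>i<Suc m. A j i * x i) = b j"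
      then obtain x where "\<forall>j<Suc m. (\<Sum>i<Suc m. A j i * x i) = (\<lambda>_. 1) j" by (elim allE[of _ "\<lambda>_. 1"] exE)
      then have "(\<Sum>i<Suc m. A m i * x i) = 1" by blast
      then show False by (simp add: A_def)
    qed
    then obtain x i1 where x: "\<forall>j<Suc m. (\<Sum>i<Suc m. A j i * x i) = 0" and i1: "i1 < Suc m" "x i1 \<noteq> 0"
      unfolding det_nonzero_surj[symmetric] det_nonzero_inj by blast
    have "lc (Suc m) x (\<lambda>i. zp (int i) * f) = lc (Suc m) x (\<lambda>i. lc m (X i) e)" using X by (intro lc_cong) auto
    also have "\<dots> = lc m (\<lambda>j. \<Sum>i<Suc m. X i j * x i) e" by (rule lc_lc)
    also have "\<dots> = 0"
    proof (rule lc_zero)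
      fix j assume "j < m"
      then show "(\<Sum>i<Suc m. X i j * x i) = 0" using x[rule_format, of j] by (simp add: A_def)
    qed
    finally have z: "lc (Suc m) x (\<lambda>i. zp (int i) * f) = 0" .
    have "\<exists>j. co f (int j) \<noteq> 0"
    proof (rule ccontr)
      assume n: "\<nexists>j. co f (int j) \<noteq> 0"
      have "f = 0"
      proof (rule HH_co_eqI[OF f(1) HH_0[OF p] p])
        fix j :: int assume "0 \<le> j"
        then have "co f j = 0" using n by (metis zero_le_imp_eq_int)
        then show "co f j = co 0 j" using co_cst[of 0 0 j] by (simp add: cst_simps)
      qed
      then show False using f0 by simp
    qed
    \<comment> \<open>The lowest term of the dependent combination is computed: it is the first
      nonzero \<open>x i\<close> times the lowest coefficient of \<open>f\<close>, so it cannot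
      vanish.\<close>
    define j0 where "j0 = (LEAST j. co f (int j) \<noteq> 0)"
    have j0: "co f (int j0) \<noteq> 0" unfolding j0_def using \<open>\<exists>j. co f (int j) \<noteq> 0\<close> by (rule LeastI_ex)
    have j1: "co f j = 0" if "j < int j0" for j
    proof (cases "j < 0")
      case True then show ?thesis using HH_neg[OF f(1)] by blast
    next
      case False
      then have "nat j < j0" "int (nat j) = j" using that by auto
      then show ?thesis using not_less_Least[of "nat j" "\<lambda>j. co f (int j) \<noteq> 0"] unfolding j0_def by simp
    qed
    define i0 where "i0 = (LEAST i. x i \<noteq> 0)"
    have i0: "x i0 \<noteq> 0" unfolding i0_def using i1(2) by (rule LeastI)
    have i0m: "i0 < Suc m" using Least_le[of "\<lambda>i. x i \<noteq> 0", OF i1(2)] i1(1) unfolding i0_def by simp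
    have i2: "x i = 0" if "i < i0" for i using not_less_Least[of i "\<lambda>i. x i \<noteq> 0"] that unfolding i0_def by simp
    have "co (lc (Suc m) x (\<lambda>i. zp (int i) * f)) (int (i0 + j0)) = (\<Sum>i<Suc m. x i * co f (int (i0 + j0) - int i))"
      unfolding co_lc[of p, OF p HH_zp[OF f(1) p, of "int _"], OF of_nat_0_le_iff] co_zp_mult ..
    also have "\<dots> = (\<Sum>i<Suc m. if i = i0 then x i0 * co f (int j0) else 0)"
    proof (intro sum.cong refl)
      fix i show "x i * co f (int (i0 + j0) - int i) = (if i = i0 then x i0 * co f (int j0) else 0)"
      proof (cases i i0 rule: linorder_cases)
        case less then show ?thesis by (simp add: i2)
      next
        case greater then show ?thesis using j1[of "int (i0 + j0) - int i"] by simp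
      qed simp
    qed
    also have "\<dots> = x i0 * co f (int j0)" using i0m by simp
    also have "\<dots> \<noteq> 0" using i0 j0 by simp
    finally show False unfolding z using co_cst[of 0 0] by (simp add: cst_simps)
  qed
  have sur: "\<exists>f\<in>HH p. TT (g * zp (int m)) f = y" if y: "y \<in> HH p" for y
  proof -
    define A where "A j i = co (e i) (int j)" for i j :: nat
    have eH: "lc m x e \<in> HH p" for x using e(1) p unfolding km by (intro lc_HH)
    have eT: "TT g (lc m x e) = 0" for x
      using TT_lc[OF gB p, of m e x] e unfolding km by (simp add: lc_def)
    have cA: "co (lc m x e) (int j) = (\<Sum>i<m. A j i * x i)" for x j
      using co_lc[OF p, of m e x "int j"] e(1) unfolding km A_def by (simp add: mult.commute)
    have dn: "zp (- int m) * f \<in> HH p" if "f \<in> HH p" "\<And>j. j < m \<Longrightarrow> co f (int j) = 0" for f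
    proof (rule HH_zp_down[OF that(1) p])
      fix j :: int assume "0 \<le> j" "j < int m"
      then show "co f j = 0" using that(2)[of "nat j"] by simp
    qed
    have up: "TT (g * zp (int m)) (zp (- int m) * f) = TT g f" for f by (simp add: TT_zp zp_simps)
    have "\<forall>x. (\<forall>j<m. (\<Sum>i<m. A j i * x i) = 0) \<longrightarrow> (\<forall>i<m. x i = 0)"
    proof (intro allI impI)
      fix x i assume x: "\<forall>j<m. (\<Sum>i<m. A j i * x i) = 0" and i: "i < m"
      have "zp (- int m) * lc m x e = 0"
      proof (rule inj)
        show "zp (- int m) * lc m x e \<in> HH p" using x by (intro dn eH) (simp add: cA)
        show "TT (g * zp (int m)) (zp (- int m) * lc m x e) = 0" unfolding up by (rule eT)
      qed
      then have "zp (int m) * (zp (- int m) * lc m x e) = 0" by simp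
      then have "lc m x e = 0" by (simp add: zp_simps)
      then show "x i = 0" using ei i unfolding km by blast
    qed
    then have "\<forall>b. \<exists>x. \<forall>j<m. (\<Sum>i<m. A j i * x i) = b j" unfolding det_nonzero_inj[symmetric] det_nonzero_surj .
    note su = this
    obtain r where r: "r \<in> HH p" "TT g r = y" using surj[OF y] by blast
    obtain x where x: "\<forall>j<m. (\<Sum>i<m. A j i * x i) = co r (int j)" using spec[OF su, of "\<lambda>j. co r (int j)"] by blast
    have d: "r - lc m x e \<in> HH p" using r eH p by (intro HH_diff)
    have "zp (- int m) * (r - lc m x e) \<in> HH p"
    proof (rule dn[OF d])
      fix j assume "j < m"
      then show "co (r - lc m x e) (int j) = 0"
        unfolding co_diff[OF LL_imp_LL1[OF HH_LL[OF r(1)] p] LL_imp_LL1[OF HH_LL[OF eH] p]] cA using x by simp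
    qed
    moreover have "TT (g * zp (int m)) (zp (- int m) * (r - lc m x e)) = y"
      unfolding up TT_diff[OF gB r(1) eH p] eT using r(2) by simp
    ultimately show ?thesis by blast
  qed
  show ?thesis by (rule Inv_I[OF _ p inj sur]) (use gB in auto)
qed

text \<open>A negative index excludes a kernel by Coburn, so \<open>T(g)\<close> is injective with a
  range of codimension \<open>m\<close>. Splitting off the first \<open>m\<close> coefficients, the
  range of the shifted operator \<open>G\<close> is that of \<open>T(g)\<close> plus the span of the
  \<open>w j\<close>, and everything depends on the square matrix \<open>A\<close> of the
  \<open>w j\<close> modulo the range of \<open>T(g)\<close>. If \<open>G\<close> has a kernel, then
  Coburn's alternative for \<open>G\<close>, whose range is closed as a finite extension of a closed
  one, makes \<open>A\<close> onto; if not, \<open>A\<close> is injective. Either way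
  \<open>A\<close> is nonsingular.\<close>

lemma Inv_of_index_neg:
  assumes F: "fredholm_index p (Toep a) (- int m)" and a: "cm a" "mk a \<in> Bd" and p: "1 < p" and g: "g = mk a" "g * g' = 1"
    and m: "0 < m"
  shows "Inv p (g * zp (- int m))"
proof -
  obtain k l e h where kl: "- int m = int k - int l"
    and e: "\<And>i. i < k \<Longrightarrow> e i \<in> HH p" "\<And>i. i < k \<Longrightarrow> TT g (e i) = 0"
    and es: "\<And>f. f \<in> HH p \<Longrightarrow> TT g f = 0 \<Longrightarrow> \<exists>x. f = lc k x e" and ei: "\<And>x i. lc k x e = 0 \<Longrightarrow> i < k \<Longrightarrow> x i = 0"
    and h: "\<And>i. i < l \<Longrightarrow> h i \<in> HH p" and hs: "\<And>f. f \<in> HH p \<Longrightarrow> \<exists>r\<in>HH p. \<exists>x. f = TT g r + lc l x h"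
    and hi: "\<And>x r i. r \<in> HH p \<Longrightarrow> TT g r = lc l x h \<Longrightarrow> i < l \<Longrightarrow> x i = 0"
    using fredholm_basis[OF F a p g(1)] by blast
  note cl = fredholm_data(1)[OF F a p, folded g(1)]
  have gB: "g \<in> Bd" using a g by simp
  have l0: "0 < l" using kl m by linarith
  have ker: "f = 0" if f: "f \<in> HH p" "TT g f = 0" for f
  proof (rule ccontr)
    assume f0: "f \<noteq> 0"
    obtain r where r: "r \<in> HH p" "TT g r = h 0"
      using kernel_surj[OF cl gB g(2) f(1) f0 f(2) p h[OF l0]] by blast
    have "TT g r = lc l (\<lambda>i. if i = 0 then 1 else 0) h" using r lc_unit[OF l0] by simp
    then show False using hi[OF r(1) _ l0] by fastforce
  qed
  have "k = 0"
  proof (rule ccontr)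
    assume "k \<noteq> 0"
    then have k: "0 < k" by simp
    have "e 0 = 0" using ker e k by blast
    then have "lc k (\<lambda>i. if i = 0 then 1 else 0) e = 0" using lc_unit[OF k] by simp
    then show False using ei[OF _ k] by fastforce
  qed
  then have lm: "l = m" using kl by simp
  define G where "G = g * zp (- int m)"
  have GB: "G \<in> Bd" using gB by (simp add: G_def)
  have Gg: "TT G (zp (int m) * f) = TT g f" for f by (simp add: G_def TT_zp zp_simps)
  define w where "w j = TT G (zp (int j))" for j :: nat
  have zH: "zp (int j) \<in> HH p" for j using p by (simp add: HH_monom)
  have zlH: "lc m x (\<lambda>j. zp (int j)) \<in> HH p" for x using zH p by (intro lc_HH)
  have wH: "w j \<in> HH p" for j unfolding w_def by (rule TT_HH[OF GB zH p])
  have "\<forall>j. \<exists>r x. r \<in> HH p \<and> w j = TT g r + lc m x h" using hs[OF wH] unfolding lm by blast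
  then obtain r A' where r: "\<And>j. r j \<in> HH p" and rA: "\<And>j. w j = TT g (r j) + lc m (A' j) h" by metis
  define A where "A i j = A' j i" for i j :: nat
  define Ax where "Ax x i = (\<Sum>j<m. A i j * x j)" for x i
  have rH: "lc m x r \<in> HH p" for x using r p by (intro lc_HH)
  have hH: "lc m x h \<in> HH p" for x using h p unfolding lm by (intro lc_HH)
  have lw: "lc m x w = TT g (lc m x r) + lc m (Ax x) h" for x
  proof -
    have "lc m x w = lc m x (\<lambda>j. TT g (r j) + lc m (A' j) h)" using rA by (intro lc_cong) auto
    then show ?thesis unfolding lc_add lc_lc TT_lc[OF gB p r] Ax_def A_def .
  qed
  have Gw: "TT G (lc m x (\<lambda>j. zp (int j))) = lc m x w" for x unfolding w_def by (rule TT_lc[OF GB p zH])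
  have dec: "\<exists>f'\<in>HH p. f = lc m (\<lambda>j. co f (int j)) (\<lambda>j. zp (int j)) + zp (int m) * f'" if f: "f \<in> HH p" for f
  proof -
    define u where "u = lc m (\<lambda>j. co f (int j)) (\<lambda>j. zp (int j))"
    have uH: "u \<in> HH p" unfolding u_def using zH p by (intro lc_HH)
    have d: "f - u \<in> HH p" using f uH p by (intro HH_diff)
    have "zp (- int m) * (f - u) \<in> HH p"
    proof (rule HH_zp_down[OF d p])
      fix j :: int assume j: "0 \<le> j" "j < int m"
      have "co u j = (\<Sum>i<m. co f (int i) * (if i = nat j then 1 else 0))"
        unfolding u_def co_lc[OF p zH] co_zp using j by (intro sum.cong) auto
      also have "\<dots> = (\<Sum>i<m. if i = nat j then co f (int i) else 0)" by (intro sum.cong) auto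
      also have "\<dots> = co f j" using j by simp
      finally show "co (f - u) j = 0"
        unfolding co_diff[OF LL_imp_LL1[OF HH_LL[OF f] p] LL_imp_LL1[OF HH_LL[OF uH] p]] by simp
    qed
    moreover have "f = u + zp (int m) * (zp (- int m) * (f - u))" by (simp add: zp_simps)
    ultimately show ?thesis unfolding u_def by blast
  qed
  have Gdec: "\<exists>f'\<in>HH p. f = lc m (\<lambda>j. co f (int j)) (\<lambda>j. zp (int j)) + zp (int m) * f' \<and>
      TT G f = TT g f' + lc m (\<lambda>j. co f (int j)) w" if f: "f \<in> HH p" for f
  proof -
    obtain f' where f': "f' \<in> HH p" "f = lc m (\<lambda>j. co f (int j)) (\<lambda>j. zp (int j)) + zp (int m) * f'" using dec[OF f] by blast
    have "TT G f = TT G (lc m (\<lambda>j. co f (int j)) (\<lambda>j. zp (int j)) + zp (int m) * f')" using f'(2) by simp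
    also have "\<dots> = lc m (\<lambda>j. co f (int j)) w + TT g f'"
      using TT_add[OF GB zlH HH_zp[OF f'(1) p] p, of "int m" "\<lambda>j. co f (int j)"] unfolding Gg Gw by simp
    finally show ?thesis using f' by (simp add: add.commute) blast
  qed
  have hz: "x i = 0" if "TT g s + lc m x h = 0" "s \<in> HH p" "i < m" for s x i
  proof -
    have "TT g (- s) = lc m x h" using that(1) TT_cst[OF gB that(2) p, of "-1"] by (simp add: cst_simps add_eq_0_iff)
    then show ?thesis using hi[OF HH_uminus[OF that(2) p]] that(3) unfolding lm by blast
  qed
  have det: "(\<forall>x. (\<forall>i<m. (\<Sum>j<m. A i j * x j) = 0) \<longrightarrow> (\<forall>j<m. x j = 0)) \<and> (\<forall>b. \<exists>x. \<forall>i<m. (\<Sum>j<m. A i j * x j) = b i)"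
  proof (cases "\<exists>f\<in>HH p. f \<noteq> 0 \<and> TT G f = 0")
    case True
    then obtain f where f: "f \<in> HH p" "f \<noteq> 0" "TT G f = 0" by blast
    have "G * (zp (int m) * g') = (zp (- int m) * zp (int m)) * (g * g')" by (simp only: G_def ac_simps)
    then have G1: "G * (zp (int m) * g') = 1" using g(2) by (simp add: zp_simps)
    have "TT G ` HH p = {s + lc m x w | s x. s \<in> TT g ` HH p}"
    proof (intro Set.set_eqI iffI)
      fix y assume "y \<in> TT G ` HH p"
      then obtain f where "f \<in> HH p" "y = TT G f" by blast
      then show "y \<in> {s + lc m x w | s x. s \<in> TT g ` HH p}" using Gdec by blast
    next
      fix y assume "y \<in> {s + lc m x w | s x. s \<in> TT g ` HH p}"
      then obtain s x where s: "s \<in> HH p" "y = TT g s + lc m x w" by blast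
      then have "y = TT G (zp (int m) * s + lc m x (\<lambda>j. zp (int j)))"
        using TT_add[OF GB HH_zp[OF s(1) p] zlH p, of "int m" x] unfolding Gg Gw by simp
      moreover have "zp (int m) * s + lc m x (\<lambda>j. zp (int j)) \<in> HH p" using s zH p by (intro HH_add HH_zp lc_HH) auto
      ultimately show "y \<in> TT G ` HH p" by blast
    qed
    then have "closedS p (TT G ` HH p)" using closedS_add_family[of p _ w, OF cl p wH] by simp
    note sG = kernel_surj[OF this GB G1 f p]
    have "\<forall>b. \<exists>x. \<forall>i<m. (\<Sum>j<m. A i j * x j) = b i"
    proof
      fix b
      obtain f where f: "f \<in> HH p" "TT G f = lc m b h" using sG[OF hH] by blast
      obtain f' where f': "f' \<in> HH p" "TT G f = TT g f' + lc m (\<lambda>j. co f (int j)) w" using Gdec[OF f(1)] by blast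
      define x where "x = (\<lambda>j. co f (int j))"
      have "TT g (f' + lc m x r) + lc m (\<lambda>i. Ax x i - b i) h = 0"
        using f f' lw[of x] by (simp add: TT_add[OF gB f'(1) rH p] lc_diff_coeff x_def[symmetric] algebra_simps)
      then have "Ax x i - b i = 0" if "i < m" for i using hz[OF _ HH_add[OF f'(1) rH p] that] by blast
      then show "\<exists>x. \<forall>i<m. (\<Sum>j<m. A i j * x j) = b i" unfolding Ax_def by auto
    qed
    then show ?thesis unfolding det_nonzero_inj[symmetric] det_nonzero_surj[symmetric] by blast
  next
    case False
    have "\<forall>x. (\<forall>i<m. (\<Sum>j<m. A i j * x j) = 0) \<longrightarrow> (\<forall>j<m. x j = 0)"
    proof (intro allI impI)
      fix x j assume x: "\<forall>i<m. (\<Sum>j<m. A i j * x j) = 0" and j: "j < m"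
      have "lc m (Ax x) h = 0" using x by (intro lc_zero) (simp add: Ax_def)
      then have e: "TT G (lc m x (\<lambda>j. zp (int j))) = TT G (zp (int m) * lc m x r)" unfolding Gw Gg lw by simp
      have H: "lc m x (\<lambda>j. zp (int j)) \<in> HH p" "zp (int m) * lc m x r \<in> HH p" using zlH HH_zp[OF rH p, of "int m"] by auto
      have "lc m x (\<lambda>j. zp (int j)) - zp (int m) * lc m x r = 0"
        using False HH_diff[OF H p] TT_diff[OF GB H p] e by auto
      then have "co (lc m x (\<lambda>j. zp (int j))) (int j) = co (zp (int m) * lc m x r) (int j)" by simp
      also have "\<dots> = 0" unfolding co_zp_mult using HH_neg[OF rH] j by simp
      also have "co (lc m x (\<lambda>j. zp (int j))) (int j) = (\<Sum>i<m. if i = j then x i else 0)"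
        unfolding co_lc[OF p zH] co_zp by (intro sum.cong) auto
      finally show "x j = 0" using j by simp
    qed
    then show ?thesis unfolding det_nonzero_inj[symmetric] det_nonzero_surj[symmetric] by blast
  qed
  show ?thesis unfolding G_def[symmetric]
  proof (rule Inv_I[OF GB p])
    fix f assume f: "f \<in> HH p" "TT G f = 0"
    obtain f' where f': "f' \<in> HH p" "f = lc m (\<lambda>j. co f (int j)) (\<lambda>j. zp (int j)) + zp (int m) * f'"
       "TT G f = TT g f' + lc m (\<lambda>j. co f (int j)) w" using Gdec[OF f(1)] by blast
    define x where "x = (\<lambda>j. co f (int j))"
    have "TT g (f' + lc m x r) + lc m (Ax x) h = 0"
      using f f'(3) lw[of x] by (simp add: TT_add[OF gB f'(1) rH p] x_def[symmetric] add.assoc)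
    then have "Ax x i = 0" if "i < m" for i using hz[OF _ HH_add[OF f'(1) rH p] that] by blast
    then have x0: "x j = 0" if "j < m" for j using conjunct1[OF det] that unfolding Ax_def by blast
    have "lc m x w = 0" "lc m x (\<lambda>j. zp (int j)) = 0" using x0 by (auto intro: lc_zero)
    then have "f = zp (int m) * f'" "TT g f' = 0" using f'(2)[folded x_def] f'(3)[folded x_def] f(2) by simp_all
    then show "f = 0" using ker[OF f'(1)] by simp
  next
    fix y assume y: "y \<in> HH p"
    obtain s b where s: "s \<in> HH p" "y = TT g s + lc m b h" using hs[OF y] unfolding lm by blast
    obtain x where x: "\<forall>i<m. (\<Sum>j<m. A i j * x j) = b i" using conjunct2[OF det] by blast
    have "lc m (Ax x) h = lc m b h" using x by (intro lc_cong) (auto simp: Ax_def)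
    then have "y = TT g (s - lc m x r) + lc m x w" unfolding lw s(2) TT_diff[OF gB s(1) rH p] by simp
    then have "TT G (zp (int m) * (s - lc m x r) + lc m x (\<lambda>j. zp (int j))) = y"
      using TT_add[OF GB HH_zp[OF HH_diff[OF s(1) rH p] p] zlH p, of "int m" x x] unfolding Gg Gw by simp
    moreover have "zp (int m) * (s - lc m x r) + lc m x (\<lambda>j. zp (int j)) \<in> HH p"
      using p by (intro HH_add HH_zp zlH HH_diff s(1) rH) auto
    ultimately show "\<exists>f\<in>HH p. TT G f = y" by blast
  qed
qed

section \<open>Wiener--Hopf factorization\<close>

lemma mult_one_inverse: "x * y = 1 \<Longrightarrow> inverse x = (y::mfun)"
proof -
  assume a: "x * y = 1"
  obtain X where X: "cm X" "x = mk X" by (rule mfun_rep)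
  obtain Y where Y: "cm Y" "y = mk Y" by (rule mfun_rep)
  have "ae_eq (\<lambda>z. X z * Y z) (\<lambda>_. 1)"
    using a X Y by (simp add: mk_simps(2,4) mk_eq_iff)
  then have "ae_eq (\<lambda>z. inverse (X z)) Y"
    unfolding ae_eq_def by (rule eventually_mono) (rule inverse_unique)
  then show ?thesis using X Y by (simp add: mk_simps(7) mk_eq_iff)
qed

lemma HH_one: "1 < p \<Longrightarrow> 1 \<in> HH p" using HH_monom[of p 0] by (simp add: zp_simps)

lemma co_one: "co 1 j = (if j = 0 then 1 else 0)" using co_zp[of 0 j] by (simp add: zp_simps)

text \<open>Let \<open>x\<close> solve \<open>T(g) x = 1\<close>. Since \<open>g * fl g = 1\<close>,
  the operator maps \<open>fl (g * x)\<close> to \<open>\<sigma>\<close>, just as it maps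
  \<open>cst \<sigma> * x\<close>, so injectivity gives \<open>g * x = cst \<sigma> * fl x\<close>;
  comparing mean values yields \<open>\<sigma> * \<sigma> = 1\<close>. The reciprocal of
  \<open>x\<close> comes from the adjoint equation \<open>T(cj g) y' = 1\<close>: with
  \<open>h = g * cj y'\<close> the product \<open>x * h\<close> is analytic and at the same time the
  reflection of an analytic function, hence constant.\<close>

lemma WH_factor:
  assumes g: "g \<in> Bd" "g * fl g = 1" and I: "Inv p g" and p: "1 < p"
  obtains x y \<sigma> where "x \<in> HH p" "y \<in> HH (conj_exp p)" "x * y = 1" "\<sigma> * \<sigma> = 1" "co x 0 = \<sigma>" "co y 0 = \<sigma>" "g * x = cst \<sigma> * fl x"
proof -
  note q = conj_exp_props(1,3)[OF p]
  obtain x where x: "x \<in> HH p" "TT g x = 1" using conjunct2[OF I[unfolded Inv_def]] HH_one[OF p] by blast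
  define \<sigma> where "\<sigma> = co x 0"
  define m where "m = g * x"
  have mL: "m \<in> LL p" unfolding m_def by (rule Bd_mult_LL[OF g(1) x(1) p])
  have cm': "co m j = (if j = 0 then 1 else 0)" if "0 \<le> j" for j
    using co_PP[OF mL p, of j] x(2) that by (simp add: TT_def m_def co_one)
  have fmH: "fl m \<in> HH p" using mL cm' by (auto simp: HH_def LL_fl co_fl)
  have "g * fl m = (g * fl g) * fl x" by (simp add: m_def ac_simps)
  then have e: "g * fl m = fl x" using g(2) by simp
  have "PP (fl x) = cst \<sigma>"
  proof (rule PP_eqI)
    show "cst \<sigma> \<in> LL 1" by (simp add: Bd_LL)
    show "co (cst \<sigma>) j = (if 0 \<le> j then co (fl x) j else 0)" for j
      using co_cst[of \<sigma> 1 j] HH_neg[OF x(1), of "- j"] by (auto simp: co_fl co_one \<sigma>_def)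
  qed
  then have "TT g (fl m - cst \<sigma> * x) = 0"
    using TT_diff[OF g(1) fmH HH_cst[OF x(1) p] p, of \<sigma>] TT_cst[OF g(1) x(1) p, of \<sigma>] x(2) e by (simp add: TT_def)
  then have "fl m - cst \<sigma> * x = 0" using Inv_inj[OF I HH_diff[OF fmH HH_cst[OF x(1) p] p] _ p] by blast
  then have fm: "fl m = cst \<sigma> * x" by simp
  have "m = fl (fl m)" by simp
  also have "\<dots> = cst \<sigma> * fl x" unfolding fm by simp
  finally have gx: "g * x = cst \<sigma> * fl x" unfolding m_def .
  have "1 = co m 0" using cm' by simp
  also have "\<dots> = \<sigma> * \<sigma>" unfolding m_def gx co_cst co_fl by (simp add: \<sigma>_def)
  finally have s2: "\<sigma> * \<sigma> = 1" ..
  obtain y' where y': "y' \<in> HH (conj_exp p)" "TT (cj g) y' = 1"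
    using conjunct2[OF Inv_dual[OF I g(1) p, unfolded Inv_def]] HH_one[OF q(1)] by blast
  have cgB: "cj g \<in> Bd" using g by simp
  define h where "h = g * cj y'"
  have kL: "cj g * y' \<in> LL (conj_exp p)" by (rule Bd_mult_LL[OF cgB y'(1) q(1)])
  have hk: "h = cj (cj g * y')" by (simp add: h_def)
  have ch: "co h j = (if j = 0 then 1 else 0)" if "j \<le> 0" for j
    unfolding hk co_cj using co_PP[OF kL q(1), of "- j"] y'(2) that by (simp add: TT_def co_one split: if_splits)
  have hH: "h \<in> HH (conj_exp p)" using LL_cj[OF kL] ch by (auto simp: HH_def hk)
  have yH: "fl (cj y') \<in> HH (conj_exp p)" using y'(1) by (auto simp: HH_def LL_cj LL_fl co_fl co_cj)
  have "x * h = (g * x) * cj y'" by (simp only: h_def ac_simps)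
  also have "\<dots> = cst \<sigma> * fl (x * fl (cj y'))" unfolding gx by (simp add: mult.assoc)
  finally have xh: "x * h = cst \<sigma> * fl (x * fl (cj y'))" .
  have "x * h = cst (co (x * h) 0)"
  proof (rule const_eqI)
    show "x * h \<in> LL 1" by (rule HH_mult(1)[OF x(1) hH p])
    show "co (x * h) j = 0" if "j \<noteq> 0" for j
    proof (cases "j < 0")
      case True then show ?thesis by (rule HH_mult(2)[OF x(1) hH p])
    next
      case False
      then have "- j < 0" using that by simp
      then show ?thesis unfolding xh co_cst co_fl HH_mult(2)[OF x(1) yH p \<open>- j < 0\<close>] by simp
    qed
  qed
  also have "co (x * h) 0 = \<sigma>" unfolding HH_mult(3)[OF x(1) hH p] using ch by (simp add: \<sigma>_def)
  finally have xh1: "x * h = cst \<sigma>" .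
  show thesis
  proof (rule that[of x "cst \<sigma> * h" \<sigma>])
    show "cst \<sigma> * h \<in> HH (conj_exp p)" by (rule HH_cst[OF hH q(1)])
    have "x * (cst \<sigma> * h) = cst \<sigma> * (x * h)" by (simp only: ac_simps)
    also have "\<dots> = cst (\<sigma> * \<sigma>)" unfolding xh1 cst_simps ..
    finally show "x * (cst \<sigma> * h) = 1" unfolding s2 cst_simps .
    show "co (cst \<sigma> * h) 0 = \<sigma>" unfolding co_cst using ch by simp
  qed (use x s2 gx in \<open>simp_all add: \<sigma>_def\<close>)
qed

lemma fl_mult_QQ:
  assumes y: "y \<in> HH (conj_exp p)" and e: "e \<in> QQ p" and p: "1 < p"
  shows "fl y * e \<in> LL 1" "\<And>j. 0 \<le> j \<Longrightarrow> co (fl y * e) j = 0"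
proof -
  have J: "JJ e \<in> HH p" by (rule JJ_QQ[OF e p])
  have f: "fl y * e = JJ (JJ e * y)" unfolding mult.commute[of "JJ e"] JJ_mult by simp
  show "fl y * e \<in> LL 1" unfolding f by (rule JJ_LL[OF HH_mult(1)[OF J y p]]) simp
  show "co (fl y * e) j = 0" if "0 \<le> j" for j
    unfolding f co_JJ by (rule HH_mult(2)[OF J y p]) (use that in simp)
qed

lemma trig_poly_mk: "trig_poly \<phi> \<Longrightarrow> cm \<phi> \<and> mk \<phi> \<in> TP"
proof -
  assume "trig_poly \<phi>"
  then obtain S c where S: "finite S" "\<phi> = (\<lambda>z. \<Sum>j\<in>S. c j * z powi j)" unfolding trig_poly_def by blast
  have "cm (\<lambda>z. \<Sum>j\<in>S. c j * z powi j) \<and> mk (\<lambda>z. \<Sum>j\<in>S. c j * z powi j) \<in> TP" using S(1)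
  proof (induction S rule: finite_induct)
    case empty
    then show ?case using TP_0 by (simp add: mk_simps(1)[symmetric])
  next
    case (insert k S)
    have "mk (\<lambda>z. c k * z powi k + (\<Sum>j\<in>S. c j * z powi j)) = cst (c k) * zp k + mk (\<lambda>z. \<Sum>j\<in>S. c j * z powi j)"
      using insert by (simp add: mk_simps(3,4,8,9))
    then show ?case using insert TP.TP_step by simp
  qed
  then show ?thesis using S(2) by simp
qed

text \<open>\<open>x * PP (y * u)\<close> is the solution \<open>f\<close> of
  \<open>T(g) f = PP (g * u)\<close>, so the bound is that of the inverse of \<open>T(g)\<close>.
  Indeed \<open>e = g * f - g * u\<close> has no analytic part, and
  \<open>y = cst \<sigma> * (g * fl y)\<close> turns it into
  \<open>y * f - y * u = cst \<sigma> * (fl y * e)\<close>, which has none either.\<close>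

lemma WH_bounded:
  assumes g: "g \<in> Bd" and I: "Inv p g" and p: "1 < p" and x: "x \<in> HH p" and y: "y \<in> HH (conj_exp p)" "x * y = 1"
    and \<sigma>: "\<sigma> * \<sigma> = 1" and gx: "g * x = cst \<sigma> * fl x"
  shows "\<exists>c. \<forall>u\<in>TP. nm p (x * PP (y * u)) \<le> c * nm p u"
proof -
  note q = conj_exp_props(1,3)[OF p]
  obtain S M where SM: "0 \<le> M \<and> (\<forall>h\<in>HH p. S h \<in> HH p \<and> TT g (S h) = h \<and> nm p (S h) \<le> M * nm p h) \<and>
     (\<forall>f\<in>HH p. S (TT g f) = f) \<and> (\<forall>h\<in>HH p. \<forall>k\<in>HH p. S (h + k) = S h + S k) \<and> (\<forall>h\<in>HH p. \<forall>c. S (cst c * h) = cst c * S h)"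
    using Inv_inverse[OF I g p] by (elim exE)
  have M: "0 \<le> M" and S: "\<And>h. h \<in> HH p \<Longrightarrow> S h \<in> HH p" "\<And>h. h \<in> HH p \<Longrightarrow> TT g (S h) = h"
     "\<And>h. h \<in> HH p \<Longrightarrow> nm p (S h) \<le> M * nm p h" using SM by simp_all
  obtain C where C: "0 \<le> C" "\<And>f. f \<in> LL p \<Longrightarrow> nm p (TT g f) \<le> C * nm p f" using TT_bound[OF g p] by blast
  have "(g * x) * (y * fl y) = cst \<sigma> * (fl x * fl y) * y" unfolding gx by (simp only: ac_simps)
  moreover have "fl x * fl y = 1" using arg_cong[OF y(2), of fl] by simp
  moreover have "(g * x) * (y * fl y) = (x * y) * (g * fl y)" by (simp only: ac_simps)
  ultimately have gy: "g * fl y = cst \<sigma> * y" using y(2) by simp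
  have "y = cst (\<sigma> * \<sigma>) * y" unfolding \<sigma> cst_simps by simp
  also have "\<dots> = cst \<sigma> * (g * fl y)" unfolding gy cst_simps by (simp only: ac_simps)
  finally have yg: "y = cst \<sigma> * (g * fl y)" .
  have "nm p (x * PP (y * u)) \<le> (M * C) * nm p u" if u: "u \<in> TP" for u
  proof -
    have uL: "u \<in> LL p" using TP_LL[OF u] p by simp
    have guL: "g * u \<in> LL p" using g uL p by (simp add: LL_Bd_mult)
    have PH: "PP (g * u) \<in> HH p" by (rule PP_HH[OF guL p])
    define f where "f = S (PP (g * u))"
    have f: "f \<in> HH p" "PP (g * f) = PP (g * u)" using S(1)[OF PH] S(2)[OF PH] by (auto simp: f_def TT_def)
    have gfL: "g * f \<in> LL p" by (rule Bd_mult_LL[OF g f(1) p])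
    define e where "e = g * f - g * u"
    have "PP e = 0" unfolding e_def PP_diff[OF gfL guL p] f(2) by simp
    then have e: "e \<in> QQ p" using PP_eq_0_iff[of e p] gfL guL p by (simp add: e_def LL_diff)
    have yfu: "y * f = y * u + cst \<sigma> * (fl y * e)"
    proof -
      have "y * f - y * u = y * (f - u)" by (simp only: right_diff_distrib)
      also have "\<dots> = cst \<sigma> * (g * fl y) * (f - u)" using yg by simp
      also have "\<dots> = cst \<sigma> * (fl y * e)" unfolding e_def right_diff_distrib[symmetric] by (simp only: ac_simps)
      finally show ?thesis by (simp add: algebra_simps)
    qed
    have yL1: "y \<in> LL 1" by (rule LL_imp_LL1[OF HH_LL[OF y(1)] q(1)])
    have yuL: "y * u \<in> LL 1" using yL1 TP_Bd[OF u] by (simp add: LL_Bd_mult')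
    have "PP (y * u) = y * f"
    proof (rule PP_eqI)
      show "y * f \<in> LL 1" using HH_mult(1)[OF f(1) y(1) p] by (simp add: mult.commute)
      fix j
      show "co (y * f) j = (if 0 \<le> j then co (y * u) j else 0)"
      proof (cases "0 \<le> j")
        case True
        have "co (y * f) j = co (y * u) j + \<sigma> * co (fl y * e) j"
          unfolding yfu co_cst[symmetric] using fl_mult_QQ(1)[OF y(1) e p] by (intro co_add yuL LL_cst) simp_all
        then show ?thesis using fl_mult_QQ(2)[OF y(1) e p True] True by simp
      next
        case False
        then show ?thesis using HH_mult(2)[OF f(1) y(1) p, of j] by (simp add: mult.commute)
      qed
    qed
    then have "x * PP (y * u) = (x * y) * f" by (simp only: mult.assoc)
    then have "nm p (x * PP (y * u)) = nm p (S (TT g u))" using y(2) by (simp add: f_def TT_def)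
    also have "\<dots> \<le> M * nm p (TT g u)" using S(3)[OF PH] by (simp add: TT_def)
    also have "\<dots> \<le> M * (C * nm p u)" by (rule mult_left_mono[OF C(2)[OF uL] M])
    finally show ?thesis by (simp add: mult.assoc)
  qed
  then show ?thesis by blast
qed

text \<open>Liouville's argument in terms of coefficients: the left side has none of negative index,
  the right side none above \<open>k\<close>.\<close>

lemma plus_minus_unique:
  assumes x: "x \<in> HH p" and A: "A \<in> HH (conj_exp p)" and B: "fl B \<in> HH (conj_exp p)" and p: "1 < p"
    and e: "x * A = cst s * (zp k * (fl x * B))" and ne: "x * A \<noteq> 0"
  shows "0 \<le> k" "k = 0 \<Longrightarrow> x * A = cst (co (x * A) 0)"
proof -
  have c: "co (x * A) j = 0" if "k < j" for j
  proof -
    have f: "fl x * B = fl (x * fl B)" by simp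
    have "co (x * A) j = s * co (x * fl B) (k - j)" unfolding e co_cst co_zp_mult f co_fl minus_diff_eq ..
    then show ?thesis using HH_mult(2)[OF x B p, of "k - j"] that by simp
  qed
  note L = HH_mult(1)[OF x A p] and n = HH_mult(2)[OF x A p]
  show "0 \<le> k"
  proof (rule ccontr)
    assume "\<not> 0 \<le> k"
    then have "co (x * A) j = 0" for j using c[of j] n[of j] by (cases "k < j") auto
    then show False using co_unique[OF L] ne by blast
  qed
  show "x * A = cst (co (x * A) 0)" if "k = 0"
  proof (rule const_eqI[OF L])
    show "co (x * A) j = 0" if "j \<noteq> 0" for j using c[of j] n[of j] \<open>k = 0\<close> that by (cases "j < 0") auto
  qed
qed

lemma Hbar_iff: "F \<in> Hbar p \<longleftrightarrow> cm F \<and> fl (mk F) \<in> HH p"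
proof -
  have l: "fl (mk F) \<in> LL p \<longleftrightarrow> mk F \<in> LL p" using LL_fl[of "fl (mk F)" p] LL_fl[of "mk F" p] by auto
  have c: "(\<forall>j>0. co (mk F) j = 0) \<longleftrightarrow> (\<forall>j<0. co (mk F) (- j) = 0)" by (metis minus_minus neg_0_less_iff_less)
  show ?thesis by (cases "cm F") (simp_all add: Hbar_def Lp_iff HH_def l co_fl fc_co c)
qed

section \<open>Existence and uniqueness of the normalised factorization\<close>

lemma WH_exists:
  assumes d: "cm d" and g: "g = mk d * zp (- k)" "g \<in> Bd" and I: "Inv p g" and p: "1 < p"
    and x: "x \<in> HH p" and y: "y \<in> HH (conj_exp p)" "x * y = 1" and \<sigma>: "\<sigma> * \<sigma> = 1" "co x 0 = \<sigma>" and gx: "g * x = cst \<sigma> * fl x"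
  shows "\<exists>am ap. wh_fact p d am k ap \<and> fc am 0 = 1"
proof -
  note q = conj_exp_props(1,3)[OF p]
  obtain ap where ap: "cm ap" "y = mk ap" by (rule mfun_rep)
  \<comment> \<open>The sign goes into the minus factor: its mean value becomes
    \<open>\<sigma> * \<sigma> = 1\<close>, as the normalisation demands.\<close>
  obtain am where am: "cm am" "cst \<sigma> * fl x = mk am" by (rule mfun_rep)
  have ss: "cst \<sigma> * cst \<sigma> = 1" unfolding cst_simps(4)[symmetric] \<sigma> cst_simps ..
  have fxy: "fl x * fl y = 1" using arg_cong[OF y(2), of fl] by simp
  have "(cst \<sigma> * fl x) * (cst \<sigma> * fl y) = (cst \<sigma> * cst \<sigma>) * (fl x * fl y)" by (simp only: ac_simps)
  then have "(cst \<sigma> * fl x) * (cst \<sigma> * fl y) = 1" unfolding ss fxy by simp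
  then have im: "mk (\<lambda>t. inverse (am t)) = cst \<sigma> * fl y" using am mult_one_inverse by (simp add: mk_simps(7)[symmetric])
  have ip: "mk (\<lambda>t. inverse (ap t)) = x"
    using ap mult_one_inverse[of y x] y(2) by (simp add: mk_simps(7)[symmetric] mult.commute)
  have "mk d = (mk d * zp (- k)) * zp k" by (simp add: mult.assoc zp_simps)
  also have "\<dots> = (g * x) * zp k * y"
  proof -
    have "(g * x) * zp k * y = (x * y) * (g * zp k)" by (simp only: ac_simps)
    then show ?thesis using y(2) g(1) by simp
  qed
  also have "\<dots> = mk (\<lambda>t. am t * t powi k * ap t)" unfolding gx am(2) ap(2) using am(1) ap(1) by (simp add: mk_simps(4,9))
  finally have 1: "ae_eq d (\<lambda>t. am t * t powi k * ap t)" using d am(1) ap(1) by (simp add: mk_eq_iff)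
  obtain c where c: "\<And>u. u \<in> TP \<Longrightarrow> nm p (x * PP (y * u)) \<le> c * nm p u"
    using WH_bounded[OF g(2) I p x y \<sigma>(1) gx] by blast
  have 2: "pnorm p (\<lambda>t. inverse (ap t) * Pr (\<lambda>z. ap z * \<phi> z) t) \<le> c * pnorm p \<phi>" if t: "trig_poly \<phi>" for \<phi>
  proof -
    have \<phi>: "cm \<phi>" "mk \<phi> \<in> TP" using trig_poly_mk[OF t] by auto
    have m: "cm (\<lambda>z. ap z * \<phi> z)" "mk (\<lambda>z. ap z * \<phi> z) = y * mk \<phi>" using ap \<phi> by (simp_all add: mk_simps(4))
    have L: "mk (\<lambda>z. ap z * \<phi> z) \<in> LL (conj_exp p)" unfolding m(2) using HH_LL[OF y(1)] TP_Bd[OF \<phi>(2)] q by (simp add: LL_Bd_mult')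
    note P = Pr_mk[OF m(1) L q(1), unfolded m(2)]
    have i: "cm (\<lambda>t. inverse (ap t))" using ap by simp
    have "mk (\<lambda>t. inverse (ap t) * Pr (\<lambda>z. ap z * \<phi> z) t) = x * PP (y * mk \<phi>)"
      using mk_simps(4)[OF i P(1)] unfolding ip P(2) by simp
    moreover have "cm (\<lambda>t. inverse (ap t) * Pr (\<lambda>z. ap z * \<phi> z) t)" using i P(1) by simp
    ultimately show ?thesis using c[OF \<phi>(2)] \<phi>(1) by (simp add: pnorm_nm)
  qed
  have "wh_fact p d am k ap" unfolding wh_fact_def
  proof (intro conjI)
    show "ap \<in> Hp (conj_exp p)" "(\<lambda>t. inverse (ap t)) \<in> Hp p" using ap y x by (auto simp: Hp_iff ip)
    show "am \<in> Hbar p" using am x p by (auto simp: Hbar_iff HH_cst simp flip: am(2))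
    show "(\<lambda>t. inverse (am t)) \<in> Hbar (conj_exp p)" using am y q by (auto simp: Hbar_iff im HH_cst)
    show "\<exists>c. \<forall>\<phi>. trig_poly \<phi> \<longrightarrow> pnorm p (\<lambda>t. inverse (ap t) * Pr (\<lambda>z. ap z * \<phi> z) t) \<le> c * pnorm p \<phi>" using 2 by blast
  qed (rule 1)
  moreover have "fc am 0 = 1" using am(1) \<sigma> by (simp add: fc_co co_cst co_fl flip: am(2))
  ultimately show ?thesis by blast
qed

text \<open>\<open>wh_plus\<close> is a choice, so an arbitrary normalised factorization has to be
  compared with the one at hand. The quotient \<open>x * A\<close> of the plus factors and its
  reciprocal \<open>y * A'\<close> both satisfy an equation of the type in
  \<open>plus_minus_unique\<close>; the two inequalities for the exponents give
  \<open>k = m\<close>, so the quotient is a constant, and the normalisation makes it 1.\<close>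

lemma WH_unique:
  assumes d: "cm d" and g: "g = mk d * zp (- k)" "g * fl g = 1" and p: "1 < p"
    and x: "x \<in> HH p" and y: "y \<in> HH (conj_exp p)" "x * y = 1" and \<sigma>: "\<sigma> * \<sigma> = 1" "co x 0 = \<sigma>" and gx: "g * x = cst \<sigma> * fl x"
    and w: "wh_fact p d am m ap" "fc am 0 = 1"
  shows "cm ap" "mk ap = y"
proof -
  note q = conj_exp_props(1,3)[OF p]
  define A A' B B' where "A = mk ap" and "A' = mk (\<lambda>t. inverse (ap t))" and "B = mk am" and "B' = mk (\<lambda>t. inverse (am t))"
  have w0: "ae_eq d (\<lambda>t. am t * t powi m * ap t)" "ap \<in> Hp (conj_exp p)" "(\<lambda>t. inverse (ap t)) \<in> Hp p"
     "am \<in> Hbar p" "(\<lambda>t. inverse (am t)) \<in> Hbar (conj_exp p)" using w(1) unfolding wh_fact_def by blast+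
  have cma: "cm ap" "cm am" using w0 by (auto simp: Hp_iff Hbar_iff)
  show "cm ap" by fact
  have A: "A \<in> HH (conj_exp p)" "A' \<in> HH p" "fl B \<in> HH p" "fl B' \<in> HH (conj_exp p)"
    using w0 by (auto simp: Hp_iff Hbar_iff A_def A'_def B_def B'_def)
  have D: "mk d = B * zp m * A" using w0(1) d cma by (simp add: A_def B_def mk_simps(4,9) mk_eq_iff)
  have ss: "cst \<sigma> * cst \<sigma> = 1" unfolding cst_simps(4)[symmetric] \<sigma> cst_simps ..
  have fxy: "fl x * fl y = 1" using arg_cong[OF y(2), of fl] by simp
  have BA: "g = B * zp (m - k) * A"
  proof -
    have "g = B * (zp m * zp (- k)) * A" unfolding g(1) D by (simp only: ac_simps)
    then show ?thesis by (simp add: zp_simps)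
  qed
  have "A * (B * zp (m - k) * fl g) = g * fl g" "B * (A * zp (m - k) * fl g) = g * fl g" unfolding BA by (simp_all only: ac_simps)
  then have iA: "A * (B * zp (m - k) * fl g) = 1" and iB: "B * (A * zp (m - k) * fl g) = 1" using g(2) by simp_all
  have A'_eq: "A' = B * zp (m - k) * fl g" using mult_one_inverse[OF iA] cma by (simp add: A_def A'_def mk_simps(7))
  have B'_eq: "B' = A * zp (m - k) * fl g" using mult_one_inverse[OF iB] cma by (simp add: B_def B'_def mk_simps(7))
  have AA: "A * A' = 1" and BB: "B * B' = 1" using iA iB by (simp_all add: A'_eq B'_eq)
  have gxy: "g = cst \<sigma> * fl x * y"
  proof -
    have "(g * x) * y = (x * y) * g" by (simp only: ac_simps)
    then show ?thesis unfolding gx y(2) by simp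
  qed
  have e1: "x * A = cst \<sigma> * (zp (k - m) * (fl x * B'))"
  proof -
    have "cst \<sigma> * (zp (k - m) * (fl x * B')) = (x * y) * (cst \<sigma> * (zp (k - m) * (fl x * B')))" using y(2) by simp
    also have "\<dots> = (cst \<sigma> * fl x * y) * (zp (k - m) * x * B')" by (simp only: ac_simps)
    also have "\<dots> = (B * B') * ((zp (m - k) * zp (k - m)) * (x * A))" unfolding gxy[symmetric] BA by (simp only: ac_simps)
    finally show ?thesis using BB by (simp add: zp_simps)
  qed
  have e2: "A' * y = cst \<sigma> * (zp (m - k) * (fl y * B))"
  proof -
    have "cst \<sigma> * (zp (m - k) * (fl y * B)) = (A * A') * (cst \<sigma> * (zp (m - k) * (fl y * B)))" using AA by simp
    also have "\<dots> = (B * zp (m - k) * A) * (cst \<sigma> * fl y * A')" by (simp only: ac_simps)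
    also have "\<dots> = (cst \<sigma> * cst \<sigma>) * (fl x * fl y) * (A' * y)" unfolding BA[symmetric] gxy by (simp only: ac_simps)
    finally show ?thesis using ss fxy by simp
  qed
  have n1: "x * A \<noteq> 0"
  proof
    assume "x * A = 0"
    then have "(x * A) * (y * A') = 0" by simp
    moreover have "(x * A) * (y * A') = (x * y) * (A * A')" by (simp only: ac_simps)
    ultimately show False using y(2) AA by simp
  qed
  have n2: "y * A' \<noteq> 0"
  proof
    assume "y * A' = 0"
    then have "(x * A) * (y * A') = 0" by simp
    moreover have "(x * A) * (y * A') = (x * y) * (A * A')" by (simp only: ac_simps)
    ultimately show False using y(2) AA by simp
  qed
  note u1 = plus_minus_unique[OF x A(1) A(4) p e1 n1]
  have yq: "A' \<in> HH (conj_exp (conj_exp p))" "fl B \<in> HH (conj_exp (conj_exp p))" using A q by auto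
  have e2': "y * A' = cst \<sigma> * (zp (m - k) * (fl y * B))" using e2 by (simp only: mult.commute)
  note u2 = plus_minus_unique[OF y(1) yq q(1) e2' n2]
  have km: "k - m = 0" using u1(1) u2(1) by simp
  define \<kappa> where "\<kappa> = co (x * A) 0"
  have xA: "x * A = cst \<kappa>" using u1(2)[OF km] by (simp add: \<kappa>_def)
  have Ay: "A = cst \<kappa> * y"
  proof -
    have "cst \<kappa> * y = (x * y) * A" unfolding xA[symmetric] by (simp only: ac_simps)
    then show ?thesis using y(2) by simp
  qed
  have "cst \<sigma> * fl x = cst \<kappa> * B"
  proof -
    have "cst \<sigma> * fl x = (x * y) * (cst \<sigma> * fl x)" using y(2) by simp
    also have "\<dots> = g * x" unfolding gxy by (simp only: ac_simps)
    also have "\<dots> = B * (x * A)" unfolding BA using km by (simp add: zp_simps ac_simps)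
    finally show ?thesis unfolding xA by (simp only: mult.commute)
  qed
  then have "co (cst \<sigma> * fl x) 0 = co (cst \<kappa> * B) 0" by simp
  then have "\<kappa> = 1" using \<sigma> w(2) cma by (simp add: co_cst co_fl B_def fc_co)
  then show "mk ap = y" using Ay by (simp add: A_def cst_simps)
qed

lemma wh_plus_eq:
  assumes d: "cm d" and g: "g = mk d * zp (- k)" "g \<in> Bd" "g * fl g = 1" and I: "Inv p g" and p: "1 < p"
  obtains x y \<sigma> where "x \<in> HH p" "y \<in> HH (conj_exp p)" "x * y = 1" "\<sigma> * \<sigma> = 1" "co x 0 = \<sigma>" "g * x = cst \<sigma> * fl x"
    "cm (wh_plus p d)" "mk (wh_plus p d) = y" "wh_sigma p d = \<sigma>"
proof -
  obtain x y \<sigma> where x: "x \<in> HH p" "y \<in> HH (conj_exp p)" "x * y = 1" "\<sigma> * \<sigma> = 1" "co x 0 = \<sigma>" "co y 0 = \<sigma>" "g * x = cst \<sigma> * fl x"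
    using WH_factor[OF g(2,3) I p] .
  define Q where "Q = (\<lambda>(am, m, ap). wh_fact p d am m ap \<and> fc am 0 = 1)"
  obtain am ap where a: "wh_fact p d am k ap" "fc am 0 = 1"
    using WH_exists[OF d g(1,2) I p x(1-5,7)] by blast
  then have "Q (am, k, ap)" by (simp add: Q_def)
  then have s: "Q (SOME z. Q z)" by (rule someI)
  obtain am' m' ap' where z: "(SOME z. Q z) = (am', m', ap')" by (cases "SOME z. Q z")
  have w: "wh_fact p d am' m' ap'" "fc am' 0 = 1" using s unfolding z by (simp_all add: Q_def)
  have "wh_plus p d = ap'" unfolding wh_plus_def Q_def[symmetric] z by simp
  then have c: "cm (wh_plus p d)" "mk (wh_plus p d) = y"
    using WH_unique[OF d g(1,3) p x(1-5,7) w] by simp_all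
  then show thesis using that[OF x(1-5,7) c] x(6) by (simp add: wh_sigma_def fc_co)
qed

section \<open>Kernel and range of \<open>T(a) + H(b)\<close>\<close>

definition THm :: "mfun \<Rightarrow> mfun \<Rightarrow> mfun \<Rightarrow> mfun" where "THm a b f = PP (a * f + b * JJ f)"

lemma THm_LL:
  assumes "a \<in> Bd" "b \<in> Bd" "f \<in> HH p" "1 < p"
  shows "a * f \<in> LL p" "b * JJ f \<in> LL p" "a * f + b * JJ f \<in> LL p"
proof -
  show 1: "a * f \<in> LL p" by (rule Bd_mult_LL[OF assms(1,3,4)])
  have "JJ f \<in> LL p" by (rule QQ_LL[OF JJ_HH[OF assms(3,4)]])
  then show 2: "b * JJ f \<in> LL p" using assms by (simp add: LL_Bd_mult)
  show "a * f + b * JJ f \<in> LL p" using 1 2 assms by (simp add: LL_add)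
qed

lemma THm_HH: "a \<in> Bd \<Longrightarrow> b \<in> Bd \<Longrightarrow> f \<in> HH p \<Longrightarrow> 1 < p \<Longrightarrow> THm a b f \<in> HH p"
  unfolding THm_def by (intro PP_HH THm_LL)

lemma THm_add:
  assumes "a \<in> Bd" "b \<in> Bd" "f \<in> HH p" "h \<in> HH p" "1 < p"
  shows "THm a b (f + h) = THm a b f + THm a b h"
proof -
  have "a * (f + h) + b * JJ (f + h) = (a * f + b * JJ f) + (a * h + b * JJ h)" by (simp add: JJ_add algebra_simps)
  then show ?thesis unfolding THm_def using PP_add[OF THm_LL(3)[OF assms(1,2,3,5)] THm_LL(3)[OF assms(1,2,4,5)] assms(5)] by simp
qed

lemma THm_cst:
  assumes "a \<in> Bd" "b \<in> Bd" "f \<in> HH p" "1 < p"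
  shows "THm a b (cst c * f) = cst c * THm a b f"
proof -
  have "a * (cst c * f) + b * JJ (cst c * f) = cst c * (a * f + b * JJ f)" unfolding JJ_mult fl_simps by (simp only: algebra_simps)
  then show ?thesis unfolding THm_def using PP_cst[OF THm_LL(3)[OF assms] THm_LL(3)[OF assms] assms(4)] by simp
qed

lemma THm_bound:
  assumes ab: "a \<in> Bd" "b \<in> Bd" and p: "1 < p"
  shows "\<exists>C. \<forall>f\<in>HH p. nm p (THm a b f) \<le> C * nm p f"
proof -
  obtain A where A: "0 \<le> A" "\<And>f. f \<in> LL p \<Longrightarrow> nm p (TT a f) \<le> A * nm p f" using TT_bound[OF ab(1) p] by blast
  obtain B where B: "0 \<le> B" "\<And>f. f \<in> LL p \<Longrightarrow> nm p (TT b f) \<le> B * nm p f" using TT_bound[OF ab(2) p] by blast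
  have "nm p (THm a b f) \<le> (A + B) * nm p f" if f: "f \<in> HH p" for f
  proof -
    note L = THm_LL[OF ab f p]
    have J: "JJ f \<in> LL p" by (rule QQ_LL[OF JJ_HH[OF f p]])
    have "THm a b f = TT a f + TT b (JJ f)" unfolding THm_def TT_def by (rule PP_add[OF L(1,2) p])
    then have "nm p (THm a b f) \<le> nm p (TT a f) + nm p (TT b (JJ f))"
      using nm_triangle[OF PP_LL[OF L(1) p] PP_LL[OF L(2) p] p] by (simp add: TT_def)
    also have "\<dots> \<le> A * nm p f + B * nm p (JJ f)" using A(2)[OF HH_LL[OF f]] B(2)[OF J] by (rule add_mono)
    also have "nm p (JJ f) = nm p f" using nm_JJ[OF HH_LL[OF f]] p by simp
    finally show ?thesis by (simp add: distrib_right)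
  qed
  then show ?thesis by blast
qed

text \<open>\<open>ai\<close> and \<open>bi\<close> are the inverses of \<open>a\<close> and
  \<open>b\<close>, \<open>y\<close> is the plus factor of \<open>d\<close> and \<open>x\<close> its
  reciprocal. The functions \<open>\<omega> k\<close> are described only by the equation that they
  solve, which keeps the choices behind \<open>omega\<close> out of the argument.\<close>

locale TH_pair =
  fixes p :: real and n :: nat and a ai b bi x y :: mfun and \<sigma> :: complex and \<omega> :: "nat \<Rightarrow> mfun"
  assumes p: "1 < p" and Bd: "a \<in> Bd" "ai \<in> Bd" "b \<in> Bd" "bi \<in> Bd"
    and ainv: "a * ai = 1" and binv: "b * bi = 1" and match: "a * fl a = b * fl b"
    and InvC: "Inv p (a * bi * zp (- 2 * int n))" and InvD: "Inv p (a * fl bi * zp (2 * int n))"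
    and x: "x \<in> HH p" and y: "y \<in> HH (conj_exp p)" and xy: "x * y = 1" and \<sigma>: "\<sigma> * \<sigma> = 1"
    and dx0: "a * fl bi * zp (2 * int n) * x = cst \<sigma> * fl x"
    and \<omega>: "\<And>k. k < n \<Longrightarrow> \<omega> k \<in> HH p"
    and \<omega>T: "\<And>k. k < n \<Longrightarrow> TT (a * bi * zp (- 2 * int n)) (\<omega> k) =
       TT (fl ai * zp (- int n)) (x * (zp (int n - 1 - int k) + cst \<sigma> * zp (int n + int k)))"
begin

definition "c = a * bi"
definition "d = a * fl bi"
definition "e k = x * (zp (int n - 1 - int k) + cst \<sigma> * zp (int n + int k))"

lemma flinv: "fl a * fl ai = 1" "fl b * fl bi = 1"
  using arg_cong[OF ainv, of fl] arg_cong[OF binv, of fl] by simp_all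

lemma fxy: "fl x * fl y = 1" using arg_cong[OF xy, of fl] by simp

lemma afa: "a * fl a * (bi * fl bi) = 1"
proof -
  have "b * fl b * (bi * fl bi) = (b * bi) * (fl b * fl bi)" by (simp only: ac_simps)
  then show ?thesis unfolding match binv flinv by simp
qed

lemma cfc: "c * fl c = 1"
proof -
  have "c * fl c = a * fl a * (bi * fl bi)" by (simp add: c_def ac_simps)
  then show ?thesis unfolding afa .
qed

lemma dfd: "d * fl d = 1"
proof -
  have "d * fl d = a * fl a * (bi * fl bi)" by (simp add: d_def ac_simps)
  then show ?thesis unfolding afa .
qed

text \<open>The source of the symbol \<open>fl ai\<close> in the definition of \<open>omega\<close>:
  when \<open>JJ u = d * u\<close>, the right side \<open>bi * JJ u\<close> of the equation for
  \<open>f\<close> is \<open>fl ai * u\<close>.\<close>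

lemma bid: "bi * d = fl ai"
proof -
  have "fl ai = fl ai * (a * fl a * (bi * fl bi))" unfolding afa by simp
  also have "\<dots> = (fl a * fl ai) * (bi * d)" by (simp only: d_def ac_simps)
  finally show ?thesis unfolding flinv by simp
qed

lemma cBd [simp]: "c \<in> Bd" "d \<in> Bd" using Bd by (simp_all add: c_def d_def)

lemma dx: "d * x = cst \<sigma> * (zp (- 2 * int n) * fl x)"
proof -
  have "cst \<sigma> * (zp (- 2 * int n) * fl x) = zp (- 2 * int n) * (cst \<sigma> * fl x)" by (simp only: ac_simps)
  also have "\<dots> = zp (- 2 * int n) * (zp (2 * int n) * (d * x))" unfolding dx0[symmetric] d_def by (simp only: ac_simps)
  also have "\<dots> = d * x" by (simp add: zp_simps)
  finally show ?thesis ..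
qed

lemma ss: "cst \<sigma> * cst \<sigma> = 1" unfolding cst_simps(4)[symmetric] \<sigma> cst_simps ..

lemma eH: "k < n \<Longrightarrow> e k \<in> HH p"
proof -
  assume k: "k < n"
  have "e k = zp (int n - 1 - int k) * x + cst \<sigma> * (zp (int n + int k) * x)" by (simp add: e_def algebra_simps)
  then show ?thesis using k p x by (auto intro!: HH_add HH_cst HH_zp)
qed

lemma leH: "lc n s e \<in> HH p" by (rule lc_HH[OF p eH])
lemma l\<omega>H: "lc n s \<omega> \<in> HH p" by (rule lc_HH[OF p \<omega>])

text \<open>By \<open>dx\<close>, multiplication by \<open>d\<close> replaces \<open>x\<close> with
  \<open>fl x\<close> at the cost of \<open>\<sigma>\<close> and a shift by \<open>- 2n\<close>. The
  exponents \<open>n - 1 - k\<close> and \<open>n + k\<close> add up to \<open>2n - 1\<close>, so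
  this shift and the flip exchange the two terms of \<open>e k\<close>, and
  \<open>\<sigma> * \<sigma> = 1\<close> restores the coefficients.\<close>

lemma JJ_e: "JJ (e k) = d * e k"
proof -
  have "d * e k = (d * x) * (zp (int n - 1 - int k) + cst \<sigma> * zp (int n + int k))" by (simp only: e_def ac_simps)
  also have "\<dots> = fl x * (cst \<sigma> * (zp (- 2 * int n) * zp (int n - 1 - int k)) + (cst \<sigma> * cst \<sigma>) * (zp (- 2 * int n) * zp (int n + int k)))"
    unfolding dx by (simp only: algebra_simps)
  also have "\<dots> = fl x * (cst \<sigma> * zp (- 1 - int n - int k) + zp (int k - int n))"
    unfolding ss zp_simps by (simp add: algebra_simps)
  finally have 1: "d * e k = fl x * (cst \<sigma> * zp (- 1 - int n - int k) + zp (int k - int n))" .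
  have "JJ (e k) = fl x * (zp (- 1) * zp (- (int n - 1 - int k)) + cst \<sigma> * (zp (- 1) * zp (- (int n + int k))))"
    by (simp add: e_def JJ_def algebra_simps)
  also have "\<dots> = fl x * (cst \<sigma> * zp (- 1 - int n - int k) + zp (int k - int n))"
    unfolding zp_simps by (simp add: algebra_simps)
  finally show ?thesis using 1 by simp
qed

lemma JJ_lc: "JJ (lc n s f) = lc n s (\<lambda>k. JJ (f k))"
  unfolding JJ_def lc_mult[symmetric] by (rule arg_cong[where f="\<lambda>u. zp (- 1) * u"], induction n) (simp_all add: lc_Suc)

lemma JJ_le: "JJ (lc n s e) = d * lc n s e"
  unfolding JJ_lc lc_mult JJ_e ..

lemma lc_e: "lc n s e = x * lc n s (\<lambda>k. zp (int n - 1 - int k) + cst \<sigma> * zp (int n + int k))"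
  unfolding lc_mult by (rule lc_cong) (simp_all add: e_def)

lemma co_lz:
  assumes "0 \<le> j"
  shows "co (lc n s (\<lambda>k. zp (int n - 1 - int k) + cst \<sigma> * zp (int n + int k))) j =
    (if j < int n then s (n - 1 - nat j) else if j < 2 * int n then \<sigma> * s (nat j - n) else 0)"
proof -
  have H: "zp (int n - 1 - int k) + cst \<sigma> * zp (int n + int k) \<in> HH p" if "k < n" for k
    using that p by (intro HH_add HH_cst HH_monom) auto
  have L: "zp i \<in> LL 1" "cst \<sigma> * zp i \<in> LL 1" for i by (simp_all add: Bd_LL)
  have "co (lc n s (\<lambda>k. zp (int n - 1 - int k) + cst \<sigma> * zp (int n + int k))) j =
     (\<Sum>k<n. s k * ((if int n - 1 - int k = j then 1 else 0) + \<sigma> * (if int n + int k = j then 1 else 0)))"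
    using co_lc[OF p H, of n "\<lambda>k. k" s j] unfolding co_add[OF L] co_cst co_zp by simp
  also have "\<dots> = (\<Sum>k<n. (if k = n - 1 - nat j then (if j < int n then s k else 0) else 0)) +
      (\<Sum>k<n. (if k = nat j - n then (if int n \<le> j then \<sigma> * s k else 0) else 0))"
    unfolding sum.distrib[symmetric]
  proof (intro sum.cong refl)
    fix k assume "k \<in> {..<n}"
    then have "int n - 1 - int k = j \<longleftrightarrow> j < int n \<and> k = n - 1 - nat j" "int n + int k = j \<longleftrightarrow> int n \<le> j \<and> k = nat j - n"
      using assms by auto
    then show "s k * ((if int n - 1 - int k = j then 1 else 0) + \<sigma> * (if int n + int k = j then 1 else 0)) =
      (if k = n - 1 - nat j then (if j < int n then s k else 0) else 0) + (if k = nat j - n then (if int n \<le> j then \<sigma> * s k else 0) else 0)"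
      by simp
  qed
  also have "\<dots> = (if j < int n then s (n - 1 - nat j) else if j < 2 * int n then \<sigma> * s (nat j - n) else 0)"
    unfolding sum.delta'[OF finite_lessThan] sum.delta[OF finite_lessThan] using assms by auto
  finally show ?thesis .
qed

lemma lz_HH: "lc n s (\<lambda>k. zp (int n - 1 - int k) + cst \<sigma> * zp (int n + int k)) \<in> HH p"
  by (rule lc_HH[OF p], intro HH_add HH_cst HH_monom) (use p in auto)

lemma le_eq_0: "lc n s e = 0 \<Longrightarrow> k < n \<Longrightarrow> s k = 0"
proof -
  assume z: "lc n s e = 0" and k: "k < n"
  have "y * lc n s e = (x * y) * lc n s (\<lambda>k. zp (int n - 1 - int k) + cst \<sigma> * zp (int n + int k))"
    unfolding lc_e by (simp only: ac_simps)
  then have "lc n s (\<lambda>k. zp (int n - 1 - int k) + cst \<sigma> * zp (int n + int k)) = 0" unfolding z xy by simp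
  then have "0 = co (lc n s (\<lambda>k. zp (int n - 1 - int k) + cst \<sigma> * zp (int n + int k))) (int (n - 1 - k))" by simp
  also have "\<dots> = s (n - 1 - nat (int (n - 1 - k)))" using co_lz[of "int (n - 1 - k)" s] k by simp
  also have "n - 1 - nat (int (n - 1 - k)) = k" using k by simp
  finally show ?thesis by simp
qed

text \<open>\<open>v = y u\<close> satisfies \<open>v = \<sigma> z^(2n-1) fl v\<close> and hence is a polynomial of degree less than \<open>2n\<close> with (skew-)symmetric coefficients.\<close>

lemma homogeneous_solution:
  assumes u: "u \<in> HH p" and J: "JJ u = d * u"
  shows "\<exists>s. u = lc n s e"
proof -
  define v where "v = u * y"
  have xv: "u = x * v"
  proof -
    have "x * v = (x * y) * u" by (simp only: v_def ac_simps)
    then show ?thesis unfolding xy by simp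
  qed
  have vL: "v \<in> LL 1" and vn: "\<And>j. j < 0 \<Longrightarrow> co v j = 0" unfolding v_def using HH_mult[OF u y p] by blast+
  have "zp (- 1) * fl v = fl y * JJ u"
  proof -
    have "fl y * JJ u = (fl x * fl y) * (zp (- 1) * fl v)" unfolding xv JJ_def by (simp add: ac_simps)
    then show ?thesis unfolding fxy by simp
  qed
  also have "\<dots> = fl y * ((d * x) * v)" unfolding J by (simp only: xv ac_simps)
  also have "\<dots> = (fl x * fl y) * (cst \<sigma> * (zp (- 2 * int n) * v))" unfolding dx by (simp only: ac_simps)
  finally have e1: "zp (- 1) * fl v = cst \<sigma> * (zp (- 2 * int n) * v)" unfolding fxy by simp
  have sym: "co v (- 1 - j) = \<sigma> * co v (j + 2 * int n)" for j
  proof -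
    have "co (zp (- 1) * fl v) j = co (cst \<sigma> * (zp (- 2 * int n) * v)) j" unfolding e1 ..
    then show ?thesis unfolding co_zp_mult co_cst co_fl by (simp add: algebra_simps)
  qed
  define s where "s k = co v (int n - 1 - int k)" for k :: nat
  have "v = lc n s (\<lambda>k. zp (int n - 1 - int k) + cst \<sigma> * zp (int n + int k))"
  proof (rule co_eqI[OF vL LL_imp_LL1[OF HH_LL[OF lz_HH] p]])
    fix j
    show "co v j = co (lc n s (\<lambda>k. zp (int n - 1 - int k) + cst \<sigma> * zp (int n + int k))) j"
    proof (cases "j < 0")
      case True then show ?thesis using vn HH_neg[OF lz_HH] by simp
    next
      case False
      have c: "co v j = \<sigma> * co v (2 * int n - 1 - j)"
      proof -
        have "\<sigma> * co v (2 * int n - 1 - j) = (\<sigma> * \<sigma>) * co v j" using sym[of "j - 2 * int n"] by (simp add: algebra_simps)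
        then show ?thesis unfolding \<sigma> by simp
      qed
      consider "j < int n" | "int n \<le> j" "j < 2 * int n" | "2 * int n \<le> j" by linarith
      then show ?thesis
      proof cases
        case 1
        then have "int n - 1 - int (n - 1 - nat j) = j" using False by simp
        then show ?thesis using 1 False co_lz[of j s] by (simp add: s_def)
      next
        case 2
        then have i: "int n - 1 - int (nat j - n) = 2 * int n - 1 - j" using False by simp
        have "co (lc n s (\<lambda>k. zp (int n - 1 - int k) + cst \<sigma> * zp (int n + int k))) j = \<sigma> * s (nat j - n)"
          using 2 False co_lz[of j s] by simp
        then show ?thesis unfolding s_def i c[symmetric] ..
      next
        case 3
        then show ?thesis using False co_lz[of j s] c vn[of "2 * int n - 1 - j"] by simp
      qed
    qed
  qed
  then have "u = lc n s e" using xv lc_e[of s] by simp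
  then show ?thesis by blast
qed

lemma JJ_d: "d * JJ (d * f) = JJ f" "c * JJ (c * f) = JJ f"
  unfolding JJ_mult mult.assoc[symmetric] dfd cfc by simp_all

text \<open>The reflection \<open>R \<mapsto> - d J R\<close> fixes the defect \<open>R\<close> of the first approximation \<open>u0\<close>, so that adding \<open>J R / 2\<close> repairs it.\<close>

lemma inhomogeneous_solution:
  assumes g: "g \<in> HH p"
  shows "\<exists>u\<in>HH p. d * u - JJ u = g - d * JJ g"
proof -
  have JgL: "JJ g \<in> LL p" by (rule QQ_LL[OF JJ_HH[OF g p]])
  have dJL: "d * JJ g \<in> LL p" using JgL p by (simp add: LL_Bd_mult)
  define r0 where "r0 = g - PP (d * JJ g)"
  have r0: "r0 \<in> HH p" unfolding r0_def by (intro HH_diff g PP_HH dJL p)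
  obtain \<psi> where \<psi>: "\<psi> \<in> HH p" "TT (d * zp (2 * int n)) \<psi> = r0"
    using conjunct2[OF InvD[unfolded Inv_def]] r0 unfolding d_def by blast
  \<comment> \<open>Solving with the invertible shifted operator and multiplying by
    \<open>zp (2 * int n)\<close> yields \<open>PP (d * u0) = r0\<close>. This settles the analytic
    part of the equation; the defect lies in \<open>QQ p\<close>.\<close>
  define u0 where "u0 = zp (2 * int n) * \<psi>"
  have u0: "u0 \<in> HH p" unfolding u0_def using p by (intro HH_zp \<psi>) auto
  have du0: "d * u0 \<in> LL p" by (rule Bd_mult_LL[OF _ u0 p]) simp
  have Pdu0: "PP (d * u0) = r0" using \<psi>(2) unfolding TT_zp u0_def[symmetric] by (simp add: TT_def)
  have Ju0: "JJ u0 \<in> QQ p" by (rule JJ_HH[OF u0 p])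
  define R where "R = (d * u0 + d * JJ g) - (JJ u0 + g)"
  have L: "d * u0 + d * JJ g \<in> LL p" "JJ u0 + g \<in> LL p"
    using du0 dJL QQ_LL[OF Ju0] HH_LL[OF g] p by (simp_all add: LL_add)
  have "PP R = (PP (d * u0) + PP (d * JJ g)) - (PP (JJ u0) + PP g)"
    unfolding R_def PP_diff[OF L p] PP_add[OF du0 dJL p] PP_add[OF QQ_LL[OF Ju0] HH_LL[OF g] p] ..
  also have "\<dots> = 0" unfolding Pdu0 PP_QQ[OF Ju0] PP_id[OF g p] r0_def by simp
  finally have RQ: "R \<in> QQ p" using PP_eq_0_iff[of R p] L p by (simp add: R_def LL_diff)
  have JR: "JJ R \<in> HH p" by (rule JJ_QQ[OF RQ p])
  have "d * JJ R = (d * JJ (d * u0) + d * JJ (d * JJ g)) - (d * JJ (JJ u0) + d * JJ g)"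
    unfolding R_def JJ_diff JJ_add right_diff_distrib distrib_left ..
  also have "\<dots> = - R" unfolding JJ_d R_def by simp
  finally have dJR: "d * JJ R = - R" .
  define u where "u = u0 + cst (1/2) * JJ R"
  have uH: "u \<in> HH p" unfolding u_def by (intro HH_add u0 HH_cst JR p)
  have "JJ u = JJ u0 + cst (1/2) * R" unfolding u_def JJ_add JJ_mult by simp
  moreover have "d * u = d * u0 - cst (1/2) * R"
  proof -
    have "d * u = d * u0 + cst (1/2) * (d * JJ R)" unfolding u_def by (simp only: algebra_simps)
    then show ?thesis unfolding dJR by simp
  qed
  ultimately have "d * u - JJ u = d * u0 - JJ u0 - (cst (1/2) + cst (1/2)) * R" by (simp add: algebra_simps)
  also have "\<dots> = d * u0 - JJ u0 - R" unfolding cst_simps(3)[symmetric] by (simp add: cst_simps)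
  also have "\<dots> = g - d * JJ g" by (simp add: R_def)
  finally show ?thesis using uH by blast
qed

text \<open>The shift by \<open>n\<close> is the balanced one: for
  \<open>f = zp (- n) * \<phi>\<close> the equation \<open>c * f + JJ f = w\<close>, multiplied by
  \<open>zp (- n)\<close>, has the analytic part that is required of \<open>\<phi>\<close> here,
  while the term with \<open>JJ f\<close> drops out. Conversely the defect \<open>r\<close> inherits
  the symmetry \<open>c * JJ r = r\<close> from \<open>w\<close>. As \<open>zp (- n) * r\<close> has
  no analytic part, its flip \<open>V\<close> lies in \<open>HH p\<close> and in the kernel of the
  invertible operator with symbol \<open>c * zp (- 2 * n)\<close>, so \<open>r = 0\<close>.\<close>

lemma solution_from_phi:
  assumes wL: "w \<in> LL p" and w: "c * JJ w = w" and \<phi>: "\<phi> \<in> HH p" "TT (c * zp (- 2 * int n)) \<phi> = PP (zp (- int n) * w)"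
    and \<phi>0: "\<And>j. j < n \<Longrightarrow> co \<phi> (int j) = 0"
  shows "zp (- int n) * \<phi> \<in> HH p" "c * (zp (- int n) * \<phi>) + JJ (zp (- int n) * \<phi>) = w"
proof -
  define f where "f = zp (- int n) * \<phi>"
  have f: "f \<in> HH p" unfolding f_def
  proof (rule HH_zp_down[OF \<phi>(1) p])
    fix j :: int assume "0 \<le> j" "j < int n"
    then show "co \<phi> j = 0" using \<phi>0[of "nat j"] by simp
  qed
  then show "zp (- int n) * \<phi> \<in> HH p" by (simp add: f_def)
  have Jf: "JJ f \<in> QQ p" by (rule JJ_HH[OF f p])
  define r where "r = c * f + JJ f - w"
  have cf: "c * f \<in> LL p" by (rule Bd_mult_LL[OF _ f p]) simp
  have rL: "r \<in> LL p" unfolding r_def using cf QQ_LL[OF Jf] wL p by (simp add: LL_diff LL_add)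
  have "c * JJ r = c * JJ (c * f) + c * JJ (JJ f) - c * JJ w" unfolding r_def JJ_diff JJ_add right_diff_distrib distrib_left ..
  then have cr: "c * JJ r = r" unfolding JJ_d w r_def by simp
  have zL: "zp (- int n) * (c * f) \<in> LL p" "zp (- int n) * JJ f \<in> QQ p" "zp (- int n) * w \<in> LL p"
    using cf wL Jf p by (auto simp: LL_zp intro!: QQ_zp)
  have "zp (- int n) * (c * f) = (zp (- int n) * zp (- int n)) * (c * \<phi>)" unfolding f_def by (simp only: ac_simps)
  also have "\<dots> = (c * zp (- 2 * int n)) * \<phi>" unfolding zp_simps by (simp add: ac_simps)
  finally have zc: "zp (- int n) * (c * f) = (c * zp (- 2 * int n)) * \<phi>" .
  have "zp (- int n) * r = zp (- int n) * (c * f) + zp (- int n) * JJ f - zp (- int n) * w"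
    unfolding r_def right_diff_distrib distrib_left ..
  then have "PP (zp (- int n) * r) = PP (zp (- int n) * (c * f)) + PP (zp (- int n) * JJ f) - PP (zp (- int n) * w)"
    using PP_diff[OF LL_add[OF zL(1) QQ_LL[OF zL(2)]] zL(3) p] PP_add[OF zL(1) QQ_LL[OF zL(2)] p] p by simp
  also have "\<dots> = 0" unfolding PP_QQ[OF zL(2)] zc using \<phi>(2) by (simp add: TT_def)
  finally have zr: "zp (- int n) * r \<in> QQ p" using PP_eq_0_iff[OF LL_zp[OF rL] p] p by simp
  define V where "V = zp (int n) * JJ r"
  have "V = JJ (zp (- int n) * r)" unfolding V_def JJ_mult by simp
  then have VH: "V \<in> HH p" using JJ_QQ[OF zr p] by simp
  have "(c * zp (- 2 * int n)) * V = (zp (- 2 * int n) * zp (int n)) * (c * JJ r)" unfolding V_def by (simp only: ac_simps)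
  also have "\<dots> = zp (- int n) * r" unfolding cr zp_simps by simp
  finally have "TT (c * zp (- 2 * int n)) V = 0" unfolding TT_def using PP_QQ[OF zr] by simp
  then have "V = 0" using Inv_inj[OF InvC VH _ p] by (simp add: c_def)
  then have "zp (- int n) * V = 0" by simp
  then have "JJ r = 0" unfolding V_def by (simp add: zp_simps)
  then have "r = 0" using JJ_JJ[of r] by simp
  then show "c * (zp (- int n) * \<phi>) + JJ (zp (- int n) * \<phi>) = w" by (simp add: r_def f_def)
qed

lemma b_times: "b * (c * f + JJ f) = a * f + b * JJ f"
proof -
  have "b * (c * f + JJ f) = (b * bi) * (a * f) + b * JJ f" unfolding c_def by (simp only: algebra_simps)
  then show ?thesis unfolding binv by simp
qed

lemma \<omega>_lc: "TT (c * zp (- 2 * int n)) (lc n s \<omega>) = TT (fl ai * zp (- int n)) (lc n s e)"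
proof -
  have B: "c * zp (- 2 * int n) \<in> Bd" "fl ai * zp (- int n) \<in> Bd" using Bd by simp_all
  have "TT (c * zp (- 2 * int n)) (lc n s \<omega>) = lc n s (\<lambda>k. TT (c * zp (- 2 * int n)) (\<omega> k))"
    by (rule TT_lc[OF B(1) p \<omega>])
  also have "\<dots> = lc n s (\<lambda>k. TT (fl ai * zp (- int n)) (e k))" by (rule lc_cong) (simp_all add: \<omega>T[simplified] e_def c_def)
  also have "\<dots> = TT (fl ai * zp (- int n)) (lc n s e)" by (rule TT_lc[OF B(2) p eH, symmetric])
  finally show ?thesis .
qed

lemma co_l\<omega>: "co (lc n s \<omega>) j = (\<Sum>k<n. co (\<omega> k) j * s k)"
  using co_lc[of p n \<omega> s j, OF p \<omega>] by (simp add: mult.commute)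

section \<open>The determinant decides injectivity and surjectivity\<close>

definition "Wdet = Determinant.det (Matrix.mat n n (\<lambda>(j, k). co (\<omega> k) (int j)))"

text \<open>A null vector \<open>s\<close> of the matrix yields a homogeneous solution
  \<open>u\<close> for which the \<open>n\<close> coefficient conditions hold. The resulting
  \<open>f\<close> satisfies \<open>a * f + b * JJ f = JJ u\<close>, which has no analytic part; it
  is nonzero because the \<open>e k\<close> are independent.\<close>

lemma Wdet_0_kernel:
  assumes "Wdet = 0" shows "\<exists>f\<in>HH p. f \<noteq> 0 \<and> THm a b f = 0"
proof -
  have "\<not> (\<forall>s. (\<forall>j<n. (\<Sum>k<n. co (\<omega> k) (int j) * s k) = 0) \<longrightarrow> (\<forall>k<n. s k = 0))"
    using assms det_nonzero_inj[of n "\<lambda>j k. co (\<omega> k) (int j)"] unfolding Wdet_def by blast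
  then obtain s k where s: "\<And>j. j < n \<Longrightarrow> (\<Sum>k<n. co (\<omega> k) (int j) * s k) = 0" and k: "k < n" "s k \<noteq> 0" by blast
  define u where "u = lc n s e"
  define w where "w = fl ai * u"
  define f where "f = zp (- int n) * lc n s \<omega>"
  have uH: "u \<in> HH p" unfolding u_def by (rule leH)
  have Ju: "JJ u = d * u" unfolding u_def by (rule JJ_le)
  have wL: "w \<in> LL p" unfolding w_def by (rule Bd_mult_LL[OF _ uH p]) (use Bd in simp)
  have wu: "w = bi * JJ u" unfolding w_def Ju mult.assoc[symmetric] bid ..
  have cw: "c * JJ w = w"
  proof -
    have "c * JJ w = bi * (d * u)" unfolding wu JJ_mult JJ_JJ by (simp only: c_def d_def ac_simps)
    then show ?thesis unfolding wu Ju .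
  qed
  have T: "TT (c * zp (- 2 * int n)) (lc n s \<omega>) = PP (zp (- int n) * w)"
    unfolding \<omega>_lc unfolding TT_def w_def u_def by (simp only: ac_simps)
  have f: "f \<in> HH p" "c * f + JJ f = w" unfolding f_def
    using solution_from_phi[OF wL cw l\<omega>H T] s unfolding co_l\<omega> by blast+
  have "a * f + b * JJ f = (b * bi) * JJ u" unfolding b_times[symmetric] f(2) wu by (simp only: ac_simps)
  then have "a * f + b * JJ f = JJ u" unfolding binv by simp
  then have "THm a b f = 0" unfolding THm_def using PP_QQ[OF JJ_HH[OF uH p]] by simp
  moreover have "f \<noteq> 0"
  proof
    assume "f = 0"
    then have "w = 0" using f(2) by simp
    then have "(fl a * fl ai) * u = 0" unfolding w_def mult.assoc by simp
    then have "u = 0" unfolding flinv by simp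
    then show False using le_eq_0 k unfolding u_def by blast
  qed
  ultimately show ?thesis using f(1) by blast
qed

text \<open>The reduction run backwards: for \<open>f\<close> in the kernel,
  \<open>u = JJ (a * f + b * JJ f)\<close> solves the homogeneous equation, so it is a combination
  of the \<open>e k\<close> with some coefficients \<open>s\<close>. Then \<open>zp n * f\<close> is
  the same combination of the \<open>\<omega> k\<close>. Its first \<open>n\<close> coefficients
  vanish, which says that \<open>s\<close> is a null vector of the matrix.\<close>

lemma Wdet_inj:
  assumes W: "Wdet \<noteq> 0" and f: "f \<in> HH p" "THm a b f = 0" shows "f = 0"
proof -
  have L: "a * f + b * JJ f \<in> LL p" by (rule THm_LL(3)[OF Bd(1,3) f(1) p])
  define u where "u = JJ (a * f + b * JJ f)"
  have "a * f + b * JJ f \<in> QQ p" using f(2) PP_eq_0_iff[OF L p] by (simp add: THm_def)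
  then have uH: "u \<in> HH p" unfolding u_def by (rule JJ_QQ[OF _ p])
  have Ju: "JJ u = a * f + b * JJ f" by (simp add: u_def)
  have "d * u = (a * fl a) * fl bi * JJ f + (fl b * fl bi) * (a * f)"
    unfolding u_def JJ_add JJ_mult JJ_JJ d_def by (simp only: algebra_simps)
  also have "(a * fl a) * fl bi * JJ f = (fl b * fl bi) * (b * JJ f)" unfolding match by (simp only: ac_simps)
  finally have du: "JJ u = d * u" unfolding flinv Ju by (simp add: add.commute)
  obtain s where s: "u = lc n s e" using homogeneous_solution[OF uH du] by blast
  have "bi * JJ u = c * f + (b * bi) * JJ f" unfolding Ju c_def by (simp only: algebra_simps)
  then have cfJ: "c * f + JJ f = fl ai * u" unfolding binv du mult.assoc[symmetric] bid by simp
  define F where "F = zp (int n) * f"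
  have FH: "F \<in> HH p" unfolding F_def using f p by (simp add: HH_zp)
  have Jf: "zp (- int n) * JJ f \<in> QQ p" using p by (intro QQ_zp JJ_HH f) auto
  have cF: "(c * zp (- 2 * int n)) * F \<in> LL p" by (rule Bd_mult_LL[OF _ FH p]) simp
  have "(fl ai * zp (- int n)) * u = zp (- int n) * (c * f + JJ f)" unfolding cfJ by (simp only: ac_simps)
  also have "\<dots> = c * (zp (- int n) * f) + zp (- int n) * JJ f" by (simp only: algebra_simps)
  also have "c * (zp (- int n) * f) = (c * zp (- 2 * int n)) * F" unfolding F_def by (simp add: mult.assoc zp_simps)
  finally have "TT (fl ai * zp (- int n)) u = TT (c * zp (- 2 * int n)) F"
    unfolding TT_def using PP_add[OF cF QQ_LL[OF Jf] p] PP_QQ[OF Jf] by simp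
  then have "TT (c * zp (- 2 * int n)) (F - lc n s \<omega>) = 0"
    using TT_diff[OF _ FH l\<omega>H p, of "c * zp (- 2 * int n)"] \<omega>_lc[of s] s by simp
  then have "F - lc n s \<omega> = 0" using Inv_inj[OF InvC HH_diff[OF FH l\<omega>H p] _ p] by (simp add: c_def)
  then have Fs: "F = lc n s \<omega>" by simp
  have "(\<Sum>k<n. co (\<omega> k) (int j) * s k) = 0" if "j < n" for j
    unfolding co_l\<omega>[symmetric] Fs[symmetric] F_def co_zp_mult using HH_neg[OF f(1)] that by simp
  then have "\<forall>k<n. s k = 0" using W det_nonzero_inj[of n "\<lambda>j k. co (\<omega> k) (int j)"] unfolding Wdet_def by blast
  then have "F = 0" unfolding Fs by (intro lc_zero) blast
  then have "zp (- int n) * F = 0" by simp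
  then show ?thesis by (simp add: F_def zp_simps)
qed

lemma Wdet_surj:
  assumes W: "Wdet \<noteq> 0" and g: "g \<in> HH p" shows "\<exists>f\<in>HH p. THm a b f = g"
proof -
  obtain u0 where u0: "u0 \<in> HH p" "d * u0 - JJ u0 = g - d * JJ g" using inhomogeneous_solution[OF g] by blast
  have bi_LL: "bi * (g + JJ u) \<in> LL p" if "u \<in> HH p" for u
    using HH_LL[OF g] QQ_LL[OF JJ_HH[OF that p]] Bd p by (simp add: LL_Bd_mult LL_add)
  define w0 where "w0 = bi * (g + JJ u0)"
  have w0L: "w0 \<in> LL p" unfolding w0_def by (rule bi_LL[OF u0(1)])
  have zw0: "zp (- int n) * w0 \<in> LL p" using w0L p by (simp add: LL_zp)
  obtain \<phi>0 where \<phi>0: "\<phi>0 \<in> HH p" "TT (c * zp (- 2 * int n)) \<phi>0 = PP (zp (- int n) * w0)"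
    using conjunct2[OF InvC[unfolded Inv_def]] PP_HH[OF zw0 p] unfolding c_def by blast
  have su: "\<forall>v. \<exists>s. \<forall>j<n. (\<Sum>k<n. co (\<omega> k) (int j) * s k) = v j"
    using W det_nonzero_surj[of n "\<lambda>j k. co (\<omega> k) (int j)"] unfolding Wdet_def by blast
  obtain s where s: "\<forall>j<n. (\<Sum>k<n. co (\<omega> k) (int j) * s k) = - co \<phi>0 (int j)"
    using spec[OF su, of "\<lambda>j. - co \<phi>0 (int j)"] by blast
  define u where "u = u0 + lc n s e"
  have uH: "u \<in> HH p" unfolding u_def by (intro HH_add u0 leH p)
  have du: "d * u + d * JJ g = g + JJ u"
    using u0(2) unfolding u_def JJ_add JJ_le by (simp add: algebra_simps)
  define w where "w = bi * (g + JJ u)"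
  have wL: "w \<in> LL p" unfolding w_def by (rule bi_LL[OF uH])
  have cw: "c * JJ w = w"
  proof -
    have "c * JJ w = bi * (d * u + d * JJ g)" unfolding w_def JJ_mult JJ_add JJ_JJ c_def d_def by (simp only: algebra_simps)
    then show ?thesis unfolding w_def du .
  qed
  define \<phi> where "\<phi> = \<phi>0 + lc n s \<omega>"
  have \<phi>: "\<phi> \<in> HH p" unfolding \<phi>_def by (intro HH_add \<phi>0 l\<omega>H p)
  have w_eq: "w = w0 + fl ai * lc n s e"
  proof -
    have "w = w0 + bi * d * lc n s e" unfolding w_def w0_def u_def JJ_add JJ_le by (simp only: algebra_simps)
    then show ?thesis unfolding bid .
  qed
  have zle: "(fl ai * zp (- int n)) * lc n s e \<in> LL p" by (rule Bd_mult_LL[OF _ leH p]) (use Bd in simp)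
  have "zp (- int n) * w = zp (- int n) * w0 + (fl ai * zp (- int n)) * lc n s e" unfolding w_eq by (simp only: algebra_simps)
  then have "PP (zp (- int n) * w) = TT (c * zp (- 2 * int n)) \<phi>0 + TT (c * zp (- 2 * int n)) (lc n s \<omega>)"
    using PP_add[OF zw0 zle p] \<phi>0(2) \<omega>_lc[of s] by (simp add: TT_def)
  then have T: "TT (c * zp (- 2 * int n)) \<phi> = PP (zp (- int n) * w)"
    unfolding \<phi>_def using TT_add[OF _ \<phi>0(1) l\<omega>H p, of "c * zp (- 2 * int n)"] by simp
  have "co \<phi> (int j) = 0" if "j < n" for j
    unfolding \<phi>_def co_add[OF LL_imp_LL1[OF HH_LL[OF \<phi>0(1)] p] LL_imp_LL1[OF HH_LL[OF l\<omega>H] p]] co_l\<omega>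
    using s that by simp
  note f = solution_from_phi[OF wL cw \<phi> T this]
  define f' where "f' = zp (- int n) * \<phi>"
  have f': "f' \<in> HH p" "c * f' + JJ f' = w" using f by (simp_all add: f'_def)
  have "a * f' + b * JJ f' = (b * bi) * (g + JJ u)" unfolding b_times[symmetric] f'(2) w_def by (simp only: ac_simps)
  then have "THm a b f' = PP (g + JJ u)" unfolding binv by (simp add: THm_def)
  also have "\<dots> = g" using PP_add[OF HH_LL[OF g] QQ_LL[OF JJ_HH[OF uH p]] p] PP_id[OF g p] PP_QQ[OF JJ_HH[OF uH p]] by simp
  finally show ?thesis using f'(1) by blast
qed

lemma Wdet_iff_inj: "Wdet \<noteq> 0 \<longleftrightarrow> (\<forall>f\<in>HH p. THm a b f = 0 \<longrightarrow> f = 0)"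
  using Wdet_0_kernel Wdet_inj by blast

end

section \<open>Invertibility of \<open>T(a) + H(b)\<close>\<close>

lemma Jflip_mk: "cm F \<Longrightarrow> cm (Jflip F) \<and> mk (Jflip F) = JJ (mk F)"
proof -
  assume F: "cm F"
  have i: "(\<lambda>t::complex. t powi - 1) = inverse" by (simp add: fun_eq_iff power_int_minus)
  have c: "cm (\<lambda>t. inverse t)" using cm_intros(7)[OF cm_intros(10)] .
  have 1: "cm (\<lambda>t. inverse t * F (inverse t))" using c F by simp
  have "JJ (mk F) = mk (\<lambda>t. inverse t * F (inverse t))"
    unfolding JJ_def mk_simps(9) mk_simps(11)[OF F] i using c F by (simp add: mk_simps(4))
  then show ?thesis using 1 by (simp add: Jflip_def)
qed

lemma TH_mk:
  assumes a: "cm a" "mk a \<in> Bd" and b: "cm b" "mk b \<in> Bd" and F: "F \<in> Hp p" and p: "1 < p"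
  shows "cm (TH a b F)" "mk (TH a b F) = THm (mk a) (mk b) (mk F)" "TH a b F \<in> Hp p"
proof -
  have F': "cm F" "mk F \<in> HH p" using F by (auto simp: Hp_iff)
  have J: "JJ (mk F) \<in> QQ p" by (rule JJ_HH[OF F'(2) p])
  have c: "cm (Jflip F)" "mk (Jflip F) = JJ (mk F)" using Jflip_mk[OF F'(1)] by auto
  have L: "mk (Jflip F) \<in> LL p" unfolding c(2) by (rule QQ_LL[OF J])
  note P = Pr_mk[OF c(1) L p]
  have Q: "cm (Qr (Jflip F))" "mk (Qr (Jflip F)) = JJ (mk F)"
    unfolding Qr_def using c P by (simp_all add: mk_simps(5)[symmetric] PP_QQ[OF J])
  have B: "cm (\<lambda>z. b z * Qr (Jflip F) z)" "mk (\<lambda>z. b z * Qr (Jflip F) z) = mk b * JJ (mk F)"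
    using b Q mk_simps(4)[OF b(1) Q(1)] by simp_all
  note L3 = THm_LL[OF a(2) b(2) F'(2) p]
  have BL: "mk (\<lambda>z. b z * Qr (Jflip F) z) \<in> LL p" unfolding B(2) by (rule L3(2))
  have H: "cm (Hank b F)" "mk (Hank b F) = PP (mk b * JJ (mk F))" using Pr_mk[OF B(1) BL p] by (auto simp: Hank_def B(2))
  note T = Toep_mk[OF a F p]
  show 1: "cm (TH a b F)" unfolding TH_def using T H by simp
  have "mk (TH a b F) = TT (mk a) (mk F) + PP (mk b * JJ (mk F))" unfolding TH_def mk_simps(3)[OF T(1) H(1), symmetric] T(2) H(2) ..
  also have "\<dots> = THm (mk a) (mk b) (mk F)" unfolding TT_def THm_def by (rule PP_add[OF L3(1,2) p, symmetric])
  finally show 2: "mk (TH a b F) = THm (mk a) (mk b) (mk F)" .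
  show "TH a b F \<in> Hp p" using 1 2 THm_HH[OF a(2) b(2) F'(2) p] by (simp add: Hp_iff)
qed

lemma sub_mk:
  assumes "cm a" "cm b" "mk b * bi = 1"
  shows "cm (sub_c a b)" "mk (sub_c a b) = mk a * bi" "cm (sub_d a b)" "mk (sub_d a b) = mk a * fl bi"
proof -
  have i: "mk (\<lambda>z. inverse (b z)) = bi" using mult_one_inverse[OF assms(3)] assms(2) by (simp add: mk_simps(7))
  have c: "cm (\<lambda>z. inverse (b z))" "cm (\<lambda>z. inverse (b (inverse z)))" using assms by simp_all
  have fi: "mk (\<lambda>z. inverse (b (inverse z))) = fl bi" using mk_simps(11)[OF c(1)] i by simp
  show "cm (sub_c a b)" "cm (sub_d a b)" using assms by (simp_all add: sub_c_def sub_d_def tld_def)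
  show "mk (sub_c a b) = mk a * bi" unfolding i[symmetric] sub_c_def divide_inverse using mk_simps(4)[OF assms(1) c(1)] by simp
  show "mk (sub_d a b) = mk a * fl bi" unfolding fi[symmetric] sub_d_def tld_def divide_inverse using mk_simps(4)[OF assms(1) c(2)] by simp
qed

text \<open>The index conditions enter only as invertibility of the two shifted Toeplitz operators.
  In this form the hypotheses pass to the adjoint pair by \<open>Inv_dual\<close> and to
  \<open>- b\<close> by a change of sign.\<close>

definition admissible :: "real \<Rightarrow> nat \<Rightarrow> (complex \<Rightarrow> complex) \<Rightarrow> mfun \<Rightarrow> (complex \<Rightarrow> complex) \<Rightarrow> mfun \<Rightarrow> bool" where
  "admissible p n a ai b bi \<longleftrightarrow> 1 < p \<and> cm a \<and> cm b \<and> mk a \<in> Bd \<and> ai \<in> Bd \<and> mk b \<in> Bd \<and> bi \<in> Bd \<and>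
     mk a * ai = 1 \<and> mk b * bi = 1 \<and> mk a * fl (mk a) = mk b * fl (mk b) \<and>
     Inv p (mk a * bi * zp (- 2 * int n)) \<and> Inv p (mk a * fl bi * zp (2 * int n))"

lemma fl_unit:
  assumes "a * fl a = b * fl b" "b * bi = (1::mfun)"
  shows "a * bi * fl (a * bi) = 1" "a * fl bi * fl (a * fl bi) = 1"
proof -
  have "fl b * fl bi = 1" using arg_cong[OF assms(2), of fl] by simp
  moreover have "a * fl a * (bi * fl bi) = (b * bi) * (fl b * fl bi)" unfolding assms(1) by (simp only: ac_simps)
  ultimately have "a * fl a * (bi * fl bi) = 1" using assms(2) by simp
  moreover have "a * bi * fl (a * bi) = a * fl a * (bi * fl bi)" "a * fl bi * fl (a * fl bi) = a * fl a * (bi * fl bi)"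
    by (simp_all add: ac_simps)
  ultimately show "a * bi * fl (a * bi) = 1" "a * fl bi * fl (a * fl bi) = 1" by simp_all
qed

text \<open>The choices hidden in \<open>wh_plus\<close> and \<open>Tinv\<close> are resolved here:
  the first is unique up to null sets, and the equation behind the second has a solution because the
  shifted operator is onto.\<close>

lemma admissible_TH_pair:
  assumes "admissible p n a ai b bi"
  obtains x y \<sigma> where "TH_pair p n (mk a) ai (mk b) bi x y \<sigma> (\<lambda>k. mk (omega p n a b k))"
    "Determinant.det (Wmat p n a b) = Determinant.det (Matrix.mat n n (\<lambda>(j, k). co (mk (omega p n a b k)) (int j)))"
proof -
  have p: "1 < p" and cm: "cm a" "cm b" and B: "mk a \<in> Bd" "ai \<in> Bd" "mk b \<in> Bd" "bi \<in> Bd" and ai: "mk a * ai = 1" and bi: "mk b * bi = 1"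
    and m: "mk a * fl (mk a) = mk b * fl (mk b)" and IC: "Inv p (mk a * bi * zp (- 2 * int n))" and ID: "Inv p (mk a * fl bi * zp (2 * int n))"
    using assms unfolding admissible_def by blast+
  note s = sub_mk[OF cm bi]
  define d where "d = sub_d a b"
  \<comment> \<open>The shape required by \<open>wh_plus_eq\<close>, with the middle exponent
    \<open>- 2 * int n\<close> of the factorization of \<open>d\<close>.\<close>
  define g where "g = mk d * zp (- (- 2 * int n))"
  have gd: "g = mk a * fl bi * zp (2 * int n)" by (simp add: g_def d_def s)
  have gB: "g \<in> Bd" using B by (simp add: gd)
  have "g * fl g = (mk a * fl bi * fl (mk a * fl bi)) * (zp (2 * int n) * zp (- (2 * int n)))" unfolding gd by (simp add: ac_simps)
  then have g1: "g * fl g = 1" unfolding fl_unit(2)[OF m bi] by (simp add: zp_simps)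
  have Ig: "Inv p g" using ID by (simp add: gd)
  obtain x y \<sigma> where xy: "x \<in> HH p" "y \<in> HH (conj_exp p)" "x * y = 1" "\<sigma> * \<sigma> = 1" "co x 0 = \<sigma>" "g * x = cst \<sigma> * fl x"
    and w: "cm (wh_plus p d)" "mk (wh_plus p d) = y" "wh_sigma p d = \<sigma>"
    using wh_plus_eq[of d g "- 2 * int n" p, OF _ g_def gB g1 Ig p] s(3) unfolding d_def by blast
  define E where "E k = (\<lambda>t. inverse (wh_plus p d t) * (t ^ (n - k - 1) + wh_sigma p d * t ^ (n + k)))" for k
  have iy: "mk (\<lambda>t. inverse (wh_plus p d t)) = x"
    using mult_one_inverse[of y x] xy(3) w(1,2) by (simp add: mk_simps(7)[symmetric] mult.commute)
  have ci: "cm (\<lambda>t. inverse (wh_plus p d t))" using w by simp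
  have cpow: "cm (\<lambda>t. t ^ i)" "mk (\<lambda>t. t ^ i) = zp (int i)" for i
    using cm_intros(2)[of "int i"] mk_simps(9)[of "int i"] by simp_all
  have E: "cm (E k) \<and> mk (E k) = x * (zp (int n - 1 - int k) + cst \<sigma> * zp (int n + int k)) \<and> E k \<in> Hp p" if k: "k < n" for k
  proof -
    have c2: "cm (\<lambda>t. \<sigma> * t ^ (n + k))" "cm (\<lambda>t. t ^ (n - k - 1) + \<sigma> * t ^ (n + k))" using cpow(1) by simp_all
    have "mk (\<lambda>t. t ^ (n - k - 1) + \<sigma> * t ^ (n + k)) = zp (int (n - k - 1)) + cst \<sigma> * zp (int (n + k))"
      unfolding mk_simps(3)[OF cpow(1) c2(1), symmetric] mk_simps(8) cpow(2)[symmetric] mk_simps(4)[OF cm_intros(1) cpow(1)] ..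
    moreover have "int (n - k - 1) = int n - 1 - int k" "int (n + k) = int n + int k" using k by auto
    ultimately have m1: "mk (\<lambda>t. t ^ (n - k - 1) + \<sigma> * t ^ (n + k)) = zp (int n - 1 - int k) + cst \<sigma> * zp (int n + int k)" by (simp only:)
    have 1: "cm (E k)" unfolding E_def w(3) using ci c2(2) by simp
    have 2: "mk (E k) = x * (zp (int n - 1 - int k) + cst \<sigma> * zp (int n + int k))"
      unfolding E_def w(3) mk_simps(4)[OF ci c2(2), symmetric] iy m1 ..
    have "mk (E k) = zp (int n - 1 - int k) * x + cst \<sigma> * (zp (int n + int k) * x)" unfolding 2 by (simp add: algebra_simps)
    then have "mk (E k) \<in> HH p" using k p xy(1) by (auto intro!: HH_add HH_cst HH_zp)
    then show ?thesis using 1 2 by (simp add: Hp_iff)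
  qed
  define A where "A = (\<lambda>t. inverse (tld a t) * t powi (- int n))"
  have iA: "mk (\<lambda>t. inverse (a t)) = ai" using mult_one_inverse[OF ai] cm(1) by (simp add: mk_simps(7))
  have cA: "cm (\<lambda>t. inverse (a t))" "cm (\<lambda>t. inverse (a (inverse t)))" using cm by simp_all
  have fA: "mk (\<lambda>t. inverse (a (inverse t))) = fl ai" using mk_simps(11)[OF cA(1)] iA by simp
  have A: "cm A" "mk A = fl ai * zp (- int n)"
    unfolding A_def tld_def using cA(2) mk_simps(4)[OF cA(2) cm_intros(2), of "- int n"] by (simp_all add: fA mk_simps(9))
  have AB: "mk A \<in> Bd" using B by (simp add: A)
  define G where "G = (\<lambda>t. sub_c a b t * t powi (- (2 * int n)))"
  have G: "cm G" "mk G = mk a * bi * zp (- 2 * int n)"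
    unfolding G_def using s(1) mk_simps(4)[OF s(1) cm_intros(2), of "- (2 * int n)"] by (simp_all add: s(2) mk_simps(9))
  have GB: "mk G \<in> Bd" using B by (simp add: G)
  have om: "omega p n a b k = Tinv p G (Toep A (E k))" for k
    unfolding omega_def Let_def G_def A_def E_def d_def ..
  have \<omega>: "omega p n a b k \<in> Hp p \<and> TT (mk G) (mk (omega p n a b k)) = TT (mk A) (mk (E k))" if k: "k < n" for k
  proof -
    have EH: "E k \<in> Hp p" using E[OF k] by blast
    note T = Toep_mk[OF A(1) AB EH p]
    have TH: "TT (mk A) (mk (E k)) \<in> HH p" using EH by (intro TT_HH AB p) (simp add: Hp_iff)
    obtain f where f: "f \<in> HH p" "TT (mk G) f = TT (mk A) (mk (E k))"
      using conjunct2[OF IC[unfolded Inv_def]] TH unfolding G(2)[symmetric] by blast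
    obtain F where F: "F \<in> Hp p" "cm F" "f = mk F" using HH_rep[OF f(1)] .
    have "F \<in> Hp p \<and> ae_eq (Toep G F) (Toep A (E k))"
      using F f(2) Toep_mk[OF G(1) GB F(1) p] T by (simp add: mk_eq_iff[symmetric])
    then have "omega p n a b k \<in> Hp p \<and> ae_eq (Toep G (omega p n a b k)) (Toep A (E k))"
      unfolding om Tinv_def by (rule someI[where P="\<lambda>F. F \<in> Hp p \<and> ae_eq (Toep G F) (Toep A (E k))"])
    then show ?thesis using Toep_mk[OF G(1) GB _ p, of "omega p n a b k"] T by (metis mk_eq_iff)
  qed
  show thesis
  proof (rule that)
    show "TH_pair p n (mk a) ai (mk b) bi x y \<sigma> (\<lambda>k. mk (omega p n a b k))"
    proof
      show "mk a * fl bi * zp (2 * int n) * x = cst \<sigma> * fl x" using xy(6) unfolding gd .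
      fix k assume k: "k < n"
      show "mk (omega p n a b k) \<in> HH p" using \<omega>[OF k] by (simp add: Hp_iff)
      show "TT (mk a * bi * zp (- 2 * int n)) (mk (omega p n a b k)) =
         TT (fl ai * zp (- int n)) (x * (zp (int n - 1 - int k) + cst \<sigma> * zp (int n + int k)))"
        using \<omega>[OF k] E[OF k] unfolding G(2) A(2) by simp
    qed (rule p B ai bi m IC ID xy(1-4))+
    have "Wmat p n a b = Matrix.mat n n (\<lambda>(j, k). co (mk (omega p n a b k)) (int j))"
      unfolding Wmat_def by (rule eq_matI) (use \<omega> in \<open>auto simp: Hp_iff fc_co\<close>)
    then show "Determinant.det (Wmat p n a b) = Determinant.det (Matrix.mat n n (\<lambda>(j, k). co (mk (omega p n a b k)) (int j)))" by simp
  qed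
qed

lemma admissible_det:
  assumes "admissible p n a ai b bi"
  shows "Determinant.det (Wmat p n a b) \<noteq> 0 \<longleftrightarrow> (\<forall>f\<in>HH p. THm (mk a) (mk b) f = 0 \<longrightarrow> f = 0)"
    and "Determinant.det (Wmat p n a b) \<noteq> 0 \<Longrightarrow> g \<in> HH p \<Longrightarrow> \<exists>f\<in>HH p. THm (mk a) (mk b) f = g"
proof -
  obtain x y \<sigma> where T: "TH_pair p n (mk a) ai (mk b) bi x y \<sigma> (\<lambda>k. mk (omega p n a b k))"
    and d: "Determinant.det (Wmat p n a b) = Determinant.det (Matrix.mat n n (\<lambda>(j, k). co (mk (omega p n a b k)) (int j)))"
    using admissible_TH_pair[OF assms] .
  have W: "TH_pair.Wdet n (\<lambda>k. mk (omega p n a b k)) = Determinant.det (Wmat p n a b)"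
    unfolding TH_pair.Wdet_def[OF T] d ..
  show "Determinant.det (Wmat p n a b) \<noteq> 0 \<longleftrightarrow> (\<forall>f\<in>HH p. THm (mk a) (mk b) f = 0 \<longrightarrow> f = 0)"
    using TH_pair.Wdet_iff_inj[OF T] unfolding W .
  show "\<exists>f\<in>HH p. THm (mk a) (mk b) f = g" if "Determinant.det (Wmat p n a b) \<noteq> 0" "g \<in> HH p"
    using TH_pair.Wdet_surj[OF T] that unfolding W by blast
qed

section \<open>One-sided inverses, injectivity and surjectivity\<close>

lemma left_invertible_inj:
  assumes L: "left_invertible p (TH a b)" and a: "cm a" "mk a \<in> Bd" and b: "cm b" "mk b \<in> Bd" and p: "1 < p"
    and f: "f \<in> HH p" "THm (mk a) (mk b) f = 0"
  shows "f = 0"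
proof -
  obtain B where B: "bounded_op p B" "\<forall>F\<in>Hp p. ae_eq (B (TH a b F)) F" using L unfolding left_invertible_def by blast
  obtain F where F: "F \<in> Hp p" "cm F" "f = mk F" using HH_rep[OF f(1)] .
  note T = TH_mk[OF a b F(1) p]
  \<comment> \<open>Zero is written as a multiple of \<open>F\<close> so that the homogeneity clause
    of \<open>bounded_op\<close> delivers \<open>B 0 = 0\<close>.\<close>
  have z: "(\<lambda>z. 0 * F z) \<in> Hp p" "cm (\<lambda>z. 0 * F z)" using HH_0[OF p] by (simp_all add: Hp_iff mk_simps(1))
  have "ae_eq (TH a b F) (\<lambda>z. 0 * F z)"
    using T(1,2) f(2) F(3) z(2) by (simp add: mk_eq_iff[symmetric] mk_simps(1))
  then have 1: "ae_eq (B (TH a b F)) (B (\<lambda>z. 0 * F z))" using B(1) T(3) z(1) unfolding bounded_op_def by blast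
  have 2: "ae_eq (B (\<lambda>z. 0 * F z)) (\<lambda>z. 0 * B F z)" using B(1) F(1) unfolding bounded_op_def by blast
  have "ae_eq F (\<lambda>z. 0 * B F z)"
    using ae_eq_trans[OF ae_eq_sym[OF B(2)[rule_format, OF F(1)]] ae_eq_trans[OF 1 2]] .
  then have "ae_eq F (\<lambda>z. 0)" by simp
  then show ?thesis using F(2,3) by (simp add: mk_eq_iff[symmetric] mk_simps(1))
qed

lemma right_invertible_surj:
  assumes R: "right_invertible p (TH a b)" and a: "cm a" "mk a \<in> Bd" and b: "cm b" "mk b \<in> Bd" and p: "1 < p"
    and g: "g \<in> HH p"
  shows "\<exists>f\<in>HH p. THm (mk a) (mk b) f = g"
proof -
  obtain B where B: "bounded_op p B" "\<forall>F\<in>Hp p. ae_eq (TH a b (B F)) F" using R unfolding right_invertible_def by blast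
  obtain G where G: "G \<in> Hp p" "cm G" "g = mk G" using HH_rep[OF g] .
  have BG: "B G \<in> Hp p" using B(1) G(1) unfolding bounded_op_def by blast
  have "THm (mk a) (mk b) (mk (B G)) = g"
    using TH_mk[OF a b BG p] B(2)[rule_format, OF G(1)] G(2,3) by (simp add: mk_eq_iff[symmetric])
  then show ?thesis using BG by (auto simp: Hp_iff)
qed

text \<open>Preimages are chosen for every representative. Since the preimage is unique as a class,
  the chosen map is well defined and linear up to null sets, and \<open>bounded_inverse\<close>
  bounds it.\<close>

lemma invertible_opI:
  assumes a: "cm a" "mk a \<in> Bd" and b: "cm b" "mk b \<in> Bd" and p: "1 < p"
    and inj: "\<And>f. f \<in> HH p \<Longrightarrow> THm (mk a) (mk b) f = 0 \<Longrightarrow> f = 0"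
    and surj: "\<And>g. g \<in> HH p \<Longrightarrow> \<exists>f\<in>HH p. THm (mk a) (mk b) f = g"
  shows "invertible_op p (TH a b)"
proof -
  define T where "T = THm (mk a) (mk b)"
  have Ta: "T (f + h) = T f + T h" if "f \<in> HH p" "h \<in> HH p" for f h unfolding T_def by (rule THm_add[OF a(2) b(2) that p])
  have Tc: "T (cst c * f) = cst c * T f" if "f \<in> HH p" for f c unfolding T_def by (rule THm_cst[OF a(2) b(2) that p])
  have TH: "T f \<in> HH p" if "f \<in> HH p" for f unfolding T_def by (rule THm_HH[OF a(2) b(2) that p])
  obtain C where C: "\<And>f. f \<in> HH p \<Longrightarrow> nm p (T f) \<le> C * nm p f" using THm_bound[OF a(2) b(2) p] unfolding T_def by blast
  have "\<exists>M\<ge>0. \<forall>f\<in>HH p. nm p f \<le> M * nm p (T f)"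
    by (rule bounded_inverse[of p T C, OF p TH Ta Tc C]) (use inj surj in \<open>auto simp: T_def\<close>)
  then obtain M where M: "\<And>f. f \<in> HH p \<Longrightarrow> nm p f \<le> M * nm p (T f)" by blast
  have uniq: "f = h" if "f \<in> HH p" "h \<in> HH p" "T f = T h" for f h
  proof -
    have "T (f + cst (- 1) * h) = 0" using Ta[OF that(1) HH_cst[OF that(2) p], of "- 1"] Tc[OF that(2), of "- 1"] that(3) by (simp add: cst_simps)
    then have "f + cst (- 1) * h = 0" using inj[OF HH_add[OF that(1) HH_cst[OF that(2) p] p]] by (simp add: T_def)
    then show ?thesis by (simp add: cst_simps)
  qed
  have "\<forall>G\<in>Hp p. \<exists>F. F \<in> Hp p \<and> T (mk F) = mk G"
  proof
    fix G assume "G \<in> Hp p"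
    then have "mk G \<in> HH p" by (simp add: Hp_iff)
    then obtain f where f: "f \<in> HH p" "T f = mk G" using surj unfolding T_def by blast
    obtain F where "F \<in> Hp p" "cm F" "f = mk F" using HH_rep[OF f(1)] .
    then show "\<exists>F. F \<in> Hp p \<and> T (mk F) = mk G" using f(2) by auto
  qed
  then have "\<exists>B. \<forall>G\<in>Hp p. B G \<in> Hp p \<and> T (mk (B G)) = mk G" by (rule bchoice)
  then obtain B where B: "\<And>G. G \<in> Hp p \<Longrightarrow> B G \<in> Hp p" "\<And>G. G \<in> Hp p \<Longrightarrow> T (mk (B G)) = mk G" by blast
  have cB: "cm (B G)" "mk (B G) \<in> HH p" if "G \<in> Hp p" for G using B(1)[OF that] by (auto simp: Hp_iff)
  have cG: "cm G" "mk G \<in> HH p" if "G \<in> Hp p" for G using that by (auto simp: Hp_iff)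
  have Tmk: "cm (TH a b F)" "mk (TH a b F) = T (mk F)" "TH a b F \<in> Hp p" if "F \<in> Hp p" for F
    using TH_mk[OF a b that p] by (auto simp: T_def)
  have "bounded_op p B" unfolding bounded_op_def
  proof (intro conjI ballI allI impI)
    show "B F \<in> Hp p" if "F \<in> Hp p" for F by (rule B(1)[OF that])
    show "ae_eq (B F) (B G)" if "F \<in> Hp p" "G \<in> Hp p" "ae_eq F G" for F G
    proof -
      have "mk F = mk G" using that cG by (simp add: mk_eq_iff)
      then have "T (mk (B F)) = T (mk (B G))" using B(2)[OF that(1)] B(2)[OF that(2)] by simp
      then have "mk (B F) = mk (B G)" by (rule uniq[OF cB(2)[OF that(1)] cB(2)[OF that(2)]])
      then show ?thesis using cB that by (simp add: mk_eq_iff)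
    qed
    show "ae_eq (B (\<lambda>z. F z + G z)) (\<lambda>z. B F z + B G z)" if FG: "F \<in> Hp p" "G \<in> Hp p" for F G
    proof -
      have m: "mk (\<lambda>z. F z + G z) = mk F + mk G" using cG FG by (simp add: mk_simps(3))
      then have H: "(\<lambda>z. F z + G z) \<in> Hp p" using cG FG p by (simp add: Hp_iff HH_add)
      have "T (mk (B F) + mk (B G)) = mk F + mk G" using B(2)[OF FG(1)] B(2)[OF FG(2)] Ta[OF cB(2)[OF FG(1)] cB(2)[OF FG(2)]] by simp
      then have "T (mk (B (\<lambda>z. F z + G z))) = T (mk (B F) + mk (B G))" using B(2)[OF H] m by simp
      then have "mk (B (\<lambda>z. F z + G z)) = mk (B F) + mk (B G)"
        by (rule uniq[OF cB(2)[OF H] HH_add[OF cB(2)[OF FG(1)] cB(2)[OF FG(2)] p]])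
      then show ?thesis using cB FG H by (simp add: mk_simps(3) mk_eq_iff)
    qed
    show "ae_eq (B (\<lambda>z. c * F z)) (\<lambda>z. c * B F z)" if F: "F \<in> Hp p" for F c
    proof -
      have m: "mk (\<lambda>z. c * F z) = cst c * mk F" using cG F by (simp add: mk_simps(4,8))
      then have H: "(\<lambda>z. c * F z) \<in> Hp p" using cG F p by (simp add: Hp_iff HH_cst)
      have "T (cst c * mk (B F)) = cst c * mk F" using B(2)[OF F] Tc[OF cB(2)[OF F]] by simp
      then have "T (mk (B (\<lambda>z. c * F z))) = T (cst c * mk (B F))" using B(2)[OF H] m by simp
      then have "mk (B (\<lambda>z. c * F z)) = cst c * mk (B F)" by (rule uniq[OF cB(2)[OF H] HH_cst[OF cB(2)[OF F] p]])
      then show ?thesis using cB F H by (simp add: mk_simps(4,8) mk_eq_iff)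
    qed
    show "\<exists>M. \<forall>f\<in>Hp p. pnorm p (B f) \<le> M * pnorm p f"
    proof (intro exI ballI)
      fix F assume F: "F \<in> Hp p"
      show "pnorm p (B F) \<le> M * pnorm p F" using M[OF cB(2)[OF F]] B(2)[OF F] cB(1)[OF F] cG(1)[OF F] by (simp add: pnorm_nm)
    qed
  qed
  moreover have "ae_eq (B (TH a b F)) F" if F: "F \<in> Hp p" for F
  proof -
    have "T (mk (B (TH a b F))) = T (mk F)" using B(2)[OF Tmk(3)[OF F]] Tmk(2)[OF F] by simp
    then have "mk (B (TH a b F)) = mk F" by (rule uniq[OF cB(2)[OF Tmk(3)[OF F]] cG(2)[OF F]])
    then show ?thesis using cB(1)[OF Tmk(3)[OF F]] cG(1)[OF F] by (simp add: mk_eq_iff)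
  qed
  moreover have "ae_eq (TH a b (B F)) F" if F: "F \<in> Hp p" for F
    using Tmk(1,2)[OF B(1)[OF F]] B(2)[OF F] cG(1)[OF F] by (simp add: mk_eq_iff[symmetric])
  ultimately show ?thesis unfolding invertible_op_def by blast
qed

lemma admissible_invertible:
  assumes A: "admissible p n a ai b bi" and d: "Determinant.det (Wmat p n a b) \<noteq> 0"
  shows "invertible_op p (TH a b)"
proof -
  have h: "cm a" "mk a \<in> Bd" "cm b" "mk b \<in> Bd" "1 < p" using A unfolding admissible_def by blast+
  show ?thesis
  proof (rule invertible_opI[OF h])
    show "f = 0" if "f \<in> HH p" "THm (mk a) (mk b) f = 0" for f using admissible_det(1)[OF A] d that by blast
    show "\<exists>f\<in>HH p. THm (mk a) (mk b) f = g" if "g \<in> HH p" for g by (rule admissible_det(2)[OF A d that])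
  qed
qed

section \<open>Adjoints, change of sign and the conclusion\<close>

lemma av_zp_cj: "av (zp j * cj v) = cnj (co v j)"
  unfolding co_def av_cj[symmetric] by (simp add: mult.commute)

text \<open>In the Hankel part the integrand is reflected: this moves the flip from \<open>f\<close>
  to \<open>h\<close> and turns \<open>b\<close> into \<open>fl b\<close>, which explains the second
  symbol of the adjoint.\<close>

lemma THm_adjoint:
  assumes a: "a \<in> Bd" "b \<in> Bd" and f: "f \<in> HH p" and h: "h \<in> HH (conj_exp p)" and p: "1 < p"
  shows "av (THm a b f * cj h) = av (f * cj (THm (cj a) (cj (fl b)) h))"
proof -
  note q = conj_exp_props(1,3)[OF p]
  have B: "cj a \<in> Bd" "cj (fl b) \<in> Bd" using a by simp_all
  note L = THm_LL[OF a f p] and M = THm_LL[OF B h q(1)]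
  have hL: "cj h \<in> LL (conj_exp p)" by (rule LL_cj[OF HH_LL[OF h]])
  have fL: "f \<in> LL p" by (rule HH_LL[OF f])
  have "av (THm a b f * cj h) = av ((a * f + b * JJ f) * cj h)" unfolding THm_def by (rule av_PP_left[OF L(3) h p])
  also have "\<dots> = av (a * f * cj h) + av (b * JJ f * cj h)"
    unfolding distrib_right by (intro av_add LL_Holder(1)[OF L(1) hL p] LL_Holder(1)[OF L(2) hL p])
  also have "av (b * JJ f * cj h) = av (f * cj (cj (fl b) * JJ h))"
  proof -
    have "fl (b * JJ f * cj h) = f * cj (cj (fl b) * JJ h)" by (simp add: JJ_def ac_simps)
    then show ?thesis using av_fl[of "b * JJ f * cj h"] by simp
  qed
  also have "a * f * cj h = f * cj (cj a * h)" by (simp add: ac_simps)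
  also have "av (f * cj (cj a * h)) + av (f * cj (cj (fl b) * JJ h)) = av (f * cj (cj a * h + cj (fl b) * JJ h))"
    unfolding cj_simps(3) distrib_left
    by (intro av_add[symmetric] LL_Holder(1)[OF fL _ p] LL_cj M(1,2))
  also have "\<dots> = av (f * cj (THm (cj a) (cj (fl b)) h))" unfolding THm_def by (rule av_PP_right[OF f M(3) p, symmetric])
  finally show ?thesis .
qed

text \<open>A kernel element of the adjoint annihilates the range, in particular every monomial
  \<open>zp j\<close> with \<open>j \<ge> 0\<close>.\<close>

lemma THm_surj_adjoint_inj:
  assumes a: "a \<in> Bd" "b \<in> Bd" and p: "1 < p" and s: "\<And>g. g \<in> HH p \<Longrightarrow> \<exists>f\<in>HH p. THm a b f = g"
    and h: "h \<in> HH (conj_exp p)" "THm (cj a) (cj (fl b)) h = 0"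
  shows "h = 0"
proof (rule HH_co_eqI[OF h(1) HH_0])
  show "1 < conj_exp p" "1 < conj_exp p" using conj_exp_props[OF p] by auto
  fix j :: int assume "0 \<le> j"
  then have "zp j \<in> HH p" using p by (simp add: HH_monom)
  then obtain f where f: "f \<in> HH p" "THm a b f = zp j" using s by blast
  have "cnj (co h j) = av (zp j * cj h)" unfolding av_zp_cj ..
  also have "\<dots> = 0" unfolding f(2)[symmetric] THm_adjoint[OF a f(1) h(1) p] h(2) by simp
  finally show "co h j = co 0 j" by simp
qed

lemma Inv_uminus:
  assumes I: "Inv p g" and p: "1 < p" and g: "g \<in> Bd" shows "Inv p (- g)"
proof -
  have T: "TT (- g) f = TT g (- f)" for f by (simp add: TT_def)
  show ?thesis
  proof (rule Inv_I[OF _ p])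
    show "- g \<in> Bd" using g by simp
    show "f = 0" if "f \<in> HH p" "TT (- g) f = 0" for f
      using Inv_inj[OF I HH_uminus[OF that(1) p] _ p] that(2) unfolding T by simp
    show "\<exists>f\<in>HH p. TT (- g) f = h" if h: "h \<in> HH p" for h
    proof -
      obtain f where f: "f \<in> HH p" "TT g f = h" using conjunct2[OF I[unfolded Inv_def]] h by blast
      then show ?thesis using HH_uminus[OF f(1) p] by (intro bexI[of _ "- f"]) (simp_all add: T)
    qed
  qed
qed

lemma admissible_uminus:
  assumes "admissible p n a ai b bi"
  shows "admissible p n a ai (\<lambda>t. - b t) (- bi)"
proof -
  have u: "mk (\<lambda>t. - b t) = - mk b" using assms by (simp add: admissible_def mk_simps(6))
  have i: "Inv p (- (mk a * bi * zp (- 2 * int n)))" "Inv p (- (mk a * fl bi * zp (2 * int n)))"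
    using assms by (auto simp: admissible_def intro!: Inv_uminus)
  show ?thesis using assms i unfolding admissible_def u by simp
qed

text \<open>For the adjoint pair the subordinated functions are the conjugates of the old ones in
  exchanged roles: the new \<open>c\<close> is \<open>cj d\<close> and the new \<open>d\<close> is
  \<open>cj c\<close>. Conjugation also exchanges \<open>zp (2 * n)\<close> and
  \<open>zp (- 2 * n)\<close>, so the two invertibility conditions are swapped and reproduce
  themselves with exponent \<open>q\<close>.\<close>

lemma admissible_adjoint:
  assumes "admissible p n a ai b bi"
  shows "admissible (conj_exp p) n (\<lambda>t. cnj (a t)) (cj ai) (\<lambda>t. cnj (tld b t)) (cj (fl bi))"
    "mk (\<lambda>t. cnj (a t)) = cj (mk a)" "mk (\<lambda>t. cnj (tld b t)) = cj (fl (mk b))"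
proof -
  have p: "1 < p" and cm: "cm a" "cm b" and B: "mk a \<in> Bd" "ai \<in> Bd" "mk b \<in> Bd" "bi \<in> Bd" and ai: "mk a * ai = 1" and bi: "mk b * bi = 1"
    and m: "mk a * fl (mk a) = mk b * fl (mk b)" and IC: "Inv p (mk a * bi * zp (- 2 * int n))" and ID: "Inv p (mk a * fl bi * zp (2 * int n))"
    using assms unfolding admissible_def by blast+
  show ma: "mk (\<lambda>t. cnj (a t)) = cj (mk a)" using cm by (simp add: mk_simps(10))
  show mb: "mk (\<lambda>t. cnj (tld b t)) = cj (fl (mk b))" using cm by (simp add: mk_simps(10,11) tld_def)
  have "Inv (conj_exp p) (cj (mk a * bi * zp (- 2 * int n)))" "Inv (conj_exp p) (cj (mk a * fl bi * zp (2 * int n)))"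
    using B by (intro Inv_dual IC ID p; simp)+
  then have I: "Inv (conj_exp p) (cj (mk a) * cj bi * zp (2 * int n))" "Inv (conj_exp p) (cj (mk a) * cj (fl bi) * zp (- 2 * int n))"
    by simp_all
  have f: "fl (mk b) * fl bi = 1" using arg_cong[OF bi, of fl] by simp
  have 1: "cj (mk a) * cj ai = 1" "cj (fl (mk b)) * cj (fl bi) = 1"
    using arg_cong[OF ai, of cj] arg_cong[OF f, of cj] by simp_all
  have 2: "cj (mk a) * fl (cj (mk a)) = cj (fl (mk b)) * fl (cj (fl (mk b)))"
    using arg_cong[OF m, of cj] by (simp add: mult.commute)
  show "admissible (conj_exp p) n (\<lambda>t. cnj (a t)) (cj ai) (\<lambda>t. cnj (tld b t)) (cj (fl bi))"
    unfolding admissible_def ma mb using conj_exp_props(1)[OF p] cm B I 1 2 by simp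
qed

text \<open>Since \<open>n \<ge> 1\<close>, the indices are nonzero, and the two shift lemmas apply
  with \<open>m = 2 * n\<close>.\<close>

lemma F_TH_admissible:
  assumes F: "F_TH p (- 2 * int n) (2 * int n) a b" and p: "1 < p" and n: "1 \<le> n"
  obtains ai bi where "admissible p n a ai b bi"
proof -
  have mp: "matching_pair a b" and Fc: "fredholm_index p (Toep (sub_c a b)) (- int (2 * n))" and Fd: "fredholm_index p (Toep (sub_d a b)) (int (2 * n))"
    using F unfolding F_TH_def by simp_all
  have a: "a \<in> GLinf" and b: "b \<in> Linf" and m: "ae_eq (\<lambda>t. a t * tld a t) (\<lambda>t. b t * tld b t)"
    using mp unfolding matching_pair_def by blast+
  obtain g where g: "a \<in> Linf" "g \<in> Linf" "ae_eq (\<lambda>z. a z * g z) (\<lambda>z. 1)" using a unfolding GLinf_def by blast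
  have cm: "cm a" "cm b" "cm g" and B: "mk a \<in> Bd" "mk b \<in> Bd" "mk g \<in> Bd" using g b by (auto simp: Linf_iff)
  define ai where "ai = mk g"
  have ai: "mk a * ai = 1" using g(3) cm by (simp add: ai_def mk_simps(2,4) mk_eq_iff)
  have m': "mk a * fl (mk a) = mk b * fl (mk b)" using m cm by (simp add: mk_simps(4,11) mk_eq_iff tld_def)
  \<comment> \<open>The matching condition makes \<open>b\<close> invertible:
    \<open>b * fl b = a * fl a\<close>, and the right side has the inverse
    \<open>ai * fl ai\<close>.\<close>
  define bi where "bi = fl (mk b) * (ai * fl ai)"
  have biB: "bi \<in> Bd" "ai \<in> Bd" using B by (simp_all add: bi_def ai_def)
  have bi: "mk b * bi = 1"
  proof -
    have "mk b * bi = (mk b * fl (mk b)) * (ai * fl ai)" by (simp only: bi_def ac_simps)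
    also have "\<dots> = (mk a * ai) * fl (mk a * ai)" unfolding m'[symmetric] by (simp add: ac_simps)
    finally show ?thesis unfolding ai by simp
  qed
  note s = sub_mk[OF cm(1,2) bi] and u = fl_unit[OF m' bi]
  have n2: "0 < 2 * n" using n by simp
  have sB: "mk (sub_c a b) \<in> Bd" "mk (sub_d a b) \<in> Bd" using B biB by (simp_all add: s)
  have "Inv p (mk a * bi * zp (- int (2 * n)))" by (rule Inv_of_index_neg[OF Fc s(1) sB(1) p s(2)[symmetric] u(1) n2])
  moreover have "Inv p (mk a * fl bi * zp (int (2 * n)))" by (rule Inv_of_index_pos[OF Fd s(3) sB(2) p s(4)[symmetric] u(2) n2])
  ultimately have "admissible p n a ai b bi" unfolding admissible_def using p cm B biB ai bi m' by simp
  then show thesis by (rule that)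
qed

theorem theorem5p4:
  fixes p :: real and n :: nat and a b :: "complex \<Rightarrow> complex"
  assumes "1 < p" and "1 \<le> n"
    and "F_TH p (- 2 * int n) (2 * int n) a b"
  shows "(left_invertible p (TH a b) \<longleftrightarrow> Determinant.det (Wmat p n a b) \<noteq> 0)
     \<and> (right_invertible p (TH a b) \<longleftrightarrow>
          Determinant.det (Wmat (conj_exp p) n (\<lambda>t. cnj (a t)) (\<lambda>t. cnj (tld b t))) \<noteq> 0)
     \<and> (invertible_op p (TH a b) \<longleftrightarrow>
          Determinant.det (Wmat p n a b) \<noteq> 0 \<and>
          Determinant.det (Wmat (conj_exp p) n (\<lambda>t. cnj (a t)) (\<lambda>t. cnj (tld b t))) \<noteq> 0)
     \<and> (Determinant.det (Wmat p n a b) \<noteq> 0 \<and> Determinant.det (Wmat p n a (\<lambda>t. - b t)) \<noteq> 0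
          \<longrightarrow> invertible_op p (TH a b) \<and> invertible_op p (TH a (\<lambda>t. - b t)))"
proof -
  note p = assms(1)
  obtain ai bi where A: "admissible p n a ai b bi" using F_TH_admissible[OF assms(3) p assms(2)] .
  have h: "cm a" "mk a \<in> Bd" "cm b" "mk b \<in> Bd" using A unfolding admissible_def by blast+
  note adj = admissible_adjoint[OF A] and q = conj_exp_props(1,3)[OF p]
  define W where "W = Determinant.det (Wmat p n a b)"
  define W' where "W' = Determinant.det (Wmat (conj_exp p) n (\<lambda>t. cnj (a t)) (\<lambda>t. cnj (tld b t)))"
  have inv: "invertible_op p (TH a b)" if "W \<noteq> 0" using admissible_invertible[OF A] that unfolding W_def .
  have l: "left_invertible p (TH a b)" and r: "right_invertible p (TH a b)" if "invertible_op p (TH a b)"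
    using that unfolding invertible_op_def left_invertible_def right_invertible_def by blast+
  have lW: "W \<noteq> 0" if "left_invertible p (TH a b)"
    unfolding W_def admissible_det(1)[OF A] using left_invertible_inj[OF that h p] by blast
  have rW: "W' \<noteq> 0" if "right_invertible p (TH a b)"
    unfolding W'_def admissible_det(1)[OF adj(1)] adj(2,3)
    using THm_surj_adjoint_inj[OF h(2,4) p right_invertible_surj[OF that h p]] by blast
  \<comment> \<open>For the adjoint pair \<open>W' \<noteq> 0\<close> gives a surjective operator.
    The adjoint of that operator, which is the original one again, is therefore injective.\<close>
  have WW: "W \<noteq> 0" if "W' \<noteq> 0"
    unfolding W_def admissible_det(1)[OF A]
  proof (intro ballI impI)
    fix f assume f: "f \<in> HH p" "THm (mk a) (mk b) f = 0"
    have B: "cj (mk a) \<in> Bd" "cj (fl (mk b)) \<in> Bd" using h by simp_all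
    show "f = 0"
    proof (rule THm_surj_adjoint_inj[OF B q(1)])
      show "\<exists>f\<in>HH (conj_exp p). THm (cj (mk a)) (cj (fl (mk b))) f = g" if "g \<in> HH (conj_exp p)" for g
        using admissible_det(2)[OF adj(1)] \<open>W' \<noteq> 0\<close> that unfolding W'_def adj(2,3) by blast
      show "f \<in> HH (conj_exp (conj_exp p))" using f(1) q(2) by simp
      show "THm (cj (cj (mk a))) (cj (fl (cj (fl (mk b))))) f = 0" using f(2) by simp
    qed
  qed
  have neg: "invertible_op p (TH a (\<lambda>t. - b t))" if "Determinant.det (Wmat p n a (\<lambda>t. - b t)) \<noteq> 0"
    by (rule admissible_invertible[OF admissible_uminus[OF A] that])
  show ?thesis unfolding W_def[symmetric] W'_def[symmetric] using inv l r lW rW WW neg by blast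
qed

end
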